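(* Let $R$ be a commutative ring, $\mathcal{P}$ an operad over $R$ and $A$ a $\mathcal{P}$-algebra. There is a bijective correspondence between vector fields of $A$ in the Rosický tangent category $(\mathsf{ALG}_{\mathcal{P}}^{op},\mathbb{T}^\circ)$ and $A$-derivations $D:A\to A$: a vector field $v\in\mathsf{V}_{\mathbb{T}^\circ}(A)$ is precisely a $\mathcal{P}$-algebra morphism $v:\mathsf{Free}_A(\Omega_A)\to A$ defined on generators by $v(a)=a$ and $v(\mathsf{d}(a))=D_v(a)$ for all $a\in A$, where $D_v:A\to A$ is an $A$-derivation. Furthermore, the induced Lie bracket is given on generators by $[v,w](a)=a$ and $[v,w](\mathsf{d}(a))=D_v(D_w(a))-D_w(D_v(a))$.
   Context: $R$ is a commutative ring. An operad $\mathcal{P}$ is a symmetric operad in $R$-modules ($R$-modules $\mathcal{P}(n)$, $n\ge0$, with right $\Sigma(n)$-actions, unit and compositions with the usual axioms). $\mathsf{ALG}_{\mathcal{P}}$ is the category of $\mathcal{P}$-algebras; operations are written $\mu(a_1,\dots,a_n)$; $\mathsf{S}(\mathcal{P},V)=\bigoplus_{n\ge0}(\mathcal{P}(n)\otimes V^{\otimes n})_{\Sigma(n)}$ is the free $\mathcal{P}$-algebra on $V$. An $A$-derivation $D:A\to A$ is an $R$-linear map with $D(\mu(a_1,\dots,a_n))=\sum_{i=1}^n\mu(a_1,\dots,D(a_i),\dots,a_n)$ for all $n\ge0$, $\mu\in\mathcal{P}(n)$. $\mathsf{T}^\circ(A)=\mathsf{Free}_A(\Omega_A)$ (free $\mathcal{P}$-algebra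 under $A$ on the module of Kähler differentials) is concretely the quotient of $\mathsf{S}(\mathcal{P},A\times A)$ by the ideal generated by the relations, for all $n\ge 0$, $\mu((a_1,0),\dots,(a_n,0))=(\mu(a_1,\dots,a_n),0)$ and $(0,\mu(a_1,\dots,a_n))=\sum_i\mu((a_1,0),\dots,(0,a_i),\dots,(a_n,0))$; one writes $a:=(a,0)$, $\mathsf{d}(a):=(0,a)$; these generate. $\mathsf{T}^\circ(f)(a)=f(a)$, $\mathsf{T}^\circ(f)(\mathsf{d}(a))=\mathsf{d}(f(a))$. $\mathsf{T}^\circ_2(A)$ is the pushout of two copies of $p^\circ_A$, generated by $a,\mathsf{d}_1(a),\mathsf{d}_2(a)$; ${\mathsf{T}^\circ}^2(A)$ is generated by $a,\mathsf{d}(a),\mathsf{d}'(a),\mathsf{d}'\mathsf{d}(a)$, with $\mathsf{d}'$ the symbol for the outer $\mathsf{T}^\circ$. The Rosický tangent structure $\mathbb{T}^\circ$ on $\mathsf{ALG}_{\mathcal{P}}^{op}$, written in $\mathsf{ALG}_{\mathcal{P}}$: $p^\circ_A:A\to\mathsf{T}^\circ(A)$, $a\mapsto a$; $s^\circ_A:\mathsf{T}^\circ(A)\to\mathsf{T}^\circ_2(A)$, $a\mapsto a$, $\mathsf{d}(a)\mapsto\mathsf{d}_1(a)+\mathsf{d}_2(a)$; $z^\circ_A:\mathsf{T}^\circ(A)\to A$, $a\mapsto a$, $\mathsf{d}(a)\mapsto0$; $l^\circ_A:{\mathsf{T}^\circ}^2(A)\to\mathsf{T}^\circ(A)$, $a\mapsto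 a$, $\mathsf{d}(a),\mathsf{d}'(a)\mapsto0$, $\mathsf{d}'\mathsf{d}(a)\mapsto\mathsf{d}(a)$; $c^\circ_A:{\mathsf{T}^\circ}^2(A)\to{\mathsf{T}^\circ}^2(A)$ swaps $\mathsf{d}(a)$ and $\mathsf{d}'(a)$ and fixes $a$, $\mathsf{d}'\mathsf{d}(a)$; $n^\circ_A:\mathsf{T}^\circ(A)\to\mathsf{T}^\circ(A)$, $a\mapsto a$, $\mathsf{d}(a)\mapsto-\mathsf{d}(a)$. In any Rosický tangent category $(\mathbb{X},(\mathsf{T},p,s,z,l,c,n))$, a vector field on $A$ is a map $v:A\to\mathsf{T}(A)$ with $p_A\circ v=1_A$, and $\mathsf{V}_{\mathbb{T}}(A)$ is the set of these. Lie bracket: for vector fields $v,w$, the maps $\mathsf{T}(w)\circ v$ and $c_A\circ\mathsf{T}(v)\circ w:A\to\mathsf{T}^2(A)$ have the same composite with $p_{\mathsf{T}(A)}$; put $\delta=s_{\mathsf{T}(A)}\langle\mathsf{T}(w)v,\ n_{\mathsf{T}(A)}c_A\mathsf{T}(v)w\rangle$; then $[v,w]$ is the unique vector field $u$ with $\delta=\mathsf{T}(s_A)\langle l_A\circ u,\ z_{\mathsf{T}(A)}\circ w\rangle$. This is applied in $\mathbb{X}=\mathsf{ALG}_{\mathcal{P}}^{op}$ with $\mathbb{T}^\circ$; thus a vector field is a $\mathcal{P}$-algebra morphism $v:\mathsf{T}^\circ(A)\to A$ with $v\circ p^\circ_A=1_A$. *)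

theory Defs
  imports "HOL-Algebra.Module" "HOL-Algebra.AbelCoset" "HOL-Combinatorics.Permutations" "HOL.Hull"
begin

section \<open>Modules\<close>

text \<open>
  Morphisms are extensional functions on the carrier, so that equality of functions is equality
  of morphisms and a set of morphisms contains every morphism exactly once.
  The fields \<open>mult\<close> and \<open>one\<close> which the record type of modules inherits from
  rings play no role and are left undefined in all constructions.
\<close>

definition linear_map ::
  "('r, 'z) ring_scheme \<Rightarrow> ('r, 'm, 'y) module_scheme \<Rightarrow> ('r, 'n, 'x) module_scheme \<Rightarrow>
    ('m \<Rightarrow> 'n) \<Rightarrow> bool"
  where "linear_map R M N f \<longleftrightarrow>
    f \<in> carrier M \<rightarrow> carrier N \<and>
    (\<forall>x\<in>carrier M. \<forall>y\<in>carrier M. f (x \<oplus>\<^bsub>M\<^esub> y) = f x \<oplus>\<^bsub>N\<^esub> f y) \<and>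
    (\<forall>r\<in>carrier R. \<forall>x\<in>carrier M. f (r \<odot>\<^bsub>M\<^esub> x) = r \<odot>\<^bsub>N\<^esub> f x)"

definition prod_module ::
  "('r, 'm, 'y) module_scheme \<Rightarrow> ('r, 'n, 'x) module_scheme \<Rightarrow> ('r, 'm \<times> 'n) module"
  where "prod_module M N =
    \<lparr>carrier = carrier M \<times> carrier N, monoid.mult = undefined, one = undefined,
     zero = (\<zero>\<^bsub>M\<^esub>, \<zero>\<^bsub>N\<^esub>),
     add = (\<lambda>(x, y) (x', y'). (x \<oplus>\<^bsub>M\<^esub> x', y \<oplus>\<^bsub>N\<^esub> y')),
     smult = (\<lambda>r (x, y). (r \<odot>\<^bsub>M\<^esub> x, r \<odot>\<^bsub>N\<^esub> y))\<rparr>"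


section \<open>Symmetric operads\<close>

text \<open>
  Right actions are written with \<^const>\<open>permute_list\<close>: the list
  \<open>permute_list \<sigma> xs\<close> has \<open>xs ! \<sigma> i\<close> in position \<open>i\<close>, which is
  a right action of the permutations of \<open>{..<length xs}\<close> on lists.
  The list form of the rule
  \<open>(\<mu> \<cdot> \<sigma>)(a\<^sub>1, \<dots>, a\<^sub>n) = \<mu>(a\<^bsub>\<sigma>\<inverse> 1\<^esub>, \<dots>, a\<^bsub>\<sigma>\<inverse> n\<^esub>)\<close>
  is therefore \<open>(\<mu> \<cdot> \<sigma>)(permute_list \<sigma> as) = \<mu>(as)\<close>.
\<close>

text \<open>
  \<open>ops P n\<close> is the module of arity \<open>n\<close>, and \<open>opact P n\<close> is the right action on it. The
  modules of different arities may share elements, so the full composition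
  \<open>opcomp P \<mu> [(k\<^sub>1, \<nu>\<^sub>1), \<dots>, (k\<^sub>n, \<nu>\<^sub>n)]\<close>, which is
  \<open>\<mu>(\<nu>\<^sub>1, \<dots>, \<nu>\<^sub>n)\<close> for \<open>\<mu>\<close> of arity \<open>n\<close> and
  \<open>\<nu>\<^sub>i\<close> of arity \<open>k\<^sub>i\<close>, receives the arities explicitly.
\<close>

record ('r, 'p) operad =
  ops :: "nat \<Rightarrow> ('r, 'p) module"
  opact :: "nat \<Rightarrow> 'p \<Rightarrow> (nat \<Rightarrow> nat) \<Rightarrow> 'p"
  opunit :: 'p
  opcomp :: "'p \<Rightarrow> (nat \<times> 'p) list \<Rightarrow> 'p"

definition arity_sum :: "(nat \<times> 'p) list \<Rightarrow> nat"
  where "arity_sum \<nu>s = sum_list (map fst \<nu>s)"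

definition ops_list :: "('r, 'p) operad \<Rightarrow> (nat \<times> 'p) list set"
  where "ops_list P = {\<nu>s. \<forall>(k, \<nu>)\<in>set \<nu>s. \<nu> \<in> carrier (ops P k)}"

text \<open>The consecutive intervals of lengths \<open>ks\<close>.\<close>

definition blocks :: "nat list \<Rightarrow> nat list list"
  where "blocks ks =
    map (\<lambda>j. [sum_list (take j ks) ..< sum_list (take (Suc j) ks)]) [0..<length ks]"

text \<open>
  The block permutation \<open>\<sigma>(k\<^sub>1, \<dots>, k\<^sub>n)\<close> and the direct sum
  \<open>\<tau>\<^sub>1 \<oplus> \<dots> \<oplus> \<tau>\<^sub>n\<close>, where \<open>\<tau>\<^sub>i\<close> permutes \<open>{..<k\<^sub>i}\<close>. They are given by their
  lists of values; if the \<open>i\<close>-th list in \<open>xss\<close> has length \<open>k\<^sub>i\<close>, then they satisfy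
  \<open>permute_list (block_perm \<sigma> ks) (concat xss) = concat (permute_list \<sigma> xss)\<close> and
  \<open>permute_list (sum_perm \<tau>s ks) (concat xss) = concat (map2 permute_list \<tau>s xss)\<close>.
\<close>

definition block_perm :: "(nat \<Rightarrow> nat) \<Rightarrow> nat list \<Rightarrow> nat \<Rightarrow> nat"
  where "block_perm \<sigma> ks i =
    (if i < sum_list ks then concat (permute_list \<sigma> (blocks ks)) ! i else i)"

definition sum_perm :: "(nat \<Rightarrow> nat) list \<Rightarrow> nat list \<Rightarrow> nat \<Rightarrow> nat"
  where "sum_perm \<tau>s ks i =
    (if i < sum_list ks then concat (map2 permute_list \<tau>s (blocks ks)) ! i else i)"

locale operad =
  fixes R :: "('r, 'z) ring_scheme" and P :: "('r, 'p) operad"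
  assumes cring: "cring R"
    and module_ops: "module R (ops P n)"
    and act_linear: "\<sigma> permutes {..<n} \<Longrightarrow>
      linear_map R (ops P n) (ops P n) (\<lambda>\<mu>. opact P n \<mu> \<sigma>)"
    and act_id: "\<mu> \<in> carrier (ops P n) \<Longrightarrow> opact P n \<mu> id = \<mu>"
    and act_comp: "\<lbrakk>\<mu> \<in> carrier (ops P n); \<sigma> permutes {..<n}; \<tau> permutes {..<n}\<rbrakk> \<Longrightarrow>
      opact P n (opact P n \<mu> \<sigma>) \<tau> = opact P n \<mu> (\<sigma> \<circ> \<tau>)"
    and unit_closed: "opunit P \<in> carrier (ops P 1)"
    and comp_linear_left: "\<nu>s \<in> ops_list P \<Longrightarrow>
      linear_map R (ops P (length \<nu>s)) (ops P (arity_sum \<nu>s)) (\<lambda>\<mu>. opcomp P \<mu> \<nu>s)"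
    and comp_linear_right:
      "\<lbrakk>\<mu> \<in> carrier (ops P (Suc (length \<nu>s + length \<xi>s))); \<nu>s \<in> ops_list P; \<xi>s \<in> ops_list P\<rbrakk> \<Longrightarrow>
        linear_map R (ops P k) (ops P (arity_sum \<nu>s + k + arity_sum \<xi>s))
          (\<lambda>\<nu>. opcomp P \<mu> (\<nu>s @ (k, \<nu>) # \<xi>s))"
    and comp_unit_left: "\<nu> \<in> carrier (ops P k) \<Longrightarrow> opcomp P (opunit P) [(k, \<nu>)] = \<nu>"
    and comp_unit_right: "\<mu> \<in> carrier (ops P n) \<Longrightarrow>
      opcomp P \<mu> (replicate n (1, opunit P)) = \<mu>"
    and comp_assoc:
      "\<lbrakk>\<mu> \<in> carrier (ops P (length \<nu>s)); \<nu>s \<in> ops_list P;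
        map length \<xi>ss = map fst \<nu>s; \<forall>\<xi>s\<in>set \<xi>ss. \<xi>s \<in> ops_list P\<rbrakk> \<Longrightarrow>
        opcomp P (opcomp P \<mu> \<nu>s) (concat \<xi>ss) =
        opcomp P \<mu> (map2 (\<lambda>(k, \<nu>) \<xi>s. (arity_sum \<xi>s, opcomp P \<nu> \<xi>s)) \<nu>s \<xi>ss)"
    and comp_act_left:
      "\<lbrakk>\<mu> \<in> carrier (ops P (length \<nu>s)); \<nu>s \<in> ops_list P; \<sigma> permutes {..<length \<nu>s}\<rbrakk> \<Longrightarrow>
        opcomp P (opact P (length \<nu>s) \<mu> \<sigma>) (permute_list \<sigma> \<nu>s) =
        opact P (arity_sum \<nu>s) (opcomp P \<mu> \<nu>s) (block_perm \<sigma> (map fst \<nu>s))"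
    and comp_act_right:
      "\<lbrakk>\<mu> \<in> carrier (ops P (length \<nu>s)); \<nu>s \<in> ops_list P;
        list_all2 (\<lambda>\<tau> (k, \<nu>). \<tau> permutes {..<k}) \<tau>s \<nu>s\<rbrakk> \<Longrightarrow>
        opcomp P \<mu> (map2 (\<lambda>\<tau> (k, \<nu>). (k, opact P k \<nu> \<tau>)) \<tau>s \<nu>s) =
        opact P (arity_sum \<nu>s) (opcomp P \<mu> \<nu>s) (sum_perm \<tau>s (map fst \<nu>s))"


section \<open>Algebras over an operad\<close>

text \<open>
  \<open>oper A \<mu> as\<close> is \<open>\<mu>(as)\<close>, where the arity of \<open>\<mu>\<close> is the length of \<open>as\<close>.
\<close>

record ('r, 'p, 'a) opalg = "('r, 'a) module" +
  oper :: "'p \<Rightarrow> 'a list \<Rightarrow> 'a"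

locale operad_algebra = operad R P
  for R :: "('r, 'z) ring_scheme" and P :: "('r, 'p) operad" +
  fixes A :: "('r, 'p, 'a) opalg"
  assumes module_alg: "module R A"
    and oper_linear_left: "set as \<subseteq> carrier A \<Longrightarrow>
      linear_map R (ops P (length as)) A (\<lambda>\<mu>. oper A \<mu> as)"
    and oper_linear_right:
      "\<lbrakk>\<mu> \<in> carrier (ops P (Suc (length as + length bs)));
        set as \<subseteq> carrier A; set bs \<subseteq> carrier A\<rbrakk> \<Longrightarrow>
        linear_map R A A (\<lambda>a. oper A \<mu> (as @ a # bs))"
    and oper_unit: "a \<in> carrier A \<Longrightarrow> oper A (opunit P) [a] = a"
    and oper_comp:
      "\<lbrakk>\<mu> \<in> carrier (ops P (length \<nu>s)); \<nu>s \<in> ops_list P;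
        map length ass = map fst \<nu>s; \<forall>as\<in>set ass. set as \<subseteq> carrier A\<rbrakk> \<Longrightarrow>
        oper A (opcomp P \<mu> \<nu>s) (concat ass) =
        oper A \<mu> (map2 (\<lambda>(k, \<nu>) as. oper A \<nu> as) \<nu>s ass)"
    and oper_act:
      "\<lbrakk>\<mu> \<in> carrier (ops P (length as)); set as \<subseteq> carrier A; \<sigma> permutes {..<length as}\<rbrakk> \<Longrightarrow>
        oper A (opact P (length as) \<mu> \<sigma>) (permute_list \<sigma> as) = oper A \<mu> as"

definition alg_hom ::
  "('r, 'z) ring_scheme \<Rightarrow> ('r, 'p) operad \<Rightarrow> ('r, 'p, 'a) opalg \<Rightarrow> ('r, 'p, 'b) opalg \<Rightarrow>
    ('a \<Rightarrow> 'b) set"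
  where "alg_hom R P A B =
    {f \<in> carrier A \<rightarrow>\<^sub>E carrier B. linear_map R A B f \<and>
      (\<forall>as. \<forall>\<mu>\<in>carrier (ops P (length as)). set as \<subseteq> carrier A \<longrightarrow>
        f (oper A \<mu> as) = oper B \<mu> (map f as))}"

definition derivations ::
  "('r, 'z) ring_scheme \<Rightarrow> ('r, 'p) operad \<Rightarrow> ('r, 'p, 'a) opalg \<Rightarrow> ('a \<Rightarrow> 'a) set"
  where "derivations R P A =
    {D \<in> carrier A \<rightarrow>\<^sub>E carrier A. linear_map R A A D \<and>
      (\<forall>as. \<forall>\<mu>\<in>carrier (ops P (length as)). set as \<subseteq> carrier A \<longrightarrow>
        D (oper A \<mu> as) = (\<Oplus>\<^bsub>A\<^esub>i\<in>{..<length as}. oper A \<mu> (as[i := D (as ! i)])))}"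

definition alg_ideal ::
  "('r, 'z) ring_scheme \<Rightarrow> ('r, 'p) operad \<Rightarrow> ('r, 'p, 'a) opalg \<Rightarrow> 'a set \<Rightarrow> bool"
  where "alg_ideal R P A I \<longleftrightarrow>
    submodule I R A \<and>
    (\<forall>as bs. \<forall>x\<in>I. \<forall>\<mu>\<in>carrier (ops P (Suc (length as + length bs))).
      set as \<subseteq> carrier A \<longrightarrow> set bs \<subseteq> carrier A \<longrightarrow> oper A \<mu> (as @ x # bs) \<in> I)"

definition quot_alg :: "('r, 'p, 'a) opalg \<Rightarrow> 'a set \<Rightarrow> ('r, 'p, 'a set) opalg"
  where "quot_alg A I =
    \<lparr>carrier = a_rcosets\<^bsub>A\<^esub> I, monoid.mult = undefined, one = undefined,
     zero = I, add = set_add A,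
     smult = (\<lambda>r X. \<Union>x\<in>X. I +>\<^bsub>A\<^esub> (r \<odot>\<^bsub>A\<^esub> x)),
     oper = (\<lambda>\<mu> Xs. \<Union>xs\<in>listset Xs. I +>\<^bsub>A\<^esub> oper A \<mu> xs)\<rparr>"


section \<open>The free algebra\<close>

text \<open>
  The direct sum of the coinvariants of \<open>P(n) \<otimes> V\<^bsup>\<otimes>n\<^esup>\<close> over all \<open>n\<close> is formed in
  one step: take the free \<open>R\<close>-module on all symbols \<open>\<mu> \<otimes> v\<^sub>1 \<otimes> \<dots> \<otimes> v\<^sub>n\<close>, written
  \<open>(\<mu>, [v\<^sub>1, \<dots>, v\<^sub>n])\<close>, with \<open>\<mu>\<close> of arity \<open>n\<close>, and divide by the relations of multilinearity and
  \<open>\<mu>\<cdot>\<sigma> \<otimes> v = \<mu> \<otimes> \<sigma>\<cdot>v\<close>. The free module carries the multilinear extension of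
  \<open>\<mu>(\<nu>\<^sub>1 \<otimes> v\<^sub>1, \<dots>, \<nu>\<^sub>n \<otimes> v\<^sub>n) =
    \<mu>(\<nu>\<^sub>1, \<dots>, \<nu>\<^sub>n) \<otimes> v\<^sub>1 \<otimes> \<dots> \<otimes> v\<^sub>n\<close> (the \<open>v\<^sub>i\<close> being tensors), which induces the operations
  of the quotient.
\<close>

type_synonym ('r, 'p, 'v) formal = "'p \<times> 'v list \<Rightarrow> 'r"
type_synonym ('r, 'p, 'v) free = "('r, 'p, 'v) formal set"

definition symbols :: "('r, 'p) operad \<Rightarrow> ('r, 'v) module \<Rightarrow> ('p \<times> 'v list) set"
  where "symbols P V = {(\<mu>, vs). \<mu> \<in> carrier (ops P (length vs)) \<and> set vs \<subseteq> carrier V}"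

definition single :: "('r, 'z) ring_scheme \<Rightarrow> 'x \<Rightarrow> 'x \<Rightarrow> 'r"
  where "single R s = (\<lambda>t. if t = s then \<one>\<^bsub>R\<^esub> else \<zero>\<^bsub>R\<^esub>)"

definition free_module :: "('r, 'z) ring_scheme \<Rightarrow> 'x set \<Rightarrow> ('r, 'x \<Rightarrow> 'r) module"
  where "free_module R X =
    \<lparr>carrier = {f. range f \<subseteq> carrier R \<and> finite {x. f x \<noteq> \<zero>\<^bsub>R\<^esub>} \<and> {x. f x \<noteq> \<zero>\<^bsub>R\<^esub>} \<subseteq> X},
     monoid.mult = undefined, one = undefined,
     zero = (\<lambda>x. \<zero>\<^bsub>R\<^esub>), add = (\<lambda>f g x. f x \<oplus>\<^bsub>R\<^esub> g x), smult = (\<lambda>r f x. r \<otimes>\<^bsub>R\<^esub> f x)\<rparr>"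

definition formal_oper ::
  "('r, 'z) ring_scheme \<Rightarrow> ('r, 'p) operad \<Rightarrow> ('r, 'v) module \<Rightarrow>
    'p \<Rightarrow> ('r, 'p, 'v) formal list \<Rightarrow> ('r, 'p, 'v) formal"
  where "formal_oper R P V \<mu> fs =
    (let F = free_module R (symbols P V) in
      \<Oplus>\<^bsub>F\<^esub>ss\<in>listset (map (\<lambda>f. {s. f s \<noteq> \<zero>\<^bsub>R\<^esub>}) fs).
        foldr (\<otimes>\<^bsub>R\<^esub>) (map2 (\<lambda>f s. f s) fs ss) \<one>\<^bsub>R\<^esub> \<odot>\<^bsub>F\<^esub>
        single R (opcomp P \<mu> (map (\<lambda>(\<nu>, vs). (length vs, \<nu>)) ss), concat (map snd ss)))"

definition formal_alg ::
  "('r, 'z) ring_scheme \<Rightarrow> ('r, 'p) operad \<Rightarrow> ('r, 'v) module \<Rightarrow>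
    ('r, 'p, ('r, 'p, 'v) formal) opalg"
  where "formal_alg R P V =
    module.extend (free_module R (symbols P V)) \<lparr>oper = formal_oper R P V\<rparr>"

definition tensor_rels ::
  "('r, 'z) ring_scheme \<Rightarrow> ('r, 'p) operad \<Rightarrow> ('r, 'v) module \<Rightarrow> ('r, 'p, 'v) formal set"
  where "tensor_rels R P V =
    (let F = free_module R (symbols P V) in
      {single R (\<mu> \<oplus>\<^bsub>ops P (length vs)\<^esub> \<mu>', vs) \<ominus>\<^bsub>F\<^esub> (single R (\<mu>, vs) \<oplus>\<^bsub>F\<^esub> single R (\<mu>', vs)) | \<mu> \<mu>' vs.
        (\<mu>, vs) \<in> symbols P V \<and> (\<mu>', vs) \<in> symbols P V} \<union>
      {single R (r \<odot>\<^bsub>ops P (length vs)\<^esub> \<mu>, vs) \<ominus>\<^bsub>F\<^esub> (r \<odot>\<^bsub>F\<^esub> single R (\<mu>, vs)) | r \<mu> vs.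
        r \<in> carrier R \<and> (\<mu>, vs) \<in> symbols P V} \<union>
      {single R (\<mu>, vs @ (x \<oplus>\<^bsub>V\<^esub> y) # ws) \<ominus>\<^bsub>F\<^esub>
          (single R (\<mu>, vs @ x # ws) \<oplus>\<^bsub>F\<^esub> single R (\<mu>, vs @ y # ws)) | \<mu> vs x y ws.
        (\<mu>, vs @ x # ws) \<in> symbols P V \<and> (\<mu>, vs @ y # ws) \<in> symbols P V} \<union>
      {single R (\<mu>, vs @ (r \<odot>\<^bsub>V\<^esub> x) # ws) \<ominus>\<^bsub>F\<^esub> (r \<odot>\<^bsub>F\<^esub> single R (\<mu>, vs @ x # ws)) | r \<mu> vs x ws.
        r \<in> carrier R \<and> (\<mu>, vs @ x # ws) \<in> symbols P V} \<union>
      {single R (opact P (length vs) \<mu> \<sigma>, permute_list \<sigma> vs) \<ominus>\<^bsub>F\<^esub> single R (\<mu>, vs) | \<mu> \<sigma> vs.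
        (\<mu>, vs) \<in> symbols P V \<and> \<sigma> permutes {..<length vs}})"

definition tensor_null ::
  "('r, 'z) ring_scheme \<Rightarrow> ('r, 'p) operad \<Rightarrow> ('r, 'v) module \<Rightarrow> ('r, 'p, 'v) formal set"
  where "tensor_null R P V =
    (\<lambda>N. submodule N R (free_module R (symbols P V))) hull tensor_rels R P V"

definition free_alg ::
  "('r, 'z) ring_scheme \<Rightarrow> ('r, 'p) operad \<Rightarrow> ('r, 'v) module \<Rightarrow>
    ('r, 'p, ('r, 'p, 'v) free) opalg"
  where "free_alg R P V = quot_alg (formal_alg R P V) (tensor_null R P V)"

definition free_gen ::
  "('r, 'z) ring_scheme \<Rightarrow> ('r, 'p) operad \<Rightarrow> ('r, 'v) module \<Rightarrow> 'v \<Rightarrow> ('r, 'p, 'v) free"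
  where "free_gen R P V v =
    tensor_null R P V +>\<^bsub>formal_alg R P V\<^esub> single R (opunit P, [v])"


section \<open>Presented algebras and pushouts\<close>

type_synonym ('r, 'p, 'v) presented = "('r, 'p, 'v) free set"

definition rel_ideal ::
  "('r, 'z) ring_scheme \<Rightarrow> ('r, 'p) operad \<Rightarrow> ('r, 'v) module \<Rightarrow> ('r, 'p, 'v) free set \<Rightarrow>
    ('r, 'p, 'v) free set"
  where "rel_ideal R P V rels = alg_ideal R P (free_alg R P V) hull rels"

definition presented_alg ::
  "('r, 'z) ring_scheme \<Rightarrow> ('r, 'p) operad \<Rightarrow> ('r, 'v) module \<Rightarrow> ('r, 'p, 'v) free set \<Rightarrow>
    ('r, 'p, ('r, 'p, 'v) presented) opalg"
  where "presented_alg R P V rels = quot_alg (free_alg R P V) (rel_ideal R P V rels)"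

definition presented_gen ::
  "('r, 'z) ring_scheme \<Rightarrow> ('r, 'p) operad \<Rightarrow> ('r, 'v) module \<Rightarrow> ('r, 'p, 'v) free set \<Rightarrow>
    'v \<Rightarrow> ('r, 'p, 'v) presented"
  where "presented_gen R P V rels v =
    rel_ideal R P V rels +>\<^bsub>free_alg R P V\<^esub> free_gen R P V v"

text \<open>
  The pushout of \<open>f : B \<rightarrow> C\<close> and \<open>g : B \<rightarrow> D\<close>: the free algebra on the module \<open>C \<times> D\<close> modulo the
  relations which make \<open>c \<mapsto> (c, 0)\<close> and \<open>d \<mapsto> (0, d)\<close> morphisms and identify
  \<open>(f b, 0)\<close> with \<open>(0, g b)\<close>.
\<close>

definition pushout_rels ::
  "('r, 'z) ring_scheme \<Rightarrow> ('r, 'p) operad \<Rightarrow> ('r, 'p, 'b) opalg \<Rightarrow> ('r, 'p, 'c) opalg \<Rightarrow>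
    ('r, 'p, 'd) opalg \<Rightarrow> ('b \<Rightarrow> 'c) \<Rightarrow> ('b \<Rightarrow> 'd) \<Rightarrow> ('r, 'p, 'c \<times> 'd) free set"
  where "pushout_rels R P B C D f g =
    (let V = prod_module C D; S = free_alg R P V; \<eta> = free_gen R P V in
      {oper S \<mu> (map (\<lambda>c. \<eta> (c, \<zero>\<^bsub>D\<^esub>)) cs) \<ominus>\<^bsub>S\<^esub> \<eta> (oper C \<mu> cs, \<zero>\<^bsub>D\<^esub>) | \<mu> cs.
        \<mu> \<in> carrier (ops P (length cs)) \<and> set cs \<subseteq> carrier C} \<union>
      {oper S \<mu> (map (\<lambda>d. \<eta> (\<zero>\<^bsub>C\<^esub>, d)) ds) \<ominus>\<^bsub>S\<^esub> \<eta> (\<zero>\<^bsub>C\<^esub>, oper D \<mu> ds) | \<mu> ds.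
        \<mu> \<in> carrier (ops P (length ds)) \<and> set ds \<subseteq> carrier D} \<union>
      {\<eta> (f b, \<zero>\<^bsub>D\<^esub>) \<ominus>\<^bsub>S\<^esub> \<eta> (\<zero>\<^bsub>C\<^esub>, g b) | b. b \<in> carrier B})"

definition pushout ::
  "('r, 'z) ring_scheme \<Rightarrow> ('r, 'p) operad \<Rightarrow> ('r, 'p, 'b) opalg \<Rightarrow> ('r, 'p, 'c) opalg \<Rightarrow>
    ('r, 'p, 'd) opalg \<Rightarrow> ('b \<Rightarrow> 'c) \<Rightarrow> ('b \<Rightarrow> 'd) \<Rightarrow>
    ('r, 'p, ('r, 'p, 'c \<times> 'd) presented) opalg"
  where "pushout R P B C D f g =
    presented_alg R P (prod_module C D) (pushout_rels R P B C D f g)"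

definition pushout_inl ::
  "('r, 'z) ring_scheme \<Rightarrow> ('r, 'p) operad \<Rightarrow> ('r, 'p, 'b) opalg \<Rightarrow> ('r, 'p, 'c) opalg \<Rightarrow>
    ('r, 'p, 'd) opalg \<Rightarrow> ('b \<Rightarrow> 'c) \<Rightarrow> ('b \<Rightarrow> 'd) \<Rightarrow> 'c \<Rightarrow> ('r, 'p, 'c \<times> 'd) presented"
  where "pushout_inl R P B C D f g =
    (\<lambda>c\<in>carrier C. presented_gen R P (prod_module C D) (pushout_rels R P B C D f g) (c, \<zero>\<^bsub>D\<^esub>))"

definition pushout_inr ::
  "('r, 'z) ring_scheme \<Rightarrow> ('r, 'p) operad \<Rightarrow> ('r, 'p, 'b) opalg \<Rightarrow> ('r, 'p, 'c) opalg \<Rightarrow>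
    ('r, 'p, 'd) opalg \<Rightarrow> ('b \<Rightarrow> 'c) \<Rightarrow> ('b \<Rightarrow> 'd) \<Rightarrow> 'd \<Rightarrow> ('r, 'p, 'c \<times> 'd) presented"
  where "pushout_inr R P B C D f g =
    (\<lambda>d\<in>carrier D. presented_gen R P (prod_module C D) (pushout_rels R P B C D f g) (\<zero>\<^bsub>C\<^esub>, d))"

text \<open>
  The morphism \<open>Q \<rightarrow> B\<close> out of a pushout \<open>Q\<close> of two copies of \<open>X\<close> with injections \<open>i\<^sub>1, i\<^sub>2 : X \<rightarrow> Q\<close>
  that is determined by \<open>f\<^sub>1, f\<^sub>2 : X \<rightarrow> B\<close>. In the opposite category it is the pairing
  \<open>\<langle>f\<^sub>1, f\<^sub>2\<rangle>\<close> into a pullback.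
\<close>

definition copair ::
  "('r, 'z) ring_scheme \<Rightarrow> ('r, 'p) operad \<Rightarrow> ('r, 'p, 'x) opalg \<Rightarrow> ('r, 'p, 'q) opalg \<Rightarrow>
    ('x \<Rightarrow> 'q) \<Rightarrow> ('x \<Rightarrow> 'q) \<Rightarrow> ('r, 'p, 'b) opalg \<Rightarrow> ('x \<Rightarrow> 'b) \<Rightarrow> ('x \<Rightarrow> 'b) \<Rightarrow> 'q \<Rightarrow> 'b"
  where "copair R P X Q i\<^sub>1 i\<^sub>2 B f\<^sub>1 f\<^sub>2 =
    (THE h. h \<in> alg_hom R P Q B \<and>
      compose (carrier X) h i\<^sub>1 = f\<^sub>1 \<and> compose (carrier X) h i\<^sub>2 = f\<^sub>2)"


section \<open>The tangent structure on the opposite of the category of algebras\<close>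

text \<open>
  All maps are written as morphisms of algebras, that is, with the direction opposite to that in
  the tangent category. The algebra \<open>tan_alg R P A\<close> is the free algebra under \<open>A\<close> on the Kaehler
  differentials of \<open>A\<close>; \<open>tan_in R P A a\<close> and \<open>tan_d R P A a\<close> are its generators
  \<open>a = (a, 0)\<close> and \<open>d(a) = (0, a)\<close>.
\<close>

type_synonym ('r, 'p, 'a) tangent = "('r, 'p, 'a \<times> 'a) presented"
type_synonym ('r, 'p, 'a) tangent2 =
  "('r, 'p, ('r, 'p, 'a) tangent \<times> ('r, 'p, 'a) tangent) presented"

definition tan_rels ::
  "('r, 'z) ring_scheme \<Rightarrow> ('r, 'p) operad \<Rightarrow> ('r, 'p, 'a) opalg \<Rightarrow> ('r, 'p, 'a \<times> 'a) free set"
  where "tan_rels R P A =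
    (let V = prod_module A A; S = free_alg R P V; \<eta> = free_gen R P V in
      {oper S \<mu> (map (\<lambda>a. \<eta> (a, \<zero>\<^bsub>A\<^esub>)) as) \<ominus>\<^bsub>S\<^esub> \<eta> (oper A \<mu> as, \<zero>\<^bsub>A\<^esub>) | \<mu> as.
        \<mu> \<in> carrier (ops P (length as)) \<and> set as \<subseteq> carrier A} \<union>
      {\<eta> (\<zero>\<^bsub>A\<^esub>, oper A \<mu> as) \<ominus>\<^bsub>S\<^esub>
          (\<Oplus>\<^bsub>S\<^esub>i\<in>{..<length as}. oper S \<mu> ((map (\<lambda>a. \<eta> (a, \<zero>\<^bsub>A\<^esub>)) as)[i := \<eta> (\<zero>\<^bsub>A\<^esub>, as ! i)])) | \<mu> as.
        \<mu> \<in> carrier (ops P (length as)) \<and> set as \<subseteq> carrier A})"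

definition tan_alg ::
  "('r, 'z) ring_scheme \<Rightarrow> ('r, 'p) operad \<Rightarrow> ('r, 'p, 'a) opalg \<Rightarrow>
    ('r, 'p, ('r, 'p, 'a) tangent) opalg"
  where "tan_alg R P A = presented_alg R P (prod_module A A) (tan_rels R P A)"

definition tan_in ::
  "('r, 'z) ring_scheme \<Rightarrow> ('r, 'p) operad \<Rightarrow> ('r, 'p, 'a) opalg \<Rightarrow> 'a \<Rightarrow> ('r, 'p, 'a) tangent"
  where "tan_in R P A a = presented_gen R P (prod_module A A) (tan_rels R P A) (a, \<zero>\<^bsub>A\<^esub>)"

definition tan_d ::
  "('r, 'z) ring_scheme \<Rightarrow> ('r, 'p) operad \<Rightarrow> ('r, 'p, 'a) opalg \<Rightarrow> 'a \<Rightarrow> ('r, 'p, 'a) tangent"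
  where "tan_d R P A a = presented_gen R P (prod_module A A) (tan_rels R P A) (\<zero>\<^bsub>A\<^esub>, a)"

definition tan_map ::
  "('r, 'z) ring_scheme \<Rightarrow> ('r, 'p) operad \<Rightarrow> ('r, 'p, 'a) opalg \<Rightarrow> ('r, 'p, 'b) opalg \<Rightarrow>
    ('a \<Rightarrow> 'b) \<Rightarrow> ('r, 'p, 'a) tangent \<Rightarrow> ('r, 'p, 'b) tangent"
  where "tan_map R P A B f =
    (THE g. g \<in> alg_hom R P (tan_alg R P A) (tan_alg R P B) \<and>
      (\<forall>a\<in>carrier A. g (tan_in R P A a) = tan_in R P B (f a) \<and>
        g (tan_d R P A a) = tan_d R P B (f a)))"

definition tan_p ::
  "('r, 'z) ring_scheme \<Rightarrow> ('r, 'p) operad \<Rightarrow> ('r, 'p, 'a) opalg \<Rightarrow> 'a \<Rightarrow> ('r, 'p, 'a) tangent"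
  where "tan_p R P A = (\<lambda>a\<in>carrier A. tan_in R P A a)"

definition tan_z ::
  "('r, 'z) ring_scheme \<Rightarrow> ('r, 'p) operad \<Rightarrow> ('r, 'p, 'a) opalg \<Rightarrow> ('r, 'p, 'a) tangent \<Rightarrow> 'a"
  where "tan_z R P A =
    (THE g. g \<in> alg_hom R P (tan_alg R P A) A \<and>
      (\<forall>a\<in>carrier A. g (tan_in R P A a) = a \<and> g (tan_d R P A a) = \<zero>\<^bsub>A\<^esub>))"

definition tan_n ::
  "('r, 'z) ring_scheme \<Rightarrow> ('r, 'p) operad \<Rightarrow> ('r, 'p, 'a) opalg \<Rightarrow>
    ('r, 'p, 'a) tangent \<Rightarrow> ('r, 'p, 'a) tangent"
  where "tan_n R P A =
    (THE g. g \<in> alg_hom R P (tan_alg R P A) (tan_alg R P A) \<and>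
      (\<forall>a\<in>carrier A. g (tan_in R P A a) = tan_in R P A a \<and>
        g (tan_d R P A a) = \<ominus>\<^bsub>tan_alg R P A\<^esub> tan_d R P A a))"

definition tan2 ::
  "('r, 'z) ring_scheme \<Rightarrow> ('r, 'p) operad \<Rightarrow> ('r, 'p, 'a) opalg \<Rightarrow>
    ('r, 'p, ('r, 'p, 'a) tangent2) opalg"
  where "tan2 R P A = pushout R P A (tan_alg R P A) (tan_alg R P A) (tan_p R P A) (tan_p R P A)"

definition tan2_in1 ::
  "('r, 'z) ring_scheme \<Rightarrow> ('r, 'p) operad \<Rightarrow> ('r, 'p, 'a) opalg \<Rightarrow>
    ('r, 'p, 'a) tangent \<Rightarrow> ('r, 'p, 'a) tangent2"
  where "tan2_in1 R P A = pushout_inl R P A (tan_alg R P A) (tan_alg R P A) (tan_p R P A) (tan_p R P A)"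

definition tan2_in2 ::
  "('r, 'z) ring_scheme \<Rightarrow> ('r, 'p) operad \<Rightarrow> ('r, 'p, 'a) opalg \<Rightarrow>
    ('r, 'p, 'a) tangent \<Rightarrow> ('r, 'p, 'a) tangent2"
  where "tan2_in2 R P A = pushout_inr R P A (tan_alg R P A) (tan_alg R P A) (tan_p R P A) (tan_p R P A)"

text \<open>The generators \<open>a\<close>, \<open>d\<^sub>1(a)\<close>, \<open>d\<^sub>2(a)\<close> of \<open>tan2 R P A\<close> are the images of \<open>a\<close>, \<open>d(a)\<close>, \<open>d(a)\<close>
  under the injections; both injections agree on \<open>a\<close>.\<close>

definition tan_s ::
  "('r, 'z) ring_scheme \<Rightarrow> ('r, 'p) operad \<Rightarrow> ('r, 'p, 'a) opalg \<Rightarrow>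
    ('r, 'p, 'a) tangent \<Rightarrow> ('r, 'p, 'a) tangent2"
  where "tan_s R P A =
    (THE g. g \<in> alg_hom R P (tan_alg R P A) (tan2 R P A) \<and>
      (\<forall>a\<in>carrier A. g (tan_in R P A a) = tan2_in1 R P A (tan_in R P A a) \<and>
        g (tan_d R P A a) =
          tan2_in1 R P A (tan_d R P A a) \<oplus>\<^bsub>tan2 R P A\<^esub> tan2_in2 R P A (tan_d R P A a)))"

text \<open>
  In \<open>tan_alg R P (tan_alg R P A)\<close> the generators \<open>a\<close>, \<open>d(a)\<close>, \<open>d'(a)\<close>, \<open>d'd(a)\<close> are obtained by applying
  \<open>tan_in\<close> (twice), \<open>tan_d\<close> inside \<open>tan_in\<close>, \<open>tan_in\<close> inside \<open>tan_d\<close>, and \<open>tan_d\<close> (twice).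
\<close>

definition tan_l ::
  "('r, 'z) ring_scheme \<Rightarrow> ('r, 'p) operad \<Rightarrow> ('r, 'p, 'a) opalg \<Rightarrow>
    ('r, 'p, ('r, 'p, 'a) tangent) tangent \<Rightarrow> ('r, 'p, 'a) tangent"
  where "tan_l R P A =
    (let T = tan_alg R P A; \<iota> = tan_in R P A; d = tan_d R P A; \<iota>' = tan_in R P T; d' = tan_d R P T in
      THE g. g \<in> alg_hom R P (tan_alg R P T) T \<and>
        (\<forall>a\<in>carrier A. g (\<iota>' (\<iota> a)) = \<iota> a \<and> g (\<iota>' (d a)) = \<zero>\<^bsub>T\<^esub> \<and>
          g (d' (\<iota> a)) = \<zero>\<^bsub>T\<^esub> \<and> g (d' (d a)) = d a))"

definition tan_c ::
  "('r, 'z) ring_scheme \<Rightarrow> ('r, 'p) operad \<Rightarrow> ('r, 'p, 'a) opalg \<Rightarrow>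
    ('r, 'p, ('r, 'p, 'a) tangent) tangent \<Rightarrow> ('r, 'p, ('r, 'p, 'a) tangent) tangent"
  where "tan_c R P A =
    (let T = tan_alg R P A; \<iota> = tan_in R P A; d = tan_d R P A; \<iota>' = tan_in R P T; d' = tan_d R P T in
      THE g. g \<in> alg_hom R P (tan_alg R P T) (tan_alg R P T) \<and>
        (\<forall>a\<in>carrier A. g (\<iota>' (\<iota> a)) = \<iota>' (\<iota> a) \<and> g (\<iota>' (d a)) = d' (\<iota> a) \<and>
          g (d' (\<iota> a)) = \<iota>' (d a) \<and> g (d' (d a)) = d' (d a)))"


section \<open>Vector fields and their Lie bracket\<close>

definition vector_fields ::
  "('r, 'z) ring_scheme \<Rightarrow> ('r, 'p) operad \<Rightarrow> ('r, 'p, 'a) opalg \<Rightarrow>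
    (('r, 'p, 'a) tangent \<Rightarrow> 'a) set"
  where "vector_fields R P A =
    {v \<in> alg_hom R P (tan_alg R P A) A.
      compose (carrier A) v (tan_p R P A) = (\<lambda>a\<in>carrier A. a)}"

text \<open>The map \<open>s\<^bsub>T(A)\<^esub>\<langle>T(w) v, n\<^bsub>T(A)\<^esub> c\<^sub>A T(v) w\<rangle>\<close>; all composites are reversed.\<close>

definition bracket_delta ::
  "('r, 'z) ring_scheme \<Rightarrow> ('r, 'p) operad \<Rightarrow> ('r, 'p, 'a) opalg \<Rightarrow>
    (('r, 'p, 'a) tangent \<Rightarrow> 'a) \<Rightarrow> (('r, 'p, 'a) tangent \<Rightarrow> 'a) \<Rightarrow>
    ('r, 'p, ('r, 'p, 'a) tangent) tangent \<Rightarrow> 'a"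
  where "bracket_delta R P A v w =
    (let T = tan_alg R P A; TT = tan_alg R P T;
         f = compose (carrier TT) v (tan_map R P T A w);
         g = compose (carrier TT) w (compose (carrier TT) (tan_map R P T A v)
               (compose (carrier TT) (tan_c R P A) (tan_n R P T)))
     in compose (carrier TT)
          (copair R P TT (tan2 R P T) (tan2_in1 R P T) (tan2_in2 R P T) A f g)
          (tan_s R P T))"

text \<open>
  The map \<open>T(s\<^sub>A)\<langle>l\<^sub>A u, z\<^bsub>T(A)\<^esub> w\<rangle>\<close>. The pairing is formed with respect to the pullback
  \<open>T(T\<^sub>2(A))\<close> of two copies of \<open>T(p\<^sub>A)\<close>, so its projections are the images of those of \<open>T\<^sub>2(A)\<close>
  under \<open>T\<close>.
\<close>

definition bracket_lift ::
  "('r, 'z) ring_scheme \<Rightarrow> ('r, 'p) operad \<Rightarrow> ('r, 'p, 'a) opalg \<Rightarrow>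
    (('r, 'p, 'a) tangent \<Rightarrow> 'a) \<Rightarrow> (('r, 'p, 'a) tangent \<Rightarrow> 'a) \<Rightarrow>
    ('r, 'p, ('r, 'p, 'a) tangent) tangent \<Rightarrow> 'a"
  where "bracket_lift R P A u w =
    (let T = tan_alg R P A; TT = tan_alg R P T; T2 = tan2 R P A;
         f = compose (carrier TT) u (tan_l R P A);
         g = compose (carrier TT) w (tan_z R P T)
     in compose (carrier TT)
          (copair R P TT (tan_alg R P T2)
            (tan_map R P T T2 (tan2_in1 R P A)) (tan_map R P T T2 (tan2_in2 R P A)) A f g)
          (tan_map R P T T2 (tan_s R P A)))"

definition lie_bracket ::
  "('r, 'z) ring_scheme \<Rightarrow> ('r, 'p) operad \<Rightarrow> ('r, 'p, 'a) opalg \<Rightarrow>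
    (('r, 'p, 'a) tangent \<Rightarrow> 'a) \<Rightarrow> (('r, 'p, 'a) tangent \<Rightarrow> 'a) \<Rightarrow> ('r, 'p, 'a) tangent \<Rightarrow> 'a"
  where "lie_bracket R P A v w =
    (THE u. u \<in> vector_fields R P A \<and> bracket_delta R P A v w = bracket_lift R P A u w)"

definition derivation_of ::
  "('r, 'z) ring_scheme \<Rightarrow> ('r, 'p) operad \<Rightarrow> ('r, 'p, 'a) opalg \<Rightarrow>
    (('r, 'p, 'a) tangent \<Rightarrow> 'a) \<Rightarrow> 'a \<Rightarrow> 'a"
  where "derivation_of R P A v = (\<lambda>a\<in>carrier A. v (tan_d R P A a))"

end

theory Submission
  imports Defs
begin

text \<open>
  A derivation of \<open>A\<close> along a morphism \<open>f : A \<rightarrow> B\<close> is the same as a morphism from \<open>A\<close> to the dual numbers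
  \<open>B[\<epsilon>]\<close> that reduces to \<open>f\<close>. Since \<open>T(A)\<close> is presented by the universal derivation \<open>d\<close>, morphisms
  \<open>T(A) \<rightarrow> B\<close> are morphisms \<open>A \<rightarrow> B[\<epsilon>]\<close>; for \<open>B = A\<close> this identifies vector fields with derivations.
  Applied twice, it determines a morphism out of \<open>T\<^sup>2(A)\<close> by its values on \<open>a\<close>, \<open>d(a)\<close>, \<open>d'(a)\<close> and
  \<open>d'd(a)\<close>, subject to a second-order Leibniz rule; the symmetry of this rule in \<open>d\<close> and \<open>d'\<close> yields the flip
  \<open>c\<close>. On these generators the two sides of the equation that defines \<open>u = [v, w]\<close> take the values
  \<open>a\<close>, \<open>D\<^sub>w a\<close>, \<open>0\<close>, \<open>D\<^sub>v D\<^sub>w a - D\<^sub>w D\<^sub>v a\<close> and \<open>a\<close>, \<open>D\<^sub>w a\<close>, \<open>0\<close>, \<open>D\<^sub>u a\<close>.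

  That the algebras \<open>T(A)\<close> exist with this universal property rests on the operad axioms: the operations of
  the formal algebra on symbols \<open>\<mu> \<otimes> v\<^sub>1 \<otimes> \<dots> \<otimes> v\<^sub>n\<close> satisfy the algebra axioms only modulo the tensor
  relations, and by multilinearity everything is checked on symbols.
\<close>

section \<open>Linear and multilinear maps\<close>

text \<open>Most structure maps, the copairing and the bracket are given by \<open>THE\<close>, so
  nothing can be computed with them before unique existence is known. Each universal property is
  therefore brought into that form: \<open>tan_hom_ex1\<close> for T(A),
  \<open>tan_tan_hom_ex1\<close> for T(T(A)), where only a Leibniz rule remains to be checked. The
  bracket also needs T of the pushout T_2(A) to be a pushout again, since the pairing in its
  defining equation lives there; dual numbers reduce this to the universal property of T_2(A). The
  main obstacle lies below the tangent structure. The null submodule of tensor relations is not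
  closed under the operations by definition, and arities are lengths of lists, so composition and
  symmetry must be followed through concatenated lists of lists. Linear combinations are
  nevertheless almost absent: a set spans if no proper submodule contains it, and a statement
  extends from a spanning set once its solutions are seen to form a submodule.\<close>

lemma linear_mapI:
  assumes "\<And>x. x \<in> carrier M \<Longrightarrow> f x \<in> carrier N"
    and "\<And>x y. \<lbrakk>x \<in> carrier M; y \<in> carrier M\<rbrakk> \<Longrightarrow> f (x \<oplus>\<^bsub>M\<^esub> y) = f x \<oplus>\<^bsub>N\<^esub> f y"
    and "\<And>r x. \<lbrakk>r \<in> carrier R; x \<in> carrier M\<rbrakk> \<Longrightarrow> f (r \<odot>\<^bsub>M\<^esub> x) = r \<odot>\<^bsub>N\<^esub> f x"
  shows "linear_map R M N f"
  using assms by (auto simp: linear_map_def)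

lemma linear_map_closed: "linear_map R M N f \<Longrightarrow> x \<in> carrier M \<Longrightarrow> f x \<in> carrier N"
  by (auto simp: linear_map_def)

lemma linear_map_add:
  "linear_map R M N f \<Longrightarrow> x \<in> carrier M \<Longrightarrow> y \<in> carrier M \<Longrightarrow>
    f (x \<oplus>\<^bsub>M\<^esub> y) = f x \<oplus>\<^bsub>N\<^esub> f y"
  by (auto simp: linear_map_def)

lemma linear_map_smult:
  "linear_map R M N f \<Longrightarrow> r \<in> carrier R \<Longrightarrow> x \<in> carrier M \<Longrightarrow>
    f (r \<odot>\<^bsub>M\<^esub> x) = r \<odot>\<^bsub>N\<^esub> f x"
  by (auto simp: linear_map_def)

text \<open>Values outside the carrier do not matter for \<open>linear_map\<close>. That
  \<open>M\<close> is a module enters because sums and multiples must stay in the carrier, where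
  \<open>f\<close> and \<open>g\<close> agree.\<close>

lemma linear_map_cong:
  assumes "module R M" "linear_map R M N f" "\<And>x. x \<in> carrier M \<Longrightarrow> f x = g x"
  shows "linear_map R M N g"
proof -
  interpret M: module R M by fact
  show ?thesis
    using assms(2,3) by (auto simp: linear_map_def Pi_iff)
qed

lemma linear_map_id: "linear_map R M M (\<lambda>x. x)"
  by (auto simp: linear_map_def)

lemma linear_map_compose:
  "linear_map R M N f \<Longrightarrow> linear_map R N K g \<Longrightarrow> linear_map R M K (\<lambda>x. g (f x))"
  unfolding linear_map_def by (auto simp: Pi_iff)

lemma linear_map_zero:
  assumes "module R M" "module R N" "linear_map R M N f"
  shows "f \<zero>\<^bsub>M\<^esub> = \<zero>\<^bsub>N\<^esub>"
proof -
  interpret M: module R M by fact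
  interpret N: module R N by fact
  \<comment> \<open>Zero is written as a scalar multiple of itself, so that homogeneity alone gives
    the claim.\<close>
  have "f \<zero>\<^bsub>M\<^esub> = f (\<zero>\<^bsub>R\<^esub> \<odot>\<^bsub>M\<^esub> \<zero>\<^bsub>M\<^esub>)" by simp
  also have "\<dots> = \<zero>\<^bsub>R\<^esub> \<odot>\<^bsub>N\<^esub> f \<zero>\<^bsub>M\<^esub>"
    by (rule linear_map_smult[OF assms(3)]) auto
  also have "\<dots> = \<zero>\<^bsub>N\<^esub>" using linear_map_closed[OF assms(3)] by simp
  finally show ?thesis .
qed

lemma linear_map_uminus:
  assumes "module R M" "module R N" "linear_map R M N f" "x \<in> carrier M"
  shows "f (\<ominus>\<^bsub>M\<^esub> x) = \<ominus>\<^bsub>N\<^esub> f x"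
proof -
  interpret M: module R M by fact
  interpret N: module R N by fact
  have "f (\<ominus>\<^bsub>M\<^esub> x) \<oplus>\<^bsub>N\<^esub> f x = f (\<ominus>\<^bsub>M\<^esub> x \<oplus>\<^bsub>M\<^esub> x)"
    using linear_map_add[OF assms(3)] assms(4) by simp
  also have "\<dots> = \<zero>\<^bsub>N\<^esub>"
    using linear_map_zero[OF assms(1-3)] assms(4) by (simp add: M.M.l_neg)
  finally show ?thesis
    using linear_map_closed[OF assms(3)] assms(4) by (simp add: N.M.minus_equality)
qed

lemma linear_map_minus:
  assumes "module R M" "module R N" "linear_map R M N f" "x \<in> carrier M" "y \<in> carrier M"
  shows "f (x \<ominus>\<^bsub>M\<^esub> y) = f x \<ominus>\<^bsub>N\<^esub> f y"
proof -
  interpret M: module R M by fact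
  show ?thesis
    using linear_map_add[OF assms(3,4), of "\<ominus>\<^bsub>M\<^esub> y"] linear_map_uminus[OF assms(1-3,5)] assms(5)
    by (simp add: a_minus_def)
qed

lemma linear_map_finsum:
  assumes "module R M" "module R N" "linear_map R M N f" "finite I" "g \<in> I \<rightarrow> carrier M"
  shows "f (\<Oplus>\<^bsub>M\<^esub>i\<in>I. g i) = (\<Oplus>\<^bsub>N\<^esub>i\<in>I. f (g i))"
proof -
  interpret M: module R M by fact
  interpret N: module R N by fact
  from assms(4,5) show ?thesis
  proof (induction I rule: finite_induct)
    case empty
    then show ?case using linear_map_zero[OF assms(1-3)] by simp
  next
    case (insert x F)
    have F: "g \<in> F \<rightarrow> carrier M" "g x \<in> carrier M"
      "(\<lambda>i. f (g i)) \<in> F \<rightarrow> carrier N" "f (g x) \<in> carrier N"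
      using insert.prems linear_map_closed[OF assms(3)] by (auto simp: Pi_iff)
    have "f (\<Oplus>\<^bsub>M\<^esub>i\<in>insert x F. g i) = f (g x \<oplus>\<^bsub>M\<^esub> (\<Oplus>\<^bsub>M\<^esub>i\<in>F. g i))"
      using F by (subst M.M.finsum_insert) (use insert.hyps in auto)
    also have "\<dots> = f (g x) \<oplus>\<^bsub>N\<^esub> (\<Oplus>\<^bsub>N\<^esub>i\<in>F. f (g i))"
      using F insert.IH linear_map_add[OF assms(3)] by simp
    also have "\<dots> = (\<Oplus>\<^bsub>N\<^esub>i\<in>insert x F. f (g i))"
      using F by (subst N.M.finsum_insert) (use insert.hyps in auto)
    finally show ?case .
  qed
qed

lemma linear_map_zero_fun:
  assumes "module R N" shows "linear_map R M N (\<lambda>x. \<zero>\<^bsub>N\<^esub>)"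
proof -
  interpret N: module R N by fact
  show ?thesis by (rule linear_mapI) auto
qed

lemma linear_map_add_fun:
  assumes "module R N" "linear_map R M N f" "linear_map R M N g"
  shows "linear_map R M N (\<lambda>x. f x \<oplus>\<^bsub>N\<^esub> g x)"
proof -
  interpret N: module R N by fact
  note c = linear_map_closed[OF assms(2)] linear_map_closed[OF assms(3)]
  show ?thesis
  proof (rule linear_mapI)
    show "f (x \<oplus>\<^bsub>M\<^esub> y) \<oplus>\<^bsub>N\<^esub> g (x \<oplus>\<^bsub>M\<^esub> y) = f x \<oplus>\<^bsub>N\<^esub> g x \<oplus>\<^bsub>N\<^esub> (f y \<oplus>\<^bsub>N\<^esub> g y)"
      if "x \<in> carrier M" "y \<in> carrier M" for x y
      using that c by (simp add: linear_map_add[OF assms(2)] linear_map_add[OF assms(3)] N.M.a_ac)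
    show "f (r \<odot>\<^bsub>M\<^esub> x) \<oplus>\<^bsub>N\<^esub> g (r \<odot>\<^bsub>M\<^esub> x) = r \<odot>\<^bsub>N\<^esub> (f x \<oplus>\<^bsub>N\<^esub> g x)"
      if "r \<in> carrier R" "x \<in> carrier M" for r x
      using that c
      by (simp add: linear_map_smult[OF assms(2)] linear_map_smult[OF assms(3)] N.smult_r_distr)
  qed (use c in auto)
qed

lemma linear_map_smult_fun:
  assumes "module R N" "linear_map R M N f" "r \<in> carrier R"
  shows "linear_map R M N (\<lambda>x. r \<odot>\<^bsub>N\<^esub> f x)"
proof -
  interpret N: module R N by fact
  note c = linear_map_closed[OF assms(2)]
  show ?thesis
  proof (rule linear_mapI)
    show "r \<odot>\<^bsub>N\<^esub> f (s \<odot>\<^bsub>M\<^esub> x) = s \<odot>\<^bsub>N\<^esub> (r \<odot>\<^bsub>N\<^esub> f x)"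
      if "s \<in> carrier R" "x \<in> carrier M" for s x
    proof -
      have "r \<odot>\<^bsub>N\<^esub> (s \<odot>\<^bsub>N\<^esub> f x) = s \<odot>\<^bsub>N\<^esub> (r \<odot>\<^bsub>N\<^esub> f x)"
        using that c assms(3) by (metis N.smult_assoc1 N.R.m_comm)
      then show ?thesis using that by (simp add: linear_map_smult[OF assms(2)])
    qed
  qed (use c assms(3) in \<open>auto simp: linear_map_add[OF assms(2)] N.smult_r_distr\<close>)
qed

lemma linear_map_uminus_fun:
  assumes "module R N" "linear_map R M N f"
  shows "linear_map R M N (\<lambda>x. \<ominus>\<^bsub>N\<^esub> f x)"
proof -
  interpret N: module R N by fact
  note c = linear_map_closed[OF assms(2)]
  show ?thesis
    by (rule linear_mapI)
      (use c in \<open>auto simp: linear_map_add[OF assms(2)] linear_map_smult[OF assms(2)]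
        N.M.minus_add N.smult_r_minus\<close>)
qed

lemma linear_map_finsum_fun:
  assumes "module R N" "finite I" "\<And>i. i \<in> I \<Longrightarrow> linear_map R M N (f i)"
  shows "linear_map R M N (\<lambda>x. \<Oplus>\<^bsub>N\<^esub>i\<in>I. f i x)"
proof -
  interpret N: module R N by fact
  note c = linear_map_closed[OF assms(3)]
  show ?thesis
  proof (rule linear_mapI)
    show "(\<Oplus>\<^bsub>N\<^esub>i\<in>I. f i (x \<oplus>\<^bsub>M\<^esub> y)) = (\<Oplus>\<^bsub>N\<^esub>i\<in>I. f i x) \<oplus>\<^bsub>N\<^esub> (\<Oplus>\<^bsub>N\<^esub>i\<in>I. f i y)"
      if "x \<in> carrier M" "y \<in> carrier M" for x y
    proof -
      have "(\<Oplus>\<^bsub>N\<^esub>i\<in>I. f i (x \<oplus>\<^bsub>M\<^esub> y)) = (\<Oplus>\<^bsub>N\<^esub>i\<in>I. f i x \<oplus>\<^bsub>N\<^esub> f i y)"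
        using that c by (intro N.M.finsum_cong') (auto simp: linear_map_add[OF assms(3)])
      also have "\<dots> = (\<Oplus>\<^bsub>N\<^esub>i\<in>I. f i x) \<oplus>\<^bsub>N\<^esub> (\<Oplus>\<^bsub>N\<^esub>i\<in>I. f i y)"
        using that c by (intro N.M.finsum_addf) auto
      finally show ?thesis .
    qed
    show "(\<Oplus>\<^bsub>N\<^esub>i\<in>I. f i (r \<odot>\<^bsub>M\<^esub> x)) = r \<odot>\<^bsub>N\<^esub> (\<Oplus>\<^bsub>N\<^esub>i\<in>I. f i x)"
      if "r \<in> carrier R" "x \<in> carrier M" for r x
    proof -
      have "(\<Oplus>\<^bsub>N\<^esub>i\<in>I. f i (r \<odot>\<^bsub>M\<^esub> x)) = (\<Oplus>\<^bsub>N\<^esub>i\<in>I. r \<odot>\<^bsub>N\<^esub> f i x)"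
        using that c by (intro N.M.finsum_cong') (auto simp: linear_map_smult[OF assms(3)])
      also have "\<dots> = r \<odot>\<^bsub>N\<^esub> (\<Oplus>\<^bsub>N\<^esub>i\<in>I. f i x)"
        using that c assms(2) by (intro N.finsum_smult_ldistr[symmetric]) auto
      finally show ?thesis .
    qed
  qed (use c in \<open>auto intro!: N.M.finsum_closed\<close>)
qed

lemma submodule_vimage:
  assumes "module R M" "module R N" "linear_map R M N f" "submodule H R N"
  shows "submodule {x \<in> carrier M. f x \<in> H} R M"
proof -
  interpret M: module R M by fact
  interpret N: module R N by fact
  note s = N.submoduleE[OF assms(4)]
  have z: "\<zero>\<^bsub>N\<^esub> \<in> H"
    using s(2,3,5) s(1) by (metis N.M.r_neg equals0I subsetD)
  show ?thesis
    by (rule M.submoduleI)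
      (auto simp: linear_map_zero[OF assms(1-3)] linear_map_uminus[OF assms(1-3)]
        linear_map_add[OF assms(3)] linear_map_smult[OF assms(3)] s z)
qed

text \<open>Extending an equation of linear maps from generators to the whole module rests on
  this.\<close>

lemma submodule_equalizer:
  assumes "module R M" "module R N" "linear_map R M N f" "linear_map R M N g"
  shows "submodule {x \<in> carrier M. f x = g x} R M"
proof -
  interpret M: module R M by fact
  show ?thesis
    by (rule M.submoduleI)
      (auto simp: linear_map_zero[OF assms(1-3)] linear_map_zero[OF assms(1,2,4)]
       linear_map_uminus[OF assms(1-3)] linear_map_uminus[OF assms(1,2,4)]
       linear_map_add[OF assms(3)] linear_map_add[OF assms(4)]
       linear_map_smult[OF assms(3)] linear_map_smult[OF assms(4)])
qed

text \<open>Linearity in a parameter is not an equation between linear maps, yet it survives zero,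
  negation, sums and multiples of \<open>x\<close>, each time by a pointwise combination of linear
  maps. It lets linearity of an operation in its operad argument be checked on generators of the
  algebra arguments.\<close>

lemma submodule_linear_in_parameter:
  assumes "module R K" "module R M" "module R N"
    and lin: "\<And>k. k \<in> carrier K \<Longrightarrow> linear_map R M N (\<phi> k)"
  shows "submodule {x \<in> carrier M. linear_map R K N (\<lambda>k. \<phi> k x)} R M"
proof -
  interpret M: module R M by fact
  note cong = linear_map_cong[OF assms(1)]
  show ?thesis
  proof (rule M.submoduleI)
    show "\<zero>\<^bsub>M\<^esub> \<in> {x \<in> carrier M. linear_map R K N (\<lambda>k. \<phi> k x)}"
      using cong[OF linear_map_zero_fun[OF assms(3)]] linear_map_zero[OF assms(2,3) lin] by simp
  next
    fix x assume x: "x \<in> {x \<in> carrier M. linear_map R K N (\<lambda>k. \<phi> k x)}"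
    have "linear_map R K N (\<lambda>k. \<phi> k (\<ominus>\<^bsub>M\<^esub> x))"
      by (rule cong[OF linear_map_uminus_fun[OF assms(3), of _ "\<lambda>k. \<phi> k x"]])
        (use x linear_map_uminus[OF assms(2,3) lin] in auto)
    then show "\<ominus>\<^bsub>M\<^esub> x \<in> {x \<in> carrier M. linear_map R K N (\<lambda>k. \<phi> k x)}" using x by simp
  next
    fix x y assume xy: "x \<in> {x \<in> carrier M. linear_map R K N (\<lambda>k. \<phi> k x)}"
      "y \<in> {x \<in> carrier M. linear_map R K N (\<lambda>k. \<phi> k x)}"
    have "linear_map R K N (\<lambda>k. \<phi> k (x \<oplus>\<^bsub>M\<^esub> y))"
      by (rule cong[OF linear_map_add_fun[OF assms(3), of _ "\<lambda>k. \<phi> k x" "\<lambda>k. \<phi> k y"]])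
        (use xy linear_map_add[OF lin] in auto)
    then show "x \<oplus>\<^bsub>M\<^esub> y \<in> {x \<in> carrier M. linear_map R K N (\<lambda>k. \<phi> k x)}" using xy by simp
  next
    fix r x assume rx: "r \<in> carrier R" "x \<in> {x \<in> carrier M. linear_map R K N (\<lambda>k. \<phi> k x)}"
    have "linear_map R K N (\<lambda>k. \<phi> k (r \<odot>\<^bsub>M\<^esub> x))"
      by (rule cong[OF linear_map_smult_fun[OF assms(3), of _ "\<lambda>k. \<phi> k x" r]])
        (use rx linear_map_smult[OF lin] in auto)
    then show "r \<odot>\<^bsub>M\<^esub> x \<in> {x \<in> carrier M. linear_map R K N (\<lambda>k. \<phi> k x)}" using rx by simp
  qed auto
qed

lemma submodule_zero_mem: "submodule H R M \<Longrightarrow> \<zero>\<^bsub>M\<^esub> \<in> H"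
  using subgroup.one_closed[OF submodule.axioms(1)] by fastforce

lemma submodule_zero: "module R M \<Longrightarrow> submodule {\<zero>\<^bsub>M\<^esub>} R M"
proof -
  assume "module R M"
  then interpret M: module R M .
  show ?thesis by (rule M.submoduleI) auto
qed

lemma submodule_Inter:
  assumes "module R M" "\<And>H. H \<in> \<H> \<Longrightarrow> submodule H R M" "\<H> \<noteq> {}"
  shows "submodule (\<Inter>\<H>) R M"
proof -
  interpret M: module R M by fact
  show ?thesis
  proof (rule M.submoduleI)
    show "\<Inter>\<H> \<subseteq> carrier M" using assms(2,3) M.submoduleE(1) by blast
    show "\<zero>\<^bsub>M\<^esub> \<in> \<Inter>\<H>" using submodule_zero_mem[OF assms(2)] by simp
  qed (use assms(2) M.submoduleE(3-5) in auto)
qed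

text \<open>Every module axiom lifts to \<open>M\<close>, holds there and is carried down again.
  With \<open>p\<close> the coset map this yields quotients; with \<open>p\<close> the identity it
  moves a module structure to a record with additional fields.\<close>

lemma module_surj_image:
  assumes "module R M" "carrier N = p ` carrier M" "p \<zero>\<^bsub>M\<^esub> = \<zero>\<^bsub>N\<^esub>"
    and add: "\<And>x y. \<lbrakk>x \<in> carrier M; y \<in> carrier M\<rbrakk> \<Longrightarrow> p (x \<oplus>\<^bsub>M\<^esub> y) = p x \<oplus>\<^bsub>N\<^esub> p y"
    and smult: "\<And>r x. \<lbrakk>r \<in> carrier R; x \<in> carrier M\<rbrakk> \<Longrightarrow> p (r \<odot>\<^bsub>M\<^esub> x) = r \<odot>\<^bsub>N\<^esub> p x"
  shows "module R N"
proof -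
  interpret M: module R M by fact
  note ps = add[symmetric] smult[symmetric]
  have surj: "\<exists>y\<in>carrier M. x = p y" if "x \<in> carrier N" for x
    using that by (simp add: assms(2) image_iff)
  have cl: "p x \<in> carrier N" if "x \<in> carrier M" for x
    using that by (simp add: assms(2))
  show ?thesis
  proof (rule moduleI)
    show "abelian_group N"
    proof (rule abelian_groupI)
      fix x y z assume "x \<in> carrier N" "y \<in> carrier N" "z \<in> carrier N"
      then obtain x' y' z' where
        [simp]: "x' \<in> carrier M" "x = p x'" "y' \<in> carrier M" "y = p y'" "z' \<in> carrier M" "z = p z'"
        using surj by metis
      show "x \<oplus>\<^bsub>N\<^esub> y \<oplus>\<^bsub>N\<^esub> z = x \<oplus>\<^bsub>N\<^esub> (y \<oplus>\<^bsub>N\<^esub> z)"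
        by (simp add: ps M.M.a_assoc)
    next
      fix x y assume "x \<in> carrier N" "y \<in> carrier N"
      then obtain x' y' where
        [simp]: "x' \<in> carrier M" "x = p x'" "y' \<in> carrier M" "y = p y'"
        using surj by metis
      show "x \<oplus>\<^bsub>N\<^esub> y \<in> carrier N" by (simp add: ps cl)
      show "x \<oplus>\<^bsub>N\<^esub> y = y \<oplus>\<^bsub>N\<^esub> x"
        using M.M.a_comm[of x' y'] by (simp add: ps)
    next
      fix x assume "x \<in> carrier N"
      then obtain x' where [simp]: "x' \<in> carrier M" "x = p x'" using surj by metis
      have "p (\<ominus>\<^bsub>M\<^esub> x') \<oplus>\<^bsub>N\<^esub> x = \<zero>\<^bsub>N\<^esub>"
        using assms(3) by (simp add: ps M.M.l_neg)
      then show "\<exists>y\<in>carrier N. y \<oplus>\<^bsub>N\<^esub> x = \<zero>\<^bsub>N\<^esub>" by (meson M.M.a_inv_closed \<open>x' \<in> carrier M\<close> cl)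
      show "\<zero>\<^bsub>N\<^esub> \<oplus>\<^bsub>N\<^esub> x = x" by (simp add: assms(3)[symmetric] ps)
    next
      show "\<zero>\<^bsub>N\<^esub> \<in> carrier N" using cl[of "\<zero>\<^bsub>M\<^esub>"] assms(3) by simp
    qed
    show "cring R" by (rule M.R.is_cring)
  next
    fix a b x assume [simp]: "a \<in> carrier R" "b \<in> carrier R" and "x \<in> carrier N"
    then obtain x' where [simp]: "x' \<in> carrier M" "x = p x'" using surj by metis
    show "(a \<oplus>\<^bsub>R\<^esub> b) \<odot>\<^bsub>N\<^esub> x = (a \<odot>\<^bsub>N\<^esub> x) \<oplus>\<^bsub>N\<^esub> (b \<odot>\<^bsub>N\<^esub> x)"
      and "(a \<otimes>\<^bsub>R\<^esub> b) \<odot>\<^bsub>N\<^esub> x = a \<odot>\<^bsub>N\<^esub> (b \<odot>\<^bsub>N\<^esub> x)"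
      by (simp_all add: ps M.smult_l_distr M.smult_assoc1)
  next
    fix a x y assume [simp]: "a \<in> carrier R" and "x \<in> carrier N" "y \<in> carrier N"
    then obtain x' y' where
      [simp]: "x' \<in> carrier M" "x = p x'" "y' \<in> carrier M" "y = p y'"
      using surj by metis
    show "a \<odot>\<^bsub>N\<^esub> (x \<oplus>\<^bsub>N\<^esub> y) = (a \<odot>\<^bsub>N\<^esub> x) \<oplus>\<^bsub>N\<^esub> (a \<odot>\<^bsub>N\<^esub> y)"
      by (simp add: ps M.smult_r_distr)
  next
    fix a x assume [simp]: "a \<in> carrier R" and "x \<in> carrier N"
    then obtain x' where [simp]: "x' \<in> carrier M" "x = p x'" using surj by metis
    show "a \<odot>\<^bsub>N\<^esub> x \<in> carrier N" by (simp add: ps cl)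
  next
    fix x assume "x \<in> carrier N"
    then obtain x' where [simp]: "x' \<in> carrier M" "x = p x'" using surj by metis
    show "\<one>\<^bsub>R\<^esub> \<odot>\<^bsub>N\<^esub> x = x" by (simp add: ps)
  qed
qed

section \<open>Spanning sets and multilinear maps\<close>

definition spans :: "('r, 'z) ring_scheme \<Rightarrow> ('r, 'm, 'y) module_scheme \<Rightarrow> 'm set \<Rightarrow> bool"
  where "spans R M G \<longleftrightarrow>
    G \<subseteq> carrier M \<and> (\<forall>H. submodule H R M \<longrightarrow> G \<subseteq> H \<longrightarrow> carrier M \<subseteq> H)"

lemma linear_map_eq_on_span:
  assumes "module R M" "module R N" "spans R M G" "linear_map R M N f" "linear_map R M N g"
    "\<And>x. x \<in> G \<Longrightarrow> f x = g x" "x \<in> carrier M"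
  shows "f x = g x"
  using submodule_equalizer[OF assms(1,2,4,5)] assms(3,6,7) unfolding spans_def by blast

lemma spans_image:
  assumes "module R M" "module R N" "linear_map R M N p" "spans R M G" "p ` carrier M = carrier N"
  shows "spans R N (p ` G)"
  unfolding spans_def
proof (intro conjI allI impI)
  show "p ` G \<subseteq> carrier N" using assms(4,5) by (auto simp: spans_def)
  fix H assume H: "submodule H R N" "p ` G \<subseteq> H"
  have "carrier M \<subseteq> {x \<in> carrier M. p x \<in> H}"
    using assms(4) H(2) submodule_vimage[OF assms(1-3) H(1)] unfolding spans_def by blast
  then show "carrier N \<subseteq> H" unfolding assms(5)[symmetric] by (intro image_subsetI) (simp add: subset_iff)
qed

text \<open>One slot is singled out by splitting the argument list. For \<open>n = 0\<close> the
  condition is vacuous, so closedness of nullary operations has to be required separately.\<close>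

definition multilinear ::
  "('r, 'z) ring_scheme \<Rightarrow> nat \<Rightarrow> ('r, 'm, 'y) module_scheme \<Rightarrow> ('r, 'n, 'x) module_scheme \<Rightarrow>
    ('m list \<Rightarrow> 'n) \<Rightarrow> bool"
  where "multilinear R n M N \<phi> \<longleftrightarrow>
    (\<forall>as bs. set as \<subseteq> carrier M \<longrightarrow> set bs \<subseteq> carrier M \<longrightarrow> Suc (length as + length bs) = n \<longrightarrow>
      linear_map R M N (\<lambda>x. \<phi> (as @ x # bs)))"

lemma multilinearD:
  "multilinear R n M N \<phi> \<Longrightarrow> set as \<subseteq> carrier M \<Longrightarrow> set bs \<subseteq> carrier M \<Longrightarrow>
    Suc (length as + length bs) = n \<Longrightarrow> linear_map R M N (\<lambda>x. \<phi> (as @ x # bs))"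
  by (auto simp: multilinear_def)

lemma multilinear_update:
  assumes "multilinear R n M N \<phi>" "set as \<subseteq> carrier M" "length as = n" "i < n"
  shows "linear_map R M N (\<lambda>x. \<phi> (as[i := x]))"
proof -
  have "linear_map R M N (\<lambda>x. \<phi> (take i as @ x # drop (Suc i) as))"
    by (rule multilinearD[OF assms(1)])
      (use assms set_take_subset[of i as] set_drop_subset[of "Suc i" as] in auto)
  then show ?thesis using assms by (simp add: upd_conv_take_nth_drop)
qed

lemma multilinearI_update:
  assumes "module R M"
    and "\<And>as i. set as \<subseteq> carrier M \<Longrightarrow> length as = n \<Longrightarrow> i < n \<Longrightarrow>
      linear_map R M N (\<lambda>x. \<phi> (as[i := x]))"
  shows "multilinear R n M N \<phi>"
  unfolding multilinear_def
proof (intro allI impI)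
  interpret M: module R M by fact
  fix as bs assume *: "set as \<subseteq> carrier M" "set bs \<subseteq> carrier M" "Suc (length as + length bs) = n"
  show "linear_map R M N (\<lambda>x. \<phi> (as @ x # bs))"
    using assms(2)[of "as @ \<zero>\<^bsub>M\<^esub> # bs" "length as"] * by simp
qed

lemma multilinear_map:
  assumes "linear_map R M N f" "multilinear R n N K \<phi>"
  shows "multilinear R n M K (\<lambda>as. \<phi> (map f as))"
  unfolding multilinear_def
proof (intro allI impI)
  fix as bs assume *: "set as \<subseteq> carrier M" "set bs \<subseteq> carrier M" "Suc (length as + length bs) = n"
  have "linear_map R N K (\<lambda>x. \<phi> (map f as @ x # map f bs))"
    by (rule multilinearD[OF assms(2)]) (use * linear_map_closed[OF assms(1)] in auto)
  from linear_map_compose[OF assms(1) this]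
  show "linear_map R M K (\<lambda>x. \<phi> (map f (as @ x # bs)))" by simp
qed

lemma multilinear_compose:
  "multilinear R n M N \<phi> \<Longrightarrow> linear_map R N K f \<Longrightarrow> multilinear R n M K (\<lambda>as. f (\<phi> as))"
  unfolding multilinear_def using linear_map_compose by blast

lemma permute_list_update:
  assumes "\<sigma> permutes {..<length xs}" "i < length xs"
  shows "permute_list \<sigma> (xs[\<sigma> i := x]) = (permute_list \<sigma> xs)[i := x]"
proof (rule nth_equalityI)
  fix j assume j: "j < length (permute_list \<sigma> (xs[\<sigma> i := x]))"
  have "\<sigma> j < length xs" using assms j permutes_in_image[OF assms(1)] by auto
  then show "permute_list \<sigma> (xs[\<sigma> i := x]) ! j = (permute_list \<sigma> xs)[i := x] ! j"
    using assms j permutes_inj[OF assms(1)]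
    by (auto simp: permute_list_nth nth_list_update inj_eq)
qed simp

lemma multilinear_permute:
  assumes "module R M" "multilinear R n M N \<phi>" "\<sigma> permutes {..<n}"
  shows "multilinear R n M N (\<lambda>as. \<phi> (permute_list \<sigma> as))"
proof (rule multilinearI_update[OF assms(1)])
  fix as i assume as: "set as \<subseteq> carrier M" "length as = n" "i < n"
  \<comment> \<open>Entry \<open>i\<close> of \<open>as\<close> appears in slot \<open>j\<close> of
    the permuted list exactly when \<open>\<sigma> j = i\<close>, because
    \<open>permute_list\<close> reads position \<open>\<sigma> j\<close> there.\<close>
  obtain j where j: "i = \<sigma> j" "j < n"
    using as(3) permutes_image[OF assms(3)] by (metis imageE lessThan_iff)
  have "linear_map R M N (\<lambda>x. \<phi> ((permute_list \<sigma> as)[j := x]))"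
    by (rule multilinear_update[OF assms(2)]) (use as assms(3) j in auto)
  then show "linear_map R M N (\<lambda>x. \<phi> (permute_list \<sigma> (as[i := x])))"
    using permute_list_update[of \<sigma> as j] assms(3) as j by simp
qed

text \<open>The induction is over an arbitrary prefix that is followed by generators: if the claim
  holds with every generator in the last place of the prefix, it holds with any element there, since
  the good elements form a submodule. \<open>Q\<close> need not be an equation; linearity in a
  parameter is covered as well.\<close>

lemma multilinear_induct:
  assumes "spans R M G"
    and slot: "\<And>as bs. set as \<subseteq> carrier M \<Longrightarrow> set bs \<subseteq> carrier M \<Longrightarrow>
      Suc (length as + length bs) = n \<Longrightarrow> submodule {x \<in> carrier M. Q (as @ x # bs)} R M"
    and base: "\<And>gs. set gs \<subseteq> G \<Longrightarrow> length gs = n \<Longrightarrow> Q gs"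
    and "set as \<subseteq> carrier M" "length as = n"
  shows "Q as"
proof -
  have "Q (as @ gs)" if "set as \<subseteq> carrier M" "set gs \<subseteq> G" "length as + length gs = n" for as gs
    using that
  proof (induction as arbitrary: gs rule: rev_induct)
    case Nil
    then show ?case using base by simp
  next
    case (snoc a as)
    have "carrier M \<subseteq> {x \<in> carrier M. Q (as @ x # gs)}"
    proof -
      have "submodule {x \<in> carrier M. Q (as @ x # gs)} R M"
        by (rule slot) (use snoc.prems assms(1) in \<open>auto simp: spans_def\<close>)
      moreover have "G \<subseteq> {x \<in> carrier M. Q (as @ x # gs)}"
        using snoc assms(1) by (auto simp: spans_def)
      ultimately show ?thesis using assms(1) by (auto simp: spans_def)
    qed
    then show ?case using snoc.prems by auto
  qed
  from this[of as "[]"] assms(4,5) show ?thesis by simp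
qed

lemma multilinear_eqI:
  assumes "module R M" "module R N" "spans R M G"
    "multilinear R n M N \<phi>" "multilinear R n M N \<psi>"
    "\<And>gs. set gs \<subseteq> G \<Longrightarrow> length gs = n \<Longrightarrow> \<phi> gs = \<psi> gs"
    "set as \<subseteq> carrier M" "length as = n"
  shows "\<phi> as = \<psi> as"
proof (rule multilinear_induct[OF assms(3), where n = n and Q = "\<lambda>as. \<phi> as = \<psi> as"])
  fix as bs assume "set as \<subseteq> carrier M" "set bs \<subseteq> carrier M" "Suc (length as + length bs) = n"
  then show "submodule {x \<in> carrier M. \<phi> (as @ x # bs) = \<psi> (as @ x # bs)} R M"
    by (intro submodule_equalizer[OF assms(1,2)] multilinearD[OF assms(4)] multilinearD[OF assms(5)])
qed (use assms(6-8) in auto)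

text \<open>The composition axiom has a list of lists as argument, with inner lengths
  \<open>ks\<close> prescribed by the arities. The inner lists are treated one after another in the
  manner of \<open>multilinear_induct\<close>, each by \<open>multilinear_eqI\<close> with the
  others held fixed.\<close>

lemma nested_multilinear_eqI:
  assumes "module R M" "module R N" "spans R M G"
    and \<phi>: "\<And>ass bss k. map length ass @ k # map length bss = ks \<Longrightarrow>
      \<forall>as\<in>set ass \<union> set bss. set as \<subseteq> carrier M \<Longrightarrow>
      multilinear R k M N (\<lambda>as. \<phi> (ass @ as # bss))"
    and \<psi>: "\<And>ass bss k. map length ass @ k # map length bss = ks \<Longrightarrow>
      \<forall>as\<in>set ass \<union> set bss. set as \<subseteq> carrier M \<Longrightarrow>
      multilinear R k M N (\<lambda>as. \<psi> (ass @ as # bss))"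
    and base: "\<And>gss. \<forall>gs\<in>set gss. set gs \<subseteq> G \<Longrightarrow> map length gss = ks \<Longrightarrow> \<phi> gss = \<psi> gss"
    and "\<forall>as\<in>set ass. set as \<subseteq> carrier M" "map length ass = ks"
  shows "\<phi> ass = \<psi> ass"
proof -
  have G: "G \<subseteq> carrier M" using assms(3) by (auto simp: spans_def)
  have "\<phi> (ass @ gss) = \<psi> (ass @ gss)"
    if "\<forall>as\<in>set ass. set as \<subseteq> carrier M" "\<forall>gs\<in>set gss. set gs \<subseteq> G"
      "map length (ass @ gss) = ks" for ass gss
    using that
  proof (induction ass arbitrary: gss rule: rev_induct)
    case Nil
    then show ?case using base by simp
  next
    case (snoc as ass)
    have car: "\<forall>as\<in>set ass \<union> set gss. set as \<subseteq> carrier M"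
      using snoc.prems(1,2) G by auto
    have "\<phi> (ass @ as # gss) = \<psi> (ass @ as # gss)"
    proof (rule multilinear_eqI[OF assms(1-3), where n = "length as"])
      show "multilinear R (length as) M N (\<lambda>as. \<phi> (ass @ as # gss))"
        by (rule \<phi>) (use snoc.prems car in auto)
      show "multilinear R (length as) M N (\<lambda>as. \<psi> (ass @ as # gss))"
        by (rule \<psi>) (use snoc.prems car in auto)
      show "\<phi> (ass @ gs # gss) = \<psi> (ass @ gs # gss)" if "set gs \<subseteq> G" "length gs = length as" for gs
        by (rule snoc.IH) (use snoc.prems that in auto)
    qed (use snoc.prems in auto)
    then show ?case by simp
  qed
  from this[of ass "[]"] assms(7,8) show ?thesis by simp
qed

section \<open>Algebras with multilinear operations and their quotients\<close>

lemma in_listset_iff: "xs \<in> listset Xs \<longleftrightarrow> list_all2 (\<in>) xs Xs"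
  by (induction Xs arbitrary: xs) (auto simp: set_Cons_def list_all2_Cons2)

lemma set_subset_imageE:
  assumes "set ys \<subseteq> f ` B"
  obtains xs where "ys = map f xs" "set xs \<subseteq> B"
proof -
  have "ys \<in> lists (f ` B)" using assms by auto
  then have "ys \<in> map f ` lists B" by (simp only: lists_image)
  then show ?thesis using that by auto
qed

lemma nested_set_subset_imageE:
  assumes "\<forall>ys\<in>set yss. set ys \<subseteq> f ` B"
  obtains xss where "yss = map (map f) xss" "\<forall>xs\<in>set xss. set xs \<subseteq> B"
proof -
  have "yss \<in> lists (lists (f ` B))" using assms by auto
  then have "yss \<in> map (map f) ` lists (lists B)" by (simp only: lists_image)
  then show ?thesis using that by auto
qed

lemma (in abelian_group) minus_eq_zero_iff:
  assumes "x \<in> carrier G" "y \<in> carrier G"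
  shows "x \<ominus> y = \<zero> \<longleftrightarrow> x = y"
  using assms minus_equality[of x "\<ominus> y"] by (auto simp: a_minus_def r_neg)

locale coset_module = module R A
  for R :: "('r, 'z) ring_scheme" and A :: "('r, 'p, 'a) opalg" +
  fixes I :: "'a set"
  assumes submodule: "submodule I R A"
begin

lemma abelian_subgroup: "abelian_subgroup I A"
  using submodule.axioms(1)[OF submodule] module.axioms(2)[OF module_axioms]
  by (intro abelian_subgroupI3 additive_subgroup.intro)

lemma carrier_quot: "carrier (quot_alg A I) = (\<lambda>x. I +>\<^bsub>A\<^esub> x) ` carrier A"
  by (auto simp: quot_alg_def A_RCOSETS_def')

lemma zero_quot: "\<zero>\<^bsub>quot_alg A I\<^esub> = I"
  by (simp add: quot_alg_def)

lemma coset_zero: "I +>\<^bsub>A\<^esub> \<zero>\<^bsub>A\<^esub> = \<zero>\<^bsub>quot_alg A I\<^esub>"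
  using abelian_subgroup.a_rcos_const[OF abelian_subgroup submodule_zero_mem[OF submodule]]
  by (simp add: zero_quot)

lemma coset_eq_iff:
  assumes "x \<in> carrier A" "y \<in> carrier A"
  shows "I +>\<^bsub>A\<^esub> x = I +>\<^bsub>A\<^esub> y \<longleftrightarrow> x \<ominus>\<^bsub>A\<^esub> y \<in> I"
  using assms abelian_subgroup.a_rcos_module[OF abelian_subgroup assms(2,1)]
    abelian_subgroup.a_repr_independence'[OF abelian_subgroup]
    abelian_subgroup.a_rcos_self[OF abelian_subgroup]
  by (metis a_minus_def)

lemma coset_eq_zero_iff:
  assumes "x \<in> carrier A"
  shows "I +>\<^bsub>A\<^esub> x = \<zero>\<^bsub>quot_alg A I\<^esub> \<longleftrightarrow> x \<in> I"
  using coset_eq_iff[OF assms M.zero_closed] assms M.minus_equality[of "\<zero>\<^bsub>A\<^esub>" "\<zero>\<^bsub>A\<^esub>"]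
  by (simp add: coset_zero a_minus_def)

lemma mem_coset_iff:
  assumes "x \<in> carrier A"
  shows "y \<in> I +>\<^bsub>A\<^esub> x \<longleftrightarrow> y \<in> carrier A \<and> I +>\<^bsub>A\<^esub> y = I +>\<^bsub>A\<^esub> x"
  using assms abelian_subgroup.a_elemrcos_carrier[OF abelian_subgroup]
    abelian_subgroup.a_repr_independence'[OF abelian_subgroup]
    abelian_subgroup.a_rcos_self[OF abelian_subgroup]
  by metis

lemma add_quot:
  assumes "x \<in> carrier A" "y \<in> carrier A"
  shows "(I +>\<^bsub>A\<^esub> x) \<oplus>\<^bsub>quot_alg A I\<^esub> (I +>\<^bsub>A\<^esub> y) = I +>\<^bsub>A\<^esub> (x \<oplus>\<^bsub>A\<^esub> y)"
  using abelian_subgroup.a_rcos_sum[OF abelian_subgroup assms] by (simp add: quot_alg_def)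

text \<open>The quotient multiplies a coset by taking a union over all its representatives.
  Linearity puts their multiples into one coset, and the union collapses because the original coset
  is not empty.\<close>

lemma smult_quot:
  assumes "r \<in> carrier R" "x \<in> carrier A"
  shows "r \<odot>\<^bsub>quot_alg A I\<^esub> (I +>\<^bsub>A\<^esub> x) = I +>\<^bsub>A\<^esub> (r \<odot>\<^bsub>A\<^esub> x)"
proof -
  have "I +>\<^bsub>A\<^esub> (r \<odot>\<^bsub>A\<^esub> y) = I +>\<^bsub>A\<^esub> (r \<odot>\<^bsub>A\<^esub> x)" if "y \<in> I +>\<^bsub>A\<^esub> x" for y
  proof -
    have y: "y \<in> carrier A" "y \<ominus>\<^bsub>A\<^esub> x \<in> I"
      using that assms mem_coset_iff coset_eq_iff by auto
    have "r \<odot>\<^bsub>A\<^esub> (y \<ominus>\<^bsub>A\<^esub> x) = r \<odot>\<^bsub>A\<^esub> y \<ominus>\<^bsub>A\<^esub> r \<odot>\<^bsub>A\<^esub> x"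
      using y assms by (simp add: a_minus_def smult_r_distr smult_r_minus)
    with y assms submoduleE(4)[OF submodule assms(1) y(2)] show ?thesis
      by (simp add: coset_eq_iff)
  qed
  moreover have "x \<in> I +>\<^bsub>A\<^esub> x" using assms mem_coset_iff by simp
  ultimately have "(\<Union>y\<in>I +>\<^bsub>A\<^esub> x. I +>\<^bsub>A\<^esub> (r \<odot>\<^bsub>A\<^esub> y)) = I +>\<^bsub>A\<^esub> (r \<odot>\<^bsub>A\<^esub> x)" by blast
  then show ?thesis by (simp add: quot_alg_def)
qed

lemma module_quot: "module R (quot_alg A I)"
  by (rule module_surj_image[where M = A and p = "\<lambda>x. I +>\<^bsub>A\<^esub> x"])
    (simp_all add: module_axioms carrier_quot coset_zero add_quot smult_quot)

lemma linear_coset: "linear_map R A (quot_alg A I) (\<lambda>x. I +>\<^bsub>A\<^esub> x)"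
  by (rule linear_mapI) (simp_all add: carrier_quot add_quot smult_quot)

lemma quot_lift:
  assumes "module R N" "linear_map R A N f" "\<And>x. x \<in> I \<Longrightarrow> f x = \<zero>\<^bsub>N\<^esub>"
  obtains g where "g \<in> carrier (quot_alg A I) \<rightarrow>\<^sub>E carrier N" "linear_map R (quot_alg A I) N g"
    "\<And>x. x \<in> carrier A \<Longrightarrow> g (I +>\<^bsub>A\<^esub> x) = f x"
proof -
  interpret N: module R N by fact
  have eq: "f x = f y" if xy: "x \<in> carrier A" "y \<in> carrier A" "I +>\<^bsub>A\<^esub> x = I +>\<^bsub>A\<^esub> y" for x y
  proof -
    have "f x \<ominus>\<^bsub>N\<^esub> f y = \<zero>\<^bsub>N\<^esub>"
      using assms(3)[of "x \<ominus>\<^bsub>A\<^esub> y"] xy coset_eq_iff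
        linear_map_minus[OF module_axioms assms(1,2)] by simp
    then show ?thesis
      using xy linear_map_closed[OF assms(2)] N.M.minus_eq_zero_iff by blast
  qed
  \<comment> \<open>A representative is chosen; \<open>eq\<close> makes the value independent of the
    choice. Restriction to the carrier makes \<open>g\<close> extensional, as morphisms have to
    be.\<close>
  define g where "g = (\<lambda>X\<in>carrier (quot_alg A I). f (SOME x. x \<in> carrier A \<and> I +>\<^bsub>A\<^esub> x = X))"
  have g: "g (I +>\<^bsub>A\<^esub> x) = f x" if "x \<in> carrier A" for x
  proof -
    have "(SOME y. y \<in> carrier A \<and> I +>\<^bsub>A\<^esub> y = I +>\<^bsub>A\<^esub> x) \<in> carrier A \<and>
      I +>\<^bsub>A\<^esub> (SOME y. y \<in> carrier A \<and> I +>\<^bsub>A\<^esub> y = I +>\<^bsub>A\<^esub> x) = I +>\<^bsub>A\<^esub> x"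
      by (rule someI[where x = x]) (use that in simp)
    then have "f (SOME y. y \<in> carrier A \<and> I +>\<^bsub>A\<^esub> y = I +>\<^bsub>A\<^esub> x) = f x"
      using eq[OF _ that] by blast
    moreover have "I +>\<^bsub>A\<^esub> x \<in> carrier (quot_alg A I)" using that carrier_quot by simp
    ultimately show ?thesis by (simp add: g_def)
  qed
  show ?thesis
  proof
    show "g \<in> carrier (quot_alg A I) \<rightarrow>\<^sub>E carrier N"
    proof (rule PiE_I)
      fix X assume "X \<in> carrier (quot_alg A I)"
      then show "g X \<in> carrier N"
        using g linear_map_closed[OF assms(2)] by (auto simp: carrier_quot)
    qed (auto simp: g_def)
    show "linear_map R (quot_alg A I) N g"
      by (rule linear_mapI)
        (auto simp: carrier_quot g add_quot smult_quot linear_map_closed[OF assms(2)]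
          linear_map_add[OF assms(2)] linear_map_smult[OF assms(2)])
  qed (rule g)
qed

end

text \<open>A common weakening of algebras: the operations are closed and multilinear, but unit,
  associativity and symmetry are not asked for. The formal algebra on symbols is treated at this
  level, and it is enough for forming quotients.\<close>

locale ops_algebra = module R A
  for R :: "('r, 'z) ring_scheme" and P :: "('r, 'p) operad" and A :: "('r, 'p, 'a) opalg" +
  assumes oper_closed:
      "\<lbrakk>\<mu> \<in> carrier (ops P (length as)); set as \<subseteq> carrier A\<rbrakk> \<Longrightarrow> oper A \<mu> as \<in> carrier A"
    and oper_multilinear: "\<mu> \<in> carrier (ops P n) \<Longrightarrow> multilinear R n A A (oper A \<mu>)"

context operad_algebra
begin

lemma alg_closed:
  "\<lbrakk>\<mu> \<in> carrier (ops P (length as)); set as \<subseteq> carrier A\<rbrakk> \<Longrightarrow> oper A \<mu> as \<in> carrier A"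
  using linear_map_closed[OF oper_linear_left] .

lemma alg_multilinear: "\<mu> \<in> carrier (ops P n) \<Longrightarrow> multilinear R n A A (oper A \<mu>)"
  using oper_linear_right by (auto simp: multilinear_def)

lemma ops_algebra: "ops_algebra R P A"
  by (rule ops_algebra.intro[OF module_alg], unfold_locales) (auto intro: alg_closed alg_multilinear)

end

text \<open>Stability in a single slot suffices for well defined operations on cosets. Both
  quotients are instances: the formal algebra by the tensor relations, and the free algebra by an
  ideal of relations.\<close>

locale ops_quotient = ops_algebra R P A + coset_module R A I
  for R :: "('r, 'z) ring_scheme" and P :: "('r, 'p) operad" and A :: "('r, 'p, 'a) opalg"
    and I :: "'a set" +
  assumes oper_ideal:
    "\<lbrakk>\<mu> \<in> carrier (ops P (Suc (length as + length bs))); set as \<subseteq> carrier A; set bs \<subseteq> carrier A;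
      x \<in> I\<rbrakk> \<Longrightarrow> oper A \<mu> (as @ x # bs) \<in> I"
begin

text \<open>Arguments are exchanged from left to right. One exchange changes the value by the
  operation with a difference from \<open>I\<close> in that slot, hence by an element of
  \<open>I\<close>.\<close>

lemma coset_oper_cong:
  assumes "list_all2 (\<lambda>x y. I +>\<^bsub>A\<^esub> x = I +>\<^bsub>A\<^esub> y) xs ys" "set xs \<subseteq> carrier A" "set ys \<subseteq> carrier A"
    "\<mu> \<in> carrier (ops P (length xs))"
  shows "I +>\<^bsub>A\<^esub> oper A \<mu> xs = I +>\<^bsub>A\<^esub> oper A \<mu> ys"
proof -
  \<comment> \<open>The list \<open>zs\<close> collects the arguments already exchanged; the
    induction needs it as an arbitrary prefix.\<close>
  have "I +>\<^bsub>A\<^esub> oper A \<mu> (zs @ xs) = I +>\<^bsub>A\<^esub> oper A \<mu> (zs @ ys)"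
    if "set zs \<subseteq> carrier A" "\<mu> \<in> carrier (ops P (length (zs @ xs)))" for zs
    using assms(1-3) that
  proof (induction xs ys arbitrary: zs rule: list_all2_induct)
    case Nil
    then show ?case by simp
  next
    case (Cons x xs y ys)
    have cl: "oper A \<mu> (zs @ x # xs) \<in> carrier A" "oper A \<mu> (zs @ y # xs) \<in> carrier A"
      using Cons.prems by (auto intro!: oper_closed)
    have lin: "linear_map R A A (\<lambda>x. oper A \<mu> (zs @ x # xs))"
      by (rule multilinearD[OF oper_multilinear]) (use Cons.prems in auto)
    have "oper A \<mu> (zs @ (x \<ominus>\<^bsub>A\<^esub> y) # xs) \<in> I"
      by (rule oper_ideal) (use Cons.prems Cons.hyps coset_eq_iff in auto)
    then have "I +>\<^bsub>A\<^esub> oper A \<mu> (zs @ x # xs) = I +>\<^bsub>A\<^esub> oper A \<mu> (zs @ y # xs)"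
      using Cons.prems cl linear_map_minus[OF module_axioms module_axioms lin, of x y]
      by (simp add: coset_eq_iff)
    also have "\<dots> = I +>\<^bsub>A\<^esub> oper A \<mu> ((zs @ [y]) @ ys)"
      using Cons.IH[of "zs @ [y]"] Cons.prems by simp
    finally show ?case by simp
  qed
  from this[of "[]"] assms show ?thesis by simp
qed

text \<open>The defining union runs over all lists of representatives, and by
  \<open>coset_oper_cong\<close> all of them yield the same coset.\<close>

lemma oper_quot:
  assumes "\<mu> \<in> carrier (ops P (length xs))" "set xs \<subseteq> carrier A"
  shows "oper (quot_alg A I) \<mu> (map (\<lambda>x. I +>\<^bsub>A\<^esub> x) xs) = I +>\<^bsub>A\<^esub> oper A \<mu> xs"
proof -
  have "I +>\<^bsub>A\<^esub> oper A \<mu> ys = I +>\<^bsub>A\<^esub> oper A \<mu> xs" if "ys \<in> listset (map (\<lambda>x. I +>\<^bsub>A\<^esub> x) xs)" for ys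
  proof -
    have *: "list_all2 (\<lambda>y x. y \<in> I +>\<^bsub>A\<^esub> x) ys xs"
      using that by (simp add: in_listset_iff list_all2_map2)
    have len: "length ys = length xs" using * by (rule list_all2_lengthD)
    have nth: "ys ! i \<in> carrier A \<and> I +>\<^bsub>A\<^esub> ys ! i = I +>\<^bsub>A\<^esub> xs ! i" if "i < length xs" for i
    proof -
      have "xs ! i \<in> carrier A" using that assms(2) nth_mem by blast
      moreover have "ys ! i \<in> I +>\<^bsub>A\<^esub> xs ! i" using list_all2_nthD2[OF * that] .
      ultimately show ?thesis using mem_coset_iff by blast
    qed
    show ?thesis
    proof (rule coset_oper_cong)
      show "set ys \<subseteq> carrier A" using nth len by (auto simp: in_set_conv_nth)
    qed (use nth len assms in \<open>auto simp: list_all2_conv_all_nth\<close>)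
  qed
  moreover have "xs \<in> listset (map (\<lambda>x. I +>\<^bsub>A\<^esub> x) xs)"
    using assms(2) mem_coset_iff
    by (auto simp: in_listset_iff list_all2_map2 list_all2_same)
  ultimately have "(\<Union>ys\<in>listset (map (\<lambda>x. I +>\<^bsub>A\<^esub> x) xs). I +>\<^bsub>A\<^esub> oper A \<mu> ys) = I +>\<^bsub>A\<^esub> oper A \<mu> xs"
    by blast
  then show ?thesis by (simp add: quot_alg_def)
qed

lemma quot_alg_hom_lift:
  assumes "module R B" "linear_map R A B f" "\<And>x. x \<in> I \<Longrightarrow> f x = \<zero>\<^bsub>B\<^esub>"
    and "\<And>\<mu> xs. \<lbrakk>\<mu> \<in> carrier (ops P (length xs)); set xs \<subseteq> carrier A\<rbrakk> \<Longrightarrow>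
      f (oper A \<mu> xs) = oper B \<mu> (map f xs)"
  obtains g where "g \<in> alg_hom R P (quot_alg A I) B" "\<And>x. x \<in> carrier A \<Longrightarrow> g (I +>\<^bsub>A\<^esub> x) = f x"
proof -
  obtain g where g: "g \<in> carrier (quot_alg A I) \<rightarrow>\<^sub>E carrier B" "linear_map R (quot_alg A I) B g"
    "\<And>x. x \<in> carrier A \<Longrightarrow> g (I +>\<^bsub>A\<^esub> x) = f x"
    using quot_lift[OF assms(1-3)] by metis
  have "g (oper (quot_alg A I) \<mu> as) = oper B \<mu> (map g as)"
    if \<mu>: "\<mu> \<in> carrier (ops P (length as))" and as: "set as \<subseteq> carrier (quot_alg A I)" for \<mu> as
  proof -
    obtain xs where xs: "as = map (\<lambda>x. I +>\<^bsub>A\<^esub> x) xs" "set xs \<subseteq> carrier A"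
      using as set_subset_imageE unfolding carrier_quot by metis
    have "map g as = map f xs" using xs g(3) by auto
    then show ?thesis
      using xs \<mu> by (simp add: oper_quot g(3) oper_closed assms(4) del: map_map)
  qed
  then have "g \<in> alg_hom R P (quot_alg A I) B" using g by (simp add: alg_hom_def)
  then show ?thesis using that g(3) by metis
qed

end

section \<open>Transport of operations along surjections\<close>

lemma ops_algebra_surj_image:
  fixes A :: "('r, 'p, 'a) opalg" and B :: "('r, 'p, 'b) opalg"
  assumes "ops_algebra R P A" "module R B" "linear_map R A B p" "p ` carrier A = carrier B"
    and op: "\<And>\<mu> xs. \<lbrakk>\<mu> \<in> carrier (ops P (length xs)); set xs \<subseteq> carrier A\<rbrakk> \<Longrightarrow>
      oper B \<mu> (map p xs) = p (oper A \<mu> xs)"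
  shows "ops_algebra R P B"
proof -
  interpret A: ops_algebra R P A by fact
  interpret B: module R B by fact
  note lift = set_subset_imageE[of _ p "carrier A", unfolded assms(4)]
  have surj: "\<exists>y\<in>carrier A. x = p y" if "x \<in> carrier B" for x
    using that by (simp add: assms(4)[symmetric] image_iff)
  note lins = linear_map_add[OF assms(3)] linear_map_smult[OF assms(3)]
    linear_map_closed[OF assms(3)]
  show ?thesis
  proof (unfold_locales, goal_cases)
    case (1 \<mu> as)
    obtain xs where xs: "as = map p xs" "set xs \<subseteq> carrier A" using 1(2) by (rule lift)
    then show ?case using 1(1) op[of \<mu> xs] A.oper_closed[of \<mu> xs] by (simp add: lins)
  next
    case (2 \<mu> n)
    show ?case
      unfolding multilinear_def
    proof (intro allI impI)
      fix as bs
      assume *: "set as \<subseteq> carrier B" "set bs \<subseteq> carrier B" "Suc (length as + length bs) = n"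
      obtain xs where xs: "as = map p xs" "set xs \<subseteq> carrier A" using *(1) by (rule lift)
      obtain ys where ys: "bs = map p ys" "set ys \<subseteq> carrier A" using *(2) by (rule lift)
      have eq: "oper B \<mu> (as @ p x # bs) = p (oper A \<mu> (xs @ x # ys))" if "x \<in> carrier A" for x
        using op[of \<mu> "xs @ x # ys"] xs ys that 2 * by auto
      have lin: "linear_map R A A (\<lambda>x. oper A \<mu> (xs @ x # ys))"
        by (rule multilinearD[OF A.oper_multilinear[OF 2]]) (use * xs ys in auto)
      show "linear_map R B B (\<lambda>a. oper B \<mu> (as @ a # bs))"
      proof (rule linear_mapI)
        fix x y assume "x \<in> carrier B" "y \<in> carrier B"
        then obtain x' y' where x': "x' \<in> carrier A" "x = p x'" "y' \<in> carrier A" "y = p y'"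
          using surj by metis
        show "oper B \<mu> (as @ (x \<oplus>\<^bsub>B\<^esub> y) # bs) = oper B \<mu> (as @ x # bs) \<oplus>\<^bsub>B\<^esub> oper B \<mu> (as @ y # bs)"
          using x' eq[of "x' \<oplus>\<^bsub>A\<^esub> y'"] linear_map_add[OF lin, of x' y'] linear_map_closed[OF lin]
            A.M.a_closed
          by (simp add: eq lins)
      next
        fix r x assume r: "r \<in> carrier R" and "x \<in> carrier B"
        then obtain x' where x': "x' \<in> carrier A" "x = p x'" using surj by metis
        show "oper B \<mu> (as @ (r \<odot>\<^bsub>B\<^esub> x) # bs) = r \<odot>\<^bsub>B\<^esub> oper B \<mu> (as @ x # bs)"
          using x' r eq[of "r \<odot>\<^bsub>A\<^esub> x'"] linear_map_smult[OF lin, of r x'] linear_map_closed[OF lin]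
            A.smult_closed
          by (simp add: eq lins)
      next
        fix x assume "x \<in> carrier B"
        then obtain x' where x': "x' \<in> carrier A" "x = p x'" using surj by metis
        then show "oper B \<mu> (as @ x # bs) \<in> carrier B"
          using linear_map_closed[OF lin] by (simp add: eq lins)
      qed
    qed
  qed
qed

text \<open>Arguments are lifted through \<open>p\<close>, the axiom is applied in \<open>A\<close>
  and the result is pushed down; for the composition axiom lists of lists are lifted entrywise. The
  use is that a quotient of an algebra by an ideal is again an algebra.\<close>

lemma operad_algebra_surj_image:
  fixes A :: "('r, 'p, 'a) opalg" and B :: "('r, 'p, 'b) opalg"
  assumes "operad_algebra R P A" "module R B" "linear_map R A B p" "p ` carrier A = carrier B"
    and op: "\<And>\<mu> xs. \<lbrakk>\<mu> \<in> carrier (ops P (length xs)); set xs \<subseteq> carrier A\<rbrakk> \<Longrightarrow>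
      oper B \<mu> (map p xs) = p (oper A \<mu> xs)"
  shows "operad_algebra R P B"
proof -
  interpret A: operad_algebra R P A by fact
  interpret A: module R A by (rule A.module_alg)
  interpret B: module R B by fact
  note lift = set_subset_imageE[of _ p "carrier A", unfolded assms(4)]
  have surj: "\<exists>y\<in>carrier A. x = p y" if "x \<in> carrier B" for x
    using that by (simp add: assms(4)[symmetric] image_iff)
  show ?thesis
  proof (intro operad_algebra.intro operad_algebra_axioms.intro)
    show "operad R P" by (rule A.operad_axioms)
    show "module R B" by fact
  next
    fix as assume "set as \<subseteq> carrier B"
    then obtain xs where xs: "as = map p xs" "set xs \<subseteq> carrier A" by (rule lift)
    have "linear_map R (ops P (length xs)) B (\<lambda>\<mu>. p (oper A \<mu> xs))"
      by (rule linear_map_compose[OF A.oper_linear_left assms(3)]) (use xs in auto)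
    from linear_map_cong[OF A.module_ops this]
    show "linear_map R (ops P (length as)) B (\<lambda>\<mu>. oper B \<mu> as)"
      using xs op by simp
  next
    fix \<mu> as bs assume "\<mu> \<in> carrier (ops P (Suc (length as + length bs)))"
      "set as \<subseteq> carrier B" "set bs \<subseteq> carrier B"
    then show "linear_map R B B (\<lambda>a. oper B \<mu> (as @ a # bs))"
      using ops_algebra.oper_multilinear[OF ops_algebra_surj_image[OF A.ops_algebra assms(2-5)]]
      by (auto simp: multilinear_def)
  next
    fix a assume "a \<in> carrier B"
    then obtain x where "x \<in> carrier A" "a = p x" using surj by metis
    then show "oper B (opunit P) [a] = a"
      using op[of "opunit P" "[x]"] A.unit_closed A.oper_unit by simp
  next
    fix \<mu> \<nu>s ass
    assume *: "\<mu> \<in> carrier (ops P (length \<nu>s))" "\<nu>s \<in> ops_list P"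
      "map length ass = map fst \<nu>s" "\<forall>as\<in>set ass. set as \<subseteq> carrier B"
    obtain xss where xss: "ass = map (map p) xss" "\<forall>xs\<in>set xss. set xs \<subseteq> carrier A"
      by (rule nested_set_subset_imageE[of ass p "carrier A"]) (use *(4) assms(4) in auto)
    have len: "length xss = length \<nu>s" and lens: "map length xss = map fst \<nu>s"
      using *(3) xss(1) by (auto simp: comp_def dest: map_eq_imp_length_eq)
    have nth: "length (xss ! i) = fst (\<nu>s ! i)" "snd (\<nu>s ! i) \<in> carrier (ops P (length (xss ! i)))"
      "set (xss ! i) \<subseteq> carrier A" if "i < length xss" for i
    proof -
      show l: "length (xss ! i) = fst (\<nu>s ! i)" using that lens len by (metis nth_map)
      show "snd (\<nu>s ! i) \<in> carrier (ops P (length (xss ! i)))"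
        using *(2) that len nth_mem[of i \<nu>s] unfolding l ops_list_def by (auto simp: case_prod_beta)
      show "set (xss ! i) \<subseteq> carrier A" using xss(2) that by simp
    qed
    have m: "map2 (\<lambda>(k, \<nu>) as. oper B \<nu> as) \<nu>s ass =
      map p (map2 (\<lambda>(k, \<nu>) as. oper A \<nu> as) \<nu>s xss)"
      by (rule nth_equalityI) (use xss(1) len nth op in \<open>auto simp: case_prod_beta\<close>)
    have c: "set (map2 (\<lambda>(k, \<nu>) as. oper A \<nu> as) \<nu>s xss) \<subseteq> carrier A"
    proof -
      have "oper A (snd (\<nu>s ! i)) (xss ! i) \<in> carrier A" if "i < length xss" for i
        by (rule A.alg_closed[OF nth(2,3)[OF that]])
      then show ?thesis using len by (auto simp: set_conv_nth case_prod_beta)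
    qed
    have "oper B (opcomp P \<mu> \<nu>s) (concat ass) = p (oper A (opcomp P \<mu> \<nu>s) (concat xss))"
    proof -
      have "length (concat xss) = arity_sum \<nu>s"
        using lens by (simp add: length_concat arity_sum_def)
      then have "opcomp P \<mu> \<nu>s \<in> carrier (ops P (length (concat xss)))"
        using linear_map_closed[OF A.comp_linear_left[OF *(2)] *(1)] by simp
      then show ?thesis using op[of _ "concat xss"] xss by (auto simp: map_concat)
    qed
    also have "\<dots> = p (oper A \<mu> (map2 (\<lambda>(k, \<nu>) as. oper A \<nu> as) \<nu>s xss))"
      using A.oper_comp[OF *(1,2) lens xss(2)] by simp
    also have "\<dots> = oper B \<mu> (map p (map2 (\<lambda>(k, \<nu>) as. oper A \<nu> as) \<nu>s xss))"
      by (rule op[symmetric]) (use *(1) len c in auto)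
    also have "\<dots> = oper B \<mu> (map2 (\<lambda>(k, \<nu>) as. oper B \<nu> as) \<nu>s ass)"
      by (simp only: m)
    finally show "oper B (opcomp P \<mu> \<nu>s) (concat ass) =
      oper B \<mu> (map2 (\<lambda>(k, \<nu>) as. oper B \<nu> as) \<nu>s ass)" .
  next
    fix \<mu> \<sigma> as
    assume *: "\<mu> \<in> carrier (ops P (length as))" "set as \<subseteq> carrier B" "\<sigma> permutes {..<length as}"
    obtain xs where xs: "as = map p xs" "set xs \<subseteq> carrier A" using *(2) by (rule lift)
    have \<sigma>: "\<sigma> permutes {..<length xs}" using * xs by simp
    have "opact P (length xs) \<mu> \<sigma> \<in> carrier (ops P (length xs))"
      using linear_map_closed[OF A.act_linear[OF \<sigma>]] * xs by simp
    then show "oper B (opact P (length as) \<mu> \<sigma>) (permute_list \<sigma> as) = oper B \<mu> as"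
      using * xs \<sigma> op[of "opact P (length xs) \<mu> \<sigma>" "permute_list \<sigma> xs"] op[of \<mu> xs] A.oper_act[of \<mu> xs \<sigma>]
      by (simp add: permute_list_map)
  qed
qed

lemma (in ops_quotient) ops_algebra_quot: "ops_algebra R P (quot_alg A I)"
  by (rule ops_algebra_surj_image[OF ops_algebra_axioms module_quot linear_coset])
    (simp_all add: carrier_quot oper_quot)

lemma (in ops_quotient) operad_algebra_quot:
  assumes "operad_algebra R P A"
  shows "operad_algebra R P (quot_alg A I)"
  by (rule operad_algebra_surj_image[OF assms module_quot linear_coset])
    (simp_all add: carrier_quot oper_quot)

section \<open>Block permutations\<close>

lemma blocks_Nil [simp]: "blocks [] = []"
  by (simp add: blocks_def)

text \<open>Recursion from the right, because a block starts at the sum of the preceding lengths,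
  which appending does not change.\<close>

lemma blocks_snoc: "blocks (ks @ [k]) = blocks ks @ [[sum_list ks ..< sum_list ks + k]]"
  by (auto simp: blocks_def)

lemma length_blocks [simp]: "length (blocks ks) = length ks"
  by (simp add: blocks_def)

lemma concat_blocks: "concat (blocks ks) = [0..<sum_list ks]"
proof (induction ks rule: rev_induct)
  case (snoc k ks)
  then show ?case by (simp add: blocks_snoc upt_add_eq_append[of 0])
qed simp

lemma map_length_blocks: "map length (blocks ks) = ks"
  by (induction ks rule: rev_induct) (simp_all add: blocks_snoc)

text \<open>This transfers statements about blocks of indices, in terms of which
  \<open>block_perm\<close> and \<open>sum_perm\<close> are defined, to arbitrary lists of
  lists.\<close>

lemma map_nth_blocks: "map (map (\<lambda>i. concat xss ! i)) (blocks (map length xss)) = xss"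
proof (induction xss rule: rev_induct)
  case (snoc xs xss)
  let ?n = "sum_list (map length xss)"
  have n: "length (concat xss) = ?n" by (simp add: length_concat)
  have lt: "\<And>b i. b \<in> set (blocks (map length xss)) \<Longrightarrow> i \<in> set b \<Longrightarrow> i < ?n"
  proof -
    fix b i assume "b \<in> set (blocks (map length xss))" "i \<in> set b"
    then have "i \<in> set (concat (blocks (map length xss)))" by auto
    then show "i < ?n" by (simp add: concat_blocks)
  qed
  have "map (map (\<lambda>i. concat (xss @ [xs]) ! i)) (blocks (map length xss)) =
    map (map (\<lambda>i. concat xss ! i)) (blocks (map length xss))"
    by (intro map_cong refl) (auto simp: nth_append n dest: lt)
  moreover have "map (\<lambda>i. concat (xss @ [xs]) ! i) [?n..<?n + length xs] = xs"
    by (rule nth_equalityI) (auto simp: nth_append n)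
  ultimately show ?case using snoc by (simp add: blocks_snoc)
qed simp

text \<open>Both operad permutations are given by value lists, so a comparison of multisets is all
  that remains to show that they are permutations.\<close>

lemma list_permutes:
  assumes "mset xs = mset [0..<n]"
  shows "(\<lambda>i. if i < n then xs ! i else i) permutes {..<n}"
proof (rule bij_imp_permutes)
  have len: "length xs = n" using mset_eq_length[OF assms] by simp
  have set: "set xs = {..<n}" using mset_eq_setD[OF assms] by (simp add: atLeast0LessThan)
  have "distinct xs" using mset_eq_imp_distinct_iff[OF assms] by simp
  then have "bij_betw (nth xs) {..<n} {..<n}" by (rule bij_betw_nth) (simp_all add: len set)
  then show "bij_betw (\<lambda>i. if i < n then xs ! i else i) {..<n} {..<n}"
    by (rule bij_betw_cong[THEN iffD1, rotated]) simp
qed simp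

lemma mset_concat_permute_list:
  assumes "\<sigma> permutes {..<length xss}"
  shows "mset (concat (permute_list \<sigma> xss)) = mset (concat xss)"
proof -
  have "mset (permute_list \<sigma> xss) = mset xss" using assms by simp
  then have "mset (map mset (permute_list \<sigma> xss)) = mset (map mset xss)" by (simp only: mset_map)
  then have "sum_list (map mset (permute_list \<sigma> xss)) = sum_list (map mset xss)"
    by (metis sum_mset_sum_list)
  then show ?thesis by (simp add: mset_concat)
qed

lemma block_perm_permutes:
  assumes "\<sigma> permutes {..<length ks}"
  shows "block_perm \<sigma> ks permutes {..<sum_list ks}"
proof -
  have "mset (concat (permute_list \<sigma> (blocks ks))) = mset [0..<sum_list ks]"
    using assms mset_concat_permute_list[of \<sigma> "blocks ks"] by (simp add: concat_blocks)
  from list_permutes[OF this] show ?thesis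
    by (simp add: block_perm_def[abs_def])
qed

lemma permute_list_nth_eq:
  assumes "length B = length xs" "\<And>i. i < length xs \<Longrightarrow> f i = B ! i"
  shows "permute_list f xs = map (\<lambda>i. xs ! i) B"
  by (rule nth_equalityI) (use assms in \<open>auto simp: permute_list_def\<close>)

text \<open>Both sides look up \<open>concat xss\<close> along the permuted index blocks: the
  permutation is defined by this list of indices, and \<open>map\<close> commutes with
  \<open>concat\<close> and \<open>permute_list\<close>.\<close>

lemma permute_list_block_perm:
  assumes "\<sigma> permutes {..<length xss}"
  shows "permute_list (block_perm \<sigma> (map length xss)) (concat xss) = concat (permute_list \<sigma> xss)"
proof -
  let ?B = "concat (permute_list \<sigma> (blocks (map length xss)))"
  have "length ?B = length (concat (blocks (map length xss)))"
    using assms by (intro mset_eq_length mset_concat_permute_list) simp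
  also have "\<dots> = length (concat xss)" by (simp add: concat_blocks length_concat)
  finally have "permute_list (block_perm \<sigma> (map length xss)) (concat xss) = map (\<lambda>i. concat xss ! i) ?B"
    by (intro permute_list_nth_eq) (auto simp: block_perm_def length_concat)
  also have "\<dots> = concat (permute_list \<sigma> (map (map (\<lambda>i. concat xss ! i)) (blocks (map length xss))))"
    using assms by (simp add: map_concat permute_list_map)
  finally show ?thesis by (simp add: map_nth_blocks)
qed

lemma mset_concat_map2_permute_list:
  assumes "list_all2 (\<lambda>\<tau> xs. \<tau> permutes {..<length xs}) \<tau>s xss"
  shows "mset (concat (map2 permute_list \<tau>s xss)) = mset (concat xss)"
  using assms by (induction rule: list_all2_induct) simp_all

lemma sum_perm_permutes:
  assumes "list_all2 (\<lambda>\<tau> k. \<tau> permutes {..<k}) \<tau>s ks"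
  shows "sum_perm \<tau>s ks permutes {..<sum_list ks}"
proof -
  have "list_all2 (\<lambda>\<tau> k. \<tau> permutes {..<k}) \<tau>s (map length (blocks ks))"
    using assms by (simp add: map_length_blocks)
  then have "list_all2 (\<lambda>\<tau> xs. \<tau> permutes {..<length xs}) \<tau>s (blocks ks)"
    by (simp add: list_all2_map2)
  then have "mset (concat (map2 permute_list \<tau>s (blocks ks))) = mset [0..<sum_list ks]"
    by (simp add: mset_concat_map2_permute_list concat_blocks)
  from list_permutes[OF this] show ?thesis
    by (simp add: sum_perm_def[abs_def])
qed

lemma permute_list_sum_perm:
  assumes "list_all2 (\<lambda>\<tau> xs. \<tau> permutes {..<length xs}) \<tau>s xss"
  shows "permute_list (sum_perm \<tau>s (map length xss)) (concat xss) = concat (map2 permute_list \<tau>s xss)"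
proof -
  let ?B = "concat (map2 permute_list \<tau>s (blocks (map length xss)))"
  have "list_all2 (\<lambda>\<tau> k. \<tau> permutes {..<k}) \<tau>s (map length (blocks (map length xss)))"
    using assms by (simp add: map_length_blocks list_all2_map2)
  then have p: "list_all2 (\<lambda>\<tau> b. \<tau> permutes {..<length b}) \<tau>s (blocks (map length xss))"
    by (simp add: list_all2_map2)
  have "length ?B = length (concat (blocks (map length xss)))"
    by (rule mset_eq_length[OF mset_concat_map2_permute_list[OF p]])
  also have "\<dots> = length (concat xss)" by (simp add: concat_blocks length_concat)
  finally have "permute_list (sum_perm \<tau>s (map length xss)) (concat xss) = map (\<lambda>i. concat xss ! i) ?B"
    by (intro permute_list_nth_eq) (auto simp: sum_perm_def length_concat)
  also have "\<dots> = concat (map2 permute_list \<tau>s (map (map (\<lambda>i. concat xss ! i)) (blocks (map length xss))))"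
  proof -
    have "map (map f) (map2 permute_list \<tau>s bs) = map2 permute_list \<tau>s (map (map f) bs)"
      if "list_all2 (\<lambda>\<tau> b. \<tau> permutes {..<length b}) \<tau>s bs" for f :: "nat \<Rightarrow> 'a" and bs
      using that by (induction rule: list_all2_induct) (simp_all add: permute_list_map)
    from this[OF p] show ?thesis by (simp add: map_concat)
  qed
  finally show ?thesis by (simp add: map_nth_blocks)
qed


section \<open>Free modules\<close>

locale free_module_on = cring R for R :: "('r, 'z) ring_scheme" (structure) +
  fixes X :: "'x set"
begin

abbreviation F where "F \<equiv> free_module R X"

abbreviation supp where "supp f \<equiv> {x. f x \<noteq> \<zero>}"

lemma carrier_free: "f \<in> carrier F \<longleftrightarrow> (\<forall>x. f x \<in> carrier R) \<and> finite (supp f) \<and> supp f \<subseteq> X"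
  by (auto simp: free_module_def)

lemma ops_free [simp]:
  "\<zero>\<^bsub>F\<^esub> = (\<lambda>x. \<zero>)" "f \<oplus>\<^bsub>F\<^esub> g = (\<lambda>x. f x \<oplus> g x)" "r \<odot>\<^bsub>F\<^esub> f = (\<lambda>x. r \<otimes> f x)"
  by (simp_all add: free_module_def)

lemma module_free: "module R F"
proof (rule moduleI)
  show "cring R" by (rule is_cring)
  show "abelian_group F"
  proof (rule abelian_groupI)
    fix f g assume fg: "f \<in> carrier F" "g \<in> carrier F"
    have "supp (\<lambda>x. f x \<oplus> g x) \<subseteq> supp f \<union> supp g" using fg by (auto simp: carrier_free)
    moreover have "finite (supp f \<union> supp g)" using fg by (auto simp: carrier_free)
    ultimately show "f \<oplus>\<^bsub>F\<^esub> g \<in> carrier F"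
      using fg by (auto simp: carrier_free intro: finite_subset)
    show "f \<oplus>\<^bsub>F\<^esub> g = g \<oplus>\<^bsub>F\<^esub> f"
      using fg by (auto simp: carrier_free a_comm)
  next
    fix f assume f: "f \<in> carrier F"
    have "supp (\<lambda>x. \<ominus> f x) = supp f"
      using f by (auto simp: carrier_free)
    then have "(\<lambda>x. \<ominus> f x) \<in> carrier F" using f by (auto simp: carrier_free)
    moreover have "(\<lambda>x. \<ominus> f x) \<oplus>\<^bsub>F\<^esub> f = \<zero>\<^bsub>F\<^esub>" using f by (auto simp: carrier_free l_neg)
    ultimately show "\<exists>g\<in>carrier F. g \<oplus>\<^bsub>F\<^esub> f = \<zero>\<^bsub>F\<^esub>" by blast
  qed (auto simp: carrier_free a_assoc)
next
  fix r f assume rf: "r \<in> carrier R" "f \<in> carrier F"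
  have "supp (\<lambda>x. r \<otimes> f x) \<subseteq> supp f" using rf by (auto simp: carrier_free)
  then show "r \<odot>\<^bsub>F\<^esub> f \<in> carrier F"
    using rf by (auto simp: carrier_free intro: finite_subset)
qed (auto simp: carrier_free l_distr r_distr m_assoc)

sublocale F: module R F by (rule module_free)

lemma supp_single: "supp (single R s) \<subseteq> {s}"
  by (auto simp: single_def)

lemma single_closed: "s \<in> X \<Longrightarrow> single R s \<in> carrier F"
  using supp_single[of s] by (auto simp: carrier_free single_def intro: finite_subset)

text \<open>A finitely supported function is built from multiples of basis vectors, one point of its
  support at a time. The induction runs over a finite superset of the support, so the point
  considered may also lie outside it.\<close>

lemma spans_free: "spans R F (single R ` X)"
  unfolding spans_def
proof (intro conjI allI impI)
  show "single R ` X \<subseteq> carrier F" using single_closed by auto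
  fix H assume H: "submodule H R F" "single R ` X \<subseteq> H"
  have "f \<in> H" if "finite S" "f \<in> carrier F" "supp f \<subseteq> S" for f S
    using that
  proof (induction S arbitrary: f rule: finite_induct)
    case empty
    then have "f = \<zero>\<^bsub>F\<^esub>" by auto
    then show ?case using submodule_zero_mem[OF H(1)] by simp
  next
    case (insert s S)
    show ?case
    proof (cases "s \<in> supp f")
      case False
      then show ?thesis using insert by blast
    next
      case True
      then have s: "s \<in> X" using insert.prems by (auto simp: carrier_free)
      have "supp (f(s := \<zero>)) \<subseteq> supp f" by auto
      then have "f(s := \<zero>) \<in> carrier F"
        using insert.prems(1) by (auto simp: carrier_free intro: finite_subset)
      then have "f(s := \<zero>) \<in> H" by (rule insert.IH) (use insert.prems in auto)
      moreover have "f s \<odot>\<^bsub>F\<^esub> single R s \<in> H"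
        using F.submoduleE(4)[OF H(1)] H(2) s insert.prems(1) by (auto simp: carrier_free)
      ultimately have "f s \<odot>\<^bsub>F\<^esub> single R s \<oplus>\<^bsub>F\<^esub> f(s := \<zero>) \<in> H"
        using F.submoduleE(5)[OF H(1)] by blast
      also have "f s \<odot>\<^bsub>F\<^esub> single R s \<oplus>\<^bsub>F\<^esub> f(s := \<zero>) = f"
        using insert.prems(1) by (auto simp: carrier_free single_def)
      finally show ?thesis .
    qed
  qed
  then show "carrier F \<subseteq> H" by (auto simp: carrier_free)
qed

lemma free_extension:
  assumes "module R M" "\<And>s. s \<in> X \<Longrightarrow> h s \<in> carrier M"
  obtains \<phi> where "linear_map R F M \<phi>" "\<And>s. s \<in> X \<Longrightarrow> \<phi> (single R s) = h s"
proof -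
  interpret M: module R M by fact
  define \<phi> where "\<phi> f = (\<Oplus>\<^bsub>M\<^esub>s\<in>supp f. f s \<odot>\<^bsub>M\<^esub> h s)" for f
  have tc: "f s \<odot>\<^bsub>M\<^esub> h s \<in> carrier M" if "f \<in> carrier F" "s \<in> X" for f s
    using that assms(2) by (auto simp: carrier_free)
  \<comment> \<open>The support varies with \<open>f\<close>, so the sum is rewritten over any
    finite set of basis elements that contains it; additivity then compares sums over one common
    set.\<close>
  have \<phi>: "\<phi> f = (\<Oplus>\<^bsub>M\<^esub>s\<in>S. f s \<odot>\<^bsub>M\<^esub> h s)"
    if "f \<in> carrier F" "finite S" "S \<subseteq> X" "supp f \<subseteq> S" for f S
    unfolding \<phi>_def
    by (rule M.M.add.finprod_mono_neutral_cong_left)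
      (use that tc assms(2) in \<open>auto simp: carrier_free subset_iff\<close>)
  show ?thesis
  proof
    show "linear_map R F M \<phi>"
    proof (rule linear_mapI)
      fix f assume "f \<in> carrier F"
      then show "\<phi> f \<in> carrier M"
        unfolding \<phi>_def using tc by (intro M.M.finsum_closed) (auto simp: carrier_free)
    next
      fix f g assume fg: "f \<in> carrier F" "g \<in> carrier F"
      let ?S = "supp f \<union> supp g"
      have S: "finite ?S" "?S \<subseteq> X" using fg by (auto simp: carrier_free)
      have "\<phi> (f \<oplus>\<^bsub>F\<^esub> g) = (\<Oplus>\<^bsub>M\<^esub>s\<in>?S. (f \<oplus>\<^bsub>F\<^esub> g) s \<odot>\<^bsub>M\<^esub> h s)"
        by (rule \<phi>[OF F.M.a_closed[OF fg] S]) (use fg in \<open>auto simp: carrier_free\<close>)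
      also have "\<dots> = (\<Oplus>\<^bsub>M\<^esub>s\<in>?S. f s \<odot>\<^bsub>M\<^esub> h s \<oplus>\<^bsub>M\<^esub> g s \<odot>\<^bsub>M\<^esub> h s)"
        by (rule M.M.finsum_cong')
          (use fg S tc assms(2) in \<open>auto simp: carrier_free subset_iff intro!: M.smult_l_distr\<close>)
      also have "\<dots> = (\<Oplus>\<^bsub>M\<^esub>s\<in>?S. f s \<odot>\<^bsub>M\<^esub> h s) \<oplus>\<^bsub>M\<^esub> (\<Oplus>\<^bsub>M\<^esub>s\<in>?S. g s \<odot>\<^bsub>M\<^esub> h s)"
        by (rule M.M.finsum_addf) (use fg S tc in blast)+
      also have "\<dots> = \<phi> f \<oplus>\<^bsub>M\<^esub> \<phi> g"
        using \<phi>[OF fg(1) S] \<phi>[OF fg(2) S] by simp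
      finally show "\<phi> (f \<oplus>\<^bsub>F\<^esub> g) = \<phi> f \<oplus>\<^bsub>M\<^esub> \<phi> g" .
    next
      fix r f assume rf: "r \<in> carrier R" "f \<in> carrier F"
      let ?S = "supp f"
      have S: "finite ?S" "?S \<subseteq> X" using rf by (auto simp: carrier_free)
      have "\<phi> (r \<odot>\<^bsub>F\<^esub> f) = (\<Oplus>\<^bsub>M\<^esub>s\<in>?S. (r \<odot>\<^bsub>F\<^esub> f) s \<odot>\<^bsub>M\<^esub> h s)"
        by (rule \<phi>[OF F.smult_closed[OF rf] S]) (use rf in \<open>auto simp: carrier_free\<close>)
      also have "\<dots> = (\<Oplus>\<^bsub>M\<^esub>s\<in>?S. r \<odot>\<^bsub>M\<^esub> (f s \<odot>\<^bsub>M\<^esub> h s))"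
        by (rule M.M.finsum_cong')
          (use rf S tc assms(2) in \<open>auto simp: carrier_free subset_iff intro!: M.smult_assoc1\<close>)
      also have "\<dots> = r \<odot>\<^bsub>M\<^esub> (\<Oplus>\<^bsub>M\<^esub>s\<in>?S. f s \<odot>\<^bsub>M\<^esub> h s)"
        by (rule M.finsum_smult_ldistr[symmetric]) (use rf S tc in blast)+
      finally show "\<phi> (r \<odot>\<^bsub>F\<^esub> f) = r \<odot>\<^bsub>M\<^esub> \<phi> f" by (simp add: \<phi>_def)
    qed
    fix s assume s: "s \<in> X"
    have "\<phi> (single R s) = (\<Oplus>\<^bsub>M\<^esub>t\<in>{s}. single R s t \<odot>\<^bsub>M\<^esub> h t)"
      by (rule \<phi>) (use s supp_single[of s] single_closed in auto)
    also have "\<dots> = h s" using s assms(2) by (simp add: single_def)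
    finally show "\<phi> (single R s) = h s" .
  qed
qed

text \<open>The coefficient that multilinear expansion of \<open>fs\<close> gives to the list
  \<open>ss\<close> of basis elements; it is the scalar in \<open>formal_oper\<close>.\<close>

definition coef :: "('x \<Rightarrow> 'r) list \<Rightarrow> 'x list \<Rightarrow> 'r"
  where "coef fs ss = foldr (\<otimes>) (map2 (\<lambda>f s. f s) fs ss) \<one>"

lemma coef_closed: "set fs \<subseteq> carrier F \<Longrightarrow> coef fs ss \<in> carrier R"
proof (induction fs arbitrary: ss)
  case (Cons f fs)
  then show ?case by (cases ss) (auto simp: coef_def carrier_free)
qed (simp add: coef_def)

lemma coef_append:
  assumes "length ss = length fs" "set fs \<subseteq> carrier F" "f \<in> carrier F" "set gs \<subseteq> carrier F"
  shows "coef (fs @ f # gs) (ss @ s # ts) = f s \<otimes> coef (fs @ gs) (ss @ ts)"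
  using assms
proof (induction ss fs rule: list_induct2)
  case Nil
  then show ?case by (simp add: coef_def)
next
  case (Cons s' ss f' fs)
  then show ?case using coef_closed[of "fs @ gs" "ss @ ts"]
    by (auto simp: coef_def carrier_free intro!: m_lcomm)
qed

text \<open>A list of the right length outside the product of the supports leaves a support in one
  of its places, and the factor there vanishes.\<close>

lemma coef_eq_zero:
  assumes "set fs \<subseteq> carrier F" "length fs = length ss"
    "ss \<notin> listset (map supp fs)"
  shows "coef fs ss = \<zero>"
  using assms(2,1,3)
proof (induction fs ss rule: list_induct2)
  case (Cons f fs s ss)
  then show ?case
    using coef_closed[of fs ss]
    by (cases "f s = \<zero>") (auto simp: coef_def carrier_free in_listset_iff set_Cons_def)
qed (simp add: in_listset_iff)

lemma coef_single: "coef (map (single R) ss) ss = \<one>"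
  by (induction ss) (simp_all add: coef_def single_def)

lemma finite_listset: "(\<And>Y. Y \<in> set Ys \<Longrightarrow> finite Y) \<Longrightarrow> finite (listset Ys)"
proof (induction Ys)
  case (Cons Y Ys)
  have "set_Cons Y (listset Ys) = (\<lambda>(y, ys). y # ys) ` (Y \<times> listset Ys)"
    by (auto simp: set_Cons_def)
  then show ?case using Cons by simp
qed simp

end

section \<open>The free algebra\<close>

lemma multilinear_insert:
  assumes "multilinear R (Suc n) M N \<phi>" "x \<in> carrier M" "k \<le> n"
  shows "multilinear R n M N (\<lambda>as. \<phi> (take k as @ x # drop k as))"
  unfolding multilinear_def
proof (intro allI impI)
  fix as bs
  assume *: "set as \<subseteq> carrier M" "set bs \<subseteq> carrier M" "Suc (length as + length bs) = n"
  show "linear_map R M N (\<lambda>y. \<phi> (take k (as @ y # bs) @ x # drop k (as @ y # bs)))"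
  proof (cases "k \<le> length as")
    case True
    have "linear_map R M N (\<lambda>y. \<phi> ((take k as @ x # drop k as) @ y # bs))"
      by (rule multilinearD[OF assms(1)])
        (use * assms True set_take_subset[of k as] set_drop_subset[of k as] in auto)
    then show ?thesis using True by simp
  next
    case False
    then obtain j where j: "k = Suc (length as + j)" using less_iff_Suc_add not_le by blast
    have "linear_map R M N (\<lambda>y. \<phi> (as @ y # (take j bs @ x # drop j bs)))"
      by (rule multilinearD[OF assms(1)])
        (use * assms j set_take_subset[of j bs] set_drop_subset[of j bs] in auto)
    then show ?thesis using j by simp
  qed
qed

lemma listset_elem:
  assumes "ss \<in> listset Ys" "\<And>Y. Y \<in> set Ys \<Longrightarrow> Y \<subseteq> X"
  shows "length ss = length Ys" "set ss \<subseteq> X"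
proof -
  have "\<Union>(set Ys) \<subseteq> X" using assms(2) by blast
  with assms(1) have "length ss = length Ys \<and> set ss \<subseteq> X"
  proof (induction Ys arbitrary: ss)
    case (Cons Y Ys)
    then obtain s ts where s: "ss = s # ts" "s \<in> Y" "ts \<in> listset Ys" by (auto simp: set_Cons_def)
    then have "s \<in> X" "length ts = length Ys \<and> set ts \<subseteq> X" using Cons by auto
    then show ?case using s(1) by simp
  qed simp
  then show "length ss = length Ys" "set ss \<subseteq> X" by simp_all
qed

text \<open>Substitution of symbols, of which \<open>formal_oper\<close> is the multilinear
  extension; the axioms of the free algebra become operad axioms for it.\<close>

definition graft :: "('r, 'p) operad \<Rightarrow> 'p \<Rightarrow> ('p \<times> 'v list) list \<Rightarrow> 'p \<times> 'v list"
  where "graft P \<mu> ss =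
    (opcomp P \<mu> (map (\<lambda>(\<nu>, vs). (length vs, \<nu>)) ss), concat (map snd ss))"

lemma arity_sum_symbols:
  "arity_sum (map (\<lambda>(\<nu>, vs). (length vs, \<nu>)) ss) = length (concat (map snd ss))"
  by (induction ss) (auto simp: arity_sum_def)

section \<open>The formal algebra on symbols\<close>

locale free_operad_algebra = operad R P
  for R :: "('r, 'z) ring_scheme" and P :: "('r, 'p) operad" +
  fixes V :: "('r, 'v) module"
  assumes module_V: "module R V"
begin

sublocale Fr: free_module_on R "symbols P V"
  by (rule free_module_on.intro[OF cring])

abbreviation F where "F \<equiv> free_module R (symbols P V)"
abbreviation FA where "FA \<equiv> formal_alg R P V"
abbreviation N where "N \<equiv> tensor_null R P V"
abbreviation S where "S \<equiv> free_alg R P V"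

lemma symbol_iff: "(\<mu>, vs) \<in> symbols P V \<longleftrightarrow> \<mu> \<in> carrier (ops P (length vs)) \<and> set vs \<subseteq> carrier V"
  by (simp add: symbols_def)

lemma symbols_ops_list:
  "set ss \<subseteq> symbols P V \<Longrightarrow> map (\<lambda>(\<nu>, vs). (length vs, \<nu>)) ss \<in> ops_list P"
  by (auto simp: ops_list_def symbols_def)

lemma graft_closed:
  assumes "\<mu> \<in> carrier (ops P (length ss))" "set ss \<subseteq> symbols P V"
  shows "graft P \<mu> ss \<in> symbols P V"
proof -
  have "opcomp P \<mu> (map (\<lambda>(\<nu>, vs). (length vs, \<nu>)) ss) \<in> carrier (ops P (length (concat (map snd ss))))"
    using linear_map_closed[OF comp_linear_left[OF symbols_ops_list[OF assms(2)]]] assms(1)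
    unfolding arity_sum_symbols by simp
  moreover have "set (concat (map snd ss)) \<subseteq> carrier V"
    using assms(2) by (fastforce simp: symbols_def)
  ultimately show ?thesis by (simp only: graft_def symbol_iff)
qed

text \<open>The defining sum runs over lists drawn from the exact supports, which change under
  addition and scaling. Larger finite sets give the same sum, since the extra lists have coefficient
  zero; this is what brings different sums to a common index set.\<close>

lemma formal_oper_eq:
  assumes "\<mu> \<in> carrier (ops P (length fs))" "set fs \<subseteq> carrier F"
    "list_all2 (\<lambda>f Y. {s. f s \<noteq> \<zero>\<^bsub>R\<^esub>} \<subseteq> Y) fs Ys" "\<And>Y. Y \<in> set Ys \<Longrightarrow> finite Y \<and> Y \<subseteq> symbols P V"
  shows "formal_oper R P V \<mu> fs =
    (\<Oplus>\<^bsub>F\<^esub>ss\<in>listset Ys. Fr.coef fs ss \<odot>\<^bsub>F\<^esub> single R (graft P \<mu> ss))"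
proof -
  have len: "length fs = length Ys" using assms(3) by (rule list_all2_lengthD)
  have ss: "length ss = length fs \<and> set ss \<subseteq> symbols P V" if "ss \<in> listset Ys" for ss
    using listset_elem[OF that, of "symbols P V"] assms(4) len by auto
  have sub: "listset (map (\<lambda>f. {s. f s \<noteq> \<zero>\<^bsub>R\<^esub>}) fs) \<subseteq> listset Ys"
  proof
    fix ss assume "ss \<in> listset (map (\<lambda>f. {s. f s \<noteq> \<zero>\<^bsub>R\<^esub>}) fs)"
    then have "list_all2 (\<lambda>s f. f s \<noteq> \<zero>\<^bsub>R\<^esub>) ss fs" by (simp add: in_listset_iff list_all2_map2)
    from list_all2_trans[OF _ this assms(3), of "(\<in>)"]
    show "ss \<in> listset Ys" by (auto simp: in_listset_iff)
  qed
  have "(\<Oplus>\<^bsub>F\<^esub>ss\<in>listset (map (\<lambda>f. {s. f s \<noteq> \<zero>\<^bsub>R\<^esub>}) fs). Fr.coef fs ss \<odot>\<^bsub>F\<^esub> single R (graft P \<mu> ss)) =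
    (\<Oplus>\<^bsub>F\<^esub>ss\<in>listset Ys. Fr.coef fs ss \<odot>\<^bsub>F\<^esub> single R (graft P \<mu> ss))"
  proof (rule Fr.F.M.add.finprod_mono_neutral_cong_left)
    show "finite (listset Ys)" by (rule Fr.finite_listset) (use assms(4) in auto)
    fix ss assume ss': "ss \<in> listset Ys - listset (map (\<lambda>f. {s. f s \<noteq> \<zero>\<^bsub>R\<^esub>}) fs)"
    have "Fr.coef fs ss = \<zero>\<^bsub>R\<^esub>"
      by (rule Fr.coef_eq_zero) (use ss' ss assms(2) in auto)
    moreover have "single R (graft P \<mu> ss) \<in> carrier F"
      using ss ss' assms(1) by (intro Fr.single_closed graft_closed) auto
    ultimately show "Fr.coef fs ss \<odot>\<^bsub>F\<^esub> single R (graft P \<mu> ss) = \<zero>\<^bsub>F\<^esub>"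
      using Fr.F.smult_l_null by (simp del: Fr.ops_free)
  next
    show "(\<lambda>ss. Fr.coef fs ss \<odot>\<^bsub>F\<^esub> single R (graft P \<mu> ss)) \<in> listset Ys \<rightarrow> carrier F"
      using ss assms(1,2)
      by (auto simp del: Fr.ops_free intro!: Fr.F.smult_closed Fr.single_closed graft_closed Fr.coef_closed)
  qed (use sub in auto)
  then show ?thesis by (simp add: formal_oper_def graft_def Fr.coef_def)
qed

lemma formal_oper_closed:
  assumes "\<mu> \<in> carrier (ops P (length fs))" "set fs \<subseteq> carrier F"
  shows "formal_oper R P V \<mu> fs \<in> carrier F"
proof -
  have fin: "finite Y \<and> Y \<subseteq> symbols P V" if "Y \<in> set (map (\<lambda>f. {s. f s \<noteq> \<zero>\<^bsub>R\<^esub>}) fs)" for Y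
  proof -
    obtain f where "f \<in> carrier F" "Y = {s. f s \<noteq> \<zero>\<^bsub>R\<^esub>}" using \<open>Y \<in> _\<close> assms(2) by auto
    then show ?thesis by (simp add: Fr.carrier_free)
  qed
  have ss: "length ss = length fs \<and> set ss \<subseteq> symbols P V"
    if "ss \<in> listset (map (\<lambda>f. {s. f s \<noteq> \<zero>\<^bsub>R\<^esub>}) fs)" for ss
    using listset_elem[OF that, of "symbols P V"] fin by auto
  have "formal_oper R P V \<mu> fs = (\<Oplus>\<^bsub>F\<^esub>ss\<in>listset (map (\<lambda>f. {s. f s \<noteq> \<zero>\<^bsub>R\<^esub>}) fs).
      Fr.coef fs ss \<odot>\<^bsub>F\<^esub> single R (graft P \<mu> ss))"
    by (rule formal_oper_eq[OF assms _ fin]) (auto simp: list_all2_map2 list_all2_same)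
  also have "\<dots> \<in> carrier F"
    using ss assms
    by (intro Fr.F.M.finsum_closed)
      (auto simp del: Fr.ops_free intro!: Fr.F.smult_closed Fr.single_closed graft_closed Fr.coef_closed)
  finally show ?thesis .
qed

lemma formal_oper_single:
  assumes "\<mu> \<in> carrier (ops P (length ss))" "set ss \<subseteq> symbols P V"
  shows "formal_oper R P V \<mu> (map (single R) ss) = single R (graft P \<mu> ss)"
proof -
  \<comment> \<open>One-point sets are used instead of supports: over the zero ring the support of
    \<open>single R s\<close> is empty, and in this way the case need not be distinguished.\<close>
  have "listset (map (\<lambda>s. {s}) ss) = {ss}" by (induction ss) (auto simp: set_Cons_def)
  moreover have "formal_oper R P V \<mu> (map (single R) ss) = (\<Oplus>\<^bsub>F\<^esub>ts\<in>listset (map (\<lambda>s. {s}) ss).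
      Fr.coef (map (single R) ss) ts \<odot>\<^bsub>F\<^esub> single R (graft P \<mu> ts))"
    by (rule formal_oper_eq)
      (use assms Fr.single_closed in
        \<open>auto simp: list_all2_map1 list_all2_map2 list_all2_same single_def\<close>)
  ultimately show ?thesis
    using Fr.single_closed[OF graft_closed[OF assms]]
    by (simp add: Fr.coef_single del: Fr.ops_free)
qed

text \<open>By \<open>coef_append\<close> the coefficient is linear in the value of the varying
  function at its symbol, so the identities hold summand by summand once all sums are taken over the
  same lists.\<close>

lemma formal_oper_multilinear:
  assumes \<mu>: "\<mu> \<in> carrier (ops P n)"
  shows "multilinear R n F F (formal_oper R P V \<mu>)"
  unfolding multilinear_def
proof (intro allI impI)
  fix fs gs
  assume *: "set fs \<subseteq> carrier F" "set gs \<subseteq> carrier F" "Suc (length fs + length gs) = n"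
  let ?s = "\<lambda>f. {s. f s \<noteq> \<zero>\<^bsub>R\<^esub>}"
  let ?T = "\<lambda>Y. listset (map ?s fs @ Y # map ?s gs)"
  let ?e = "\<lambda>ss. single R (graft P \<mu> ss)"
  have fin: "finite (?s f)" "?s f \<subseteq> symbols P V" if "f \<in> carrier F" for f
    using that by (auto simp: Fr.carrier_free)
  have val: "f s \<in> carrier R" if "f \<in> carrier F" for f s
    using that Fr.carrier_free by blast
  have fin': "finite Y \<and> Y \<subseteq> symbols P V" if Y: "Y \<in> set (map ?s fs) \<union> set (map ?s gs)" for Y
  proof -
    obtain f where "f \<in> carrier F" "Y = ?s f" using Y * by auto
    then show ?thesis using fin by simp
  qed
  have coef: "Fr.coef (fs @ gs) ss \<in> carrier R" for ss
    by (rule Fr.coef_closed) (use * in auto)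
  have eq: "formal_oper R P V \<mu> (fs @ f # gs) =
      (\<Oplus>\<^bsub>F\<^esub>ss\<in>?T Y. Fr.coef (fs @ f # gs) ss \<odot>\<^bsub>F\<^esub> ?e ss)"
    if "f \<in> carrier F" "finite Y" "Y \<subseteq> symbols P V" "?s f \<subseteq> Y" for f Y
  proof (rule formal_oper_eq)
    show "finite Z \<and> Z \<subseteq> symbols P V" if "Z \<in> set (map ?s fs @ Y # map ?s gs)" for Z
      using that fin'[of Z] \<open>finite Y\<close> \<open>Y \<subseteq> symbols P V\<close> by auto
  qed (use that * \<mu> in \<open>auto simp: list_all2_map2 list_all2_same list_all2_append\<close>)
  have split: "\<exists>as s bs. ss = as @ s # bs \<and> length as = length fs \<and> length bs = length gs \<and>
      set ss \<subseteq> symbols P V" if "ss \<in> ?T Y" "Y \<subseteq> symbols P V" for ss Y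
  proof -
    have ss: "list_all2 (\<in>) ss (map ?s fs @ Y # map ?s gs)" using that by (simp add: in_listset_iff)
    have "set ss \<subseteq> symbols P V"
      by (rule listset_elem(2)[OF that(1)]) (use that(2) fin' in auto)
    moreover obtain as s bs where "ss = as @ s # bs" "length as = length fs" "length bs = length gs"
      using ss by (auto simp: list_all2_append2 list_all2_Cons2 dest: list_all2_lengthD)
    ultimately show ?thesis by blast
  qed
  have e: "?e ss \<in> carrier F" if "ss \<in> ?T Y" "Y \<subseteq> symbols P V" for ss Y
    using split[OF that] \<mu> * by (auto intro!: Fr.single_closed graft_closed)
  have c: "Fr.coef (fs @ f # gs) ss \<in> carrier R" if "f \<in> carrier F" for f ss
    using * that by (intro Fr.coef_closed) auto
  have ce: "Fr.coef (fs @ f # gs) ss \<odot>\<^bsub>F\<^esub> ?e ss \<in> carrier F"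
    if "f \<in> carrier F" "ss \<in> ?T Y" "Y \<subseteq> symbols P V" for f ss Y
    using c e that by (intro Fr.F.smult_closed) auto
  have finT: "finite (?T Y)" if "finite Y" for Y
    by (rule Fr.finite_listset) (use that * fin in auto)
  show "linear_map R F F (\<lambda>x. formal_oper R P V \<mu> (fs @ x # gs))"
  proof (rule linear_mapI)
    fix f assume "f \<in> carrier F"
    then show "formal_oper R P V \<mu> (fs @ f # gs) \<in> carrier F"
      using * \<mu> by (intro formal_oper_closed) auto
  next
    fix f g assume f: "f \<in> carrier F" and g: "g \<in> carrier F"
    \<comment> \<open>The union of the two supports contains that of the sum and serves for all
      three values.\<close>
    let ?Y = "?s f \<union> ?s g"
    have Y: "finite ?Y" "?Y \<subseteq> symbols P V" using fin f g by auto
    have fg: "f \<oplus>\<^bsub>F\<^esub> g \<in> carrier F" using f g by (rule Fr.F.M.a_closed)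
    have add: "Fr.coef (fs @ (f \<oplus>\<^bsub>F\<^esub> g) # gs) ss \<odot>\<^bsub>F\<^esub> ?e ss =
      Fr.coef (fs @ f # gs) ss \<odot>\<^bsub>F\<^esub> ?e ss \<oplus>\<^bsub>F\<^esub> Fr.coef (fs @ g # gs) ss \<odot>\<^bsub>F\<^esub> ?e ss"
      if ss: "ss \<in> ?T ?Y" for ss
    proof -
      obtain as s bs where d: "ss = as @ s # bs" "length as = length fs" "length bs = length gs"
        using split[OF ss Y(2)] by blast
      have "f s \<in> carrier R" "g s \<in> carrier R" "Fr.coef (fs @ gs) (as @ bs) \<in> carrier R"
        using val f g coef by auto
      then have "Fr.coef (fs @ (f \<oplus>\<^bsub>F\<^esub> g) # gs) ss =
        Fr.coef (fs @ f # gs) ss \<oplus>\<^bsub>R\<^esub> Fr.coef (fs @ g # gs) ss"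
        unfolding d(1) Fr.coef_append[OF d(2) *(1) f *(2)] Fr.coef_append[OF d(2) *(1) g *(2)]
          Fr.coef_append[OF d(2) *(1) fg *(2)]
        by (simp add: Fr.l_distr)
      then show ?thesis
        using Fr.F.smult_l_distr[OF c[OF f] c[OF g] e[OF ss Y(2)]] by simp
    qed
    have "formal_oper R P V \<mu> (fs @ (f \<oplus>\<^bsub>F\<^esub> g) # gs) =
      (\<Oplus>\<^bsub>F\<^esub>ss\<in>?T ?Y. Fr.coef (fs @ (f \<oplus>\<^bsub>F\<^esub> g) # gs) ss \<odot>\<^bsub>F\<^esub> ?e ss)"
      by (rule eq[OF fg Y]) (use f g in \<open>auto simp: Fr.carrier_free\<close>)
    also have "\<dots> = (\<Oplus>\<^bsub>F\<^esub>ss\<in>?T ?Y. Fr.coef (fs @ f # gs) ss \<odot>\<^bsub>F\<^esub> ?e ss \<oplus>\<^bsub>F\<^esub>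
        Fr.coef (fs @ g # gs) ss \<odot>\<^bsub>F\<^esub> ?e ss)"
      by (rule Fr.F.M.finsum_cong')
        (use add ce[OF f _ Y(2)] ce[OF g _ Y(2)] Fr.F.M.a_closed in blast)+
    also have "\<dots> = (\<Oplus>\<^bsub>F\<^esub>ss\<in>?T ?Y. Fr.coef (fs @ f # gs) ss \<odot>\<^bsub>F\<^esub> ?e ss) \<oplus>\<^bsub>F\<^esub>
        (\<Oplus>\<^bsub>F\<^esub>ss\<in>?T ?Y. Fr.coef (fs @ g # gs) ss \<odot>\<^bsub>F\<^esub> ?e ss)"
      by (rule Fr.F.M.finsum_addf) (use ce[OF f _ Y(2)] ce[OF g _ Y(2)] in blast)+
    also have "\<dots> = formal_oper R P V \<mu> (fs @ f # gs) \<oplus>\<^bsub>F\<^esub> formal_oper R P V \<mu> (fs @ g # gs)"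
      using eq[OF f Y] eq[OF g Y] by (simp del: Fr.ops_free)
    finally show "formal_oper R P V \<mu> (fs @ (f \<oplus>\<^bsub>F\<^esub> g) # gs) =
      formal_oper R P V \<mu> (fs @ f # gs) \<oplus>\<^bsub>F\<^esub> formal_oper R P V \<mu> (fs @ g # gs)" .
  next
    fix r f assume r: "r \<in> carrier R" and f: "f \<in> carrier F"
    note Y = fin[OF f]
    have rf: "r \<odot>\<^bsub>F\<^esub> f \<in> carrier F" using r f by (rule Fr.F.smult_closed)
    have mul: "Fr.coef (fs @ (r \<odot>\<^bsub>F\<^esub> f) # gs) ss \<odot>\<^bsub>F\<^esub> ?e ss =
      r \<odot>\<^bsub>F\<^esub> (Fr.coef (fs @ f # gs) ss \<odot>\<^bsub>F\<^esub> ?e ss)"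
      if ss: "ss \<in> ?T (?s f)" for ss
    proof -
      obtain as s bs where d: "ss = as @ s # bs" "length as = length fs" "length bs = length gs"
        using split[OF ss Y(2)] by blast
      have "f s \<in> carrier R" "Fr.coef (fs @ gs) (as @ bs) \<in> carrier R"
        using val f coef by auto
      then have "Fr.coef (fs @ (r \<odot>\<^bsub>F\<^esub> f) # gs) ss = r \<otimes>\<^bsub>R\<^esub> Fr.coef (fs @ f # gs) ss"
        unfolding d(1) Fr.coef_append[OF d(2) *(1) f *(2)] Fr.coef_append[OF d(2) *(1) rf *(2)]
        using r by (simp add: Fr.m_assoc)
      then show ?thesis
        using Fr.F.smult_assoc1[OF r c[OF f] e[OF ss Y(2)]] by simp
    qed
    have "formal_oper R P V \<mu> (fs @ (r \<odot>\<^bsub>F\<^esub> f) # gs) =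
      (\<Oplus>\<^bsub>F\<^esub>ss\<in>?T (?s f). Fr.coef (fs @ (r \<odot>\<^bsub>F\<^esub> f) # gs) ss \<odot>\<^bsub>F\<^esub> ?e ss)"
      by (rule eq[OF rf Y]) (use r in auto)
    also have "\<dots> = (\<Oplus>\<^bsub>F\<^esub>ss\<in>?T (?s f). r \<odot>\<^bsub>F\<^esub> (Fr.coef (fs @ f # gs) ss \<odot>\<^bsub>F\<^esub> ?e ss))"
      by (rule Fr.F.M.finsum_cong')
        (use mul ce[OF f _ Y(2)] Fr.F.smult_closed[OF r] in blast)+
    also have "\<dots> = r \<odot>\<^bsub>F\<^esub> (\<Oplus>\<^bsub>F\<^esub>ss\<in>?T (?s f). Fr.coef (fs @ f # gs) ss \<odot>\<^bsub>F\<^esub> ?e ss)"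
      by (rule Fr.F.finsum_smult_ldistr[symmetric]) (use finT Y r ce[OF f _ Y(2)] in blast)+
    also have "\<dots> = r \<odot>\<^bsub>F\<^esub> formal_oper R P V \<mu> (fs @ f # gs)"
      using eq[OF f Y] by (simp del: Fr.ops_free)
    finally show "formal_oper R P V \<mu> (fs @ (r \<odot>\<^bsub>F\<^esub> f) # gs) =
      r \<odot>\<^bsub>F\<^esub> formal_oper R P V \<mu> (fs @ f # gs)" .
  qed
qed

lemma formal_alg_simps [simp]:
  "carrier FA = carrier F" "\<zero>\<^bsub>FA\<^esub> = \<zero>\<^bsub>F\<^esub>" "x \<oplus>\<^bsub>FA\<^esub> y = x \<oplus>\<^bsub>F\<^esub> y" "r \<odot>\<^bsub>FA\<^esub> x = r \<odot>\<^bsub>F\<^esub> x"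
  "oper FA = formal_oper R P V"
  by (simp_all add: formal_alg_def module.extend_def free_module_def)

lemma linear_FA_F: "linear_map R FA F (\<lambda>x. x)"
  by (simp add: linear_map_def del: Fr.ops_free)

lemma module_FA: "module R FA"
  by (rule module_surj_image[OF Fr.module_free, where p = "\<lambda>x. x"]) (simp_all del: Fr.ops_free)

lemma linear_map_FA_iff [simp]: "linear_map R FA M f \<longleftrightarrow> linear_map R F M f"
  by (simp add: linear_map_def del: Fr.ops_free)

lemma ops_algebra_FA: "ops_algebra R P FA"
proof (rule ops_algebra.intro[OF module_FA], unfold_locales)
  fix \<mu> n assume "\<mu> \<in> carrier (ops P n)"
  then show "multilinear R n FA FA (oper FA \<mu>)"
    using formal_oper_multilinear[of \<mu> n]
    by (simp add: multilinear_def) (simp add: linear_map_def del: Fr.ops_free)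
qed (simp add: formal_oper_closed)

lemma tensor_rels_closed: "tensor_rels R P V \<subseteq> carrier F"
proof -
  interpret V: module R V by (rule module_V)
  note cl = Fr.F.M.minus_closed Fr.F.M.a_closed Fr.F.smult_closed Fr.single_closed
  have op: "\<mu> \<oplus>\<^bsub>ops P n\<^esub> \<mu>' \<in> carrier (ops P n)" "r \<odot>\<^bsub>ops P n\<^esub> \<mu> \<in> carrier (ops P n)"
    if "\<mu> \<in> carrier (ops P n)" "\<mu>' \<in> carrier (ops P n)" "r \<in> carrier R" for \<mu> \<mu>' n r
    using that module_ops[of n] by (auto intro: module.smult_closed abelian_monoid.a_closed
        abelian_group.axioms module.axioms)
  have act: "opact P n \<mu> \<sigma> \<in> carrier (ops P n)" if "\<mu> \<in> carrier (ops P n)" "\<sigma> permutes {..<n}" for n \<mu> \<sigma>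
    using linear_map_closed[OF act_linear[OF that(2)] that(1)] .
  show ?thesis
    unfolding tensor_rels_def Let_def
    by (auto simp: symbol_iff simp del: Fr.ops_free intro!: cl op act)
qed

lemma submodule_N: "submodule N R F"
  unfolding tensor_null_def hull_def
  by (rule submodule_Inter[OF Fr.module_free])
    (use Fr.F.carrier_is_submodule tensor_rels_closed in auto)

lemma submodule_N_FA: "submodule N R FA"
  using submodule_vimage[OF module_FA Fr.module_free linear_FA_F submodule_N]
    Fr.F.submoduleE(1)[OF submodule_N]
  by (simp add: Int_absorb1 Int_def[symmetric] Collect_conj_eq)

text \<open>The universal property of coinvariant tensors. Linearity in the operation, linearity in
  each vector and invariance under permutations correspond to the five families of
  \<open>tensor_rels\<close>; the kernel of \<open>L\<close> is a submodule and therefore contains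
  their hull.\<close>

lemma linear_kills_null:
  assumes "module R M" "linear_map R F M L"
    and op: "\<And>vs. set vs \<subseteq> carrier V \<Longrightarrow>
      linear_map R (ops P (length vs)) M (\<lambda>\<mu>. L (single R (\<mu>, vs)))"
    and vec: "\<And>\<mu> vs ws. \<lbrakk>\<mu> \<in> carrier (ops P (Suc (length vs + length ws)));
        set vs \<subseteq> carrier V; set ws \<subseteq> carrier V\<rbrakk> \<Longrightarrow>
      linear_map R V M (\<lambda>x. L (single R (\<mu>, vs @ x # ws)))"
    and act: "\<And>\<mu> \<sigma> vs. \<lbrakk>\<mu> \<in> carrier (ops P (length vs)); set vs \<subseteq> carrier V;
        \<sigma> permutes {..<length vs}\<rbrakk> \<Longrightarrow>
      L (single R (opact P (length vs) \<mu> \<sigma>, permute_list \<sigma> vs)) = L (single R (\<mu>, vs))"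
    and "x \<in> N"
  shows "L x = \<zero>\<^bsub>M\<^esub>"
proof -
  interpret M: module R M by fact
  interpret V: module R V by (rule module_V)
  note cl = Fr.F.M.a_closed Fr.F.smult_closed Fr.single_closed
  have opc: "\<mu> \<oplus>\<^bsub>ops P n\<^esub> \<mu>' \<in> carrier (ops P n)" "r \<odot>\<^bsub>ops P n\<^esub> \<mu> \<in> carrier (ops P n)"
    if "\<mu> \<in> carrier (ops P n)" "\<mu>' \<in> carrier (ops P n)" "r \<in> carrier R" for \<mu> \<mu>' n r
    using that module_ops[of n] by (auto intro: module.smult_closed abelian_monoid.a_closed
        abelian_group.axioms module.axioms)
  have actc: "opact P n \<mu> \<sigma> \<in> carrier (ops P n)" if "\<mu> \<in> carrier (ops P n)" "\<sigma> permutes {..<n}" for n \<mu> \<sigma>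
    using linear_map_closed[OF act_linear[OF that(2)] that(1)] .
  have kill: "L (x \<ominus>\<^bsub>F\<^esub> y) = \<zero>\<^bsub>M\<^esub>" if "x \<in> carrier F" "y \<in> carrier F" "L x = L y" for x y
    using that linear_map_minus[OF Fr.module_free assms(1,2) that(1,2)]
      linear_map_closed[OF assms(2)] M.M.minus_eq_zero_iff by simp
  have rels: "L r = \<zero>\<^bsub>M\<^esub>" if "r \<in> tensor_rels R P V" for r
    using that unfolding tensor_rels_def Let_def
  proof (elim UnE CollectE exE conjE)
    fix \<mu> \<mu>' vs
    assume r: "r = single R (\<mu> \<oplus>\<^bsub>ops P (length vs)\<^esub> \<mu>', vs) \<ominus>\<^bsub>F\<^esub> (single R (\<mu>, vs) \<oplus>\<^bsub>F\<^esub> single R (\<mu>', vs))"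
      and s: "(\<mu>, vs) \<in> symbols P V" "(\<mu>', vs) \<in> symbols P V"
    show ?thesis
      unfolding r
      by (rule kill)
        (use s linear_map_add[OF op, of vs \<mu> \<mu>'] opc[OF _ _ Fr.zero_closed] in
          \<open>auto simp: symbol_iff Fr.single_closed linear_map_add[OF assms(2)] simp del: Fr.ops_free intro!: cl\<close>)
  next
    fix a \<mu> vs
    assume r: "r = single R (a \<odot>\<^bsub>ops P (length vs)\<^esub> \<mu>, vs) \<ominus>\<^bsub>F\<^esub> a \<odot>\<^bsub>F\<^esub> single R (\<mu>, vs)"
      and s: "a \<in> carrier R" "(\<mu>, vs) \<in> symbols P V"
    show ?thesis
      unfolding r
      by (rule kill)
        (use s linear_map_smult[OF op, of vs a \<mu>] opc(2) in
          \<open>auto simp: symbol_iff Fr.single_closed linear_map_smult[OF assms(2)] simp del: Fr.ops_free intro!: cl\<close>)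
  next
    fix \<mu> vs x y ws
    assume r: "r = single R (\<mu>, vs @ (x \<oplus>\<^bsub>V\<^esub> y) # ws) \<ominus>\<^bsub>F\<^esub>
        (single R (\<mu>, vs @ x # ws) \<oplus>\<^bsub>F\<^esub> single R (\<mu>, vs @ y # ws))"
      and s: "(\<mu>, vs @ x # ws) \<in> symbols P V" "(\<mu>, vs @ y # ws) \<in> symbols P V"
    show ?thesis
      unfolding r
      by (rule kill)
        (use s linear_map_add[OF vec, of \<mu> vs ws x y] in
          \<open>auto simp: symbol_iff Fr.single_closed linear_map_add[OF assms(2)] simp del: Fr.ops_free intro!: cl\<close>)
  next
    fix a \<mu> vs x ws
    assume r: "r = single R (\<mu>, vs @ (a \<odot>\<^bsub>V\<^esub> x) # ws) \<ominus>\<^bsub>F\<^esub> a \<odot>\<^bsub>F\<^esub> single R (\<mu>, vs @ x # ws)"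
      and s: "a \<in> carrier R" "(\<mu>, vs @ x # ws) \<in> symbols P V"
    show ?thesis
      unfolding r
      by (rule kill)
        (use s linear_map_smult[OF vec, of \<mu> vs ws a x] in
          \<open>auto simp: symbol_iff Fr.single_closed linear_map_smult[OF assms(2)] simp del: Fr.ops_free intro!: cl\<close>)
  next
    fix \<mu> \<sigma> vs
    assume r: "r = single R (opact P (length vs) \<mu> \<sigma>, permute_list \<sigma> vs) \<ominus>\<^bsub>F\<^esub> single R (\<mu>, vs)"
      and s: "(\<mu>, vs) \<in> symbols P V" "\<sigma> permutes {..<length vs}"
    show ?thesis
      unfolding r
      by (rule kill) (use s act actc in \<open>auto simp: symbol_iff intro!: cl\<close>)
  qed
  have "N \<subseteq> {x \<in> carrier F. L x \<in> {\<zero>\<^bsub>M\<^esub>}}"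
    unfolding tensor_null_def
    by (rule hull_minimal)
      (use rels tensor_rels_closed submodule_vimage[OF Fr.module_free assms(1,2) submodule_zero[OF assms(1)]]
        in auto)
  then show ?thesis using assms(6) by auto
qed

end

lemma alg_hom_linear: "f \<in> alg_hom R P A B \<Longrightarrow> linear_map R A B f"
  by (simp add: alg_hom_def)

lemma alg_hom_closed: "f \<in> alg_hom R P A B \<Longrightarrow> x \<in> carrier A \<Longrightarrow> f x \<in> carrier B"
  by (rule linear_map_closed[OF alg_hom_linear])

lemma alg_hom_oper:
  "f \<in> alg_hom R P A B \<Longrightarrow> \<mu> \<in> carrier (ops P (length as)) \<Longrightarrow> set as \<subseteq> carrier A \<Longrightarrow>
    f (oper A \<mu> as) = oper B \<mu> (map f as)"
  by (auto simp: alg_hom_def)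

lemma alg_hom_eqI:
  assumes "f \<in> alg_hom R P A B" "g \<in> alg_hom R P A B" "\<And>x. x \<in> carrier A \<Longrightarrow> f x = g x"
  shows "f = g"
proof (rule PiE_ext)
  show "f \<in> carrier A \<rightarrow>\<^sub>E carrier B" "g \<in> carrier A \<rightarrow>\<^sub>E carrier B"
    using assms(1,2) by (simp_all add: alg_hom_def)
qed (rule assms(3))

lemma multilinear_append:
  assumes "multilinear R (length xs + k + length ys) M N \<phi>" "set xs \<subseteq> carrier M" "set ys \<subseteq> carrier M"
  shows "multilinear R k M N (\<lambda>as. \<phi> (xs @ as @ ys))"
  unfolding multilinear_def
proof (intro allI impI)
  fix as bs
  assume *: "set as \<subseteq> carrier M" "set bs \<subseteq> carrier M" "Suc (length as + length bs) = k"
  have "linear_map R M N (\<lambda>x. \<phi> ((xs @ as) @ x # (bs @ ys)))"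
    by (rule multilinearD[OF assms(1)]) (use * assms in auto)
  then show "linear_map R M N (\<lambda>x. \<phi> (xs @ (as @ x # bs) @ ys))" by simp
qed

section \<open>The free algebra as a quotient of the formal algebra\<close>

context free_operad_algebra
begin

abbreviation sym_arities :: "('p \<times> 'v list) list \<Rightarrow> (nat \<times> 'p) list"
  where "sym_arities ss \<equiv> map (\<lambda>(\<nu>, vs). (length vs, \<nu>)) ss"

lemma coset_module_FA: "coset_module R FA N"
  by (intro coset_module.intro module_FA coset_module_axioms.intro submodule_N_FA)

lemma module_S: "module R S"
  using coset_module.module_quot[OF coset_module_FA] by (simp add: free_alg_def)

lemma linear_S: "linear_map R F S (\<lambda>x. N +>\<^bsub>FA\<^esub> x)"
  using coset_module.linear_coset[OF coset_module_FA] by (simp add: free_alg_def)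

lemma coset_S_eqI:
  assumes "x \<ominus>\<^bsub>F\<^esub> y \<in> tensor_rels R P V" "x \<in> carrier F" "y \<in> carrier F"
  shows "N +>\<^bsub>FA\<^esub> x = N +>\<^bsub>FA\<^esub> y"
proof -
  have "x \<ominus>\<^bsub>FA\<^esub> y = x \<ominus>\<^bsub>F\<^esub> y"
    using linear_map_minus[OF module_FA Fr.module_free linear_FA_F, of x y] assms by simp
  then show ?thesis
    using assms coset_module.coset_eq_iff[OF coset_module_FA, of x y]
    by (simp add: tensor_null_def hull_inc)
qed

definition tensor :: "'p \<times> 'v list \<Rightarrow> ('r, 'p, 'v) free"
  where "tensor s = N +>\<^bsub>FA\<^esub> single R s"

lemma tensor_closed: "s \<in> symbols P V \<Longrightarrow> tensor s \<in> carrier S"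
  unfolding tensor_def by (rule linear_map_closed[OF linear_S Fr.single_closed])

lemma spans_S: "spans R S (tensor ` symbols P V)"
proof -
  have "(\<lambda>x. N +>\<^bsub>FA\<^esub> x) ` carrier F = carrier S"
    using coset_module.carrier_quot[OF coset_module_FA] by (simp add: free_alg_def)
  from spans_image[OF Fr.module_free module_S linear_S Fr.spans_free this]
  show ?thesis by (simp add: image_image tensor_def)
qed

lemma tensor_add:
  assumes "s \<in> symbols P V" "t \<in> symbols P V" "u \<in> symbols P V"
    "single R s \<ominus>\<^bsub>F\<^esub> (single R t \<oplus>\<^bsub>F\<^esub> single R u) \<in> tensor_rels R P V"
  shows "tensor s = tensor t \<oplus>\<^bsub>S\<^esub> tensor u"
proof -
  have "single R t \<oplus>\<^bsub>F\<^esub> single R u \<in> carrier F"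
    by (intro Fr.F.M.a_closed Fr.single_closed assms)
  with coset_S_eqI[OF assms(4)] show ?thesis
    using linear_map_add[OF linear_S Fr.single_closed Fr.single_closed, OF assms(2,3)] assms(1)
    by (simp add: tensor_def Fr.single_closed del: Fr.ops_free)
qed

lemma tensor_smult:
  assumes "r \<in> carrier R" "s \<in> symbols P V" "t \<in> symbols P V"
    "single R s \<ominus>\<^bsub>F\<^esub> (r \<odot>\<^bsub>F\<^esub> single R t) \<in> tensor_rels R P V"
  shows "tensor s = r \<odot>\<^bsub>S\<^esub> tensor t"
proof -
  have "r \<odot>\<^bsub>F\<^esub> single R t \<in> carrier F"
    by (intro Fr.F.smult_closed Fr.single_closed assms)
  with coset_S_eqI[OF assms(4)] show ?thesis
    using linear_map_smult[OF linear_S assms(1) Fr.single_closed[OF assms(3)]] assms(2)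
    by (simp add: tensor_def Fr.single_closed del: Fr.ops_free)
qed

lemma tensor_linear_op:
  assumes vs: "set vs \<subseteq> carrier V"
  shows "linear_map R (ops P (length vs)) S (\<lambda>\<mu>. tensor (\<mu>, vs))"
proof -
  interpret O: module R "ops P (length vs)" by (rule module_ops)
  have sym: "(\<mu>, vs) \<in> symbols P V" if "\<mu> \<in> carrier (ops P (length vs))" for \<mu>
    using that vs by (simp add: symbol_iff)
  show ?thesis
  proof (rule linear_mapI)
    fix \<mu> \<nu> assume *: "\<mu> \<in> carrier (ops P (length vs))" "\<nu> \<in> carrier (ops P (length vs))"
    show "tensor (\<mu> \<oplus>\<^bsub>ops P (length vs)\<^esub> \<nu>, vs) = tensor (\<mu>, vs) \<oplus>\<^bsub>S\<^esub> tensor (\<nu>, vs)"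
    proof (rule tensor_add)
      show "single R (\<mu> \<oplus>\<^bsub>ops P (length vs)\<^esub> \<nu>, vs) \<ominus>\<^bsub>F\<^esub> (single R (\<mu>, vs) \<oplus>\<^bsub>F\<^esub> single R (\<nu>, vs))
        \<in> tensor_rels R P V"
        unfolding tensor_rels_def Let_def using * sym by blast
    qed (use * sym in simp_all)
  next
    fix r \<mu> assume *: "r \<in> carrier R" "\<mu> \<in> carrier (ops P (length vs))"
    show "tensor (r \<odot>\<^bsub>ops P (length vs)\<^esub> \<mu>, vs) = r \<odot>\<^bsub>S\<^esub> tensor (\<mu>, vs)"
    proof (rule tensor_smult[OF *(1)])
      show "single R (r \<odot>\<^bsub>ops P (length vs)\<^esub> \<mu>, vs) \<ominus>\<^bsub>F\<^esub> (r \<odot>\<^bsub>F\<^esub> single R (\<mu>, vs)) \<in> tensor_rels R P V"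
        unfolding tensor_rels_def Let_def using * sym by blast
    qed (use * sym in simp_all)
  qed (use sym in \<open>simp add: tensor_closed\<close>)
qed

lemma tensor_linear_vec:
  assumes \<mu>: "\<mu> \<in> carrier (ops P (Suc (length vs + length ws)))"
    and vs: "set vs \<subseteq> carrier V" "set ws \<subseteq> carrier V"
  shows "linear_map R V S (\<lambda>x. tensor (\<mu>, vs @ x # ws))"
proof -
  interpret V: module R V by (rule module_V)
  have sym: "(\<mu>, vs @ x # ws) \<in> symbols P V" if "x \<in> carrier V" for x
    using that assms by (simp add: symbol_iff)
  show ?thesis
  proof (rule linear_mapI)
    fix x y assume *: "x \<in> carrier V" "y \<in> carrier V"
    show "tensor (\<mu>, vs @ (x \<oplus>\<^bsub>V\<^esub> y) # ws) =
        tensor (\<mu>, vs @ x # ws) \<oplus>\<^bsub>S\<^esub> tensor (\<mu>, vs @ y # ws)"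
    proof (rule tensor_add)
      show "single R (\<mu>, vs @ (x \<oplus>\<^bsub>V\<^esub> y) # ws) \<ominus>\<^bsub>F\<^esub>
          (single R (\<mu>, vs @ x # ws) \<oplus>\<^bsub>F\<^esub> single R (\<mu>, vs @ y # ws)) \<in> tensor_rels R P V"
        unfolding tensor_rels_def Let_def using sym[OF *(1)] sym[OF *(2)] by blast
    qed (use * sym in simp_all)
  next
    fix r x assume *: "r \<in> carrier R" "x \<in> carrier V"
    show "tensor (\<mu>, vs @ (r \<odot>\<^bsub>V\<^esub> x) # ws) = r \<odot>\<^bsub>S\<^esub> tensor (\<mu>, vs @ x # ws)"
    proof (rule tensor_smult[OF *(1)])
      show "single R (\<mu>, vs @ (r \<odot>\<^bsub>V\<^esub> x) # ws) \<ominus>\<^bsub>F\<^esub> (r \<odot>\<^bsub>F\<^esub> single R (\<mu>, vs @ x # ws))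
          \<in> tensor_rels R P V"
        unfolding tensor_rels_def Let_def using sym[OF *(2)] *(1) by blast
    qed (use * sym in simp_all)
  qed (use sym in \<open>simp add: tensor_closed\<close>)
qed

lemma tensor_act:
  assumes "(\<mu>, vs) \<in> symbols P V" "\<sigma> permutes {..<length vs}"
  shows "tensor (opact P (length vs) \<mu> \<sigma>, permute_list \<sigma> vs) = tensor (\<mu>, vs)"
  unfolding tensor_def
proof (rule coset_S_eqI)
  show "single R (opact P (length vs) \<mu> \<sigma>, permute_list \<sigma> vs) \<ominus>\<^bsub>F\<^esub> single R (\<mu>, vs) \<in> tensor_rels R P V"
    unfolding tensor_rels_def Let_def using assms by blast
qed (use assms linear_map_closed[OF act_linear[OF assms(2)]] in
    \<open>auto intro!: Fr.single_closed simp: symbol_iff\<close>)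

lemma tensor_graft_linear_op:
  assumes \<mu>: "\<mu> \<in> carrier (ops P (Suc (length ss + length ts)))"
    and ss: "set ss \<subseteq> symbols P V" "set ts \<subseteq> symbols P V" and vs: "set vs \<subseteq> carrier V"
  shows "linear_map R (ops P (length vs)) S (\<lambda>\<nu>. tensor (graft P \<mu> (ss @ (\<nu>, vs) # ts)))"
proof -
  let ?C = "concat (map snd ss) @ vs @ concat (map snd ts)"
  have C: "set ?C \<subseteq> carrier V" using ss vs by (fastforce simp: symbols_def)
  have "linear_map R (ops P (length vs)) (ops P (length ?C))
      (\<lambda>\<nu>. opcomp P \<mu> (sym_arities ss @ (length vs, \<nu>) # sym_arities ts))"
    using comp_linear_right[of \<mu> "sym_arities ss" "sym_arities ts" "length vs"] \<mu>
      symbols_ops_list[OF ss(1)] symbols_ops_list[OF ss(2)]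
    unfolding arity_sum_symbols by (simp add: add.assoc)
  from linear_map_compose[OF this tensor_linear_op[OF C]] show ?thesis
    by (simp add: graft_def)
qed

text \<open>Permuting the vectors of one inserted symbol permutes one block of the concatenated
  vector list: it is the sum permutation with identities in all other places. By
  \<open>comp_act_right\<close> the composite operation changes by the same permutation, so
  \<open>tensor_act\<close> identifies the two symbols.\<close>

lemma graft_act_right:
  assumes \<mu>: "\<mu> \<in> carrier (ops P (Suc (length ss + length ts)))"
    and ss: "set ss \<subseteq> symbols P V" "set ts \<subseteq> symbols P V" and s: "(\<nu>, vs) \<in> symbols P V"
    and \<sigma>: "\<sigma> permutes {..<length vs}"
  shows "tensor (graft P \<mu> (ss @ (opact P (length vs) \<nu> \<sigma>, permute_list \<sigma> vs) # ts)) =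
    tensor (graft P \<mu> (ss @ (\<nu>, vs) # ts))"
proof -
  let ?us = "ss @ (\<nu>, vs) # ts"
  let ?\<tau>s = "map (\<lambda>_. id) ss @ \<sigma> # map (\<lambda>_. id) ts"
  let ?\<tau> = "sum_perm ?\<tau>s (map length (map snd ?us))"
  have us: "set ?us \<subseteq> symbols P V" using ss s by auto
  have all: "list_all2 (\<lambda>\<tau> xs. \<tau> permutes {..<length xs}) ?\<tau>s (map snd ?us)"
    using \<sigma> by (auto simp: list_all2_append list_all2_map1 list_all2_map2 list_all2_same permutes_id)
  have perm: "?\<tau> permutes {..<length (concat (map snd ?us))}"
    unfolding length_concat
    by (rule sum_perm_permutes) (use all in \<open>simp only: list_all2_map2\<close>)
  have fst: "map fst (sym_arities xs) = map length (map snd xs)" for xs :: "('p \<times> 'v list) list"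
    by (induction xs) auto
  have id: "map2 (\<lambda>\<tau> (k, \<nu>). (k, opact P k \<nu> \<tau>)) (map (\<lambda>_. id) xs) (sym_arities xs) = sym_arities xs"
    if "set xs \<subseteq> symbols P V" for xs
    using that by (induction xs) (auto simp: symbol_iff act_id)
  have "opcomp P \<mu> (map2 (\<lambda>\<tau> (k, \<nu>). (k, opact P k \<nu> \<tau>)) ?\<tau>s (sym_arities ?us)) =
    opact P (length (concat (map snd ?us))) (opcomp P \<mu> (sym_arities ?us)) ?\<tau>"
    using comp_act_right[of \<mu> "sym_arities ?us" ?\<tau>s] \<mu> symbols_ops_list[OF us] all
    unfolding arity_sum_symbols fst by (simp add: list_all2_append list_all2_map1 list_all2_map2 case_prod_beta)
  moreover have "map2 (\<lambda>\<tau> (k, \<nu>). (k, opact P k \<nu> \<tau>)) ?\<tau>s (sym_arities ?us) =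
    sym_arities (ss @ (opact P (length vs) \<nu> \<sigma>, permute_list \<sigma> vs) # ts)"
    using id[OF ss(1)] id[OF ss(2)] by simp
  moreover have "permute_list ?\<tau> (concat (map snd ?us)) =
    concat (map snd (ss @ (opact P (length vs) \<nu> \<sigma>, permute_list \<sigma> vs) # ts))"
  proof -
    have "map2 permute_list (map (\<lambda>_. id) xs) (map snd xs) = map snd xs" for xs :: "('p \<times> 'v list) list"
      by (induction xs) auto
    then show ?thesis using permute_list_sum_perm[OF all] by simp
  qed
  ultimately have "graft P \<mu> (ss @ (opact P (length vs) \<nu> \<sigma>, permute_list \<sigma> vs) # ts) =
    (opact P (length (concat (map snd ?us))) (fst (graft P \<mu> ?us)) ?\<tau>, permute_list ?\<tau> (concat (map snd ?us)))"
    by (simp only: graft_def fst_conv)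
  then show ?thesis
    using tensor_act[OF _ perm, of "fst (graft P \<mu> ?us)"] graft_closed[of \<mu> ?us] \<mu> us
    by (simp add: graft_def)
qed

text \<open>\<open>tensor_null\<close> is generated as a submodule only, so its stability under the
  operations has to be proved. By multilinearity the arguments other than \<open>x\<close> may be
  taken to be symbols; the operation is then a linear map \<open>L\<close> of the one remaining
  argument, and \<open>linear_kills_null\<close> applies to it.\<close>

lemma formal_oper_null:
  assumes \<mu>: "\<mu> \<in> carrier (ops P (Suc (length fs + length gs)))"
    and fs: "set fs \<subseteq> carrier F" "set gs \<subseteq> carrier F" and x: "x \<in> N"
  shows "formal_oper R P V \<mu> (fs @ x # gs) \<in> N"
proof -
  let ?k = "length fs" and ?n = "length fs + length gs"
  have xF: "x \<in> carrier F" using x Fr.F.submoduleE(1)[OF submodule_N] by auto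
  \<comment> \<open>All arguments other than \<open>x\<close> form one list, cut at
    \<open>?k\<close> to reinsert \<open>x\<close>, so that \<open>multilinear_eqI\<close> can vary
    them together.\<close>
  let ?\<phi> = "\<lambda>hs. N +>\<^bsub>FA\<^esub> formal_oper R P V \<mu> (take ?k hs @ x # drop ?k hs)"
  have "?\<phi> (fs @ gs) = \<zero>\<^bsub>S\<^esub>"
  proof (rule multilinear_eqI[OF Fr.module_free module_S Fr.spans_free,
        where n = ?n and \<phi> = ?\<phi> and \<psi> = "\<lambda>_. \<zero>\<^bsub>S\<^esub>"])
    have "multilinear R (Suc ?n) F S (\<lambda>hs. N +>\<^bsub>FA\<^esub> formal_oper R P V \<mu> hs)"
      using multilinear_compose[OF formal_oper_multilinear[OF \<mu>] linear_S] by simp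
    from multilinear_insert[OF this xF, of ?k] show "multilinear R ?n F S ?\<phi>" by simp
    show "multilinear R ?n F S (\<lambda>_. \<zero>\<^bsub>S\<^esub>)"
      by (simp add: multilinear_def linear_map_zero_fun module_S)
    show "set (fs @ gs) \<subseteq> carrier F" using fs by simp
  next
    fix hs assume hs: "set hs \<subseteq> single R ` symbols P V" "length hs = ?n"
    obtain us where us: "hs = map (single R) us" "set us \<subseteq> symbols P V"
      using hs(1) by (rule set_subset_imageE)
    define ss ts where "ss = take ?k us" and "ts = drop ?k us"
    have ss: "set ss \<subseteq> symbols P V" "set ts \<subseteq> symbols P V"
      using us(2) set_take_subset[of ?k us] set_drop_subset[of ?k us] by (auto simp: ss_def ts_def)
    have len: "Suc (length ss + length ts) = Suc ?n" using hs us by (simp add: ss_def ts_def)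
    have \<mu>': "\<mu> \<in> carrier (ops P (Suc (length ss + length ts)))" using \<mu> len by simp
    define L where "L f = N +>\<^bsub>FA\<^esub> formal_oper R P V \<mu> (map (single R) ss @ f # map (single R) ts)" for f
    have L: "L (single R s) = tensor (graft P \<mu> (ss @ s # ts))" if "s \<in> symbols P V" for s
      using formal_oper_single[of \<mu> "ss @ s # ts"] that ss \<mu>' by (simp add: L_def tensor_def)
    have linL: "linear_map R F S L"
    proof -
      have "linear_map R F F (\<lambda>f. formal_oper R P V \<mu> (map (single R) ss @ f # map (single R) ts))"
        by (rule multilinearD[OF formal_oper_multilinear[OF \<mu>']]) (use ss Fr.single_closed in auto)
      from linear_map_compose[OF this linear_S] show ?thesis by (simp add: L_def[abs_def])
    qed
    have "L x = \<zero>\<^bsub>S\<^esub>"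
    proof (rule linear_kills_null[OF module_S linL _ _ _ x])
      fix vs assume vs: "set vs \<subseteq> carrier V"
      show "linear_map R (ops P (length vs)) S (\<lambda>\<nu>. L (single R (\<nu>, vs)))"
        by (rule linear_map_cong[OF module_ops tensor_graft_linear_op[OF \<mu>' ss vs]])
          (use vs in \<open>simp add: L symbol_iff\<close>)
    next
      fix \<nu> vs ws assume \<nu>: "\<nu> \<in> carrier (ops P (Suc (length vs + length ws)))"
        and vs: "set vs \<subseteq> carrier V" "set ws \<subseteq> carrier V"
      interpret V: module R V by (rule module_V)
      let ?pre = "concat (map snd ss) @ vs" and ?post = "ws @ concat (map snd ts)"
      \<comment> \<open>After substitution the vectors of the inserted symbol sit inside one long
        vector list, and \<open>?\<rho>\<close> is an operation that does not depend on them. The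
        zero vector below only fills the open slot, in order to read off the arity of
        \<open>?\<rho>\<close> from \<open>graft_closed\<close>.\<close>
      let ?\<rho> = "opcomp P \<mu> (sym_arities ss @ (Suc (length vs + length ws), \<nu>) # sym_arities ts)"
      have "(\<nu>, vs @ \<zero>\<^bsub>V\<^esub> # ws) \<in> symbols P V" using \<nu> vs by (simp add: symbol_iff)
      then have "graft P \<mu> (ss @ (\<nu>, vs @ \<zero>\<^bsub>V\<^esub> # ws) # ts) \<in> symbols P V"
        using \<mu>' ss by (intro graft_closed) auto
      then have "?\<rho> \<in> carrier (ops P (Suc (length ?pre + length ?post)))"
        "set ?pre \<subseteq> carrier V" "set ?post \<subseteq> carrier V"
        by (simp_all add: graft_def symbol_iff add_ac)
      from linear_map_cong[OF module_V tensor_linear_vec[OF this]]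
      show "linear_map R V S (\<lambda>y. L (single R (\<nu>, vs @ y # ws)))"
        using \<nu> vs by (simp add: L symbol_iff graft_def)
    next
      fix \<nu> \<sigma> vs assume \<nu>: "\<nu> \<in> carrier (ops P (length vs))" "set vs \<subseteq> carrier V"
        "\<sigma> permutes {..<length vs}"
      then have "(\<nu>, vs) \<in> symbols P V" "(opact P (length vs) \<nu> \<sigma>, permute_list \<sigma> vs) \<in> symbols P V"
        using linear_map_closed[OF act_linear[OF \<nu>(3)]] by (auto simp: symbol_iff)
      then show "L (single R (opact P (length vs) \<nu> \<sigma>, permute_list \<sigma> vs)) = L (single R (\<nu>, vs))"
        using graft_act_right[OF \<mu>' ss _ \<nu>(3)] by (simp add: L)
    qed
    then show "?\<phi> hs = \<zero>\<^bsub>S\<^esub>"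
      by (simp add: L_def us(1) ss_def ts_def take_map drop_map)
  qed simp
  then have "N +>\<^bsub>FA\<^esub> formal_oper R P V \<mu> (fs @ x # gs) = \<zero>\<^bsub>quot_alg FA N\<^esub>"
    by (simp add: free_alg_def)
  moreover have "formal_oper R P V \<mu> (fs @ x # gs) \<in> carrier F"
    by (rule formal_oper_closed) (use \<mu> fs xF in auto)
  ultimately show ?thesis
    using coset_module.coset_eq_zero_iff[OF coset_module_FA] by simp
qed

lemma ops_quotient_FA: "ops_quotient R P FA N"
  by (intro ops_quotient.intro ops_algebra_FA coset_module_FA ops_quotient_axioms.intro)
    (simp add: formal_oper_null)

lemma ops_algebra_S: "ops_algebra R P S"
  using ops_quotient.ops_algebra_quot[OF ops_quotient_FA] by (simp add: free_alg_def)

lemma oper_tensor: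
  assumes "\<mu> \<in> carrier (ops P (length ss))" "set ss \<subseteq> symbols P V"
  shows "oper S \<mu> (map tensor ss) = tensor (graft P \<mu> ss)"
proof -
  have "set (map (single R) ss) \<subseteq> carrier FA" using assms(2) Fr.single_closed by auto
  from ops_quotient.oper_quot[OF ops_quotient_FA _ this, of \<mu>]
  show ?thesis using assms by (simp add: free_alg_def tensor_def[abs_def] comp_def formal_oper_single)
qed

end

context operad
begin

lemma comp_closed:
  "\<mu> \<in> carrier (ops P (length \<nu>s)) \<Longrightarrow> \<nu>s \<in> ops_list P \<Longrightarrow>
    opcomp P \<mu> \<nu>s \<in> carrier (ops P (arity_sum \<nu>s))"
  using linear_map_closed[OF comp_linear_left] .

lemma act_closed:
  "\<mu> \<in> carrier (ops P n) \<Longrightarrow> \<sigma> permutes {..<n} \<Longrightarrow> opact P n \<mu> \<sigma> \<in> carrier (ops P n)"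
  using linear_map_closed[OF act_linear] .

end

context free_operad_algebra
begin

text \<open>Here the predicate of \<open>multilinear_induct\<close> is not an equation; its slot
  sections are submodules by \<open>submodule_linear_in_parameter\<close>. On tensors, linearity
  comes from that of operad composition in its outer operation.\<close>

lemma oper_S_linear_left:
  assumes "set as \<subseteq> carrier S"
  shows "linear_map R (ops P (length as)) S (\<lambda>\<mu>. oper S \<mu> as)"
proof -
  interpret S: ops_algebra R P S by (rule ops_algebra_S)
  define n where "n = length as"
  have "linear_map R (ops P n) S (\<lambda>\<mu>. oper S \<mu> as)"
  proof (rule multilinear_induct[OF spans_S, where n = n])
    fix as bs assume as: "set as \<subseteq> carrier S" "set bs \<subseteq> carrier S" "Suc (length as + length bs) = n"
    show "submodule {x \<in> carrier S. linear_map R (ops P n) S (\<lambda>\<mu>. oper S \<mu> (as @ x # bs))} R S"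
      by (rule submodule_linear_in_parameter[OF module_ops module_S module_S])
        (rule multilinearD[OF S.oper_multilinear as])
  next
    fix gs assume "set gs \<subseteq> tensor ` symbols P V" "length gs = n"
    then obtain ss where ss: "gs = map tensor ss" "set ss \<subseteq> symbols P V" "length ss = n"
      by (metis length_map set_subset_imageE)
    have vs: "set (concat (map snd ss)) \<subseteq> carrier V" using ss(2) by (fastforce simp: symbols_def)
    have "linear_map R (ops P n) (ops P (length (concat (map snd ss)))) (\<lambda>\<mu>. opcomp P \<mu> (sym_arities ss))"
      using comp_linear_left[OF symbols_ops_list[OF ss(2)]] ss(3) unfolding arity_sum_symbols by simp
    from linear_map_cong[OF module_ops linear_map_compose[OF this tensor_linear_op[OF vs]]]
    show "linear_map R (ops P n) S (\<lambda>\<mu>. oper S \<mu> gs)"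
      using ss by (simp add: oper_tensor graft_def)
  qed (use assms n_def in auto)
  then show ?thesis by (simp add: n_def)
qed

text \<open>This is \<open>comp_assoc\<close>, together with the fact that concatenating the vectors
  in two stages or at once gives the same list.\<close>

lemma graft_assoc:
  assumes \<mu>: "\<mu> \<in> carrier (ops P (length \<nu>s))" and \<nu>s: "\<nu>s \<in> ops_list P"
    and len: "map length sss = map fst \<nu>s" and sss: "\<forall>ss\<in>set sss. set ss \<subseteq> symbols P V"
  shows "graft P (opcomp P \<mu> \<nu>s) (concat sss) = graft P \<mu> (map2 (\<lambda>(k, \<nu>) ss. graft P \<nu> ss) \<nu>s sss)"
proof -
  have l: "length \<nu>s = length sss" using len by (metis length_map)
  have "opcomp P (opcomp P \<mu> \<nu>s) (concat (map sym_arities sss)) =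
    opcomp P \<mu> (map2 (\<lambda>(k, \<nu>) \<xi>s. (arity_sum \<xi>s, opcomp P \<nu> \<xi>s)) \<nu>s (map sym_arities sss))"
    using \<mu> \<nu>s len sss symbols_ops_list by (intro comp_assoc) (auto simp: comp_def)
  moreover have "map2 (\<lambda>(k, \<nu>) \<xi>s. (arity_sum \<xi>s, opcomp P \<nu> \<xi>s)) \<nu>s (map sym_arities sss) =
    sym_arities (map2 (\<lambda>(k, \<nu>) ss. graft P \<nu> ss) \<nu>s sss)"
    using l by (induction \<nu>s sss rule: list_induct2) (auto simp: graft_def arity_sum_symbols)
  moreover have "concat (map snd (concat sss)) =
    concat (map snd (map2 (\<lambda>(k, \<nu>) ss. graft P \<nu> ss) \<nu>s sss))"
    using l by (induction \<nu>s sss rule: list_induct2) (auto simp: graft_def)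
  ultimately show ?thesis by (simp add: graft_def map_concat)
qed

text \<open>Both sides of the three equational axioms are multilinear, so tensors of symbols suffice
  as arguments. There the unit, composition and symmetry axioms become
  \<open>comp_unit_left\<close>, \<open>comp_assoc\<close> and \<open>comp_act_left\<close>, the
  last up to the permutation relation among tensors.\<close>

lemma operad_algebra_S: "operad_algebra R P S"
proof (intro operad_algebra.intro operad_algebra_axioms.intro)
  interpret S: ops_algebra R P S by (rule ops_algebra_S)
  show "operad R P" by (rule operad_axioms)
  show "module R S" by (rule module_S)
  show "linear_map R (ops P (length as)) S (\<lambda>\<mu>. oper S \<mu> as)" if "set as \<subseteq> carrier S" for as
    using that by (rule oper_S_linear_left)
  show "linear_map R S S (\<lambda>a. oper S \<mu> (as @ a # bs))"
    if "\<mu> \<in> carrier (ops P (Suc (length as + length bs)))" "set as \<subseteq> carrier S" "set bs \<subseteq> carrier S"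
    for \<mu> as bs
    by (rule multilinearD[OF S.oper_multilinear[OF that(1)] that(2,3)]) simp
  show "oper S (opunit P) [a] = a" if "a \<in> carrier S" for a
  proof (rule linear_map_eq_on_span[OF module_S module_S spans_S _ linear_map_id _ that])
    show "linear_map R S S (\<lambda>a. oper S (opunit P) [a])"
      using multilinearD[OF S.oper_multilinear[OF unit_closed], of "[]" "[]"] by simp
    fix x assume "x \<in> tensor ` symbols P V"
    then obtain s where s: "x = tensor s" "s \<in> symbols P V" by auto
    have "graft P (opunit P) [s] = s"
      using s(2) comp_unit_left[of "fst s"] by (auto simp: graft_def symbol_iff split: prod.split)
    then show "oper S (opunit P) [x] = x"
      using oper_tensor[of "opunit P" "[s]"] s unit_closed by simp
  qed
  show "oper S (opcomp P \<mu> \<nu>s) (concat ass) = oper S \<mu> (map2 (\<lambda>(k, \<nu>) as. oper S \<nu> as) \<nu>s ass)"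
    if \<mu>: "\<mu> \<in> carrier (ops P (length \<nu>s))" and \<nu>s: "\<nu>s \<in> ops_list P"
      and len: "map length ass = map fst \<nu>s" and ass: "\<forall>as\<in>set ass. set as \<subseteq> carrier S"
    for \<mu> \<nu>s ass
  proof (rule nested_multilinear_eqI[OF module_S module_S spans_S _ _ _ ass len,
        where \<phi> = "\<lambda>ass. oper S (opcomp P \<mu> \<nu>s) (concat ass)"
          and \<psi> = "\<lambda>ass. oper S \<mu> (map2 (\<lambda>(k, \<nu>) as. oper S \<nu> as) \<nu>s ass)"])
    fix ass bss k
    assume ks: "map length ass @ k # map length bss = map fst \<nu>s"
      and cl: "\<forall>as\<in>set ass \<union> set bss. set as \<subseteq> carrier S"
    have "arity_sum \<nu>s = length (concat ass) + k + length (concat bss)"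
      by (simp add: arity_sum_def ks[symmetric] length_concat)
    then have "multilinear R (length (concat ass) + k + length (concat bss)) S S (oper S (opcomp P \<mu> \<nu>s))"
      using S.oper_multilinear[OF comp_closed[OF \<mu> \<nu>s]] by simp
    from multilinear_append[OF this]
    show "multilinear R k S S (\<lambda>as. oper S (opcomp P \<mu> \<nu>s) (concat (ass @ as # bss)))"
      using cl by auto
    \<comment> \<open>To vary one inner list, the list of operations is split at the same place: the
      operation \<open>\<nu>\<close> found there is multilinear on that list, and
      \<open>\<mu>\<close> is linear in the result.\<close>
    obtain \<nu>s1 \<nu> \<nu>s2 where n: "\<nu>s = \<nu>s1 @ (k, \<nu>) # \<nu>s2" "map length ass = map fst \<nu>s1"
      "map length bss = map fst \<nu>s2"
    proof -
      from ks[symmetric] obtain us x vs where "\<nu>s = us @ x # vs" "map fst us = map length ass"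
        "fst x = k" "map fst vs = map length bss"
        by (auto simp: map_eq_append_conv map_eq_Cons_conv)
      then show ?thesis using that[of us "snd x" vs] by (cases x) simp
    qed
    have l: "length ass = length \<nu>s1" "length bss = length \<nu>s2" using n by (metis length_map)+
    have closed: "set (map2 (\<lambda>(k, \<nu>) as. oper S \<nu> as) \<nu>s' ass') \<subseteq> carrier S"
      if "map length ass' = map fst \<nu>s'" "\<nu>s' \<in> ops_list P" "\<forall>as\<in>set ass'. set as \<subseteq> carrier S"
      for \<nu>s' ass'
    proof -
      have "length \<nu>s' = length ass'" using that(1) by (metis length_map)
      then show ?thesis using that
        by (induction \<nu>s' ass' rule: list_induct2) (auto simp: ops_list_def intro!: S.oper_closed)
    qed
    have in_ops: "\<nu>s1 \<in> ops_list P" "\<nu>s2 \<in> ops_list P" "\<nu> \<in> carrier (ops P k)"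
      using \<nu>s n by (auto simp: ops_list_def)
    have "linear_map R S S (\<lambda>x. oper S \<mu> (map2 (\<lambda>(k, \<nu>) as. oper S \<nu> as) \<nu>s1 ass @ x #
        map2 (\<lambda>(k, \<nu>) as. oper S \<nu> as) \<nu>s2 bss))"
      by (rule multilinearD[OF S.oper_multilinear[OF \<mu>]])
        (use n l in_ops cl closed[of ass \<nu>s1] closed[of bss \<nu>s2] in auto)
    from multilinear_compose[OF S.oper_multilinear[OF in_ops(3)] this]
    show "multilinear R k S S (\<lambda>as. oper S \<mu> (map2 (\<lambda>(k, \<nu>) as. oper S \<nu> as) \<nu>s (ass @ as # bss)))"
      using n(1) l by simp
  next
    fix gss assume gss: "\<forall>gs\<in>set gss. set gs \<subseteq> tensor ` symbols P V" "map length gss = map fst \<nu>s"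
    obtain sss where sss: "gss = map (map tensor) sss" "\<forall>ss\<in>set sss. set ss \<subseteq> symbols P V"
      using gss(1) by (rule nested_set_subset_imageE)
    have len: "map length sss = map fst \<nu>s" using gss(2) sss(1) by (simp add: comp_def)
    then have l: "length \<nu>s = length sss" by (metis length_map)
    have "length (concat sss) = arity_sum \<nu>s" by (simp add: length_concat len arity_sum_def)
    then have "oper S (opcomp P \<mu> \<nu>s) (concat gss) = tensor (graft P (opcomp P \<mu> \<nu>s) (concat sss))"
      using oper_tensor[of "opcomp P \<mu> \<nu>s" "concat sss"] sss comp_closed[OF \<mu> \<nu>s]
      by (auto simp: map_concat)
    also have "\<dots> = tensor (graft P \<mu> (map2 (\<lambda>(k, \<nu>) ss. graft P \<nu> ss) \<nu>s sss))"
      by (simp only: graft_assoc[OF \<mu> \<nu>s len sss(2)])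
    also have "\<dots> = oper S \<mu> (map tensor (map2 (\<lambda>(k, \<nu>) ss. graft P \<nu> ss) \<nu>s sss))"
    proof (rule oper_tensor[symmetric])
      show "set (map2 (\<lambda>(k, \<nu>) ss. graft P \<nu> ss) \<nu>s sss) \<subseteq> symbols P V"
        using l len \<nu>s sss(2)
        by (induction \<nu>s sss rule: list_induct2) (auto simp: ops_list_def intro!: graft_closed)
    qed (use \<mu> l in simp)
    also have "map tensor (map2 (\<lambda>(k, \<nu>) ss. graft P \<nu> ss) \<nu>s sss) =
      map2 (\<lambda>(k, \<nu>) as. oper S \<nu> as) \<nu>s gss"
      using l len \<nu>s sss(2) unfolding sss(1)
      by (induction \<nu>s sss rule: list_induct2) (auto simp: ops_list_def oper_tensor)
    finally show "oper S (opcomp P \<mu> \<nu>s) (concat gss) =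
      oper S \<mu> (map2 (\<lambda>(k, \<nu>) as. oper S \<nu> as) \<nu>s gss)" .
  qed
  show "oper S (opact P (length as) \<mu> \<sigma>) (permute_list \<sigma> as) = oper S \<mu> as"
    if \<mu>: "\<mu> \<in> carrier (ops P (length as))" and as: "set as \<subseteq> carrier S"
      and \<sigma>: "\<sigma> permutes {..<length as}"
    for \<mu> as \<sigma>
  proof (rule multilinear_eqI[OF module_S module_S spans_S, where n = "length as"
        and \<phi> = "\<lambda>xs. oper S (opact P (length as) \<mu> \<sigma>) (permute_list \<sigma> xs)" and \<psi> = "oper S \<mu>"])
    show "multilinear R (length as) S S (\<lambda>xs. oper S (opact P (length as) \<mu> \<sigma>) (permute_list \<sigma> xs))"
      by (rule multilinear_permute[OF module_S S.oper_multilinear[OF act_closed[OF \<mu> \<sigma>]] \<sigma>])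
    show "multilinear R (length as) S S (oper S \<mu>)" by (rule S.oper_multilinear[OF \<mu>])
    fix gs assume gs: "set gs \<subseteq> tensor ` symbols P V" "length gs = length as"
    obtain ss where ss: "gs = map tensor ss" "set ss \<subseteq> symbols P V"
      using gs(1) by (rule set_subset_imageE)
    have len: "length ss = length as" using gs ss by simp
    have \<sigma>': "\<sigma> permutes {..<length ss}" "\<sigma> permutes {..<length (map snd ss)}"
      "\<sigma> permutes {..<length (sym_arities ss)}"
      using \<sigma> len by simp_all
    have fst: "map fst (sym_arities ss) = map length (map snd ss)" by (induction ss) auto
    have pss: "set (permute_list \<sigma> ss) \<subseteq> symbols P V" using ss(2) \<sigma>' by simp
    have "oper S (opact P (length as) \<mu> \<sigma>) (permute_list \<sigma> gs) =
      tensor (graft P (opact P (length as) \<mu> \<sigma>) (permute_list \<sigma> ss))"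
      using oper_tensor[of "opact P (length as) \<mu> \<sigma>" "permute_list \<sigma> ss"] pss act_closed[OF \<mu> \<sigma>] len \<sigma>'
      by (simp add: ss(1) permute_list_map)
    \<comment> \<open>\<open>comp_act_left\<close> turns the permutation of the symbols into the
      block permutation of their concatenated vectors, which \<open>tensor_act\<close> removes in
      the next step.\<close>
    also have "graft P (opact P (length as) \<mu> \<sigma>) (permute_list \<sigma> ss) =
      (opact P (length (concat (map snd ss))) (opcomp P \<mu> (sym_arities ss))
          (block_perm \<sigma> (map length (map snd ss))),
        permute_list (block_perm \<sigma> (map length (map snd ss))) (concat (map snd ss)))"
      using comp_act_left[of \<mu> "sym_arities ss" \<sigma>] \<mu> len symbols_ops_list[OF ss(2)] \<sigma>'
      unfolding permute_list_block_perm[OF \<sigma>'(2)] arity_sum_symbols fst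
      by (simp add: graft_def permute_list_map)
    also have "tensor \<dots> = tensor (opcomp P \<mu> (sym_arities ss), concat (map snd ss))"
    proof (rule tensor_act)
      show "(opcomp P \<mu> (sym_arities ss), concat (map snd ss)) \<in> symbols P V"
        using graft_closed[of \<mu> ss] \<mu> ss(2) len by (simp add: graft_def)
      show "block_perm \<sigma> (map length (map snd ss)) permutes {..<length (concat (map snd ss))}"
        using block_perm_permutes[of \<sigma> "map length (map snd ss)"] \<sigma>' by (simp add: length_concat)
    qed
    also have "\<dots> = oper S \<mu> gs"
      using oper_tensor[of \<mu> ss] \<mu> ss len by (simp add: graft_def)
    finally show "oper S (opact P (length as) \<mu> \<sigma>) (permute_list \<sigma> gs) = oper S \<mu> gs" .
  qed (use as in auto)
qed

section \<open>Universal property of the free algebra\<close>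

lemma free_gen_eq: "free_gen R P V v = tensor (opunit P, [v])"
  by (simp add: free_gen_def tensor_def)

lemma free_gen_linear: "linear_map R V S (free_gen R P V)"
  using tensor_linear_vec[of "opunit P" "[]" "[]"] unit_closed
  by (simp add: free_gen_eq[abs_def])

text \<open>Units inserted into \<open>\<mu>\<close> are neutral, so substituting the generators
  returns the symbol. Uniqueness of morphisms out of the free algebra follows from this.\<close>

lemma tensor_eq_oper:
  assumes "(\<mu>, vs) \<in> symbols P V"
  shows "tensor (\<mu>, vs) = oper S \<mu> (map (free_gen R P V) vs)"
proof -
  have "graft P \<mu> (map (\<lambda>v. (opunit P, [v])) vs) = (\<mu>, vs)"
    using assms comp_unit_right[of \<mu> "length vs"]
    by (simp add: graft_def comp_def symbol_iff map_replicate_const)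
  moreover have "set (map (\<lambda>v. (opunit P, [v])) vs) \<subseteq> symbols P V"
    using assms unit_closed by (auto simp: symbol_iff)
  ultimately show ?thesis
    using oper_tensor[of \<mu> "map (\<lambda>v. (opunit P, [v])) vs"] assms
    by (simp add: free_gen_eq[abs_def] comp_def symbol_iff)
qed

text \<open>The value on a symbol is forced: the operation applied to the images of the vectors.
  Multilinearity and symmetry in \<open>B\<close> let it descend through
  \<open>linear_kills_null\<close>, and \<open>oper_comp\<close> in \<open>B\<close> makes it a
  morphism.\<close>

lemma free_alg_hom_exists:
  assumes "operad_algebra R P B" "linear_map R V B f"
  obtains g where "g \<in> alg_hom R P S B" "\<And>v. v \<in> carrier V \<Longrightarrow> g (free_gen R P V v) = f v"
proof -
  interpret B: operad_algebra R P B by fact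
  interpret S: operad_algebra R P S by (rule operad_algebra_S)
  have f_closed: "set (map f vs) \<subseteq> carrier B" if "set vs \<subseteq> carrier V" for vs
    using that linear_map_closed[OF assms(2)] by auto
  define h where "h s = oper B (fst s) (map f (snd s))" for s
  have h: "h s \<in> carrier B" if "s \<in> symbols P V" for s
    using that f_closed[of "snd s"] B.alg_closed[of "fst s" "map f (snd s)"]
    by (cases s) (simp add: h_def symbol_iff)
  have "\<exists>\<phi>. linear_map R F B \<phi> \<and> (\<forall>s\<in>symbols P V. \<phi> (single R s) = h s)"
  proof (rule Fr.free_extension[OF B.module_alg h])
    fix \<phi> assume "linear_map R F B \<phi>" "\<And>s. s \<in> symbols P V \<Longrightarrow> \<phi> (single R s) = h s"
    then show ?thesis by (intro exI[of _ \<phi>]) simp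
  qed
  then obtain \<phi> where "linear_map R F B \<phi>" "\<forall>s\<in>symbols P V. \<phi> (single R s) = h s" by metis
  then have \<phi>: "linear_map R F B \<phi>"
    "(\<mu>, vs) \<in> symbols P V \<Longrightarrow> \<phi> (single R (\<mu>, vs)) = oper B \<mu> (map f vs)" for \<mu> vs
    by (simp_all add: h_def)
  have kills: "\<phi> x = \<zero>\<^bsub>B\<^esub>" if "x \<in> N" for x
  proof (rule linear_kills_null[OF B.module_alg \<phi>(1) _ _ _ that])
    fix vs assume vs: "set vs \<subseteq> carrier V"
    show "linear_map R (ops P (length vs)) B (\<lambda>\<mu>. \<phi> (single R (\<mu>, vs)))"
      using linear_map_cong[OF module_ops B.oper_linear_left[OF f_closed[OF vs]]] vs
      by (simp add: \<phi>(2) symbol_iff)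
  next
    fix \<mu> vs ws assume *: "\<mu> \<in> carrier (ops P (Suc (length vs + length ws)))"
      "set vs \<subseteq> carrier V" "set ws \<subseteq> carrier V"
    have "linear_map R B B (\<lambda>x. oper B \<mu> (map f vs @ x # map f ws))"
      by (rule B.oper_linear_right) (use * f_closed in auto)
    from linear_map_cong[OF module_V linear_map_compose[OF assms(2) this]]
    show "linear_map R V B (\<lambda>x. \<phi> (single R (\<mu>, vs @ x # ws)))"
      using * by (simp add: \<phi>(2) symbol_iff)
  next
    fix \<mu> \<sigma> vs assume *: "\<mu> \<in> carrier (ops P (length vs))" "set vs \<subseteq> carrier V"
      "\<sigma> permutes {..<length vs}"
    show "\<phi> (single R (opact P (length vs) \<mu> \<sigma>, permute_list \<sigma> vs)) = \<phi> (single R (\<mu>, vs))"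
      using B.oper_act[of \<mu> "map f vs" \<sigma>] * f_closed act_closed[OF *(1,3)]
      by (simp add: \<phi>(2) symbol_iff permute_list_map)
  qed
  have "linear_map R FA B \<phi>" using \<phi>(1) by simp
  have "\<exists>g. g \<in> carrier S \<rightarrow>\<^sub>E carrier B \<and> linear_map R S B g \<and>
    (\<forall>x\<in>carrier F. g (N +>\<^bsub>FA\<^esub> x) = \<phi> x)"
  proof (rule coset_module.quot_lift[OF coset_module_FA B.module_alg \<open>linear_map R FA B \<phi>\<close> kills])
    fix g assume "g \<in> carrier (quot_alg FA N) \<rightarrow>\<^sub>E carrier B" "linear_map R (quot_alg FA N) B g"
      "\<And>x. x \<in> carrier FA \<Longrightarrow> g (N +>\<^bsub>FA\<^esub> x) = \<phi> x"
    then show ?thesis by (intro exI[of _ g]) (simp add: free_alg_def)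
  qed
  then obtain g where g: "g \<in> carrier S \<rightarrow>\<^sub>E carrier B" "linear_map R S B g"
    "\<And>x. x \<in> carrier F \<Longrightarrow> g (N +>\<^bsub>FA\<^esub> x) = \<phi> x"
    by metis
  have g_tensor: "g (tensor (\<mu>, vs)) = oper B \<mu> (map f vs)" if "(\<mu>, vs) \<in> symbols P V" for \<mu> vs
    using g(3)[OF Fr.single_closed[OF that]] \<phi>(2)[OF that] by (simp add: tensor_def)
  have "g (oper S \<mu> as) = oper B \<mu> (map g as)"
    if \<mu>: "\<mu> \<in> carrier (ops P (length as))" and as: "set as \<subseteq> carrier S" for \<mu> as
  proof (rule multilinear_eqI[OF module_S B.module_alg spans_S, where n = "length as"
        and \<phi> = "\<lambda>as. g (oper S \<mu> as)" and \<psi> = "\<lambda>as. oper B \<mu> (map g as)"])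
    show "multilinear R (length as) S B (\<lambda>as. g (oper S \<mu> as))"
      by (rule multilinear_compose[OF S.alg_multilinear[OF \<mu>] g(2)])
    show "multilinear R (length as) S B (\<lambda>as. oper B \<mu> (map g as))"
      by (rule multilinear_map[OF g(2) B.alg_multilinear[OF \<mu>]])
    fix gs assume gs: "set gs \<subseteq> tensor ` symbols P V" "length gs = length as"
    obtain ss where ss: "gs = map tensor ss" "set ss \<subseteq> symbols P V"
      using gs(1) by (rule set_subset_imageE)
    have \<mu>': "\<mu> \<in> carrier (ops P (length ss))" using \<mu> gs(2) ss(1) by simp
    have "g (oper S \<mu> gs) = g (tensor (graft P \<mu> ss))"
      using oper_tensor[OF \<mu>' ss(2)] by (simp add: ss(1))
    also have "\<dots> = oper B (opcomp P \<mu> (sym_arities ss)) (concat (map (map f \<circ> snd) ss))"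
      using g_tensor[of "opcomp P \<mu> (sym_arities ss)" "concat (map snd ss)"] graft_closed[OF \<mu>' ss(2)]
      by (simp add: graft_def map_concat)
    also have "\<dots> = oper B \<mu> (map2 (\<lambda>(k, \<nu>) as. oper B \<nu> as) (sym_arities ss) (map (map f \<circ> snd) ss))"
    proof (rule B.oper_comp)
      show "\<forall>as\<in>set (map (map f \<circ> snd) ss). set as \<subseteq> carrier B"
        using ss(2) f_closed by (fastforce simp: symbols_def)
    qed (use \<mu>' symbols_ops_list[OF ss(2)] in \<open>auto simp: comp_def case_prod_beta\<close>)
    also have "map2 (\<lambda>(k, \<nu>) as. oper B \<nu> as) (sym_arities ss) (map (map f \<circ> snd) ss) = map g gs"
      unfolding ss(1) using ss(2) by (induction ss) (auto simp: g_tensor)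
    finally show "g (oper S \<mu> gs) = oper B \<mu> (map g gs)" .
  qed (use as in auto)
  then have "g \<in> alg_hom R P S B" using g(1,2) by (simp add: alg_hom_def)
  moreover have "g (free_gen R P V v) = f v" if "v \<in> carrier V" for v
    using g_tensor[of "opunit P" "[v]"] unit_closed that B.oper_unit linear_map_closed[OF assms(2)]
    by (simp add: free_gen_eq symbol_iff)
  ultimately show ?thesis using that by blast
qed

lemma free_alg_hom_eq:
  assumes "module R B" "g \<in> alg_hom R P S B" "h \<in> alg_hom R P S B"
    "\<And>v. v \<in> carrier V \<Longrightarrow> g (free_gen R P V v) = h (free_gen R P V v)"
  shows "g = h"
proof (rule alg_hom_eqI[OF assms(2,3)])
  fix x assume x: "x \<in> carrier S"
  show "g x = h x"
  proof (rule linear_map_eq_on_span[OF module_S assms(1) spans_S _ _ _ x])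
    fix y assume "y \<in> tensor ` symbols P V"
    then obtain \<mu> vs where y: "y = tensor (\<mu>, vs)" "(\<mu>, vs) \<in> symbols P V" by auto
    have cl: "set (map (free_gen R P V) vs) \<subseteq> carrier S"
      using y(2) linear_map_closed[OF free_gen_linear] by (auto simp: symbol_iff)
    have \<mu>: "\<mu> \<in> carrier (ops P (length (map (free_gen R P V) vs)))"
      using y(2) by (simp add: symbol_iff)
    have "map g (map (free_gen R P V) vs) = map h (map (free_gen R P V) vs)"
      using y(2) assms(4) by (auto simp: symbol_iff)
    then show "g y = h y"
      unfolding y(1) tensor_eq_oper[OF y(2)] alg_hom_oper[OF assms(2) \<mu> cl]
        alg_hom_oper[OF assms(3) \<mu> cl] by (simp only:)
  qed (simp_all add: alg_hom_linear[OF assms(2)] alg_hom_linear[OF assms(3)])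
qed

end

section \<open>Presented algebras\<close>

text \<open>Morphisms without the extensionality built into \<open>alg_hom\<close>. Plain composites
  of functions stay inside this notion, and \<open>restrict\<close> leads back to
  \<open>alg_hom\<close> where equality of morphisms matters.\<close>

definition algebra_map ::
  "('r, 'z) ring_scheme \<Rightarrow> ('r, 'p) operad \<Rightarrow> ('r, 'p, 'a) opalg \<Rightarrow> ('r, 'p, 'b) opalg \<Rightarrow>
    ('a \<Rightarrow> 'b) \<Rightarrow> bool"
  where "algebra_map R P A B f \<longleftrightarrow> linear_map R A B f \<and>
    (\<forall>as. \<forall>\<mu>\<in>carrier (ops P (length as)). set as \<subseteq> carrier A \<longrightarrow>
      f (oper A \<mu> as) = oper B \<mu> (map f as))"

lemma algebra_mapI:
  assumes "linear_map R A B f"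
    "\<And>\<mu> as. \<mu> \<in> carrier (ops P (length as)) \<Longrightarrow> set as \<subseteq> carrier A \<Longrightarrow>
      f (oper A \<mu> as) = oper B \<mu> (map f as)"
  shows "algebra_map R P A B f"
  using assms by (simp add: algebra_map_def)

lemma algebra_map_linear: "algebra_map R P A B f \<Longrightarrow> linear_map R A B f"
  by (simp add: algebra_map_def)

lemma algebra_map_closed: "algebra_map R P A B f \<Longrightarrow> x \<in> carrier A \<Longrightarrow> f x \<in> carrier B"
  by (rule linear_map_closed[OF algebra_map_linear])

lemma algebra_map_oper:
  "algebra_map R P A B f \<Longrightarrow> \<mu> \<in> carrier (ops P (length as)) \<Longrightarrow> set as \<subseteq> carrier A \<Longrightarrow>
    f (oper A \<mu> as) = oper B \<mu> (map f as)"
  by (simp add: algebra_map_def)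

lemma alg_hom_iff:
  "f \<in> alg_hom R P A B \<longleftrightarrow> f \<in> carrier A \<rightarrow>\<^sub>E carrier B \<and> algebra_map R P A B f"
  by (auto simp: alg_hom_def algebra_map_def)

lemma alg_hom_algebra_map: "f \<in> alg_hom R P A B \<Longrightarrow> algebra_map R P A B f"
  by (simp add: alg_hom_iff)

lemma algebra_map_cong:
  assumes "ops_algebra R P A" "algebra_map R P A B f" "\<And>x. x \<in> carrier A \<Longrightarrow> f x = g x"
  shows "algebra_map R P A B g"
proof -
  interpret A: ops_algebra R P A by fact
  show ?thesis
  proof (rule algebra_mapI)
    show "linear_map R A B g"
      by (rule linear_map_cong[OF A.module_axioms algebra_map_linear[OF assms(2)] assms(3)])
    fix \<mu> as assume *: "\<mu> \<in> carrier (ops P (length as))" "set as \<subseteq> carrier A"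
    have "map f as = map g as" using *(2) assms(3) by auto
    then show "g (oper A \<mu> as) = oper B \<mu> (map g as)"
      using algebra_map_oper[OF assms(2) *] assms(3)[OF A.oper_closed[OF *]] by metis
  qed
qed

lemma algebra_map_restrict:
  assumes "ops_algebra R P A" "algebra_map R P A B f"
  shows "restrict f (carrier A) \<in> alg_hom R P A B"
proof -
  have "algebra_map R P A B (restrict f (carrier A))"
    by (rule algebra_map_cong[OF assms]) simp
  then show ?thesis using algebra_map_closed[OF assms(2)] by (simp add: alg_hom_iff)
qed

lemma algebra_map_id: "algebra_map R P A A (\<lambda>x. x)"
  by (simp add: algebra_map_def linear_map_id)

lemma algebra_map_compose:
  assumes "algebra_map R P A B f" "algebra_map R P B C g"
  shows "algebra_map R P A C (\<lambda>x. g (f x))"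
proof (rule algebra_mapI)
  show "linear_map R A C (\<lambda>x. g (f x))"
    using assms by (intro linear_map_compose[OF algebra_map_linear algebra_map_linear])
  fix \<mu> as assume *: "\<mu> \<in> carrier (ops P (length as))" "set as \<subseteq> carrier A"
  have "set (map f as) \<subseteq> carrier B" using *(2) algebra_map_closed[OF assms(1)] by auto
  then show "g (f (oper A \<mu> as)) = oper C \<mu> (map (\<lambda>x. g (f x)) as)"
    using algebra_map_oper[OF assms(1) *] algebra_map_oper[OF assms(2), of \<mu> "map f as"] *(1)
    by (simp add: comp_def)
qed

lemma alg_hom_compose:
  assumes "operad_algebra R P A" "f \<in> alg_hom R P A B" "g \<in> alg_hom R P B C"
  shows "compose (carrier A) g f \<in> alg_hom R P A C"
  using algebra_map_restrict[OF operad_algebra.ops_algebra[OF assms(1)]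
      algebra_map_compose[OF alg_hom_algebra_map alg_hom_algebra_map, OF assms(2,3)]]
  by (simp add: compose_def)

lemma submodule_kernel:
  assumes "module R M" "module R N" "linear_map R M N f"
  shows "submodule {x \<in> carrier M. f x = \<zero>\<^bsub>N\<^esub>} R M"
  by (rule submodule_equalizer[OF assms linear_map_zero_fun[OF assms(2)]])

text \<open>A zero in one slot makes a multilinear operation vanish, so kernels absorb
  operations.\<close>

lemma alg_ideal_kernel:
  assumes "ops_algebra R P A" "ops_algebra R P B" "algebra_map R P A B f"
  shows "alg_ideal R P A {x \<in> carrier A. f x = \<zero>\<^bsub>B\<^esub>}"
  unfolding alg_ideal_def
proof (intro conjI allI ballI impI)
  interpret A: ops_algebra R P A by fact
  interpret B: ops_algebra R P B by fact
  note lin = algebra_map_linear[OF assms(3)]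
  show "submodule {x \<in> carrier A. f x = \<zero>\<^bsub>B\<^esub>} R A"
    by (rule submodule_kernel[OF A.module_axioms B.module_axioms lin])
  fix as bs x \<mu>
  assume *: "x \<in> {x \<in> carrier A. f x = \<zero>\<^bsub>B\<^esub>}" "\<mu> \<in> carrier (ops P (Suc (length as + length bs)))"
    "set as \<subseteq> carrier A" "set bs \<subseteq> carrier A"
  have "linear_map R B B (\<lambda>y. oper B \<mu> (map f as @ y # map f bs))"
    by (rule multilinearD[OF B.oper_multilinear[OF *(2)]]) (use * linear_map_closed[OF lin] in auto)
  from linear_map_zero[OF B.module_axioms B.module_axioms this]
  have "f (oper A \<mu> (as @ x # bs)) = \<zero>\<^bsub>B\<^esub>"
    using algebra_map_oper[OF assms(3), of \<mu> "as @ x # bs"] * by simp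
  then show "oper A \<mu> (as @ x # bs) \<in> {x \<in> carrier A. f x = \<zero>\<^bsub>B\<^esub>}"
    using A.oper_closed[of \<mu> "as @ x # bs"] * by simp
qed

lemma alg_ideal_carrier:
  assumes "ops_algebra R P A"
  shows "alg_ideal R P A (carrier A)"
proof -
  interpret A: ops_algebra R P A by fact
  show ?thesis using A.carrier_is_submodule by (simp add: alg_ideal_def A.oper_closed)
qed

lemma alg_ideal_hull:
  assumes "ops_algebra R P A" "X \<subseteq> carrier A"
  shows "alg_ideal R P A (alg_ideal R P A hull X)"
  unfolding hull_def
proof -
  interpret A: ops_algebra R P A by fact
  let ?H = "{I. alg_ideal R P A I \<and> X \<subseteq> I}"
  have ne: "?H \<noteq> {}" using alg_ideal_carrier[OF assms(1)] assms(2) by auto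
  have "submodule (\<Inter>?H) R A"
    by (rule submodule_Inter[OF A.module_axioms _ ne]) (simp add: alg_ideal_def)
  then show "alg_ideal R P A (\<Inter>?H)"
    by (simp add: alg_ideal_def)
qed

locale presented_operad_algebra = free_operad_algebra R P V
  for R :: "('r, 'z) ring_scheme" and P :: "('r, 'p) operad" and V :: "('r, 'v) module" +
  fixes rels :: "('r, 'p, 'v) free set"
  assumes rels: "rels \<subseteq> carrier (free_alg R P V)"
begin

abbreviation J where "J \<equiv> rel_ideal R P V rels"
abbreviation Q where "Q \<equiv> presented_alg R P V rels"
abbreviation gen where "gen \<equiv> presented_gen R P V rels"

lemma ops_quotient_S: "ops_quotient R P S J"
proof -
  have "alg_ideal R P S J"
    unfolding rel_ideal_def by (rule alg_ideal_hull[OF ops_algebra_S rels])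
  then show ?thesis
    by (intro ops_quotient.intro ops_algebra_S coset_module.intro module_S
        coset_module_axioms.intro ops_quotient_axioms.intro) (simp_all add: alg_ideal_def)
qed

lemma coset_module_S: "coset_module R S J"
  using ops_quotient_S by (rule ops_quotient.axioms)

lemma operad_algebra_Q: "operad_algebra R P Q"
  unfolding presented_alg_def
  by (rule ops_quotient.operad_algebra_quot[OF ops_quotient_S operad_algebra_S])

lemma algebra_map_Q: "algebra_map R P S Q (\<lambda>x. J +>\<^bsub>S\<^esub> x)"
  unfolding presented_alg_def
  by (rule algebra_mapI)
    (simp_all add: coset_module.linear_coset[OF coset_module_S] ops_quotient.oper_quot[OF ops_quotient_S])

lemma gen_linear: "linear_map R V Q gen"
  using linear_map_compose[OF free_gen_linear algebra_map_linear[OF algebra_map_Q]]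
  by (simp add: presented_gen_def[abs_def])

lemma rel_zero: "x \<in> rels \<Longrightarrow> J +>\<^bsub>S\<^esub> x = \<zero>\<^bsub>Q\<^esub>"
  unfolding presented_alg_def
  using coset_module.coset_eq_zero_iff[OF coset_module_S, of x] rels hull_inc[of x rels]
  by (auto simp: rel_ideal_def)

text \<open>The kernel of the extension to the free algebra is an ideal, so it contains
  \<open>J\<close> as soon as it contains the relations. Hypothesis \<open>rel\<close> quantifies
  over all extensions \<open>g\<close> because the actual one is only obtained inside the proof; the
  relations have to be evaluated from the values on generators.\<close>

lemma presented_hom_exists:
  assumes B: "operad_algebra R P B" and f: "linear_map R V B f"
    and rel: "\<And>g x. \<lbrakk>algebra_map R P S B g; \<And>v. v \<in> carrier V \<Longrightarrow> g (free_gen R P V v) = f v;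
      x \<in> rels\<rbrakk> \<Longrightarrow> g x = \<zero>\<^bsub>B\<^esub>"
  shows "\<exists>h\<in>alg_hom R P Q B. \<forall>v\<in>carrier V. h (gen v) = f v"
proof (rule free_alg_hom_exists[OF B f])
  interpret B: operad_algebra R P B by fact
  fix g assume g: "g \<in> alg_hom R P S B" "\<And>v. v \<in> carrier V \<Longrightarrow> g (free_gen R P V v) = f v"
  note g' = alg_hom_algebra_map[OF g(1)]
  have "J \<subseteq> {x \<in> carrier S. g x = \<zero>\<^bsub>B\<^esub>}"
    unfolding rel_ideal_def
    by (rule hull_minimal) (use rels rel[OF g' g(2)]
        alg_ideal_kernel[OF ops_algebra_S B.ops_algebra g'] in auto)
  then have kill: "g x = \<zero>\<^bsub>B\<^esub>" if "x \<in> J" for x using that by auto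
  show ?thesis
  proof (rule ops_quotient.quot_alg_hom_lift[OF ops_quotient_S B.module_alg alg_hom_linear[OF g(1)] kill])
    show "g (oper S \<mu> xs) = oper B \<mu> (map g xs)"
      if "\<mu> \<in> carrier (ops P (length xs))" "set xs \<subseteq> carrier S" for \<mu> xs
      by (rule alg_hom_oper[OF g(1) that])
    fix h assume h: "h \<in> alg_hom R P (quot_alg S J) B" "\<And>x. x \<in> carrier S \<Longrightarrow> h (J +>\<^bsub>S\<^esub> x) = g x"
    have "h (gen v) = f v" if "v \<in> carrier V" for v
      using h(2)[OF linear_map_closed[OF free_gen_linear that]] g(2)[OF that]
      by (simp add: presented_gen_def)
    then show ?thesis using h(1) by (auto simp: presented_alg_def)
  qed
qed

text \<open>Composition with the surjection from the free algebra reduces this to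
  \<open>free_alg_hom_eq\<close>.\<close>

lemma presented_hom_eq:
  assumes "module R B" "g \<in> alg_hom R P Q B" "h \<in> alg_hom R P Q B"
    "\<And>v. v \<in> carrier V \<Longrightarrow> g (gen v) = h (gen v)"
  shows "g = h"
proof (rule alg_hom_eqI[OF assms(2,3)])
  fix y assume "y \<in> carrier Q"
  then have "y \<in> (\<lambda>x. J +>\<^bsub>S\<^esub> x) ` carrier S"
    unfolding presented_alg_def coset_module.carrier_quot[OF coset_module_S] .
  then obtain x where x: "x \<in> carrier S" "y = J +>\<^bsub>S\<^esub> x" by auto
  have hom: "restrict (\<lambda>x. k (J +>\<^bsub>S\<^esub> x)) (carrier S) \<in> alg_hom R P S B"
    if "k \<in> alg_hom R P Q B" for k
    by (rule algebra_map_restrict[OF ops_algebra_S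
          algebra_map_compose[OF algebra_map_Q alg_hom_algebra_map[OF that]]])
  have "restrict (\<lambda>x. g (J +>\<^bsub>S\<^esub> x)) (carrier S) = restrict (\<lambda>x. h (J +>\<^bsub>S\<^esub> x)) (carrier S)"
    by (rule free_alg_hom_eq[OF assms(1) hom[OF assms(2)] hom[OF assms(3)]])
      (use assms(4) linear_map_closed[OF free_gen_linear] in \<open>simp add: presented_gen_def\<close>)
  from fun_cong[OF this, of x] x show "g y = h y" by simp
qed

end


section \<open>Derivations and dual numbers\<close>

lemma prod_module_simps [simp]:
  "carrier (prod_module M N) = carrier M \<times> carrier N"
  "\<zero>\<^bsub>prod_module M N\<^esub> = (\<zero>\<^bsub>M\<^esub>, \<zero>\<^bsub>N\<^esub>)"
  "x \<oplus>\<^bsub>prod_module M N\<^esub> y = (fst x \<oplus>\<^bsub>M\<^esub> fst y, snd x \<oplus>\<^bsub>N\<^esub> snd y)"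
  "r \<odot>\<^bsub>prod_module M N\<^esub> x = (r \<odot>\<^bsub>M\<^esub> fst x, r \<odot>\<^bsub>N\<^esub> snd x)"
  by (simp_all add: prod_module_def case_prod_beta)

lemma module_prod:
  assumes "module R M" "module R N"
  shows "module R (prod_module M N)"
proof (rule moduleI)
  interpret M: module R M by fact
  interpret N: module R N by fact
  show "cring R" by (rule M.R.is_cring)
  show "abelian_group (prod_module M N)"
  proof (rule abelian_groupI)
    fix x assume "x \<in> carrier (prod_module M N)"
    then show "\<exists>y\<in>carrier (prod_module M N). y \<oplus>\<^bsub>prod_module M N\<^esub> x = \<zero>\<^bsub>prod_module M N\<^esub>"
      by (intro bexI[of _ "(\<ominus>\<^bsub>M\<^esub> fst x, \<ominus>\<^bsub>N\<^esub> snd x)"]) (auto simp: M.M.l_neg N.M.l_neg)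
  qed (auto simp: M.M.a_ac N.M.a_ac)
  show "\<one>\<^bsub>R\<^esub> \<odot>\<^bsub>prod_module M N\<^esub> x = x" if "x \<in> carrier (prod_module M N)" for x
    using that by auto
qed (use assms in \<open>auto simp: module.smult_l_distr module.smult_r_distr module.smult_assoc1
    module.smult_closed\<close>)

lemma linear_map_fst: "linear_map R (prod_module M N) M fst"
  and linear_map_snd: "linear_map R (prod_module M N) N snd"
  by (auto simp: linear_map_def)

lemma linear_map_pair:
  "linear_map R K M f \<Longrightarrow> linear_map R K N g \<Longrightarrow> linear_map R K (prod_module M N) (\<lambda>x. (f x, g x))"
  by (auto simp: linear_map_def)

lemma linear_map_inl: "module R N \<Longrightarrow> linear_map R M (prod_module M N) (\<lambda>x. (x, \<zero>\<^bsub>N\<^esub>))"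
  and linear_map_inr: "module R M \<Longrightarrow> linear_map R N (prod_module M N) (\<lambda>x. (\<zero>\<^bsub>M\<^esub>, x))"
  by (rule linear_map_pair[OF linear_map_id linear_map_zero_fun], assumption)
    (rule linear_map_pair[OF linear_map_zero_fun linear_map_id])

lemma linear_map_prod:
  assumes "module R K" "linear_map R M K f" "linear_map R N K g"
  shows "linear_map R (prod_module M N) K (\<lambda>x. f (fst x) \<oplus>\<^bsub>K\<^esub> g (snd x))"
  by (intro linear_map_add_fun[OF assms(1)] linear_map_compose[OF linear_map_fst assms(2)]
      linear_map_compose[OF linear_map_snd assms(3)])

text \<open>The \<open>\<epsilon>\<close>-coefficient of \<open>\<mu>\<close> evaluated at the
  entries \<open>x + y \<epsilon>\<close>. Since the second list is independent of the first, the
  same formula serves derivations, dual numbers and, iterated, the second-order rule.\<close>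

definition leibniz ::
  "('r, 'p, 'b) opalg \<Rightarrow> 'p \<Rightarrow> 'b list \<Rightarrow> 'b list \<Rightarrow> 'b"
  where "leibniz B \<mu> xs ys = (\<Oplus>\<^bsub>B\<^esub>i\<in>{..<length xs}. oper B \<mu> (xs[i := ys ! i]))"

definition derivation_along ::
  "('r, 'z) ring_scheme \<Rightarrow> ('r, 'p) operad \<Rightarrow> ('r, 'p, 'a) opalg \<Rightarrow> ('r, 'p, 'b) opalg \<Rightarrow>
    ('a \<Rightarrow> 'b) \<Rightarrow> ('a \<Rightarrow> 'b) \<Rightarrow> bool"
  where "derivation_along R P A B f \<delta> \<longleftrightarrow> linear_map R A B \<delta> \<and>
    (\<forall>as. \<forall>\<mu>\<in>carrier (ops P (length as)). set as \<subseteq> carrier A \<longrightarrow>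
      \<delta> (oper A \<mu> as) = leibniz B \<mu> (map f as) (map \<delta> as))"

text \<open>The algebra \<open>B[\<epsilon>]\<close> with \<open>\<epsilon>\<^sup>2 = 0\<close>, where \<open>(b, c)\<close> stands for \<open>b + c\<epsilon>\<close>.\<close>

definition dual_alg :: "('r, 'p, 'b) opalg \<Rightarrow> ('r, 'p, 'b \<times> 'b) opalg"
  where "dual_alg B = module.extend (prod_module B B)
    \<lparr>oper = \<lambda>\<mu> xs. (oper B \<mu> (map fst xs), leibniz B \<mu> (map fst xs) (map snd xs))\<rparr>"

lemma dual_alg_simps [simp]:
  "carrier (dual_alg B) = carrier B \<times> carrier B"
  "\<zero>\<^bsub>dual_alg B\<^esub> = (\<zero>\<^bsub>B\<^esub>, \<zero>\<^bsub>B\<^esub>)"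
  "x \<oplus>\<^bsub>dual_alg B\<^esub> y = (fst x \<oplus>\<^bsub>B\<^esub> fst y, snd x \<oplus>\<^bsub>B\<^esub> snd y)"
  "r \<odot>\<^bsub>dual_alg B\<^esub> x = (r \<odot>\<^bsub>B\<^esub> fst x, r \<odot>\<^bsub>B\<^esub> snd x)"
  "oper (dual_alg B) \<mu> xs = (oper B \<mu> (map fst xs), leibniz B \<mu> (map fst xs) (map snd xs))"
  by (simp_all add: dual_alg_def module.extend_def prod_module_def case_prod_beta)

lemma linear_map_dual_iff:
  "linear_map R M (dual_alg B) f \<longleftrightarrow>
    linear_map R M B (\<lambda>x. fst (f x)) \<and> linear_map R M B (\<lambda>x. snd (f x))"
  by (auto simp: linear_map_def prod_eq_iff Pi_iff mem_Times_iff)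

lemma module_dual: "module R B \<Longrightarrow> module R (dual_alg B)"
  by (rule module_surj_image[OF module_prod[of R B B], where p = "\<lambda>x. x"]) auto

lemma (in abelian_monoid) finsum_lessThan_add:
  fixes m n :: nat
  assumes "h \<in> {..<m + n} \<rightarrow> carrier G"
  shows "(\<Oplus>i\<in>{..<m + n}. h i) = (\<Oplus>i\<in>{..<m}. h i) \<oplus> (\<Oplus>i\<in>{..<n}. h (m + i))"
proof -
  have "{..<m + n} = {..<m} \<union> (\<lambda>i. m + i) ` {..<n}"
  proof (intro equalityI subsetI)
    fix i assume "i \<in> {..<m + n}"
    then show "i \<in> {..<m} \<union> (\<lambda>i. m + i) ` {..<n}"
      by (cases "i < m") (auto intro!: image_eqI[of _ _ "i - m"])
  qed auto
  then have "(\<Oplus>i\<in>{..<m + n}. h i) = (\<Oplus>i\<in>{..<m}. h i) \<oplus> (\<Oplus>i\<in>(\<lambda>i. m + i) ` {..<n}. h i)"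
    using assms by (simp only:) (rule finsum_Un_disjoint; auto simp: Pi_iff)
  also have "(\<Oplus>i\<in>(\<lambda>i. m + i) ` {..<n}. h i) = (\<Oplus>i\<in>{..<n}. h (m + i))"
    by (rule finsum_reindex) (use assms in \<open>auto simp: Pi_iff\<close>)
  finally show ?thesis .
qed

lemma (in abelian_monoid) finsum_lessThan_Suc:
  fixes n :: nat
  assumes "h \<in> {..n} \<rightarrow> carrier G"
  shows "(\<Oplus>i\<in>{..<Suc n}. h i) = (\<Oplus>i\<in>{..<n}. h i) \<oplus> h n"
proof -
  have "(\<Oplus>i\<in>{..<Suc n}. h i) = h n \<oplus> (\<Oplus>i\<in>{..<n}. h i)"
    unfolding lessThan_Suc by (rule finsum_insert) (use assms in auto)
  also have "\<dots> = (\<Oplus>i\<in>{..<n}. h i) \<oplus> h n"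
    using assms by (intro a_comm finsum_closed) auto
  finally show ?thesis .
qed

lemma (in abelian_monoid) finsum_swap:
  assumes "\<And>i j. i < m \<Longrightarrow> j < n \<Longrightarrow> h i j \<in> carrier G"
  shows "(\<Oplus>i\<in>{..<m :: nat}. \<Oplus>j\<in>{..<n :: nat}. h i j) = (\<Oplus>j\<in>{..<n}. \<Oplus>i\<in>{..<m}. h i j)"
  using assms
proof (induction m)
  case 0
  then show ?case by (simp add: finsum_zero)
next
  case (Suc m)
  have "(\<Oplus>i\<in>{..<Suc m}. \<Oplus>j\<in>{..<n}. h i j) =
      (\<Oplus>i\<in>{..<m}. \<Oplus>j\<in>{..<n}. h i j) \<oplus> (\<Oplus>j\<in>{..<n}. h m j)"
    by (rule finsum_lessThan_Suc) (use Suc.prems in \<open>auto intro!: finsum_closed\<close>)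
  also have "\<dots> = (\<Oplus>j\<in>{..<n}. \<Oplus>i\<in>{..<m}. h i j) \<oplus> (\<Oplus>j\<in>{..<n}. h m j)"
    using Suc by simp
  also have "\<dots> = (\<Oplus>j\<in>{..<n}. (\<Oplus>i\<in>{..<m}. h i j) \<oplus> h m j)"
    by (rule finsum_addf[symmetric]) (use Suc.prems in \<open>auto intro!: finsum_closed\<close>)
  also have "\<dots> = (\<Oplus>j\<in>{..<n}. \<Oplus>i\<in>{..<Suc m}. h i j)"
    by (rule finsum_cong')
      (use Suc.prems in \<open>auto intro!: finsum_closed finsum_lessThan_Suc[symmetric]\<close>)
  finally show ?case .
qed

text \<open>Positions of the concatenation are grouped by the inner list they belong to, with the
  total length of the earlier lists as offset. This organises Leibniz sums of composite
  operations.\<close>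

lemma (in abelian_monoid) finsum_concat:
  assumes "h \<in> {..<length (concat xss)} \<rightarrow> carrier G"
  shows "(\<Oplus>i\<in>{..<length (concat xss)}. h i) =
    (\<Oplus>j\<in>{..<length xss}. \<Oplus>i\<in>{..<length (xss ! j)}. h (length (concat (take j xss)) + i))"
  using assms
proof (induction xss rule: rev_induct)
  case Nil
  then show ?case by simp
next
  case (snoc xs xss)
  have bound: "length (concat (take j xss)) + i < length (concat xss)"
    if "j < length xss" "i < length (xss ! j)" for i j
  proof -
    have "concat xss = concat (take j xss) @ xss ! j @ concat (drop (Suc j) xss)"
      by (subst id_take_nth_drop[OF that(1)]) simp
    then show ?thesis using that(2) by (metis add_less_cancel_left length_append trans_less_add1)
  qed
  have h: "h \<in> {..<length (concat xss)} \<rightarrow> carrier G" using snoc.prems by auto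
  have "(\<Oplus>i\<in>{..<length (concat (xss @ [xs]))}. h i) =
    (\<Oplus>i\<in>{..<length (concat xss)}. h i) \<oplus> (\<Oplus>i\<in>{..<length xs}. h (length (concat xss) + i))"
    using finsum_lessThan_add[of h "length (concat xss)" "length xs"] snoc.prems by simp
  also have "(\<Oplus>i\<in>{..<length (concat xss)}. h i) =
      (\<Oplus>j\<in>{..<length xss}. \<Oplus>i\<in>{..<length ((xss @ [xs]) ! j)}.
        h (length (concat (take j (xss @ [xs]))) + i))"
    unfolding snoc.IH[OF h]
    using h bound by (intro finsum_cong') (auto simp: nth_append intro!: finsum_closed)
  also have "\<dots> \<oplus> (\<Oplus>i\<in>{..<length xs}. h (length (concat xss) + i)) =
    (\<Oplus>j\<in>{..<Suc (length xss)}. \<Oplus>i\<in>{..<length ((xss @ [xs]) ! j)}.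
        h (length (concat (take j (xss @ [xs]))) + i))"
    by (subst finsum_lessThan_Suc)
      (use snoc.prems h bound in \<open>fastforce simp: nth_append Pi_iff le_less intro!: finsum_closed\<close>)+
  finally show ?case by simp
qed

lemma concat_update:
  assumes "j < length xss" "i < length (xss ! j)"
  shows "concat (xss[j := (xss ! j)[i := x]]) = (concat xss)[length (concat (take j xss)) + i := x]"
proof -
  have "concat xss = concat (take j xss) @ xss ! j @ concat (drop (Suc j) xss)"
    by (subst id_take_nth_drop[OF assms(1)]) simp
  moreover have "concat (xss[j := ys]) = concat (take j xss) @ ys @ concat (drop (Suc j) xss)" for ys
    using assms(1) by (simp add: upd_conv_take_nth_drop)
  ultimately show ?thesis using assms(2) by (simp add: list_update_append)
qed

lemma concat_nth_offset:
  assumes "j < length xss" "i < length (xss ! j)"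
  shows "concat xss ! (length (concat (take j xss)) + i) = xss ! j ! i"
proof -
  have "concat xss = concat (take j xss) @ xss ! j @ concat (drop (Suc j) xss)"
    by (subst id_take_nth_drop[OF assms(1)]) simp
  then show ?thesis using assms(2) by (simp add: nth_append)
qed

section \<open>The dual numbers over an algebra\<close>

context operad_algebra
begin

interpretation A: module R A by (rule module_alg)

lemma oper_update_linear:
  "\<mu> \<in> carrier (ops P (length as)) \<Longrightarrow> set as \<subseteq> carrier A \<Longrightarrow> i < length as \<Longrightarrow>
    linear_map R A A (\<lambda>x. oper A \<mu> (as[i := x]))"
  by (rule multilinear_update[OF alg_multilinear]) simp_all

lemma oper_update_closed:
  "\<mu> \<in> carrier (ops P (length as)) \<Longrightarrow> set as \<subseteq> carrier A \<Longrightarrow> i < length as \<Longrightarrow> x \<in> carrier A \<Longrightarrow>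
    oper A \<mu> (as[i := x]) \<in> carrier A"
  by (rule linear_map_closed[OF oper_update_linear])

lemma leibniz_closed:
  assumes "\<mu> \<in> carrier (ops P (length xs))" "set xs \<subseteq> carrier A" "set ys \<subseteq> carrier A"
    "length ys = length xs"
  shows "leibniz A \<mu> xs ys \<in> carrier A"
  unfolding leibniz_def
proof (rule A.M.finsum_closed)
  show "(\<lambda>i. oper A \<mu> (xs[i := ys ! i])) \<in> {..<length xs} \<rightarrow> carrier A"
  proof (rule Pi_I)
    fix i assume i: "i \<in> {..<length xs}"
    then have "ys ! i \<in> set ys" using assms(4) by simp
    then show "oper A \<mu> (xs[i := ys ! i]) \<in> carrier A"
      using oper_update_closed[OF assms(1,2)] i assms(3) by auto
  qed
qed

lemma leibniz_cong:
  assumes "\<mu> \<in> carrier (ops P (length xs))" "set xs \<subseteq> carrier A"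
    "\<And>i. i < length xs \<Longrightarrow> ys i \<in> carrier A \<and> zs i = ys i"
  shows "(\<Oplus>\<^bsub>A\<^esub>i\<in>{..<length xs}. oper A \<mu> (xs[i := zs i])) =
    (\<Oplus>\<^bsub>A\<^esub>i\<in>{..<length xs}. oper A \<mu> (xs[i := ys i]))"
  by (rule A.M.finsum_cong') (use oper_update_closed[OF assms(1,2)] assms(3) in auto)

lemma derivations_iff:
  "D \<in> derivations R P A \<longleftrightarrow>
    D \<in> carrier A \<rightarrow>\<^sub>E carrier A \<and> derivation_along R P A A (\<lambda>x. x) D"
proof -
  have "leibniz A \<mu> as (map D as) = (\<Oplus>\<^bsub>A\<^esub>i\<in>{..<length as}. oper A \<mu> (as[i := D (as ! i)]))"
    if "D \<in> carrier A \<rightarrow>\<^sub>E carrier A" "\<mu> \<in> carrier (ops P (length as))" "set as \<subseteq> carrier A" for \<mu> as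
    unfolding leibniz_def by (rule leibniz_cong) (use that nth_mem[of _ as] in \<open>auto simp: PiE_iff subset_iff\<close>)
  then show ?thesis
    unfolding derivations_def derivation_along_def by auto
qed

text \<open>Varying entry \<open>k\<close> affects the summand \<open>i = k\<close> of the Leibniz
  sum through the second component and every other summand through the first; each summand is
  therefore linear by itself.\<close>

lemma dual_multilinear:
  assumes \<mu>: "\<mu> \<in> carrier (ops P n)"
  shows "multilinear R n (dual_alg A) (dual_alg A) (oper (dual_alg A) \<mu>)"
proof (rule multilinearI_update[OF module_dual[OF module_alg]])
  fix as k assume as: "set as \<subseteq> carrier (dual_alg A)" "length as = n" "k < n"
  let ?f = "map fst as" and ?s = "map snd as"
  have cl: "set ?f \<subseteq> carrier A" "set ?s \<subseteq> carrier A" using as by auto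
  have lin: "linear_map R (dual_alg A) A fst" "linear_map R (dual_alg A) A snd"
    by (auto simp: linear_map_def)
  have up: "linear_map R (dual_alg A) A (\<lambda>x. oper A \<mu> (xs[k := fst x]))"
    "linear_map R (dual_alg A) A (\<lambda>x. oper A \<mu> (xs[k := snd x]))"
    if "set xs \<subseteq> carrier A" "length xs = n" for xs
    using that \<mu> as(3)
    by (auto intro!: linear_map_compose[OF lin(1) oper_update_linear]
        linear_map_compose[OF lin(2) oper_update_linear])
  have "linear_map R (dual_alg A) A
      (\<lambda>x. \<Oplus>\<^bsub>A\<^esub>i\<in>{..<n}. oper A \<mu> ((?f[k := fst x])[i := (?s[k := snd x]) ! i]))"
  proof (rule linear_map_finsum_fun[OF module_alg])
    fix i assume i: "i \<in> {..<n}"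
    show "linear_map R (dual_alg A) A (\<lambda>x. oper A \<mu> ((?f[k := fst x])[i := (?s[k := snd x]) ! i]))"
    proof (cases "i = k")
      case True
      then show ?thesis using up(2)[OF cl(1)] as by simp
    next
      case False
      have "set (?f[i := ?s ! i]) \<subseteq> carrier A"
        using cl i as by (intro set_update_subsetI) (auto simp del: map_map)
      from up(1)[OF this] show ?thesis
        using False as by (simp add: list_update_swap)
    qed
  qed simp
  then show "linear_map R (dual_alg A) (dual_alg A) (\<lambda>x. oper (dual_alg A) \<mu> (as[k := x]))"
    using up(1)[OF cl(1)] as by (simp add: linear_map_dual_iff leibniz_def map_update)
qed

text \<open>First components satisfy the axioms because \<open>A\<close> does. For second components
  the composition axiom is the chain rule, and symmetry is a reindexing of the Leibniz sum by
  \<open>\<sigma>\<close>.\<close>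

lemma operad_algebra_dual: "operad_algebra R P (dual_alg A)"
proof (intro operad_algebra.intro operad_algebra_axioms.intro)
  show "operad R P" by (rule operad_axioms)
  show "module R (dual_alg A)" by (rule module_dual[OF module_alg])
  show "linear_map R (ops P (length as)) (dual_alg A) (\<lambda>\<mu>. oper (dual_alg A) \<mu> as)"
    if as: "set as \<subseteq> carrier (dual_alg A)" for as
  proof -
    have cl: "set (map fst as) \<subseteq> carrier A" "set (map snd as) \<subseteq> carrier A" using as by auto
    have "linear_map R (ops P (length as)) A (\<lambda>\<mu>. oper A \<mu> ((map fst as)[i := map snd as ! i]))"
      if "i < length as" for i
    proof -
      have "set ((map fst as)[i := map snd as ! i]) \<subseteq> carrier A"
        using cl that by (intro set_update_subsetI) (auto simp del: map_map)
      from oper_linear_left[OF this] show ?thesis by simp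
    qed
    then have "linear_map R (ops P (length as)) A (\<lambda>\<mu>. leibniz A \<mu> (map fst as) (map snd as))"
      unfolding leibniz_def by (intro linear_map_finsum_fun[OF module_alg]) auto
    then show ?thesis
      using oper_linear_left[OF cl(1)] by (simp add: linear_map_dual_iff)
  qed
  show "linear_map R (dual_alg A) (dual_alg A) (\<lambda>a. oper (dual_alg A) \<mu> (as @ a # bs))"
    if "\<mu> \<in> carrier (ops P (Suc (length as + length bs)))" "set as \<subseteq> carrier (dual_alg A)"
      "set bs \<subseteq> carrier (dual_alg A)" for \<mu> as bs
    by (rule multilinearD[OF dual_multilinear[OF that(1)] that(2,3)]) simp
  show "oper (dual_alg A) (opunit P) [a] = a" if "a \<in> carrier (dual_alg A)" for a
  proof -
    have a: "fst a \<in> carrier A" "snd a \<in> carrier A" using that by auto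
    have "leibniz A (opunit P) [fst a] [snd a] = snd a"
      using A.M.finsum_lessThan_Suc[of "\<lambda>i. oper A (opunit P) ([fst a][i := [snd a] ! i])" 0] a
      by (simp add: leibniz_def oper_unit)
    then show ?thesis using a by (simp add: oper_unit)
  qed
  show "oper (dual_alg A) (opcomp P \<mu> \<nu>s) (concat xss) =
      oper (dual_alg A) \<mu> (map2 (\<lambda>(k, \<nu>) as. oper (dual_alg A) \<nu> as) \<nu>s xss)"
    if \<mu>: "\<mu> \<in> carrier (ops P (length \<nu>s))" and \<nu>s: "\<nu>s \<in> ops_list P"
      and len: "map length xss = map fst \<nu>s" and xss: "\<forall>as\<in>set xss. set as \<subseteq> carrier (dual_alg A)"
    for \<mu> \<nu>s xss
  proof -
    define yss where "yss = map (map fst) xss"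
    define zss where "zss = map (map snd) xss"
    let ?ev = "map2 (\<lambda>(k, \<nu>) as. oper A \<nu> as) \<nu>s"
    have l: "length \<nu>s = length xss" using len by (metis length_map)
    have leny: "map length yss = map fst \<nu>s" using len by (simp add: yss_def comp_def)
    have ly: "length yss = length \<nu>s" "length zss = length \<nu>s" using l by (simp_all add: yss_def zss_def)
    have lj: "length (yss ! j) = length (xss ! j)" "length (zss ! j) = length (xss ! j)"
      "length (xss ! j) = fst (\<nu>s ! j)" if "j < length \<nu>s" for j
      using that l len by (simp_all add: yss_def zss_def) (metis nth_map)
    have ycl: "\<forall>as\<in>set yss. set as \<subseteq> carrier A" and zcl: "\<forall>as\<in>set zss. set as \<subseteq> carrier A"
      using xss by (fastforce simp: yss_def zss_def)+
    have ycl': "set (yss ! j) \<subseteq> carrier A" "set (zss ! j) \<subseteq> carrier A" if "j < length \<nu>s" for j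
      using that ycl zcl ly by simp_all
    have \<nu>cl: "snd (\<nu>s ! j) \<in> carrier (ops P (length (yss ! j)))" if "j < length \<nu>s" for j
      using \<nu>s nth_mem[OF that] lj(1,3)[OF that] by (auto simp: ops_list_def case_prod_beta)
    have evn: "?ev yss ! j = oper A (snd (\<nu>s ! j)) (yss ! j)" if "j < length \<nu>s" for j
      using that ly by (simp add: case_prod_beta)
    have evl: "length (?ev yss) = length \<nu>s" using ly by simp
    have evcl: "set (?ev yss) \<subseteq> carrier A"
      unfolding set_conv_nth using alg_closed[OF \<nu>cl ycl'(1)] evn evl by auto
    have cyl: "length (concat yss) = arity_sum \<nu>s"
      using leny by (simp add: length_concat arity_sum_def)
    have \<mu>\<nu>: "opcomp P \<mu> \<nu>s \<in> carrier (ops P (length (concat yss)))"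
      using comp_closed[OF \<mu> \<nu>s] cyl by simp
    have ccl: "set (concat yss) \<subseteq> carrier A" "set (concat zss) \<subseteq> carrier A"
      using ycl zcl by auto
    have lcz: "length (concat zss) = length (concat yss)"
      by (simp add: yss_def zss_def length_concat comp_def)
    \<comment> \<open>Changing one leaf of the composite amounts to changing one argument of the
      outer operation: \<open>oper_comp\<close> is applied to the list of lists with that leaf
      updated.\<close>
    have upd: "oper A (opcomp P \<mu> \<nu>s) ((concat yss)[length (concat (take j yss)) + i := z]) =
        oper A \<mu> ((?ev yss)[j := oper A (snd (\<nu>s ! j)) ((yss ! j)[i := z])])"
      if j: "j < length \<nu>s" and i: "i < length (yss ! j)" and z: "z \<in> carrier A" for i j z
    proof -
      let ?yss = "yss[j := (yss ! j)[i := z]]"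
      have "oper A (opcomp P \<mu> \<nu>s) (concat ?yss) = oper A \<mu> (?ev ?yss)"
      proof (rule oper_comp[OF \<mu> \<nu>s])
        show "map length ?yss = map fst \<nu>s"
          using leny j ly by (simp add: map_update list_update_same_conv)
            (metis nth_map)
        have "set ((yss ! j)[i := z]) \<subseteq> carrier A"
          by (rule set_update_subsetI[OF ycl'(1)[OF j] z])
        then show "\<forall>as\<in>set ?yss. set as \<subseteq> carrier A"
          using ycl set_update_subset_insert[of yss j] by fastforce
      qed
      moreover have "?ev ?yss = (?ev yss)[j := oper A (snd (\<nu>s ! j)) ((yss ! j)[i := z])]"
        by (rule nth_equalityI) (use ly j in \<open>auto simp: nth_list_update case_prod_beta\<close>)
      ultimately show ?thesis using concat_update[of j yss i z] j i ly by simp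
    qed
    have zin: "zss ! j ! i \<in> carrier A" if "j < length \<nu>s" "i < length (yss ! j)" for i j
      using ycl'(2)[OF that(1)] lj[OF that(1)] that(2) by (metis in_mono nth_mem)
    have czin: "concat zss ! i \<in> carrier A" if "i < length (concat yss)" for i
      using ccl(2) that lcz by (metis in_mono nth_mem)
    have "leibniz A (opcomp P \<mu> \<nu>s) (concat yss) (concat zss) =
      (\<Oplus>\<^bsub>A\<^esub>j\<in>{..<length yss}. \<Oplus>\<^bsub>A\<^esub>i\<in>{..<length (yss ! j)}. oper A (opcomp P \<mu> \<nu>s)
        ((concat yss)[length (concat (take j yss)) + i := concat zss ! (length (concat (take j yss)) + i)]))"
      unfolding leibniz_def
      by (rule A.M.finsum_concat)
        (use oper_update_closed[OF \<mu>\<nu> ccl(1)] czin in auto)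
    also have "\<dots> = (\<Oplus>\<^bsub>A\<^esub>j\<in>{..<length \<nu>s}.
      oper A \<mu> ((?ev yss)[j := leibniz A (snd (\<nu>s ! j)) (yss ! j) (zss ! j)]))"
      unfolding ly(1)
    proof (rule A.M.finsum_cong'[OF refl])
      show "(\<lambda>j. oper A \<mu> ((?ev yss)[j := leibniz A (snd (\<nu>s ! j)) (yss ! j) (zss ! j)])) \<in>
          {..<length \<nu>s} \<rightarrow> carrier A"
        using oper_update_closed[of \<mu> "?ev yss"] \<mu> evl evcl leibniz_closed[OF \<nu>cl ycl'] lj by simp
      fix j assume "j \<in> {..<length \<nu>s}"
      then have j: "j < length \<nu>s" by simp
      have take: "length (concat (take j yss)) = length (concat (take j zss))"
        by (simp add: yss_def zss_def take_map length_concat comp_def)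
      have z: "concat zss ! (length (concat (take j yss)) + i) = zss ! j ! i"
        if "i < length (yss ! j)" for i
        unfolding take by (rule concat_nth_offset) (use j that ly lj in auto)
      \<comment> \<open>Linearity in slot \<open>j\<close> of \<open>\<mu>\<close> moves the sum
        over the leaves of block \<open>j\<close> into that slot, where it becomes the inner Leibniz
        sum.\<close>
      have lin: "linear_map R A A (\<lambda>x. oper A \<mu> ((?ev yss)[j := x]))"
        by (rule oper_update_linear) (use \<mu> evl evcl j in auto)
      have "(\<Oplus>\<^bsub>A\<^esub>i\<in>{..<length (yss ! j)}. oper A (opcomp P \<mu> \<nu>s)
          ((concat yss)[length (concat (take j yss)) + i := concat zss ! (length (concat (take j yss)) + i)])) =
        (\<Oplus>\<^bsub>A\<^esub>i\<in>{..<length (yss ! j)}.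
          oper A \<mu> ((?ev yss)[j := oper A (snd (\<nu>s ! j)) ((yss ! j)[i := zss ! j ! i])]))"
        by (rule A.M.finsum_cong')
          (use upd[OF j] zin[OF j] z linear_map_closed[OF lin] oper_update_closed[OF \<nu>cl[OF j] ycl'(1)[OF j]]
            in auto)
      also have "\<dots> = oper A \<mu> ((?ev yss)[j := leibniz A (snd (\<nu>s ! j)) (yss ! j) (zss ! j)])"
        unfolding leibniz_def
        by (rule linear_map_finsum[OF module_alg module_alg lin, symmetric])
          (use zin[OF j] oper_update_closed[OF \<nu>cl[OF j] ycl'(1)[OF j]] in auto)
      finally show "(\<Oplus>\<^bsub>A\<^esub>i\<in>{..<length (yss ! j)}. oper A (opcomp P \<mu> \<nu>s)
          ((concat yss)[length (concat (take j yss)) + i := concat zss ! (length (concat (take j yss)) + i)])) =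
        oper A \<mu> ((?ev yss)[j := leibniz A (snd (\<nu>s ! j)) (yss ! j) (zss ! j)])" .
    qed
    also have "\<dots> = leibniz A \<mu> (?ev yss) (map2 (\<lambda>(k, \<nu>) as. leibniz A \<nu> (map fst as) (map snd as)) \<nu>s xss)"
      unfolding leibniz_def[of A \<mu>] evl
    proof (rule A.M.finsum_cong'[OF refl])
      have e: "map2 (\<lambda>(k, \<nu>) as. leibniz A \<nu> (map fst as) (map snd as)) \<nu>s xss ! j =
        leibniz A (snd (\<nu>s ! j)) (yss ! j) (zss ! j)" if "j < length \<nu>s" for j
        using that l by (simp add: case_prod_beta yss_def zss_def)
      have cl: "oper A \<mu> ((?ev yss)[j := leibniz A (snd (\<nu>s ! j)) (yss ! j) (zss ! j)]) \<in> carrier A"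
        if "j < length \<nu>s" for j
        by (rule oper_update_closed)
          (use \<mu> evl evcl that lj leibniz_closed[OF \<nu>cl[OF that] ycl'[OF that]] in simp_all)
      show "(\<lambda>j. oper A \<mu> ((?ev yss)[j :=
          map2 (\<lambda>(k, \<nu>) as. leibniz A \<nu> (map fst as) (map snd as)) \<nu>s xss ! j])) \<in>
          {..<length \<nu>s} \<rightarrow> carrier A"
        using cl e by (simp only: Pi_iff lessThan_iff) simp
      show "oper A \<mu> ((?ev yss)[j := leibniz A (snd (\<nu>s ! j)) (yss ! j) (zss ! j)]) =
        oper A \<mu> ((?ev yss)[j :=
          map2 (\<lambda>(k, \<nu>) as. leibniz A \<nu> (map fst as) (map snd as)) \<nu>s xss ! j])"
        if "j \<in> {..<length \<nu>s}" for j
        using e[of j] that by (simp only: lessThan_iff)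
    qed
    finally have leib: "leibniz A (opcomp P \<mu> \<nu>s) (concat yss) (concat zss) =
      leibniz A \<mu> (?ev yss) (map2 (\<lambda>(k, \<nu>) as. leibniz A \<nu> (map fst as) (map snd as)) \<nu>s xss)" .
    have e1: "map fst (map2 (\<lambda>(k, \<nu>) as. oper (dual_alg A) \<nu> as) \<nu>s xss) = ?ev yss"
      by (rule nth_equalityI) (use l in \<open>auto simp: case_prod_beta yss_def\<close>)
    have e2: "map snd (map2 (\<lambda>(k, \<nu>) as. oper (dual_alg A) \<nu> as) \<nu>s xss) =
      map2 (\<lambda>(k, \<nu>) as. leibniz A \<nu> (map fst as) (map snd as)) \<nu>s xss"
      by (rule nth_equalityI) (use l in \<open>auto simp: case_prod_beta\<close>)
    show ?thesis
      unfolding dual_alg_simps(5)[of A "opcomp P \<mu> \<nu>s"] dual_alg_simps(5)[of A \<mu>] e1 e2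
      using leib oper_comp[OF \<mu> \<nu>s leny ycl] by (simp add: map_concat yss_def zss_def)
  qed
  show "oper (dual_alg A) (opact P (length xs) \<mu> \<sigma>) (permute_list \<sigma> xs) = oper (dual_alg A) \<mu> xs"
    if \<mu>: "\<mu> \<in> carrier (ops P (length xs))" and xs: "set xs \<subseteq> carrier (dual_alg A)"
      and \<sigma>: "\<sigma> permutes {..<length xs}" for \<mu> xs \<sigma>
  proof -
    let ?f = "map fst xs" and ?s = "map snd xs"
    have cl: "set ?f \<subseteq> carrier A" "set ?s \<subseteq> carrier A" using xs by auto
    have bd: "\<sigma> i < length xs" if "i < length xs" for i
      using permutes_in_image[OF \<sigma>, of i] that by simp
    have up: "oper A \<mu> (?f[i := ?s ! i]) \<in> carrier A" if "i < length xs" for i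
      using oper_update_closed[of \<mu> ?f i "?s ! i"] \<mu> cl that by (auto simp: subset_iff)
    \<comment> \<open>Summand \<open>i\<close> of the permuted sum is summand
      \<open>\<sigma> i\<close> of the original one.\<close>
    have "leibniz A (opact P (length xs) \<mu> \<sigma>) (permute_list \<sigma> ?f) (permute_list \<sigma> ?s) =
      (\<Oplus>\<^bsub>A\<^esub>i\<in>{..<length xs}. oper A \<mu> (?f[\<sigma> i := ?s ! \<sigma> i]))"
    proof -
      have "oper A (opact P (length xs) \<mu> \<sigma>) ((permute_list \<sigma> ?f)[i := permute_list \<sigma> ?s ! i]) =
        oper A \<mu> (?f[\<sigma> i := ?s ! \<sigma> i])" if "i < length xs" for i
      proof -
        have "set (?f[\<sigma> i := ?s ! \<sigma> i]) \<subseteq> carrier A"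
          using cl bd[OF that] by (intro set_update_subsetI) (auto simp del: map_map)
        then show ?thesis
          using oper_act[of \<mu> "?f[\<sigma> i := ?s ! \<sigma> i]" \<sigma>] permute_list_update[of \<sigma> ?f i "?s ! \<sigma> i"]
            permute_list_nth[of \<sigma> ?s i] \<mu> \<sigma> that by simp
      qed
      then show ?thesis
        unfolding leibniz_def length_permute_list length_map
        by (intro A.M.finsum_cong') (use up bd in auto)
    qed
    also have "\<dots> = (\<Oplus>\<^bsub>A\<^esub>i\<in>\<sigma> ` {..<length xs}. oper A \<mu> (?f[i := ?s ! i]))"
      by (rule A.M.finsum_reindex[symmetric])
        (use up bd permutes_inj[OF \<sigma>] in \<open>auto intro: inj_on_subset\<close>)
    also have "\<dots> = leibniz A \<mu> ?f ?s" by (simp add: permutes_image[OF \<sigma>] leibniz_def)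
    finally show ?thesis
      using oper_act[of \<mu> ?f \<sigma>] \<mu> cl \<sigma> by (simp add: permute_list_map)
  qed
qed

end

section \<open>Derivations along a map\<close>

lemma algebra_map_dual_iff:
  "algebra_map R P A (dual_alg B) f \<longleftrightarrow>
    algebra_map R P A B (\<lambda>x. fst (f x)) \<and> derivation_along R P A B (\<lambda>x. fst (f x)) (\<lambda>x. snd (f x))"
  by (auto simp: algebra_map_def derivation_along_def linear_map_dual_iff comp_def prod_eq_iff)

lemma linear_map_list_closed: "linear_map R A B f \<Longrightarrow> set as \<subseteq> carrier A \<Longrightarrow> set (map f as) \<subseteq> carrier B"
  by (auto dest: linear_map_closed)

lemma derivation_along_linear: "derivation_along R P A B f \<delta> \<Longrightarrow> linear_map R A B \<delta>"
  by (simp add: derivation_along_def)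

lemma derivation_along_oper:
  "derivation_along R P A B f \<delta> \<Longrightarrow> \<mu> \<in> carrier (ops P (length as)) \<Longrightarrow> set as \<subseteq> carrier A \<Longrightarrow>
    \<delta> (oper A \<mu> as) = leibniz B \<mu> (map f as) (map \<delta> as)"
  by (simp add: derivation_along_def)

lemma derivation_along_cong:
  assumes "ops_algebra R P A" "derivation_along R P A B f \<delta>"
    "\<And>x. x \<in> carrier A \<Longrightarrow> f x = g x" "\<And>x. x \<in> carrier A \<Longrightarrow> \<delta> x = \<epsilon> x"
  shows "derivation_along R P A B g \<epsilon>"
  unfolding derivation_along_def
proof (intro conjI allI ballI impI)
  interpret A: ops_algebra R P A by fact
  show "linear_map R A B \<epsilon>"
    by (rule linear_map_cong[OF A.module_axioms derivation_along_linear[OF assms(2)] assms(4)])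
  fix as \<mu> assume *: "\<mu> \<in> carrier (ops P (length as))" "set as \<subseteq> carrier A"
  have "map f as = map g as" "map \<delta> as = map \<epsilon> as" using *(2) assms(3,4) by auto
  then show "\<epsilon> (oper A \<mu> as) = leibniz B \<mu> (map g as) (map \<epsilon> as)"
    using derivation_along_oper[OF assms(2) *] assms(4)[OF A.oper_closed[OF *]] by metis
qed

lemma leibniz_algebra_map:
  assumes "operad_algebra R P B" "operad_algebra R P C" "algebra_map R P B C g"
    "\<mu> \<in> carrier (ops P (length xs))" "set xs \<subseteq> carrier B" "set ys \<subseteq> carrier B" "length ys = length xs"
  shows "g (leibniz B \<mu> xs ys) = leibniz C \<mu> (map g xs) (map g ys)"
proof -
  interpret B: operad_algebra R P B by fact
  interpret C: operad_algebra R P C by fact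
  interpret CM: module R C by (rule C.module_alg)
  note lin = algebra_map_linear[OF assms(3)]
  have yi: "ys ! i \<in> carrier B" if "i < length xs" for i
    using that assms(6,7) by (metis in_mono nth_mem)
  have cl: "oper B \<mu> (xs[i := ys ! i]) \<in> carrier B" if "i < length xs" for i
    by (rule B.oper_update_closed[OF assms(4,5) that yi[OF that]])
  have "g (leibniz B \<mu> xs ys) = (\<Oplus>\<^bsub>C\<^esub>i\<in>{..<length xs}. g (oper B \<mu> (xs[i := ys ! i])))"
    unfolding leibniz_def
    by (rule linear_map_finsum[OF B.module_alg C.module_alg lin]) (use cl in auto)
  also have "\<dots> = leibniz C \<mu> (map g xs) (map g ys)"
    unfolding leibniz_def length_map
  proof (rule CM.M.finsum_cong'[OF refl])
    have "g (oper B \<mu> (xs[i := ys ! i])) = oper C \<mu> ((map g xs)[i := map g ys ! i])"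
      if "i < length xs" for i
      using algebra_map_oper[OF assms(3), of \<mu> "xs[i := ys ! i]"] assms(4,5,7) that yi[OF that]
        set_update_subsetI[OF assms(5) yi[OF that]]
      by (simp add: map_update)
    moreover have "g (oper B \<mu> (xs[i := ys ! i])) \<in> carrier C" if "i < length xs" for i
      by (rule linear_map_closed[OF lin cl[OF that]])
    ultimately show "(\<lambda>i. oper C \<mu> ((map g xs)[i := map g ys ! i])) \<in> {..<length xs} \<rightarrow> carrier C"
      "\<And>i. i \<in> {..<length xs} \<Longrightarrow>
        g (oper B \<mu> (xs[i := ys ! i])) = oper C \<mu> ((map g xs)[i := map g ys ! i])"
      by auto
  qed
  finally show ?thesis .
qed

lemma derivation_along_compose:
  assumes "operad_algebra R P B" "operad_algebra R P C" "derivation_along R P A B f \<delta>"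
    "linear_map R A B f" "algebra_map R P B C g"
  shows "derivation_along R P A C (\<lambda>x. g (f x)) (\<lambda>x. g (\<delta> x))"
  unfolding derivation_along_def
proof (intro conjI allI ballI impI)
  show "linear_map R A C (\<lambda>x. g (\<delta> x))"
    by (rule linear_map_compose[OF derivation_along_linear[OF assms(3)] algebra_map_linear[OF assms(5)]])
  fix as \<mu> assume *: "\<mu> \<in> carrier (ops P (length as))" "set as \<subseteq> carrier A"
  show "g (\<delta> (oper A \<mu> as)) = leibniz C \<mu> (map (\<lambda>x. g (f x)) as) (map (\<lambda>x. g (\<delta> x)) as)"
    using leibniz_algebra_map[OF assms(1,2,5), of \<mu> "map f as" "map \<delta> as"] *
      derivation_along_oper[OF assms(3) *] linear_map_list_closed[OF assms(4) *(2)]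
      linear_map_list_closed[OF derivation_along_linear[OF assms(3)] *(2)]
    by (simp add: comp_def)
qed

lemma derivation_along_precompose:
  assumes "algebra_map R P A B f" "derivation_along R P B C g \<delta>"
  shows "derivation_along R P A C (\<lambda>x. g (f x)) (\<lambda>x. \<delta> (f x))"
  unfolding derivation_along_def
proof (intro conjI allI ballI impI)
  show "linear_map R A C (\<lambda>x. \<delta> (f x))"
    by (rule linear_map_compose[OF algebra_map_linear[OF assms(1)] derivation_along_linear[OF assms(2)]])
  fix as \<mu> assume *: "\<mu> \<in> carrier (ops P (length as))" "set as \<subseteq> carrier A"
  show "\<delta> (f (oper A \<mu> as)) = leibniz C \<mu> (map (\<lambda>x. g (f x)) as) (map (\<lambda>x. \<delta> (f x)) as)"
    using derivation_along_oper[OF assms(2), of \<mu> "map f as"] * algebra_map_oper[OF assms(1) *]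
      linear_map_list_closed[OF algebra_map_linear[OF assms(1)] *(2)]
    by (simp add: comp_def)
qed

context operad_algebra
begin

interpretation AM: module R A by (rule module_alg)

lemma derivation_along_zero:
  assumes "linear_map R B A f"
  shows "derivation_along R P B A f (\<lambda>_. \<zero>\<^bsub>A\<^esub>)"
  unfolding derivation_along_def
proof (intro conjI allI ballI impI)
  show "linear_map R B A (\<lambda>_. \<zero>\<^bsub>A\<^esub>)" by (rule linear_map_zero_fun[OF module_alg])
  fix as \<mu> assume *: "\<mu> \<in> carrier (ops P (length as))" "set as \<subseteq> carrier B"
  have "oper A \<mu> ((map f as)[i := \<zero>\<^bsub>A\<^esub>]) = \<zero>\<^bsub>A\<^esub>" if "i < length as" for i
    using linear_map_zero[OF module_alg module_alg oper_update_linear[of \<mu> "map f as" i]]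
      * that linear_map_list_closed[OF assms *(2)] by simp
  then have "leibniz A \<mu> (map f as) (map (\<lambda>_. \<zero>\<^bsub>A\<^esub>) as) = (\<Oplus>\<^bsub>A\<^esub>i\<in>{..<length as}. \<zero>\<^bsub>A\<^esub>)"
    unfolding leibniz_def length_map by (intro AM.M.finsum_cong') auto
  then show "\<zero>\<^bsub>A\<^esub> = leibniz A \<mu> (map f as) (map (\<lambda>_. \<zero>\<^bsub>A\<^esub>) as)"
    by (simp add: AM.M.finsum_zero)
qed

lemma derivation_along_add:
  assumes f: "linear_map R B A f" and \<delta>: "derivation_along R P B A f \<delta>" "derivation_along R P B A f \<epsilon>"
  shows "derivation_along R P B A f (\<lambda>x. \<delta> x \<oplus>\<^bsub>A\<^esub> \<epsilon> x)"
  unfolding derivation_along_def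
proof (intro conjI allI ballI impI)
  note ld = derivation_along_linear[OF \<delta>(1)] derivation_along_linear[OF \<delta>(2)]
  show "linear_map R B A (\<lambda>x. \<delta> x \<oplus>\<^bsub>A\<^esub> \<epsilon> x)"
    by (rule linear_map_add_fun[OF module_alg ld])
  fix as \<mu> assume *: "\<mu> \<in> carrier (ops P (length as))" "set as \<subseteq> carrier B"
  let ?up = "\<lambda>\<gamma> i. oper A \<mu> ((map f as)[i := map \<gamma> as ! i])"
  have lin: "linear_map R A A (\<lambda>y. oper A \<mu> ((map f as)[i := y]))" if "i < length as" for i
    by (rule oper_update_linear) (use * that linear_map_list_closed[OF f *(2)] in auto)
  have cl: "\<delta> (as ! i) \<in> carrier A" "\<epsilon> (as ! i) \<in> carrier A" if "i < length as" for i
    using that *(2) linear_map_closed[OF ld(1)] linear_map_closed[OF ld(2)] by (auto simp: subset_iff)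
  have add: "?up (\<lambda>x. \<delta> x \<oplus>\<^bsub>A\<^esub> \<epsilon> x) i = ?up \<delta> i \<oplus>\<^bsub>A\<^esub> ?up \<epsilon> i" if "i < length as" for i
    using linear_map_add[OF lin cl, of i] that by simp
  have upcl: "?up \<delta> i \<in> carrier A" "?up \<epsilon> i \<in> carrier A" if "i < length as" for i
    using linear_map_closed[OF lin] cl that by simp_all
  have "leibniz A \<mu> (map f as) (map (\<lambda>x. \<delta> x \<oplus>\<^bsub>A\<^esub> \<epsilon> x) as) =
      (\<Oplus>\<^bsub>A\<^esub>i\<in>{..<length as}. ?up \<delta> i \<oplus>\<^bsub>A\<^esub> ?up \<epsilon> i)"
    unfolding leibniz_def length_map by (rule AM.M.finsum_cong') (use add upcl in auto)
  also have "\<dots> = leibniz A \<mu> (map f as) (map \<delta> as) \<oplus>\<^bsub>A\<^esub> leibniz A \<mu> (map f as) (map \<epsilon> as)"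
    unfolding leibniz_def length_map by (rule AM.M.finsum_addf) (use upcl in auto)
  finally show "\<delta> (oper B \<mu> as) \<oplus>\<^bsub>A\<^esub> \<epsilon> (oper B \<mu> as) =
      leibniz A \<mu> (map f as) (map (\<lambda>x. \<delta> x \<oplus>\<^bsub>A\<^esub> \<epsilon> x) as)"
    using derivation_along_oper[OF \<delta>(1) *] derivation_along_oper[OF \<delta>(2) *] by simp
qed

lemma derivation_along_uminus:
  assumes f: "linear_map R B A f" and \<delta>: "derivation_along R P B A f \<delta>"
  shows "derivation_along R P B A f (\<lambda>x. \<ominus>\<^bsub>A\<^esub> \<delta> x)"
  unfolding derivation_along_def
proof (intro conjI allI ballI impI)
  note ld = derivation_along_linear[OF \<delta>]
  show "linear_map R B A (\<lambda>x. \<ominus>\<^bsub>A\<^esub> \<delta> x)"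
    by (rule linear_map_uminus_fun[OF module_alg ld])
  fix as \<mu> assume *: "\<mu> \<in> carrier (ops P (length as))" "set as \<subseteq> carrier B"
  let ?up = "\<lambda>\<gamma> i. oper A \<mu> ((map f as)[i := map \<gamma> as ! i])"
  have lin: "linear_map R A A (\<lambda>y. oper A \<mu> ((map f as)[i := y]))" if "i < length as" for i
    by (rule oper_update_linear) (use * that linear_map_list_closed[OF f *(2)] in auto)
  have cl: "\<delta> (as ! i) \<in> carrier A" if "i < length as" for i
    using that *(2) linear_map_closed[OF ld] by (auto simp: subset_iff)
  have neg: "?up (\<lambda>x. \<ominus>\<^bsub>A\<^esub> \<delta> x) i = \<ominus>\<^bsub>A\<^esub> ?up \<delta> i" if "i < length as" for i
    using linear_map_uminus[OF module_alg module_alg lin cl, of i] that by simp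
  have upcl: "?up \<delta> i \<in> carrier A" if "i < length as" for i
    using linear_map_closed[OF lin] cl that by simp_all
  have "leibniz A \<mu> (map f as) (map (\<lambda>x. \<ominus>\<^bsub>A\<^esub> \<delta> x) as) = (\<Oplus>\<^bsub>A\<^esub>i\<in>{..<length as}. \<ominus>\<^bsub>A\<^esub> ?up \<delta> i)"
    unfolding leibniz_def length_map by (rule AM.M.finsum_cong') (use neg upcl in auto)
  also have "\<dots> = \<ominus>\<^bsub>A\<^esub> leibniz A \<mu> (map f as) (map \<delta> as)"
    unfolding leibniz_def length_map
    by (rule linear_map_finsum[OF module_alg module_alg linear_map_uminus_fun[OF module_alg linear_map_id],
          symmetric]) (use upcl in auto)
  finally show "\<ominus>\<^bsub>A\<^esub> \<delta> (oper B \<mu> as) = leibniz A \<mu> (map f as) (map (\<lambda>x. \<ominus>\<^bsub>A\<^esub> \<delta> x) as)"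
    using derivation_along_oper[OF \<delta> *] by simp
qed

end


section \<open>Pushouts\<close>

context presented_operad_algebra
begin

lemma gen_closed: "v \<in> carrier V \<Longrightarrow> gen v \<in> carrier Q"
  by (rule linear_map_closed[OF gen_linear])

lemma free_gen_closed: "v \<in> carrier V \<Longrightarrow> free_gen R P V v \<in> carrier S"
  by (rule linear_map_closed[OF free_gen_linear])

lemma coset_eq_if_rel:
  assumes "x \<ominus>\<^bsub>S\<^esub> y \<in> rels" "x \<in> carrier S" "y \<in> carrier S"
  shows "J +>\<^bsub>S\<^esub> x = J +>\<^bsub>S\<^esub> y"
proof -
  interpret Q: operad_algebra R P Q by (rule operad_algebra_Q)
  interpret QM: module R Q by (rule Q.module_alg)
  note lin = algebra_map_linear[OF algebra_map_Q]
  show ?thesis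
    using rel_zero[OF assms(1)] linear_map_minus[OF module_S Q.module_alg lin assms(2,3)]
      QM.M.minus_eq_zero_iff linear_map_closed[OF lin] assms(2,3) by simp
qed

lemma coset_oper_gen:
  assumes "\<mu> \<in> carrier (ops P (length vs))" "set vs \<subseteq> carrier V"
  shows "J +>\<^bsub>S\<^esub> oper S \<mu> (map (free_gen R P V) vs) = oper Q \<mu> (map gen vs)"
  using algebra_map_oper[OF algebra_map_Q, of \<mu> "map (free_gen R P V) vs"] assms
    linear_map_list_closed[OF free_gen_linear assms(2)]
  by (simp add: presented_gen_def[abs_def] comp_def)

text \<open>Relations of this form say precisely that a linear inclusion of generators is a
  morphism. Both pushout injections and \<open>tan_in\<close> are obtained in this way.\<close>

lemma gen_algebra_map:
  assumes C: "operad_algebra R P C" and i: "linear_map R C V i"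
    and rel: "\<And>\<mu> cs. \<lbrakk>\<mu> \<in> carrier (ops P (length cs)); set cs \<subseteq> carrier C\<rbrakk> \<Longrightarrow>
      oper S \<mu> (map (\<lambda>c. free_gen R P V (i c)) cs) \<ominus>\<^bsub>S\<^esub> free_gen R P V (i (oper C \<mu> cs)) \<in> rels"
  shows "algebra_map R P C Q (\<lambda>c. gen (i c))"
proof (rule algebra_mapI[OF linear_map_compose[OF i gen_linear]])
  fix \<mu> cs assume *: "\<mu> \<in> carrier (ops P (length cs))" "set cs \<subseteq> carrier C"
  have vs: "set (map i cs) \<subseteq> carrier V" by (rule linear_map_list_closed[OF i *(2)])
  have "J +>\<^bsub>S\<^esub> oper S \<mu> (map (free_gen R P V) (map i cs)) =
      J +>\<^bsub>S\<^esub> free_gen R P V (i (oper C \<mu> cs))"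
  proof (rule coset_eq_if_rel)
    show "oper S \<mu> (map (free_gen R P V) (map i cs)) \<in> carrier S"
      using *(1) by (intro operad_algebra.alg_closed[OF operad_algebra_S]
          linear_map_list_closed[OF free_gen_linear vs]) simp
    show "free_gen R P V (i (oper C \<mu> cs)) \<in> carrier S"
      by (intro free_gen_closed linear_map_closed[OF i] operad_algebra.alg_closed[OF C] *)
  qed (use rel[OF *] in \<open>simp add: comp_def\<close>)
  then show "gen (i (oper C \<mu> cs)) = oper Q \<mu> (map (\<lambda>c. gen (i c)) cs)"
    using coset_oper_gen[OF _ vs, of \<mu>] *(1) by (simp add: presented_gen_def comp_def)
qed

lemma algebra_map_kills_difference:
  assumes "module R B" "algebra_map R P S B k" "x \<in> carrier S" "y \<in> carrier S" "k x = k y"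
  shows "k (x \<ominus>\<^bsub>S\<^esub> y) = \<zero>\<^bsub>B\<^esub>"
proof -
  interpret B: module R B by fact
  show ?thesis
    using linear_map_minus[OF module_S assms(1) algebra_map_linear[OF assms(2)] assms(3,4)] assms(5)
      B.M.minus_eq_zero_iff algebra_map_closed[OF assms(2)] assms(3,4) by simp
qed

text \<open>The counterpart of \<open>gen_algebra_map\<close> for maps out of a presented algebra:
  since \<open>k\<close> restricts to the morphism \<open>h\<close> along the inclusion
  \<open>i\<close>, it takes equal values on both sides of such a relation.\<close>

lemma oper_relation_killed:
  assumes C: "operad_algebra R P C" and i: "linear_map R C V i"
    and B: "module R B" and h: "algebra_map R P C B h" and k: "algebra_map R P S B k"
    and kh: "\<And>c. c \<in> carrier C \<Longrightarrow> k (free_gen R P V (i c)) = h c"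
    and *: "\<mu> \<in> carrier (ops P (length cs))" "set cs \<subseteq> carrier C"
  shows "k (oper S \<mu> (map (\<lambda>c. free_gen R P V (i c)) cs) \<ominus>\<^bsub>S\<^esub> free_gen R P V (i (oper C \<mu> cs))) = \<zero>\<^bsub>B\<^esub>"
proof (rule algebra_map_kills_difference[OF B k])
  note lin = linear_map_compose[OF i free_gen_linear]
  have s: "set (map (\<lambda>c. free_gen R P V (i c)) cs) \<subseteq> carrier S"
    by (rule linear_map_list_closed[OF lin *(2)])
  show "oper S \<mu> (map (\<lambda>c. free_gen R P V (i c)) cs) \<in> carrier S"
    by (rule operad_algebra.alg_closed[OF operad_algebra_S _ s]) (use *(1) in simp)
  have o: "oper C \<mu> cs \<in> carrier C" by (rule operad_algebra.alg_closed[OF C *])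
  then show "free_gen R P V (i (oper C \<mu> cs)) \<in> carrier S" by (rule linear_map_closed[OF lin])
  have m: "map k (map (\<lambda>c. free_gen R P V (i c)) cs) = map h cs" using *(2) kh by auto
  have "k (oper S \<mu> (map (\<lambda>c. free_gen R P V (i c)) cs)) = oper B \<mu> (map h cs)"
    unfolding m[symmetric] by (rule algebra_map_oper[OF k _ s]) (use *(1) in simp)
  then show "k (oper S \<mu> (map (\<lambda>c. free_gen R P V (i c)) cs)) = k (free_gen R P V (i (oper C \<mu> cs)))"
    using kh[OF o] algebra_map_oper[OF h *] by simp
qed

end

locale pushout_data = C: operad_algebra R P C + D: operad_algebra R P D
  for R :: "('r, 'z) ring_scheme" and P :: "('r, 'p) operad"
    and C :: "('r, 'p, 'c) opalg" and D :: "('r, 'p, 'd) opalg" +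
  fixes B :: "('r, 'p, 'b) opalg" and f :: "'b \<Rightarrow> 'c" and g :: "'b \<Rightarrow> 'd"
  assumes f_closed: "b \<in> carrier B \<Longrightarrow> f b \<in> carrier C"
    and g_closed: "b \<in> carrier B \<Longrightarrow> g b \<in> carrier D"
begin

interpretation CM: module R C by (rule C.module_alg)
interpretation DM: module R D by (rule D.module_alg)

lemma free_operad_algebra_prod: "free_operad_algebra R P (prod_module C D)"
  by (intro free_operad_algebra.intro C.operad_axioms free_operad_algebra_axioms.intro
      module_prod C.module_alg D.module_alg)

lemma pushout_rels_closed: "pushout_rels R P B C D f g \<subseteq> carrier (free_alg R P (prod_module C D))"
proof -
  interpret F: free_operad_algebra R P "prod_module C D" by (rule free_operad_algebra_prod)
  interpret S: operad_algebra R P F.S by (rule F.operad_algebra_S)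
  interpret SM: module R F.S by (rule F.module_S)
  note gcl = linear_map_closed[OF F.free_gen_linear]
  have 1: "(oper F.S \<mu> (map (\<lambda>c. free_gen R P (prod_module C D) (c, \<zero>\<^bsub>D\<^esub>)) cs)) \<in> carrier F.S"
    if "\<mu> \<in> carrier (ops P (length cs))" "set cs \<subseteq> carrier C" for \<mu> cs
    by (rule S.alg_closed) (use that in \<open>auto intro!: gcl\<close>)
  have 2: "(oper F.S \<mu> (map (\<lambda>c. free_gen R P (prod_module C D) (\<zero>\<^bsub>C\<^esub>, c)) cs)) \<in> carrier F.S"
    if "\<mu> \<in> carrier (ops P (length cs))" "set cs \<subseteq> carrier D" for \<mu> cs
    by (rule S.alg_closed) (use that in \<open>auto intro!: gcl\<close>)
  show ?thesis
    unfolding pushout_rels_def Let_def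
    by (auto intro!: SM.M.minus_closed 1 2 gcl C.alg_closed D.alg_closed f_closed g_closed)
qed

sublocale Po: presented_operad_algebra R P "prod_module C D" "pushout_rels R P B C D f g"
  by (intro presented_operad_algebra.intro free_operad_algebra_prod
      presented_operad_algebra_axioms.intro pushout_rels_closed)

abbreviation PO where "PO \<equiv> pushout R P B C D f g"
abbreviation inl where "inl \<equiv> pushout_inl R P B C D f g"
abbreviation inr where "inr \<equiv> pushout_inr R P B C D f g"

lemma operad_algebra_pushout: "operad_algebra R P PO"
  unfolding pushout_def by (rule Po.operad_algebra_Q)

lemma inl_hom: "inl \<in> alg_hom R P C PO"
  unfolding pushout_inl_def pushout_def
  by (rule algebra_map_restrict[OF C.ops_algebra], rule Po.gen_algebra_map[OF C.operad_algebra_axioms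
        linear_map_inl[OF D.module_alg]]) (unfold pushout_rels_def Let_def, blast)

lemma inr_hom: "inr \<in> alg_hom R P D PO"
  unfolding pushout_inr_def pushout_def
  by (rule algebra_map_restrict[OF D.ops_algebra], rule Po.gen_algebra_map[OF D.operad_algebra_axioms
        linear_map_inr[OF C.module_alg]]) (unfold pushout_rels_def Let_def, blast)

lemma inl_inr:
  assumes "b \<in> carrier B"
  shows "inl (f b) = inr (g b)"
proof -
  have "Po.J +>\<^bsub>Po.S\<^esub> free_gen R P (prod_module C D) (f b, \<zero>\<^bsub>D\<^esub>) =
    Po.J +>\<^bsub>Po.S\<^esub> free_gen R P (prod_module C D) (\<zero>\<^bsub>C\<^esub>, g b)"
  proof (rule Po.coset_eq_if_rel)
    show "free_gen R P (prod_module C D) (f b, \<zero>\<^bsub>D\<^esub>) \<ominus>\<^bsub>Po.S\<^esub> free_gen R P (prod_module C D) (\<zero>\<^bsub>C\<^esub>, g b)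
      \<in> pushout_rels R P B C D f g"
      unfolding pushout_rels_def Let_def using assms by blast
  qed (use f_closed[OF assms] g_closed[OF assms] in \<open>auto intro!: Po.free_gen_closed\<close>)
  then show ?thesis
    using f_closed[OF assms] g_closed[OF assms]
    by (simp add: pushout_inl_def pushout_inr_def presented_gen_def)
qed

text \<open>On the generating module the map has to send \<open>(c, d)\<close> to
  \<open>h\<^sub>1 c + h\<^sub>2 d\<close>. The operation relations are respected because
  \<open>h\<^sub>1\<close> and \<open>h\<^sub>2\<close> are morphisms, the identifying relations
  because of \<open>agree\<close>.\<close>

lemma pushout_hom_exists:
  assumes E: "operad_algebra R P E" and h: "algebra_map R P C E h\<^sub>1" "algebra_map R P D E h\<^sub>2"
    and agree: "\<And>b. b \<in> carrier B \<Longrightarrow> h\<^sub>1 (f b) = h\<^sub>2 (g b)"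
  shows "\<exists>h\<in>alg_hom R P PO E. (\<forall>c\<in>carrier C. h (inl c) = h\<^sub>1 c) \<and> (\<forall>d\<in>carrier D. h (inr d) = h\<^sub>2 d)"
proof -
  interpret E: operad_algebra R P E by fact
  interpret EM: module R E by (rule E.module_alg)
  note lin = algebra_map_linear[OF h(1)] algebra_map_linear[OF h(2)]
  note cl = linear_map_closed[OF lin(1)] linear_map_closed[OF lin(2)]
  note zero = linear_map_zero[OF C.module_alg E.module_alg lin(1)]
    linear_map_zero[OF D.module_alg E.module_alg lin(2)]
  let ?F = "\<lambda>x. h\<^sub>1 (fst x) \<oplus>\<^bsub>E\<^esub> h\<^sub>2 (snd x)"
  let ?\<eta> = "free_gen R P (prod_module C D)"
  have "\<exists>h\<in>alg_hom R P Po.Q E. \<forall>v\<in>carrier (prod_module C D). h (Po.gen v) = ?F v"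
  proof (rule Po.presented_hom_exists[OF E linear_map_prod[OF E.module_alg lin]])
    fix k x assume k: "algebra_map R P Po.S E k" "\<And>v. v \<in> carrier (prod_module C D) \<Longrightarrow> k (?\<eta> v) = ?F v"
      and x: "x \<in> pushout_rels R P B C D f g"
    have k1: "k (?\<eta> (c, \<zero>\<^bsub>D\<^esub>)) = h\<^sub>1 c" if "c \<in> carrier C" for c
      using that k(2)[of "(c, \<zero>\<^bsub>D\<^esub>)"] zero cl by simp
    have k2: "k (?\<eta> (\<zero>\<^bsub>C\<^esub>, d)) = h\<^sub>2 d" if "d \<in> carrier D" for d
      using that k(2)[of "(\<zero>\<^bsub>C\<^esub>, d)"] zero cl by simp
    show "k x = \<zero>\<^bsub>E\<^esub>"
      using x unfolding pushout_rels_def Let_def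
    proof (elim UnE CollectE exE conjE)
      fix \<mu> cs assume "x = oper Po.S \<mu> (map (\<lambda>c. ?\<eta> (c, \<zero>\<^bsub>D\<^esub>)) cs) \<ominus>\<^bsub>Po.S\<^esub> ?\<eta> (oper C \<mu> cs, \<zero>\<^bsub>D\<^esub>)"
        and "\<mu> \<in> carrier (ops P (length cs))" "set cs \<subseteq> carrier C"
      then show ?thesis
        using Po.oper_relation_killed[OF C.operad_algebra_axioms linear_map_inl[OF D.module_alg]
            E.module_alg h(1) k(1) k1, of \<mu> cs] by simp
    next
      fix \<mu> cs assume "x = oper Po.S \<mu> (map (\<lambda>c. ?\<eta> (\<zero>\<^bsub>C\<^esub>, c)) cs) \<ominus>\<^bsub>Po.S\<^esub> ?\<eta> (\<zero>\<^bsub>C\<^esub>, oper D \<mu> cs)"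
        and "\<mu> \<in> carrier (ops P (length cs))" "set cs \<subseteq> carrier D"
      then show ?thesis
        using Po.oper_relation_killed[OF D.operad_algebra_axioms linear_map_inr[OF C.module_alg]
            E.module_alg h(2) k(1) k2, of \<mu> cs] by simp
    next
      fix b assume x: "x = ?\<eta> (f b, \<zero>\<^bsub>D\<^esub>) \<ominus>\<^bsub>Po.S\<^esub> ?\<eta> (\<zero>\<^bsub>C\<^esub>, g b)" and b: "b \<in> carrier B"
      show ?thesis
        unfolding x
        by (rule Po.algebra_map_kills_difference[OF E.module_alg k(1)])
          (use f_closed[OF b] g_closed[OF b] k1 k2 agree[OF b] in \<open>auto intro!: Po.free_gen_closed\<close>)
    qed
  qed
  then obtain k where k: "k \<in> alg_hom R P Po.Q E"
    "\<forall>v\<in>carrier (prod_module C D). k (Po.gen v) = ?F v" by (elim bexE)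
  show ?thesis
  proof (intro bexI[of _ k] conjI ballI)
    show "k \<in> alg_hom R P PO E" using k(1) by (simp add: pushout_def)
    show "k (inl c) = h\<^sub>1 c" if "c \<in> carrier C" for c
      using bspec[OF k(2), of "(c, \<zero>\<^bsub>D\<^esub>)"] that zero cl by (simp add: pushout_inl_def)
    show "k (inr d) = h\<^sub>2 d" if "d \<in> carrier D" for d
      using bspec[OF k(2), of "(\<zero>\<^bsub>C\<^esub>, d)"] that zero cl by (simp add: pushout_inr_def)
  qed
qed

lemma pushout_hom_eq:
  assumes E: "module R E" and h: "h \<in> alg_hom R P PO E" "k \<in> alg_hom R P PO E"
    and "\<And>c. c \<in> carrier C \<Longrightarrow> h (inl c) = k (inl c)" "\<And>d. d \<in> carrier D \<Longrightarrow> h (inr d) = k (inr d)"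
  shows "h = k"
proof (rule Po.presented_hom_eq[OF E])
  show hk: "h \<in> alg_hom R P Po.Q E" "k \<in> alg_hom R P Po.Q E" using h by (simp_all add: pushout_def)
  fix v assume v: "v \<in> carrier (prod_module C D)"
  obtain c d where cd: "v = (c, d)" "c \<in> carrier C" "d \<in> carrier D" using v by auto
  have "Po.gen v = Po.gen (c, \<zero>\<^bsub>D\<^esub>) \<oplus>\<^bsub>Po.Q\<^esub> Po.gen (\<zero>\<^bsub>C\<^esub>, d)"
    using linear_map_add[OF Po.gen_linear, of "(c, \<zero>\<^bsub>D\<^esub>)" "(\<zero>\<^bsub>C\<^esub>, d)"] cd by simp
  moreover have "Po.gen (c, \<zero>\<^bsub>D\<^esub>) \<in> carrier Po.Q" "Po.gen (\<zero>\<^bsub>C\<^esub>, d) \<in> carrier Po.Q"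
    using cd by (auto intro!: Po.gen_closed)
  ultimately show "h (Po.gen v) = k (Po.gen v)"
    using assms(4)[OF cd(2)] assms(5)[OF cd(3)] cd linear_map_add[OF alg_hom_linear[OF hk(1)]]
      linear_map_add[OF alg_hom_linear[OF hk(2)]]
    by (simp add: pushout_inl_def pushout_inr_def)
qed

end

section \<open>The tangent algebra\<close>

context operad_algebra
begin

interpretation AM: module R A by (rule module_alg)

lemma free_operad_algebra_square: "free_operad_algebra R P (prod_module A A)"
  by (intro free_operad_algebra.intro operad_axioms free_operad_algebra_axioms.intro
      module_prod module_alg)

text \<open>The definition indexes \<open>as ! i\<close> inside the generator, while
  \<open>leibniz\<close> indexes the mapped list; the two agree for indices in range. In this form
  \<open>leibniz_algebra_map\<close> applies to the relations.\<close>

lemma tan_rels_leibniz: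
  "tan_rels R P A =
    (let V = prod_module A A; S = free_alg R P V; \<eta> = free_gen R P V in
      {oper S \<mu> (map (\<lambda>a. \<eta> (a, \<zero>\<^bsub>A\<^esub>)) as) \<ominus>\<^bsub>S\<^esub> \<eta> (oper A \<mu> as, \<zero>\<^bsub>A\<^esub>) | \<mu> as.
        \<mu> \<in> carrier (ops P (length as)) \<and> set as \<subseteq> carrier A} \<union>
      {\<eta> (\<zero>\<^bsub>A\<^esub>, oper A \<mu> as) \<ominus>\<^bsub>S\<^esub>
          leibniz S \<mu> (map (\<lambda>a. \<eta> (a, \<zero>\<^bsub>A\<^esub>)) as) (map (\<lambda>a. \<eta> (\<zero>\<^bsub>A\<^esub>, a)) as) | \<mu> as.
        \<mu> \<in> carrier (ops P (length as)) \<and> set as \<subseteq> carrier A})"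
proof -
  interpret F: free_operad_algebra R P "prod_module A A" by (rule free_operad_algebra_square)
  interpret S: operad_algebra R P F.S by (rule F.operad_algebra_S)
  let ?\<eta> = "free_gen R P (prod_module A A)"
  have "leibniz F.S \<mu> (map (\<lambda>a. ?\<eta> (a, \<zero>\<^bsub>A\<^esub>)) as) (map (\<lambda>a. ?\<eta> (\<zero>\<^bsub>A\<^esub>, a)) as) =
    (\<Oplus>\<^bsub>F.S\<^esub>i\<in>{..<length as}. oper F.S \<mu> ((map (\<lambda>a. ?\<eta> (a, \<zero>\<^bsub>A\<^esub>)) as)[i := ?\<eta> (\<zero>\<^bsub>A\<^esub>, as ! i)]))"
    if *: "\<mu> \<in> carrier (ops P (length as)) \<and> set as \<subseteq> carrier A" for \<mu> as
  proof -
    have "as ! i \<in> carrier A" if "i < length as" for i using * nth_mem[OF that] by auto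
    then have cl: "?\<eta> (\<zero>\<^bsub>A\<^esub>, as ! i) \<in> carrier F.S" if "i < length as" for i
      using that by (intro linear_map_closed[OF F.free_gen_linear]) simp
    have "set (map (\<lambda>a. ?\<eta> (a, \<zero>\<^bsub>A\<^esub>)) as) \<subseteq> carrier F.S"
      using * by (auto intro!: linear_map_closed[OF F.free_gen_linear])
    then show ?thesis
      unfolding leibniz_def
      using S.leibniz_cong[of \<mu> "map (\<lambda>a. ?\<eta> (a, \<zero>\<^bsub>A\<^esub>)) as" "\<lambda>i. ?\<eta> (\<zero>\<^bsub>A\<^esub>, as ! i)"
          "\<lambda>i. map (\<lambda>a. ?\<eta> (\<zero>\<^bsub>A\<^esub>, a)) as ! i"] * cl by simp
  qed
  then show ?thesis
    unfolding tan_rels_def Let_def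
    by (intro arg_cong2[where f = "(\<union>)"] refl Collect_cong ex_cong1 rev_conj_cong) simp
qed

lemma tan_rels_closed: "tan_rels R P A \<subseteq> carrier (free_alg R P (prod_module A A))"
proof -
  interpret F: free_operad_algebra R P "prod_module A A" by (rule free_operad_algebra_square)
  interpret S: operad_algebra R P F.S by (rule F.operad_algebra_S)
  interpret SM: module R F.S by (rule F.module_S)
  let ?\<eta> = "free_gen R P (prod_module A A)"
  note gcl = linear_map_closed[OF F.free_gen_linear]
  have s: "set (map (\<lambda>a. ?\<eta> (a, \<zero>\<^bsub>A\<^esub>)) as) \<subseteq> carrier F.S" "set (map (\<lambda>a. ?\<eta> (\<zero>\<^bsub>A\<^esub>, a)) as) \<subseteq> carrier F.S"
    if "set as \<subseteq> carrier A" for as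
    using that by (auto intro!: gcl)
  have o: "oper F.S \<mu> (map (\<lambda>a. ?\<eta> (a, \<zero>\<^bsub>A\<^esub>)) as) \<in> carrier F.S"
    and l: "leibniz F.S \<mu> (map (\<lambda>a. ?\<eta> (a, \<zero>\<^bsub>A\<^esub>)) as) (map (\<lambda>a. ?\<eta> (\<zero>\<^bsub>A\<^esub>, a)) as) \<in> carrier F.S"
    and g: "?\<eta> (oper A \<mu> as, \<zero>\<^bsub>A\<^esub>) \<in> carrier F.S" "?\<eta> (\<zero>\<^bsub>A\<^esub>, oper A \<mu> as) \<in> carrier F.S"
    if *: "\<mu> \<in> carrier (ops P (length as))" "set as \<subseteq> carrier A" for \<mu> as
  proof -
    show "oper F.S \<mu> (map (\<lambda>a. ?\<eta> (a, \<zero>\<^bsub>A\<^esub>)) as) \<in> carrier F.S"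
      by (rule S.alg_closed[OF _ s(1)[OF *(2)]]) (use *(1) in simp)
    show "leibniz F.S \<mu> (map (\<lambda>a. ?\<eta> (a, \<zero>\<^bsub>A\<^esub>)) as) (map (\<lambda>a. ?\<eta> (\<zero>\<^bsub>A\<^esub>, a)) as) \<in> carrier F.S"
      by (rule S.leibniz_closed[OF _ s[OF *(2)]]) (use *(1) in simp_all)
    show "?\<eta> (oper A \<mu> as, \<zero>\<^bsub>A\<^esub>) \<in> carrier F.S" "?\<eta> (\<zero>\<^bsub>A\<^esub>, oper A \<mu> as) \<in> carrier F.S"
      using alg_closed[OF *] by (auto intro!: gcl)
  qed
  show ?thesis
  proof
    fix x assume "x \<in> tan_rels R P A"
    then show "x \<in> carrier F.S"
      unfolding tan_rels_leibniz Let_def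
    proof (elim UnE CollectE exE conjE)
      fix \<mu> as assume x: "x = oper F.S \<mu> (map (\<lambda>a. ?\<eta> (a, \<zero>\<^bsub>A\<^esub>)) as) \<ominus>\<^bsub>F.S\<^esub> ?\<eta> (oper A \<mu> as, \<zero>\<^bsub>A\<^esub>)"
        and *: "\<mu> \<in> carrier (ops P (length as))" "set as \<subseteq> carrier A"
      show ?thesis unfolding x by (rule SM.M.minus_closed[OF o[OF *] g(1)[OF *]])
    next
      fix \<mu> as assume x: "x = ?\<eta> (\<zero>\<^bsub>A\<^esub>, oper A \<mu> as) \<ominus>\<^bsub>F.S\<^esub>
          leibniz F.S \<mu> (map (\<lambda>a. ?\<eta> (a, \<zero>\<^bsub>A\<^esub>)) as) (map (\<lambda>a. ?\<eta> (\<zero>\<^bsub>A\<^esub>, a)) as)"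
        and *: "\<mu> \<in> carrier (ops P (length as))" "set as \<subseteq> carrier A"
      show ?thesis unfolding x by (rule SM.M.minus_closed[OF g(2)[OF *] l[OF *]])
    qed
  qed
qed

sublocale Tan: presented_operad_algebra R P "prod_module A A" "tan_rels R P A"
  by (intro presented_operad_algebra.intro free_operad_algebra_square
      presented_operad_algebra_axioms.intro tan_rels_closed)

abbreviation TA where "TA \<equiv> tan_alg R P A"
abbreviation inA where "inA \<equiv> tan_in R P A"
abbreviation dA where "dA \<equiv> tan_d R P A"

lemma operad_algebra_tan: "operad_algebra R P TA"
  unfolding tan_alg_def by (rule Tan.operad_algebra_Q)

lemma tan_in_linear: "linear_map R A TA inA"
  unfolding tan_in_def[abs_def] tan_alg_def
  by (rule linear_map_compose[OF linear_map_inl[OF module_alg] Tan.gen_linear])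

lemma tan_d_linear: "linear_map R A TA dA"
  unfolding tan_d_def[abs_def] tan_alg_def
  by (rule linear_map_compose[OF linear_map_inr[OF module_alg] Tan.gen_linear])

lemma tan_gen_lists:
  assumes "set as \<subseteq> carrier A"
  shows "set (map (\<lambda>a. free_gen R P (prod_module A A) (a, \<zero>\<^bsub>A\<^esub>)) as) \<subseteq> carrier Tan.S"
    "set (map (\<lambda>a. free_gen R P (prod_module A A) (\<zero>\<^bsub>A\<^esub>, a)) as) \<subseteq> carrier Tan.S"
  using assms by (auto intro!: Tan.free_gen_closed)

lemma tan_in_algebra_map: "algebra_map R P A TA inA"
  unfolding tan_in_def[abs_def] tan_alg_def
  by (rule Tan.gen_algebra_map[OF operad_algebra_axioms linear_map_inl[OF module_alg]])
    (unfold tan_rels_def Let_def, blast)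

lemma tan_d_derivation: "derivation_along R P A TA inA dA"
  unfolding derivation_along_def
proof (intro conjI allI ballI impI tan_d_linear)
  fix \<mu> as assume *: "\<mu> \<in> carrier (ops P (length as))" "set as \<subseteq> carrier A"
  let ?\<eta> = "free_gen R P (prod_module A A)"
  let ?L = "leibniz Tan.S \<mu> (map (\<lambda>a. ?\<eta> (a, \<zero>\<^bsub>A\<^esub>)) as) (map (\<lambda>a. ?\<eta> (\<zero>\<^bsub>A\<^esub>, a)) as)"
  have "Tan.J +>\<^bsub>Tan.S\<^esub> ?\<eta> (\<zero>\<^bsub>A\<^esub>, oper A \<mu> as) = Tan.J +>\<^bsub>Tan.S\<^esub> ?L"
  proof (rule Tan.coset_eq_if_rel)
    show "?\<eta> (\<zero>\<^bsub>A\<^esub>, oper A \<mu> as) \<ominus>\<^bsub>Tan.S\<^esub> ?L \<in> tan_rels R P A"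
      unfolding tan_rels_leibniz Let_def using * by blast
    show "?L \<in> carrier Tan.S"
      by (rule operad_algebra.leibniz_closed[OF Tan.operad_algebra_S _ tan_gen_lists[OF *(2)]])
        (use *(1) in simp_all)
  qed (use alg_closed[OF *] in \<open>auto intro!: Tan.free_gen_closed\<close>)
  moreover have "Tan.J +>\<^bsub>Tan.S\<^esub> ?L = leibniz TA \<mu> (map inA as) (map dA as)"
    using leibniz_algebra_map[OF Tan.operad_algebra_S Tan.operad_algebra_Q Tan.algebra_map_Q _
        tan_gen_lists[OF *(2)], of \<mu>] *(1)
    by (simp add: tan_alg_def tan_in_def[abs_def] tan_d_def[abs_def] presented_gen_def comp_def)
  ultimately show "dA (oper A \<mu> as) = leibniz TA \<mu> (map inA as) (map dA as)"
    by (simp add: tan_d_def presented_gen_def)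
qed

text \<open>The linear map \<open>(a, b) \<mapsto> f a + \<delta> b\<close> on the generating module
  respects the first family of relations since \<open>f\<close> is a morphism, and the second since
  \<open>\<delta>\<close> is a derivation along it.\<close>

lemma tan_hom_exists:
  assumes B: "operad_algebra R P B" and f: "algebra_map R P A B f" and \<delta>: "derivation_along R P A B f \<delta>"
  shows "\<exists>g\<in>alg_hom R P TA B. \<forall>a\<in>carrier A. g (inA a) = f a \<and> g (dA a) = \<delta> a"
proof -
  interpret B: operad_algebra R P B by fact
  interpret BM: module R B by (rule B.module_alg)
  note lin = algebra_map_linear[OF f] derivation_along_linear[OF \<delta>]
  note cl = linear_map_closed[OF lin(1)] linear_map_closed[OF lin(2)]
  note zero = linear_map_zero[OF module_alg B.module_alg lin(1)]
    linear_map_zero[OF module_alg B.module_alg lin(2)]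
  let ?F = "\<lambda>x. f (fst x) \<oplus>\<^bsub>B\<^esub> \<delta> (snd x)"
  let ?\<eta> = "free_gen R P (prod_module A A)"
  have "\<exists>h\<in>alg_hom R P Tan.Q B. \<forall>v\<in>carrier (prod_module A A). h (Tan.gen v) = ?F v"
  proof (rule Tan.presented_hom_exists[OF B linear_map_prod[OF B.module_alg lin]])
    fix k x assume k: "algebra_map R P Tan.S B k" "\<And>v. v \<in> carrier (prod_module A A) \<Longrightarrow> k (?\<eta> v) = ?F v"
      and x: "x \<in> tan_rels R P A"
    have k1: "k (?\<eta> (a, \<zero>\<^bsub>A\<^esub>)) = f a" if "a \<in> carrier A" for a
      using that k(2)[of "(a, \<zero>\<^bsub>A\<^esub>)"] zero cl by simp
    have k2: "k (?\<eta> (\<zero>\<^bsub>A\<^esub>, a)) = \<delta> a" if "a \<in> carrier A" for a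
      using that k(2)[of "(\<zero>\<^bsub>A\<^esub>, a)"] zero cl by simp
    have m: "map k (map (\<lambda>a. ?\<eta> (a, \<zero>\<^bsub>A\<^esub>)) as) = map f as"
      "map k (map (\<lambda>a. ?\<eta> (\<zero>\<^bsub>A\<^esub>, a)) as) = map \<delta> as" if "set as \<subseteq> carrier A" for as
      using that k1 k2 by auto
    show "k x = \<zero>\<^bsub>B\<^esub>"
      using x unfolding tan_rels_leibniz Let_def
    proof (elim UnE CollectE exE conjE)
      fix \<mu> as assume "x = oper Tan.S \<mu> (map (\<lambda>a. ?\<eta> (a, \<zero>\<^bsub>A\<^esub>)) as) \<ominus>\<^bsub>Tan.S\<^esub> ?\<eta> (oper A \<mu> as, \<zero>\<^bsub>A\<^esub>)"
        and "\<mu> \<in> carrier (ops P (length as))" "set as \<subseteq> carrier A"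
      then show ?thesis
        using Tan.oper_relation_killed[OF operad_algebra_axioms linear_map_inl[OF module_alg]
            B.module_alg f k(1) k1, of \<mu> as] by simp
    next
      fix \<mu> as
      assume x: "x = ?\<eta> (\<zero>\<^bsub>A\<^esub>, oper A \<mu> as) \<ominus>\<^bsub>Tan.S\<^esub>
          leibniz Tan.S \<mu> (map (\<lambda>a. ?\<eta> (a, \<zero>\<^bsub>A\<^esub>)) as) (map (\<lambda>a. ?\<eta> (\<zero>\<^bsub>A\<^esub>, a)) as)"
        and *: "\<mu> \<in> carrier (ops P (length as))" "set as \<subseteq> carrier A"
      note s = tan_gen_lists[OF *(2)]
      show ?thesis
        unfolding x
      proof (rule Tan.algebra_map_kills_difference[OF B.module_alg k(1)])
        show "leibniz Tan.S \<mu> (map (\<lambda>a. ?\<eta> (a, \<zero>\<^bsub>A\<^esub>)) as) (map (\<lambda>a. ?\<eta> (\<zero>\<^bsub>A\<^esub>, a)) as) \<in> carrier Tan.S"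
          by (rule operad_algebra.leibniz_closed[OF Tan.operad_algebra_S _ s]) (use *(1) in simp_all)
        show "?\<eta> (\<zero>\<^bsub>A\<^esub>, oper A \<mu> as) \<in> carrier Tan.S"
          using alg_closed[OF *] by (intro Tan.free_gen_closed) simp
        have "k (leibniz Tan.S \<mu> (map (\<lambda>a. ?\<eta> (a, \<zero>\<^bsub>A\<^esub>)) as) (map (\<lambda>a. ?\<eta> (\<zero>\<^bsub>A\<^esub>, a)) as)) =
            leibniz B \<mu> (map f as) (map \<delta> as)"
          unfolding m[OF *(2), symmetric]
          by (rule leibniz_algebra_map[OF Tan.operad_algebra_S B k(1) _ s]) (use *(1) in simp_all)
        then show "k (?\<eta> (\<zero>\<^bsub>A\<^esub>, oper A \<mu> as)) =
            k (leibniz Tan.S \<mu> (map (\<lambda>a. ?\<eta> (a, \<zero>\<^bsub>A\<^esub>)) as) (map (\<lambda>a. ?\<eta> (\<zero>\<^bsub>A\<^esub>, a)) as))"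
          using k2[OF alg_closed[OF *]] derivation_along_oper[OF \<delta> *] by simp
      qed
    qed
  qed
  then obtain k where k: "k \<in> alg_hom R P Tan.Q B"
    "\<forall>v\<in>carrier (prod_module A A). k (Tan.gen v) = ?F v" by (elim bexE)
  show ?thesis
  proof (intro bexI[of _ k] conjI ballI)
    show "k \<in> alg_hom R P TA B" using k(1) by (simp add: tan_alg_def)
    fix a assume a: "a \<in> carrier A"
    show "k (inA a) = f a"
      using bspec[OF k(2), of "(a, \<zero>\<^bsub>A\<^esub>)"] a zero cl by (simp add: tan_in_def)
    show "k (dA a) = \<delta> a"
      using bspec[OF k(2), of "(\<zero>\<^bsub>A\<^esub>, a)"] a zero cl by (simp add: tan_d_def)
  qed
qed

lemma tan_hom_eq:
  assumes B: "module R B" and h: "h \<in> alg_hom R P TA B" "k \<in> alg_hom R P TA B"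
    and eq: "\<And>a. a \<in> carrier A \<Longrightarrow> h (inA a) = k (inA a)" "\<And>a. a \<in> carrier A \<Longrightarrow> h (dA a) = k (dA a)"
  shows "h = k"
proof (rule Tan.presented_hom_eq[OF B])
  show hk: "h \<in> alg_hom R P Tan.Q B" "k \<in> alg_hom R P Tan.Q B" using h by (simp_all add: tan_alg_def)
  fix v assume v: "v \<in> carrier (prod_module A A)"
  obtain a b where ab: "v = (a, b)" "a \<in> carrier A" "b \<in> carrier A" using v by auto
  have "Tan.gen v = inA a \<oplus>\<^bsub>Tan.Q\<^esub> dA b"
    using linear_map_add[OF Tan.gen_linear, of "(a, \<zero>\<^bsub>A\<^esub>)" "(\<zero>\<^bsub>A\<^esub>, b)"] ab
    by (simp add: tan_in_def tan_d_def)
  moreover have "inA a \<in> carrier Tan.Q" "dA b \<in> carrier Tan.Q"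
    using ab by (auto intro!: Tan.gen_closed simp: tan_in_def tan_d_def)
  ultimately show "h (Tan.gen v) = k (Tan.gen v)"
    using eq ab linear_map_add[OF alg_hom_linear[OF hk(1)]]
      linear_map_add[OF alg_hom_linear[OF hk(2)]] by simp
qed

text \<open>In the shape of the \<open>THE\<close> definitions of the structure maps, so that
  \<open>theI'\<close> delivers their values at once.\<close>

lemma tan_hom_ex1:
  assumes "operad_algebra R P B" "algebra_map R P A B f" "derivation_along R P A B f \<delta>"
  shows "\<exists>!g. g \<in> alg_hom R P TA B \<and> (\<forall>a\<in>carrier A. g (inA a) = f a \<and> g (dA a) = \<delta> a)"
proof (rule ex_ex1I)
  show "\<exists>g. g \<in> alg_hom R P TA B \<and> (\<forall>a\<in>carrier A. g (inA a) = f a \<and> g (dA a) = \<delta> a)"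
    using tan_hom_exists[OF assms] by (elim bexE) (intro exI conjI)
next
  fix g h
  assume "g \<in> alg_hom R P TA B \<and> (\<forall>a\<in>carrier A. g (inA a) = f a \<and> g (dA a) = \<delta> a)"
    "h \<in> alg_hom R P TA B \<and> (\<forall>a\<in>carrier A. h (inA a) = f a \<and> h (dA a) = \<delta> a)"
  then show "g = h" by (intro tan_hom_eq[OF operad_algebra.module_alg[OF assms(1)]]) auto
qed

lemma tan_in_closed: "a \<in> carrier A \<Longrightarrow> inA a \<in> carrier TA"
  by (rule linear_map_closed[OF tan_in_linear])

lemma tan_d_closed: "a \<in> carrier A \<Longrightarrow> dA a \<in> carrier TA"
  by (rule linear_map_closed[OF tan_d_linear])

section \<open>The structure maps p, z, n, s and the action of T on morphisms\<close>

lemma tan_p_hom: "tan_p R P A \<in> alg_hom R P A TA"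
  unfolding tan_p_def by (rule algebra_map_restrict[OF ops_algebra tan_in_algebra_map])

lemma tan_map:
  assumes "operad_algebra R P B" "algebra_map R P A B f"
  shows "tan_map R P A B f \<in> alg_hom R P TA (tan_alg R P B)"
    "\<And>a. a \<in> carrier A \<Longrightarrow> tan_map R P A B f (inA a) = tan_in R P B (f a)"
    "\<And>a. a \<in> carrier A \<Longrightarrow> tan_map R P A B f (dA a) = tan_d R P B (f a)"
proof -
  interpret B: operad_algebra R P B by fact
  have "\<exists>!g. g \<in> alg_hom R P TA B.TA \<and>
      (\<forall>a\<in>carrier A. g (inA a) = tan_in R P B (f a) \<and> g (dA a) = tan_d R P B (f a))"
    by (rule tan_hom_ex1[OF B.operad_algebra_tan algebra_map_compose[OF assms(2) B.tan_in_algebra_map]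
          derivation_along_precompose[OF assms(2) B.tan_d_derivation]])
  from theI'[OF this] show "tan_map R P A B f \<in> alg_hom R P TA (tan_alg R P B)"
    "\<And>a. a \<in> carrier A \<Longrightarrow> tan_map R P A B f (inA a) = tan_in R P B (f a)"
    "\<And>a. a \<in> carrier A \<Longrightarrow> tan_map R P A B f (dA a) = tan_d R P B (f a)"
    by (simp_all add: tan_map_def)
qed

lemma tan_z:
  shows "tan_z R P A \<in> alg_hom R P TA A"
    "\<And>a. a \<in> carrier A \<Longrightarrow> tan_z R P A (inA a) = a"
    "\<And>a. a \<in> carrier A \<Longrightarrow> tan_z R P A (dA a) = \<zero>\<^bsub>A\<^esub>"
proof -
  have "\<exists>!g. g \<in> alg_hom R P TA A \<and> (\<forall>a\<in>carrier A. g (inA a) = a \<and> g (dA a) = \<zero>\<^bsub>A\<^esub>)"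
    by (rule tan_hom_ex1[OF operad_algebra_axioms algebra_map_id
          derivation_along_zero[OF linear_map_id]])
  from theI'[OF this] show "tan_z R P A \<in> alg_hom R P TA A"
    "\<And>a. a \<in> carrier A \<Longrightarrow> tan_z R P A (inA a) = a"
    "\<And>a. a \<in> carrier A \<Longrightarrow> tan_z R P A (dA a) = \<zero>\<^bsub>A\<^esub>"
    by (simp_all add: tan_z_def)
qed

lemma tan_n:
  shows "tan_n R P A \<in> alg_hom R P TA TA"
    "\<And>a. a \<in> carrier A \<Longrightarrow> tan_n R P A (inA a) = inA a"
    "\<And>a. a \<in> carrier A \<Longrightarrow> tan_n R P A (dA a) = \<ominus>\<^bsub>TA\<^esub> dA a"
proof -
  interpret T: operad_algebra R P TA by (rule operad_algebra_tan)
  have "\<exists>!g. g \<in> alg_hom R P TA TA \<and>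
      (\<forall>a\<in>carrier A. g (inA a) = inA a \<and> g (dA a) = \<ominus>\<^bsub>TA\<^esub> dA a)"
    by (rule tan_hom_ex1[OF operad_algebra_tan tan_in_algebra_map
          T.derivation_along_uminus[OF tan_in_linear tan_d_derivation]])
  from theI'[OF this] show "tan_n R P A \<in> alg_hom R P TA TA"
    "\<And>a. a \<in> carrier A \<Longrightarrow> tan_n R P A (inA a) = inA a"
    "\<And>a. a \<in> carrier A \<Longrightarrow> tan_n R P A (dA a) = \<ominus>\<^bsub>TA\<^esub> dA a"
    by (simp_all add: tan_n_def)
qed

lemma pushout_data_tan2: "pushout_data R P TA TA A (tan_p R P A) (tan_p R P A)"
  by (intro pushout_data.intro operad_algebra_tan pushout_data_axioms.intro)
    (rule alg_hom_closed[OF tan_p_hom], assumption)+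

lemma operad_algebra_tan2: "operad_algebra R P (tan2 R P A)"
  unfolding tan2_def by (rule pushout_data.operad_algebra_pushout[OF pushout_data_tan2])

lemma tan2_in1_hom: "tan2_in1 R P A \<in> alg_hom R P TA (tan2 R P A)"
  unfolding tan2_def tan2_in1_def by (rule pushout_data.inl_hom[OF pushout_data_tan2])

lemma tan2_in2_hom: "tan2_in2 R P A \<in> alg_hom R P TA (tan2 R P A)"
  unfolding tan2_def tan2_in2_def by (rule pushout_data.inr_hom[OF pushout_data_tan2])

lemma tan2_in_eq:
  assumes "a \<in> carrier A"
  shows "tan2_in2 R P A (inA a) = tan2_in1 R P A (inA a)"
  using pushout_data.inl_inr[OF pushout_data_tan2 assms] assms
  by (simp add: tan2_in1_def tan2_in2_def tan_p_def)

lemma tan2_hom_exists: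
  assumes "operad_algebra R P E" "algebra_map R P TA E h\<^sub>1" "algebra_map R P TA E h\<^sub>2"
    "\<And>a. a \<in> carrier A \<Longrightarrow> h\<^sub>1 (inA a) = h\<^sub>2 (inA a)"
  shows "\<exists>h\<in>alg_hom R P (tan2 R P A) E.
    (\<forall>x\<in>carrier TA. h (tan2_in1 R P A x) = h\<^sub>1 x) \<and> (\<forall>x\<in>carrier TA. h (tan2_in2 R P A x) = h\<^sub>2 x)"
  unfolding tan2_def tan2_in1_def tan2_in2_def
  by (rule pushout_data.pushout_hom_exists[OF pushout_data_tan2 assms(1-3)])
    (simp add: tan_p_def assms(4))

lemma tan2_hom_eq:
  assumes "module R E" "h \<in> alg_hom R P (tan2 R P A) E" "k \<in> alg_hom R P (tan2 R P A) E"
    "\<And>x. x \<in> carrier TA \<Longrightarrow> h (tan2_in1 R P A x) = k (tan2_in1 R P A x)"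
    "\<And>x. x \<in> carrier TA \<Longrightarrow> h (tan2_in2 R P A x) = k (tan2_in2 R P A x)"
  shows "h = k"
  using pushout_data.pushout_hom_eq[OF pushout_data_tan2 assms(1), of h k] assms(2-5)
  unfolding tan2_def tan2_in1_def tan2_in2_def by simp

lemma tan_s:
  shows "tan_s R P A \<in> alg_hom R P TA (tan2 R P A)"
    "\<And>a. a \<in> carrier A \<Longrightarrow> tan_s R P A (inA a) = tan2_in1 R P A (inA a)"
    "\<And>a. a \<in> carrier A \<Longrightarrow> tan_s R P A (dA a) =
      tan2_in1 R P A (dA a) \<oplus>\<^bsub>tan2 R P A\<^esub> tan2_in2 R P A (dA a)"
proof -
  interpret T: operad_algebra R P TA by (rule operad_algebra_tan)
  interpret T2: operad_algebra R P "tan2 R P A" by (rule operad_algebra_tan2)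
  note in1 = alg_hom_algebra_map[OF tan2_in1_hom] and in2 = alg_hom_algebra_map[OF tan2_in2_hom]
  have f: "algebra_map R P A (tan2 R P A) (\<lambda>a. tan2_in1 R P A (inA a))"
    by (rule algebra_map_compose[OF tan_in_algebra_map in1])
  have d1: "derivation_along R P A (tan2 R P A) (\<lambda>a. tan2_in1 R P A (inA a)) (\<lambda>a. tan2_in1 R P A (dA a))"
    by (rule derivation_along_compose[OF operad_algebra_tan operad_algebra_tan2 tan_d_derivation
          tan_in_linear in1])
  \<comment> \<open>This is a derivation along the second injection to begin with. Both injections
    agree on \<open>A\<close>, so it is also one along the morphism used in \<open>d1\<close>, which
    is what allows the two to be added.\<close>
  have d2: "derivation_along R P A (tan2 R P A) (\<lambda>a. tan2_in1 R P A (inA a)) (\<lambda>a. tan2_in2 R P A (dA a))"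
    by (rule derivation_along_cong[OF ops_algebra derivation_along_compose[OF operad_algebra_tan
            operad_algebra_tan2 tan_d_derivation tan_in_linear in2]])
      (simp_all add: tan2_in_eq)
  have "\<exists>!g. g \<in> alg_hom R P TA (tan2 R P A) \<and>
      (\<forall>a\<in>carrier A. g (inA a) = tan2_in1 R P A (inA a) \<and>
        g (dA a) = tan2_in1 R P A (dA a) \<oplus>\<^bsub>tan2 R P A\<^esub> tan2_in2 R P A (dA a))"
    by (rule tan_hom_ex1[OF operad_algebra_tan2 f
          T2.derivation_along_add[OF algebra_map_linear[OF f] d1 d2]])
  from theI'[OF this] show "tan_s R P A \<in> alg_hom R P TA (tan2 R P A)"
    "\<And>a. a \<in> carrier A \<Longrightarrow> tan_s R P A (inA a) = tan2_in1 R P A (inA a)"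
    "\<And>a. a \<in> carrier A \<Longrightarrow> tan_s R P A (dA a) =
      tan2_in1 R P A (dA a) \<oplus>\<^bsub>tan2 R P A\<^esub> tan2_in2 R P A (dA a)"
    by (simp_all add: tan_s_def)
qed

text \<open>The converse of \<open>tan_hom_exists\<close>: morphisms out of T of an algebra become
  morphisms into dual numbers, which removes one level of T at a time.\<close>

lemma tan_hom_dual:
  assumes "operad_algebra R P B" "h \<in> alg_hom R P TA B"
  shows "algebra_map R P A (dual_alg B) (\<lambda>a. (h (inA a), h (dA a)))"
  using algebra_map_compose[OF tan_in_algebra_map alg_hom_algebra_map[OF assms(2)]]
    derivation_along_compose[OF operad_algebra_tan assms(1) tan_d_derivation tan_in_linear
      alg_hom_algebra_map[OF assms(2)]]
  by (simp add: algebra_map_dual_iff)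

end

section \<open>Second-order derivations\<close>

text \<open>The value of a composite of two derivations on \<open>\<mu>(xs)\<close>, if the first one takes \<open>xs\<close> to \<open>ys\<close>, the
  second one takes \<open>xs\<close> to \<open>zs\<close> and the composite takes \<open>xs\<close> to \<open>ws\<close>.\<close>

definition leibniz2 ::
  "('r, 'p, 'b) opalg \<Rightarrow> 'p \<Rightarrow> 'b list \<Rightarrow> 'b list \<Rightarrow> 'b list \<Rightarrow> 'b list \<Rightarrow> 'b"
  where "leibniz2 B \<mu> xs ys zs ws =
    (\<Oplus>\<^bsub>B\<^esub>i\<in>{..<length xs}. leibniz B \<mu> (xs[i := ys ! i]) (zs[i := ws ! i]))"

context operad_algebra
begin

interpretation AM: module R A by (rule module_alg)

text \<open>The second component of each summand over the dual numbers is itself a Leibniz sum;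
  adding these up gives \<open>leibniz2\<close>.\<close>

lemma leibniz_dual:
  assumes \<mu>: "\<mu> \<in> carrier (ops P (length xs))" and xs: "set xs \<subseteq> carrier (dual_alg A)"
    and ys: "set ys \<subseteq> carrier (dual_alg A)" and len: "length ys = length xs"
  shows "leibniz (dual_alg A) \<mu> xs ys =
    (leibniz A \<mu> (map fst xs) (map fst ys), leibniz2 A \<mu> (map fst xs) (map fst ys) (map snd xs) (map snd ys))"
proof -
  interpret U: operad_algebra R P "dual_alg A" by (rule operad_algebra_dual)
  have lin: "linear_map R (dual_alg A) A fst" "linear_map R (dual_alg A) A snd"
    by (auto simp: linear_map_def)
  have yi: "ys ! i \<in> carrier (dual_alg A)" if "i < length xs" for i
    using that ys len by (metis in_mono nth_mem)
  have tm: "oper (dual_alg A) \<mu> (xs[i := ys ! i]) =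
      (oper A \<mu> ((map fst xs)[i := map fst ys ! i]),
        leibniz A \<mu> ((map fst xs)[i := map fst ys ! i]) ((map snd xs)[i := map snd ys ! i]))"
    if "i < length xs" for i
    using that len by (simp add: map_update)
  have cl: "(\<lambda>i. oper (dual_alg A) \<mu> (xs[i := ys ! i])) \<in> {..<length xs} \<rightarrow> carrier (dual_alg A)"
    using U.oper_update_closed[OF \<mu> xs] yi by (auto simp del: dual_alg_simps)
  have cl': "oper A \<mu> ((map fst xs)[i := map fst ys ! i]) \<in> carrier A"
    "leibniz A \<mu> ((map fst xs)[i := map fst ys ! i]) ((map snd xs)[i := map snd ys ! i]) \<in> carrier A"
    if "i < length xs" for i
    using funcset_mem[OF cl, of i] that unfolding tm[OF that] by simp_all
  have "fst (leibniz (dual_alg A) \<mu> xs ys) = leibniz A \<mu> (map fst xs) (map fst ys)"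
    unfolding leibniz_def[of "dual_alg A"] leibniz_def[of A _ "map fst xs"] length_map
      linear_map_finsum[OF module_dual[OF module_alg] module_alg lin(1) finite_lessThan cl]
    by (rule AM.M.finsum_cong') (use cl' tm in auto)
  moreover have "snd (leibniz (dual_alg A) \<mu> xs ys) =
      leibniz2 A \<mu> (map fst xs) (map fst ys) (map snd xs) (map snd ys)"
    unfolding leibniz_def[of "dual_alg A"] leibniz2_def length_map
      linear_map_finsum[OF module_dual[OF module_alg] module_alg lin(2) finite_lessThan cl]
    by (rule AM.M.finsum_cong') (use cl' tm in auto)
  ultimately show ?thesis by (simp add: prod_eq_iff)
qed

text \<open>Here \<open>f\<close>, \<open>\<delta>\<close>, \<open>\<delta>'\<close> and
  \<open>\<epsilon>\<close> play the roles of the values at \<open>a\<close>, \<open>d(a)\<close>,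
  \<open>d'(a)\<close> and \<open>d'd(a)\<close>; the last condition is the second-order Leibniz
  rule.\<close>

lemma derivation_along_dual_iff:
  assumes f: "linear_map R B A f" and \<delta>': "linear_map R B A \<delta>'"
  shows "derivation_along R P B (dual_alg A) (\<lambda>x. (f x, \<delta>' x)) (\<lambda>x. (\<delta> x, \<epsilon> x)) \<longleftrightarrow>
    derivation_along R P B A f \<delta> \<and> linear_map R B A \<epsilon> \<and>
    (\<forall>as. \<forall>\<mu>\<in>carrier (ops P (length as)). set as \<subseteq> carrier B \<longrightarrow>
      \<epsilon> (oper B \<mu> as) = leibniz2 A \<mu> (map f as) (map \<delta> as) (map \<delta>' as) (map \<epsilon> as))"
proof -
  have "leibniz (dual_alg A) \<mu> (map (\<lambda>x. (f x, \<delta>' x)) as) (map (\<lambda>x. (\<delta> x, \<epsilon> x)) as) =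
      (leibniz A \<mu> (map f as) (map \<delta> as), leibniz2 A \<mu> (map f as) (map \<delta> as) (map \<delta>' as) (map \<epsilon> as))"
    if "linear_map R B A \<delta>" "linear_map R B A \<epsilon>" "\<mu> \<in> carrier (ops P (length as))" "set as \<subseteq> carrier B"
    for \<mu> as
  proof -
    have "set (map (\<lambda>x. (f x, \<delta>' x)) as) \<subseteq> carrier (dual_alg A)"
      "set (map (\<lambda>x. (\<delta> x, \<epsilon> x)) as) \<subseteq> carrier (dual_alg A)"
      by (rule linear_map_list_closed[of R B, OF _ that(4)], simp add: linear_map_dual_iff f \<delta>' that)+
    from leibniz_dual[OF _ this] that(3) show ?thesis by (simp add: comp_def)
  qed
  then show ?thesis
    unfolding derivation_along_def linear_map_dual_iff by auto
qed

text \<open>In the double sum over positions \<open>i\<close> and \<open>j\<close>, the terms with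
  \<open>i \<noteq> j\<close> replace two different entries, and the replacements commute; for
  \<open>i = j\<close> the second replacement overwrites the first with an entry of
  \<open>ws\<close>. Exchanging the order of summation therefore exchanges \<open>ys\<close> and
  \<open>zs\<close>.\<close>

lemma leibniz2_swap:
  assumes \<mu>: "\<mu> \<in> carrier (ops P (length xs))" and cl: "set xs \<subseteq> carrier A" "set ys \<subseteq> carrier A"
    "set zs \<subseteq> carrier A" "set ws \<subseteq> carrier A"
    and len: "length ys = length xs" "length zs = length xs" "length ws = length xs"
  shows "leibniz2 A \<mu> xs ys zs ws = leibniz2 A \<mu> xs zs ys ws"
proof -
  let ?n = "length xs"
  have nth: "ys ! i \<in> carrier A" "zs ! i \<in> carrier A" "ws ! i \<in> carrier A" if "i < ?n" for i
    using that cl len by (metis in_mono nth_mem)+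
  let ?t = "\<lambda>ys zs i j. oper A \<mu> (xs[i := ys ! i, j := zs[i := ws ! i] ! j])"
  have closed: "oper A \<mu> (xs[i := y, j := z]) \<in> carrier A"
    if "i < ?n" "j < ?n" "y \<in> carrier A" "z \<in> carrier A" for i j y z
    by (rule oper_update_closed) (use that \<mu> set_update_subsetI[OF cl(1) that(3), of i] in auto)
  have tcl: "?t ys zs i j \<in> carrier A" "?t zs ys i j \<in> carrier A" if "i < ?n" "j < ?n" for i j
    using that nth len by (auto simp: nth_list_update intro!: closed oper_update_closed[OF \<mu> cl(1)])
  have eq: "?t ys zs i j = ?t zs ys j i" if "i < ?n" "j < ?n" for i j
    using that len by (cases "i = j") (auto simp: list_update_swap)
  have "leibniz2 A \<mu> xs ys zs ws = (\<Oplus>\<^bsub>A\<^esub>i\<in>{..<?n}. \<Oplus>\<^bsub>A\<^esub>j\<in>{..<?n}. ?t ys zs i j)"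
    by (simp add: leibniz2_def leibniz_def)
  also have "\<dots> = (\<Oplus>\<^bsub>A\<^esub>j\<in>{..<?n}. \<Oplus>\<^bsub>A\<^esub>i\<in>{..<?n}. ?t ys zs i j)"
    by (rule AM.M.finsum_swap) (rule tcl(1))
  also have "\<dots> = (\<Oplus>\<^bsub>A\<^esub>j\<in>{..<?n}. \<Oplus>\<^bsub>A\<^esub>i\<in>{..<?n}. ?t zs ys j i)"
    by (intro AM.M.finsum_cong') (use tcl eq in \<open>auto intro!: AM.M.finsum_closed\<close>)
  also have "\<dots> = leibniz2 A \<mu> xs zs ys ws"
    by (simp add: leibniz2_def leibniz_def)
  finally show ?thesis .
qed

text \<open>Off the diagonal some argument is an entry of \<open>zs\<close>, hence zero; the
  diagonal terms carry the entries of \<open>ws\<close> and form the ordinary Leibniz sum.\<close>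

lemma leibniz2_zero:
  assumes \<mu>: "\<mu> \<in> carrier (ops P (length xs))" and cl: "set xs \<subseteq> carrier A" "set ys \<subseteq> carrier A"
    "set zs \<subseteq> {\<zero>\<^bsub>A\<^esub>}" "set ws \<subseteq> carrier A"
    and len: "length ys = length xs" "length zs = length xs" "length ws = length xs"
  shows "leibniz2 A \<mu> xs ys zs ws = leibniz A \<mu> xs ws"
proof -
  let ?n = "length xs"
  have nth: "ys ! i \<in> carrier A" "ws ! i \<in> carrier A" "zs ! i = \<zero>\<^bsub>A\<^esub>" if "i < ?n" for i
    using that cl len by (metis in_mono nth_mem singletonD)+
  have "leibniz A \<mu> (xs[i := ys ! i]) (zs[i := ws ! i]) = oper A \<mu> (xs[i := ws ! i])"
    if i: "i < ?n" for i
  proof -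
    have s: "set (xs[i := ys ! i]) \<subseteq> carrier A" by (rule set_update_subsetI[OF cl(1) nth(1)[OF i]])
    have z: "oper A \<mu> (xs[i := ys ! i, j := \<zero>\<^bsub>A\<^esub>]) = \<zero>\<^bsub>A\<^esub>" if "j < ?n" for j
      using linear_map_zero[OF module_alg module_alg oper_update_linear[OF _ s, of \<mu> j]] \<mu> that by simp
    have "leibniz A \<mu> (xs[i := ys ! i]) (zs[i := ws ! i]) =
      (\<Oplus>\<^bsub>A\<^esub>j\<in>{..<?n}. if i = j then oper A \<mu> (xs[j := ws ! j]) else \<zero>\<^bsub>A\<^esub>)"
      unfolding leibniz_def length_list_update
      by (rule AM.M.finsum_cong')
        (use i len nth z oper_update_closed[OF \<mu> cl(1)] in \<open>auto simp: nth_list_update\<close>)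
    also have "\<dots> = oper A \<mu> (xs[i := ws ! i])"
      by (rule AM.M.finsum_singleton)
        (use i oper_update_closed[OF \<mu> cl(1)] nth in auto)
    finally show ?thesis .
  qed
  then show ?thesis
    unfolding leibniz2_def leibniz_def[of A \<mu> xs]
    by (intro AM.M.finsum_cong') (use nth oper_update_closed[OF \<mu> cl(1)] in auto)
qed

text \<open>The canonical flip before passage to T(T(A)): the two first-order parts change places,
  the second-order part stays, and \<open>leibniz2_swap\<close> shows that the rule is the
  same.\<close>

lemma derivation_along_dual_swap:
  assumes F: "algebra_map R P B (dual_alg A) (\<lambda>x. (f x, \<delta>' x))"
    and \<Delta>: "derivation_along R P B (dual_alg A) (\<lambda>x. (f x, \<delta>' x)) (\<lambda>x. (\<delta> x, \<epsilon> x))"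
  shows "algebra_map R P B (dual_alg A) (\<lambda>x. (f x, \<delta> x))"
    "derivation_along R P B (dual_alg A) (\<lambda>x. (f x, \<delta> x)) (\<lambda>x. (\<delta>' x, \<epsilon> x))"
proof -
  have f: "algebra_map R P B A f" "derivation_along R P B A f \<delta>'"
    using F by (simp_all add: algebra_map_dual_iff)
  note lf = algebra_map_linear[OF f(1)] and l' = derivation_along_linear[OF f(2)]
  have \<delta>: "derivation_along R P B A f \<delta>" "linear_map R B A \<epsilon>"
    "\<And>as \<mu>. \<mu> \<in> carrier (ops P (length as)) \<Longrightarrow> set as \<subseteq> carrier B \<Longrightarrow>
      \<epsilon> (oper B \<mu> as) = leibniz2 A \<mu> (map f as) (map \<delta> as) (map \<delta>' as) (map \<epsilon> as)"
    using \<Delta> unfolding derivation_along_dual_iff[OF lf l'] by auto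
  note l = derivation_along_linear[OF \<delta>(1)]
  show "algebra_map R P B (dual_alg A) (\<lambda>x. (f x, \<delta> x))"
    using f(1) \<delta>(1) by (simp add: algebra_map_dual_iff)
  have "\<epsilon> (oper B \<mu> as) = leibniz2 A \<mu> (map f as) (map \<delta>' as) (map \<delta> as) (map \<epsilon> as)"
    if "\<mu> \<in> carrier (ops P (length as))" "set as \<subseteq> carrier B" for as \<mu>
    unfolding \<delta>(3)[OF that]
    by (rule leibniz2_swap) (use that linear_map_list_closed[OF _ that(2)] lf l' l \<delta>(2) in simp_all)
  then show "derivation_along R P B (dual_alg A) (\<lambda>x. (f x, \<delta> x)) (\<lambda>x. (\<delta>' x, \<epsilon> x))"
    unfolding derivation_along_dual_iff[OF lf l] using f(2) \<delta>(2) by blast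
qed

section \<open>Morphisms out of the double tangent algebra\<close>

abbreviation TTA where "TTA \<equiv> tan_alg R P TA"
abbreviation inT where "inT \<equiv> tan_in R P TA"
abbreviation dT where "dT \<equiv> tan_d R P TA"

text \<open>A morphism on T(T(A)) is determined by the morphism from T(A) to dual numbers that
  collects its values on \<open>inT\<close> and \<open>dT\<close>, and this one by its values on
  \<open>inA\<close> and \<open>dA\<close>.\<close>

lemma tan_tan_hom_eq:
  assumes B: "operad_algebra R P B" and g: "g \<in> alg_hom R P TTA B" "h \<in> alg_hom R P TTA B"
    and eq: "\<And>a. a \<in> carrier A \<Longrightarrow> g (inT (inA a)) = h (inT (inA a))"
      "\<And>a. a \<in> carrier A \<Longrightarrow> g (inT (dA a)) = h (inT (dA a))"
      "\<And>a. a \<in> carrier A \<Longrightarrow> g (dT (inA a)) = h (dT (inA a))"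
      "\<And>a. a \<in> carrier A \<Longrightarrow> g (dT (dA a)) = h (dT (dA a))"
  shows "g = h"
proof -
  interpret T: operad_algebra R P TA by (rule operad_algebra_tan)
  interpret B: operad_algebra R P B by fact
  have r: "restrict (\<lambda>x. (k (inT x), k (dT x))) (carrier TA) \<in> alg_hom R P TA (dual_alg B)"
    if "k \<in> alg_hom R P TTA B" for k
    by (rule algebra_map_restrict[OF T.ops_algebra T.tan_hom_dual[OF B that]])
  have "restrict (\<lambda>x. (g (inT x), g (dT x))) (carrier TA) =
      restrict (\<lambda>x. (h (inT x), h (dT x))) (carrier TA)"
    by (rule tan_hom_eq[OF module_dual[OF B.module_alg] r[OF g(1)] r[OF g(2)]])
      (simp_all add: tan_in_closed tan_d_closed eq)
  note * = fun_cong[OF this]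
  show ?thesis
  proof (rule T.tan_hom_eq[OF B.module_alg g])
    fix x assume "x \<in> carrier TA"
    then show "g (inT x) = h (inT x)" "g (dT x) = h (dT x)" using *[of x] by simp_all
  qed
qed

text \<open>The outer differential is the \<open>\<epsilon>\<close>-direction: the first pair
  consists of the values at \<open>a\<close> and \<open>d'(a)\<close>, the second of those at
  \<open>d(a)\<close> and \<open>d'd(a)\<close>. Existence comes from extending over T(A) with
  values in dual numbers and then over T(T(A)).\<close>

lemma tan_tan_hom_ex1:
  assumes B: "operad_algebra R P B" and F: "algebra_map R P A (dual_alg B) (\<lambda>a. (f a, \<delta>' a))"
    and \<Delta>: "derivation_along R P A (dual_alg B) (\<lambda>a. (f a, \<delta>' a)) (\<lambda>a. (\<delta> a, \<epsilon> a))"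
  shows "\<exists>!g. g \<in> alg_hom R P TTA B \<and> (\<forall>a\<in>carrier A.
    g (inT (inA a)) = f a \<and> g (inT (dA a)) = \<delta> a \<and> g (dT (inA a)) = \<delta>' a \<and> g (dT (dA a)) = \<epsilon> a)"
proof (rule ex_ex1I)
  interpret T: operad_algebra R P TA by (rule operad_algebra_tan)
  interpret B: operad_algebra R P B by fact
  obtain H where H: "H \<in> alg_hom R P TA (dual_alg B)"
    "\<forall>a\<in>carrier A. H (inA a) = (f a, \<delta>' a) \<and> H (dA a) = (\<delta> a, \<epsilon> a)"
    using tan_hom_exists[OF B.operad_algebra_dual F \<Delta>] by (elim bexE)
  have "algebra_map R P TA B (\<lambda>x. fst (H x))"
    "derivation_along R P TA B (\<lambda>x. fst (H x)) (\<lambda>x. snd (H x))"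
    using alg_hom_algebra_map[OF H(1)] by (simp_all add: algebra_map_dual_iff)
  from T.tan_hom_exists[OF B this] obtain g where g: "g \<in> alg_hom R P TTA B"
    "\<forall>x\<in>carrier TA. g (inT x) = fst (H x) \<and> g (dT x) = snd (H x)" by (elim bexE)
  show "\<exists>g. g \<in> alg_hom R P TTA B \<and> (\<forall>a\<in>carrier A.
    g (inT (inA a)) = f a \<and> g (inT (dA a)) = \<delta> a \<and> g (dT (inA a)) = \<delta>' a \<and> g (dT (dA a)) = \<epsilon> a)"
    using g H(2) by (intro exI[of _ g]) (simp add: tan_in_closed tan_d_closed)
next
  fix g h
  assume "g \<in> alg_hom R P TTA B \<and> (\<forall>a\<in>carrier A.
    g (inT (inA a)) = f a \<and> g (inT (dA a)) = \<delta> a \<and> g (dT (inA a)) = \<delta>' a \<and> g (dT (dA a)) = \<epsilon> a)"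
   "h \<in> alg_hom R P TTA B \<and> (\<forall>a\<in>carrier A.
    h (inT (inA a)) = f a \<and> h (inT (dA a)) = \<delta> a \<and> h (dT (inA a)) = \<delta>' a \<and> h (dT (dA a)) = \<epsilon> a)"
  then show "g = h" by (intro tan_tan_hom_eq[OF B]) auto
qed

text \<open>The prescribed first-order parts are zero, so \<open>leibniz2_zero\<close> reduces the
  second-order rule to the Leibniz rule of \<open>d\<close>.\<close>

lemma tan_l:
  shows "tan_l R P A \<in> alg_hom R P TTA TA"
    "\<And>a. a \<in> carrier A \<Longrightarrow> tan_l R P A (inT (inA a)) = inA a"
    "\<And>a. a \<in> carrier A \<Longrightarrow> tan_l R P A (inT (dA a)) = \<zero>\<^bsub>TA\<^esub>"
    "\<And>a. a \<in> carrier A \<Longrightarrow> tan_l R P A (dT (inA a)) = \<zero>\<^bsub>TA\<^esub>"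
    "\<And>a. a \<in> carrier A \<Longrightarrow> tan_l R P A (dT (dA a)) = dA a"
proof -
  interpret T: operad_algebra R P TA by (rule operad_algebra_tan)
  interpret TM: module R TA by (rule T.module_alg)
  note zero = T.derivation_along_zero[OF tan_in_linear]
  have F: "algebra_map R P A (dual_alg TA) (\<lambda>a. (inA a, \<zero>\<^bsub>TA\<^esub>))"
    using tan_in_algebra_map zero by (simp add: algebra_map_dual_iff)
  have "dA (oper A \<mu> as) = leibniz2 TA \<mu> (map inA as) (map (\<lambda>_. \<zero>\<^bsub>TA\<^esub>) as) (map (\<lambda>_. \<zero>\<^bsub>TA\<^esub>) as) (map dA as)"
    if "\<mu> \<in> carrier (ops P (length as))" "set as \<subseteq> carrier A" for \<mu> as
    unfolding derivation_along_oper[OF tan_d_derivation that]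
    by (rule T.leibniz2_zero[symmetric])
      (use that tan_in_closed tan_d_closed in auto)
  then have "derivation_along R P A (dual_alg TA) (\<lambda>a. (inA a, \<zero>\<^bsub>TA\<^esub>)) (\<lambda>a. (\<zero>\<^bsub>TA\<^esub>, dA a))"
    unfolding T.derivation_along_dual_iff[OF tan_in_linear linear_map_zero_fun[OF T.module_alg]]
    using zero tan_d_linear by blast
  from theI'[OF tan_tan_hom_ex1[OF operad_algebra_tan F this]]
  show "tan_l R P A \<in> alg_hom R P TTA TA"
    "\<And>a. a \<in> carrier A \<Longrightarrow> tan_l R P A (inT (inA a)) = inA a"
    "\<And>a. a \<in> carrier A \<Longrightarrow> tan_l R P A (inT (dA a)) = \<zero>\<^bsub>TA\<^esub>"
    "\<And>a. a \<in> carrier A \<Longrightarrow> tan_l R P A (dT (inA a)) = \<zero>\<^bsub>TA\<^esub>"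
    "\<And>a. a \<in> carrier A \<Longrightarrow> tan_l R P A (dT (dA a)) = dA a"
    by (simp_all add: tan_l_def Let_def)
qed

text \<open>The four kinds of generators are the data of the identity in
  \<open>tan_tan_hom_ex1\<close>; \<open>derivation_along_dual_swap\<close> exchanges
  \<open>d(a)\<close> and \<open>d'(a)\<close> in these data.\<close>

lemma tan_c:
  shows "tan_c R P A \<in> alg_hom R P TTA TTA"
    "\<And>a. a \<in> carrier A \<Longrightarrow> tan_c R P A (inT (inA a)) = inT (inA a)"
    "\<And>a. a \<in> carrier A \<Longrightarrow> tan_c R P A (inT (dA a)) = dT (inA a)"
    "\<And>a. a \<in> carrier A \<Longrightarrow> tan_c R P A (dT (inA a)) = inT (dA a)"
    "\<And>a. a \<in> carrier A \<Longrightarrow> tan_c R P A (dT (dA a)) = dT (dA a)"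
proof -
  interpret T: operad_algebra R P TA by (rule operad_algebra_tan)
  interpret TT: operad_algebra R P TTA by (rule T.operad_algebra_tan)
  have K: "algebra_map R P TA (dual_alg TTA) (\<lambda>x. (inT x, dT x))"
    using T.tan_in_algebra_map T.tan_d_derivation by (simp add: algebra_map_dual_iff)
  note F = algebra_map_compose[OF tan_in_algebra_map K]
    and \<Delta> = derivation_along_compose[OF operad_algebra_tan TT.operad_algebra_dual tan_d_derivation
        tan_in_linear K]
  from theI'[OF tan_tan_hom_ex1[OF T.operad_algebra_tan TT.derivation_along_dual_swap[OF F \<Delta>]]]
  show "tan_c R P A \<in> alg_hom R P TTA TTA"
    "\<And>a. a \<in> carrier A \<Longrightarrow> tan_c R P A (inT (inA a)) = inT (inA a)"
    "\<And>a. a \<in> carrier A \<Longrightarrow> tan_c R P A (inT (dA a)) = dT (inA a)"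
    "\<And>a. a \<in> carrier A \<Longrightarrow> tan_c R P A (dT (inA a)) = inT (dA a)"
    "\<And>a. a \<in> carrier A \<Longrightarrow> tan_c R P A (dT (dA a)) = dT (dA a)"
    by (simp_all add: tan_c_def Let_def)
qed

end

section \<open>Vector fields and the Lie bracket\<close>

text \<open>Both functions are extensional on the carrier of \<open>X\<close>, so equality can be
  tested pointwise there.\<close>

lemma compose_eq_iff:
  assumes "f \<in> alg_hom R P X B"
  shows "compose (carrier X) h i = f \<longleftrightarrow> (\<forall>x\<in>carrier X. h (i x) = f x)"
proof
  assume "compose (carrier X) h i = f"
  then show "\<forall>x\<in>carrier X. h (i x) = f x" by (auto simp: compose_def)
next
  assume *: "\<forall>x\<in>carrier X. h (i x) = f x"
  show "compose (carrier X) h i = f"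
    by (rule extensionalityI[where A = "carrier X"])
      (use assms * in \<open>auto simp: compose_def alg_hom_def PiE_def\<close>)
qed

text \<open>Stated for arbitrary \<open>i\<^sub>1\<close> and \<open>i\<^sub>2\<close>, because
  copairings are formed both over T_2 of an algebra and over T(T_2(A)).\<close>

lemma copair_eqI:
  assumes "f\<^sub>1 \<in> alg_hom R P X B" "f\<^sub>2 \<in> alg_hom R P X B"
    and ex1: "\<exists>!h. h \<in> alg_hom R P Q B \<and> (\<forall>x\<in>carrier X. h (i\<^sub>1 x) = f\<^sub>1 x) \<and> (\<forall>x\<in>carrier X. h (i\<^sub>2 x) = f\<^sub>2 x)"
  shows "copair R P X Q i\<^sub>1 i\<^sub>2 B f\<^sub>1 f\<^sub>2 \<in> alg_hom R P Q B"
    "\<And>x. x \<in> carrier X \<Longrightarrow> copair R P X Q i\<^sub>1 i\<^sub>2 B f\<^sub>1 f\<^sub>2 (i\<^sub>1 x) = f\<^sub>1 x"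
    "\<And>x. x \<in> carrier X \<Longrightarrow> copair R P X Q i\<^sub>1 i\<^sub>2 B f\<^sub>1 f\<^sub>2 (i\<^sub>2 x) = f\<^sub>2 x"
  using theI'[OF ex1]
  unfolding copair_def compose_eq_iff[OF assms(1)] compose_eq_iff[OF assms(2)] by auto

context operad_algebra
begin

interpretation AM: module R A by (rule module_alg)

lemma copair_tan2:
  assumes E: "operad_algebra R P E" and f: "f\<^sub>1 \<in> alg_hom R P TA E" "f\<^sub>2 \<in> alg_hom R P TA E"
    and agree: "\<And>a. a \<in> carrier A \<Longrightarrow> f\<^sub>1 (inA a) = f\<^sub>2 (inA a)"
  shows "copair R P TA (tan2 R P A) (tan2_in1 R P A) (tan2_in2 R P A) E f\<^sub>1 f\<^sub>2 \<in> alg_hom R P (tan2 R P A) E"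
    "\<And>x. x \<in> carrier TA \<Longrightarrow>
      copair R P TA (tan2 R P A) (tan2_in1 R P A) (tan2_in2 R P A) E f\<^sub>1 f\<^sub>2 (tan2_in1 R P A x) = f\<^sub>1 x"
    "\<And>x. x \<in> carrier TA \<Longrightarrow>
      copair R P TA (tan2 R P A) (tan2_in1 R P A) (tan2_in2 R P A) E f\<^sub>1 f\<^sub>2 (tan2_in2 R P A x) = f\<^sub>2 x"
proof -
  have "\<exists>!h. h \<in> alg_hom R P (tan2 R P A) E \<and> (\<forall>x\<in>carrier TA. h (tan2_in1 R P A x) = f\<^sub>1 x) \<and>
    (\<forall>x\<in>carrier TA. h (tan2_in2 R P A x) = f\<^sub>2 x)"
  proof (rule ex_ex1I)
    show "\<exists>h. h \<in> alg_hom R P (tan2 R P A) E \<and> (\<forall>x\<in>carrier TA. h (tan2_in1 R P A x) = f\<^sub>1 x) \<and>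
      (\<forall>x\<in>carrier TA. h (tan2_in2 R P A x) = f\<^sub>2 x)"
      using tan2_hom_exists[OF E alg_hom_algebra_map[OF f(1)] alg_hom_algebra_map[OF f(2)]] agree
      by (simp only: Bex_def)
  next
    fix h k
    assume "h \<in> alg_hom R P (tan2 R P A) E \<and> (\<forall>x\<in>carrier TA. h (tan2_in1 R P A x) = f\<^sub>1 x) \<and>
        (\<forall>x\<in>carrier TA. h (tan2_in2 R P A x) = f\<^sub>2 x)"
      "k \<in> alg_hom R P (tan2 R P A) E \<and> (\<forall>x\<in>carrier TA. k (tan2_in1 R P A x) = f\<^sub>1 x) \<and>
        (\<forall>x\<in>carrier TA. k (tan2_in2 R P A x) = f\<^sub>2 x)"
    then show "h = k" by (intro tan2_hom_eq[OF operad_algebra.module_alg[OF E]]) auto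
  qed
  from copair_eqI[OF f this]
  show "copair R P TA (tan2 R P A) (tan2_in1 R P A) (tan2_in2 R P A) E f\<^sub>1 f\<^sub>2 \<in> alg_hom R P (tan2 R P A) E"
    "\<And>x. x \<in> carrier TA \<Longrightarrow>
      copair R P TA (tan2 R P A) (tan2_in1 R P A) (tan2_in2 R P A) E f\<^sub>1 f\<^sub>2 (tan2_in1 R P A x) = f\<^sub>1 x"
    "\<And>x. x \<in> carrier TA \<Longrightarrow>
      copair R P TA (tan2 R P A) (tan2_in1 R P A) (tan2_in2 R P A) E f\<^sub>1 f\<^sub>2 (tan2_in2 R P A x) = f\<^sub>2 x"
    by auto
qed

abbreviation T2A where "T2A \<equiv> tan2 R P A"
abbreviation Tin1 where "Tin1 \<equiv> tan_map R P TA T2A (tan2_in1 R P A)"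
abbreviation Tin2 where "Tin2 \<equiv> tan_map R P TA T2A (tan2_in2 R P A)"

lemma Tin1:
  "Tin1 \<in> alg_hom R P TTA (tan_alg R P T2A)"
  "\<And>x. x \<in> carrier TA \<Longrightarrow> Tin1 (inT x) = tan_in R P T2A (tan2_in1 R P A x)"
  "\<And>x. x \<in> carrier TA \<Longrightarrow> Tin1 (dT x) = tan_d R P T2A (tan2_in1 R P A x)"
  using operad_algebra.tan_map[OF operad_algebra_tan operad_algebra_tan2 alg_hom_algebra_map[OF tan2_in1_hom]]
  by auto

lemma Tin2:
  "Tin2 \<in> alg_hom R P TTA (tan_alg R P T2A)"
  "\<And>x. x \<in> carrier TA \<Longrightarrow> Tin2 (inT x) = tan_in R P T2A (tan2_in2 R P A x)"
  "\<And>x. x \<in> carrier TA \<Longrightarrow> Tin2 (dT x) = tan_d R P T2A (tan2_in2 R P A x)"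
  using operad_algebra.tan_map[OF operad_algebra_tan operad_algebra_tan2 alg_hom_algebra_map[OF tan2_in2_hom]]
  by auto

text \<open>The tangent functor preserves the pushout \<open>tan2 R P A\<close>, because morphisms from \<open>T(B)\<close> to \<open>E\<close> are
  morphisms from \<open>B\<close> to the dual numbers over \<open>E\<close>.\<close>

lemma copair_tan_tan2:
  assumes E: "operad_algebra R P E" and f: "f\<^sub>1 \<in> alg_hom R P TTA E" "f\<^sub>2 \<in> alg_hom R P TTA E"
    and agree: "\<And>a. a \<in> carrier A \<Longrightarrow> f\<^sub>1 (inT (inA a)) = f\<^sub>2 (inT (inA a))"
      "\<And>a. a \<in> carrier A \<Longrightarrow> f\<^sub>1 (dT (inA a)) = f\<^sub>2 (dT (inA a))"
  shows "copair R P TTA (tan_alg R P T2A) Tin1 Tin2 E f\<^sub>1 f\<^sub>2 \<in> alg_hom R P (tan_alg R P T2A) E"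
    "\<And>x. x \<in> carrier TTA \<Longrightarrow> copair R P TTA (tan_alg R P T2A) Tin1 Tin2 E f\<^sub>1 f\<^sub>2 (Tin1 x) = f\<^sub>1 x"
    "\<And>x. x \<in> carrier TTA \<Longrightarrow> copair R P TTA (tan_alg R P T2A) Tin1 Tin2 E f\<^sub>1 f\<^sub>2 (Tin2 x) = f\<^sub>2 x"
proof -
  interpret E: operad_algebra R P E by fact
  interpret T: operad_algebra R P TA by (rule operad_algebra_tan)
  interpret TT: operad_algebra R P TTA by (rule T.operad_algebra_tan)
  interpret T2: operad_algebra R P T2A by (rule operad_algebra_tan2)
  have "\<exists>!h. h \<in> alg_hom R P T2.TA E \<and> (\<forall>x\<in>carrier TTA. h (Tin1 x) = f\<^sub>1 x) \<and>
    (\<forall>x\<in>carrier TTA. h (Tin2 x) = f\<^sub>2 x)"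
  proof (rule ex_ex1I)
    \<comment> \<open>The copairing is formed with values in the dual numbers over \<open>E\<close>;
      the two equations \<open>agree\<close> give compatibility in the two components.\<close>
    have "\<exists>H\<in>alg_hom R P T2A (dual_alg E).
      (\<forall>x\<in>carrier TA. H (tan2_in1 R P A x) = (f\<^sub>1 (inT x), f\<^sub>1 (dT x))) \<and>
      (\<forall>x\<in>carrier TA. H (tan2_in2 R P A x) = (f\<^sub>2 (inT x), f\<^sub>2 (dT x)))"
      by (rule tan2_hom_exists[OF E.operad_algebra_dual T.tan_hom_dual[OF E f(1)] T.tan_hom_dual[OF E f(2)]])
        (simp add: agree)
    then obtain H where H: "H \<in> alg_hom R P T2A (dual_alg E)"
      "\<forall>x\<in>carrier TA. H (tan2_in1 R P A x) = (f\<^sub>1 (inT x), f\<^sub>1 (dT x))"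
      "\<forall>x\<in>carrier TA. H (tan2_in2 R P A x) = (f\<^sub>2 (inT x), f\<^sub>2 (dT x))"
      by (elim bexE conjE)
    have "algebra_map R P T2A E (\<lambda>y. fst (H y))"
      "derivation_along R P T2A E (\<lambda>y. fst (H y)) (\<lambda>y. snd (H y))"
      using alg_hom_algebra_map[OF H(1)] by (simp_all add: algebra_map_dual_iff)
    from T2.tan_hom_exists[OF E this] obtain h where h: "h \<in> alg_hom R P T2.TA E"
      "\<forall>y\<in>carrier T2A. h (T2.inA y) = fst (H y) \<and> h (T2.dA y) = snd (H y)" by (elim bexE)
    have cl: "tan2_in1 R P A x \<in> carrier T2A" "tan2_in2 R P A x \<in> carrier T2A" if "x \<in> carrier TA" for x
      by (rule alg_hom_closed[OF tan2_in1_hom that] alg_hom_closed[OF tan2_in2_hom that])+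
    have 1: "compose (carrier TTA) h Tin1 = f\<^sub>1"
      by (rule T.tan_hom_eq[OF E.module_alg alg_hom_compose[OF T.operad_algebra_tan Tin1(1) h(1)] f(1)])
        (use h(2) H(2) cl in \<open>simp_all add: compose_def T.tan_in_closed T.tan_d_closed Tin1\<close>)
    have 2: "compose (carrier TTA) h Tin2 = f\<^sub>2"
      by (rule T.tan_hom_eq[OF E.module_alg alg_hom_compose[OF T.operad_algebra_tan Tin2(1) h(1)] f(2)])
        (use h(2) H(3) cl in \<open>simp_all add: compose_def T.tan_in_closed T.tan_d_closed Tin2\<close>)
    show "\<exists>h. h \<in> alg_hom R P T2.TA E \<and> (\<forall>x\<in>carrier TTA. h (Tin1 x) = f\<^sub>1 x) \<and>
      (\<forall>x\<in>carrier TTA. h (Tin2 x) = f\<^sub>2 x)"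
      using 1 2 h(1) unfolding compose_eq_iff[OF f(1)] compose_eq_iff[OF f(2)] by (intro exI conjI)
  next
    fix h k
    assume h: "h \<in> alg_hom R P T2.TA E \<and> (\<forall>x\<in>carrier TTA. h (Tin1 x) = f\<^sub>1 x) \<and>
        (\<forall>x\<in>carrier TTA. h (Tin2 x) = f\<^sub>2 x)"
      and k: "k \<in> alg_hom R P T2.TA E \<and> (\<forall>x\<in>carrier TTA. k (Tin1 x) = f\<^sub>1 x) \<and>
        (\<forall>x\<in>carrier TTA. k (Tin2 x) = f\<^sub>2 x)"
    have r: "restrict (\<lambda>y. (l (T2.inA y), l (T2.dA y))) (carrier T2A) \<in> alg_hom R P T2A (dual_alg E)"
      if "l \<in> alg_hom R P T2.TA E" for l
      by (rule algebra_map_restrict[OF T2.ops_algebra T2.tan_hom_dual[OF E that]])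
    have cl: "tan2_in1 R P A x \<in> carrier T2A" "tan2_in2 R P A x \<in> carrier T2A" if "x \<in> carrier TA" for x
      by (rule alg_hom_closed[OF tan2_in1_hom that] alg_hom_closed[OF tan2_in2_hom that])+
    have vals: "l (T2.inA (tan2_in1 R P A x)) = f\<^sub>1 (inT x)" "l (T2.dA (tan2_in1 R P A x)) = f\<^sub>1 (dT x)"
      "l (T2.inA (tan2_in2 R P A x)) = f\<^sub>2 (inT x)" "l (T2.dA (tan2_in2 R P A x)) = f\<^sub>2 (dT x)"
      if "\<forall>x\<in>carrier TTA. l (Tin1 x) = f\<^sub>1 x" "\<forall>x\<in>carrier TTA. l (Tin2 x) = f\<^sub>2 x" "x \<in> carrier TA" for l x
      using that(3) bspec[OF that(1), of "inT x"] bspec[OF that(1), of "dT x"]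
        bspec[OF that(2), of "inT x"] bspec[OF that(2), of "dT x"]
      by (simp_all add: T.tan_in_closed T.tan_d_closed Tin1 Tin2)
    have "restrict (\<lambda>y. (h (T2.inA y), h (T2.dA y))) (carrier T2A) =
        restrict (\<lambda>y. (k (T2.inA y), k (T2.dA y))) (carrier T2A)"
      by (rule tan2_hom_eq[OF module_dual[OF E.module_alg] r r])
        (use h k vals[of h] vals[of k] cl in simp_all)
    note * = fun_cong[OF this]
    show "h = k"
    proof (rule T2.tan_hom_eq[OF E.module_alg])
      fix y assume "y \<in> carrier T2A"
      then show "h (T2.inA y) = k (T2.inA y)" "h (T2.dA y) = k (T2.dA y)" using *[of y] by simp_all
    qed (use h k in simp_all)
  qed
  from copair_eqI[OF f this]
  show "copair R P TTA T2.TA Tin1 Tin2 E f\<^sub>1 f\<^sub>2 \<in> alg_hom R P T2.TA E"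
    "\<And>x. x \<in> carrier TTA \<Longrightarrow> copair R P TTA T2.TA Tin1 Tin2 E f\<^sub>1 f\<^sub>2 (Tin1 x) = f\<^sub>1 x"
    "\<And>x. x \<in> carrier TTA \<Longrightarrow> copair R P TTA T2.TA Tin1 Tin2 E f\<^sub>1 f\<^sub>2 (Tin2 x) = f\<^sub>2 x"
    by auto
qed

lemma vector_fields_iff:
  "v \<in> vector_fields R P A \<longleftrightarrow> v \<in> alg_hom R P TA A \<and> (\<forall>a\<in>carrier A. v (inA a) = a)"
proof -
  have "restrict (\<lambda>a. a) (carrier A) \<in> alg_hom R P A A"
    by (rule algebra_map_restrict[OF ops_algebra algebra_map_id])
  from compose_eq_iff[OF this, where h = v and i = "tan_p R P A"] show ?thesis
    by (simp add: vector_fields_def) (simp add: tan_p_def)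
qed

text \<open>Composing the universal derivation with \<open>v\<close> gives a derivation along
  \<open>v\<close> after \<open>inA\<close>, which is the identity for a vector field.\<close>

lemma derivation_of_derivation:
  assumes "v \<in> vector_fields R P A"
  shows "derivation_along R P A A (\<lambda>a. a) (\<lambda>a. v (dA a))"
  using assms derivation_along_cong[OF ops_algebra
      derivation_along_compose[OF operad_algebra_tan operad_algebra_axioms tan_d_derivation
        tan_in_linear alg_hom_algebra_map], of v "\<lambda>a. a" "\<lambda>a. v (dA a)"]
  by (simp add: vector_fields_iff)

lemma derivation_of_mem:
  assumes "v \<in> vector_fields R P A"
  shows "derivation_of R P A v \<in> derivations R P A"
proof -
  have "derivation_along R P A A (\<lambda>a. a) (derivation_of R P A v)"
    by (rule derivation_along_cong[OF ops_algebra derivation_of_derivation[OF assms]])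
      (simp_all add: derivation_of_def)
  moreover have "derivation_of R P A v \<in> carrier A \<rightarrow>\<^sub>E carrier A"
    using assms alg_hom_closed[of v R P TA A] tan_d_closed
    by (auto simp: derivation_of_def vector_fields_iff)
  ultimately show ?thesis by (simp add: derivations_iff)
qed

lemma vector_field_exists:
  assumes "derivation_along R P A A (\<lambda>a. a) D"
  shows "\<exists>v\<in>vector_fields R P A. \<forall>a\<in>carrier A. v (dA a) = D a"
  using tan_hom_exists[OF operad_algebra_axioms algebra_map_id assms]
  by (auto simp: vector_fields_iff)

lemma vector_field_eqI:
  assumes "v \<in> vector_fields R P A" "w \<in> vector_fields R P A"
    "\<And>a. a \<in> carrier A \<Longrightarrow> v (dA a) = w (dA a)"
  shows "v = w"
  by (rule tan_hom_eq[OF module_alg]) (use assms in \<open>simp_all add: vector_fields_iff\<close>)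

lemma bij_betw_derivation_of:
  "bij_betw (derivation_of R P A) (vector_fields R P A) (derivations R P A)"
  unfolding bij_betw_def
proof (intro conjI equalityI subsetI inj_onI)
  fix v w assume vw: "v \<in> vector_fields R P A" "w \<in> vector_fields R P A"
    and eq: "derivation_of R P A v = derivation_of R P A w"
  show "v = w"
  proof (rule vector_field_eqI[OF vw])
    fix a assume "a \<in> carrier A"
    then show "v (dA a) = w (dA a)" using fun_cong[OF eq, of a] by (simp add: derivation_of_def)
  qed
next
  fix D assume "D \<in> derivation_of R P A ` vector_fields R P A"
  then show "D \<in> derivations R P A" using derivation_of_mem by blast
next
  fix D assume D: "D \<in> derivations R P A"
  then obtain v where v: "v \<in> vector_fields R P A" "\<forall>a\<in>carrier A. v (dA a) = D a"
    using vector_field_exists[of D] by (auto simp: derivations_iff)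
  have "derivation_of R P A v = D"
    by (rule extensionalityI[where A = "carrier A"])
      (use v(2) D in \<open>auto simp: derivation_of_def derivations_iff PiE_def\<close>)
  then show "D \<in> derivation_of R P A ` vector_fields R P A" using v(1) by blast
qed

section \<open>The bracket of two fixed vector fields\<close>

context
  fixes v w
  assumes v: "v \<in> vector_fields R P A" and w: "w \<in> vector_fields R P A"
begin

private lemma vh: "v \<in> alg_hom R P TA A" "\<And>a. a \<in> carrier A \<Longrightarrow> v (inA a) = a"
  using v by (simp_all add: vector_fields_iff)

private lemma wh: "w \<in> alg_hom R P TA A" "\<And>a. a \<in> carrier A \<Longrightarrow> w (inA a) = a"
  using w by (simp_all add: vector_fields_iff)

private lemma vd: "a \<in> carrier A \<Longrightarrow> v (dA a) \<in> carrier A"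
  by (rule alg_hom_closed[OF vh(1) tan_d_closed])

private lemma wd: "a \<in> carrier A \<Longrightarrow> w (dA a) \<in> carrier A"
  by (rule alg_hom_closed[OF wh(1) tan_d_closed])

lemma bracket_delta:
  shows "bracket_delta R P A v w \<in> alg_hom R P TTA A"
    "\<And>a. a \<in> carrier A \<Longrightarrow> bracket_delta R P A v w (inT (inA a)) = a"
    "\<And>a. a \<in> carrier A \<Longrightarrow> bracket_delta R P A v w (inT (dA a)) = w (dA a)"
    "\<And>a. a \<in> carrier A \<Longrightarrow> bracket_delta R P A v w (dT (inA a)) = \<zero>\<^bsub>A\<^esub>"
    "\<And>a. a \<in> carrier A \<Longrightarrow>
      bracket_delta R P A v w (dT (dA a)) = v (dA (w (dA a))) \<ominus>\<^bsub>A\<^esub> w (dA (v (dA a)))"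
proof -
  interpret T: operad_algebra R P TA by (rule operad_algebra_tan)
  interpret TT: operad_algebra R P TTA by (rule T.operad_algebra_tan)
  interpret TTM: module R TTA by (rule TT.module_alg)
  note Tv = T.tan_map[OF operad_algebra_axioms alg_hom_algebra_map[OF vh(1)]]
  note Tw = T.tan_map[OF operad_algebra_axioms alg_hom_algebra_map[OF wh(1)]]
  define f where "f = compose (carrier TTA) v (tan_map R P TA A w)"
  define cn where "cn = compose (carrier TTA) (tan_c R P A) (tan_n R P TA)"
  define g where "g = compose (carrier TTA) w (compose (carrier TTA) (tan_map R P TA A v) cn)"
  have fh: "f \<in> alg_hom R P TTA A"
    unfolding f_def by (rule alg_hom_compose[OF T.operad_algebra_tan Tw(1) vh(1)])
  have cnh: "cn \<in> alg_hom R P TTA TTA"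
    unfolding cn_def by (rule alg_hom_compose[OF T.operad_algebra_tan T.tan_n(1) tan_c(1)])
  have gh: "g \<in> alg_hom R P TTA A"
    unfolding g_def
    by (rule alg_hom_compose[OF T.operad_algebra_tan alg_hom_compose[OF T.operad_algebra_tan cnh Tv(1)] wh(1)])
  note cl = tan_in_closed tan_d_closed T.tan_in_closed T.tan_d_closed
  note w_cl = alg_hom_closed[OF wh(1)] and v_cl = alg_hom_closed[OF vh(1)]
  have f_in: "f (inT x) = w x" "f (dT x) = v (dA (w x))" if "x \<in> carrier TA" for x
    using that by (simp_all add: f_def compose_def cl Tw vh w_cl)
  \<comment> \<open>In the direction of algebras the negation comes before the flip, so the signs
    land on \<open>d'(a)\<close> and \<open>d'd(a)\<close>; the flip then carries the first of these
    to \<open>d(a)\<close>, sign included.\<close>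
  have cn: "cn (inT (inA a)) = inT (inA a)" "cn (inT (dA a)) = dT (inA a)"
    "cn (dT (inA a)) = \<ominus>\<^bsub>TTA\<^esub> inT (dA a)" "cn (dT (dA a)) = \<ominus>\<^bsub>TTA\<^esub> dT (dA a)"
    if "a \<in> carrier A" for a
    using that
    by (simp_all add: cn_def compose_def cl T.tan_n tan_c
        linear_map_uminus[OF TT.module_alg TT.module_alg alg_hom_linear[OF tan_c(1)]])
  have neg: "w (tan_map R P TA A v (\<ominus>\<^bsub>TTA\<^esub> y)) = \<ominus>\<^bsub>A\<^esub> w (tan_map R P TA A v y)" if "y \<in> carrier TTA" for y
    by (rule linear_map_uminus[OF TT.module_alg module_alg
          linear_map_compose[OF alg_hom_linear[OF Tv(1)] alg_hom_linear[OF wh(1)]] that])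
  have g1: "g (inT (inA a)) = a" "g (inT (dA a)) = w (dA a)"
    "g (dT (inA a)) = \<ominus>\<^bsub>A\<^esub> v (dA a)" "g (dT (dA a)) = \<ominus>\<^bsub>A\<^esub> w (dA (v (dA a)))"
    if "a \<in> carrier A" for a
    using that by (simp_all add: g_def compose_def cl cn neg Tv vh wh v_cl)
  \<comment> \<open>The copairing requires \<open>f\<close> and \<open>g\<close> to agree on the
    image of T(A). For \<open>f\<close> the value is immediate; for \<open>g\<close> only the values
    at \<open>inA\<close> and \<open>dA\<close> are known, so uniqueness of morphisms out of T(A) is
    invoked.\<close>
  have g_in: "g (inT x) = w x" if "x \<in> carrier TA" for x
  proof -
    have "restrict (\<lambda>x. g (inT x)) (carrier TA) = w"
      by (rule tan_hom_eq[OF module_alg algebra_map_restrict[OF T.ops_algebra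
              algebra_map_compose[OF T.tan_in_algebra_map alg_hom_algebra_map[OF gh]]] wh(1)])
        (simp_all add: cl g1 wh)
    from fun_cong[OF this, of x] that show ?thesis by simp
  qed
  let ?h = "copair R P TTA (tan2 R P TA) (tan2_in1 R P TA) (tan2_in2 R P TA) A f g"
  have "f (inT x) = g (inT x)" if "x \<in> carrier TA" for x
    using that by (simp add: f_in g_in)
  note h = T.copair_tan2[OF operad_algebra_axioms fh gh this]
  have \<delta>: "bracket_delta R P A v w = compose (carrier TTA) ?h (tan_s R P TA)"
    by (simp add: bracket_delta_def Let_def f_def g_def cn_def)
  show "bracket_delta R P A v w \<in> alg_hom R P TTA A"
    unfolding \<delta> by (rule alg_hom_compose[OF T.operad_algebra_tan T.tan_s(1) h(1)])
  have \<delta>_in: "bracket_delta R P A v w (inT x) = w x" if "x \<in> carrier TA" for x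
    using that by (simp add: \<delta> compose_def cl T.tan_s h f_in)
  \<comment> \<open>\<open>tan_s\<close> splits \<open>dT x\<close> into its two copies, on which
    the copairing is \<open>f\<close> and \<open>g\<close>.\<close>
  have \<delta>_d: "bracket_delta R P A v w (dT x) = v (dA (w x)) \<oplus>\<^bsub>A\<^esub> g (dT x)" if "x \<in> carrier TA" for x
    using that
    by (simp add: \<delta> compose_def cl T.tan_s h f_in linear_map_add[OF alg_hom_linear[OF h(1)]]
        alg_hom_closed[OF T.tan2_in1_hom] alg_hom_closed[OF T.tan2_in2_hom])
  fix a assume a: "a \<in> carrier A"
  show "bracket_delta R P A v w (inT (inA a)) = a" "bracket_delta R P A v w (inT (dA a)) = w (dA a)"
    using a by (simp_all add: \<delta>_in cl wh)
  \<comment> \<open>The two contributions are \<open>v (dA a)\<close> and its negative.\<close>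
  show "bracket_delta R P A v w (dT (inA a)) = \<zero>\<^bsub>A\<^esub>"
    using a by (simp add: \<delta>_d cl g1 wh vd AM.M.r_neg)
  show "bracket_delta R P A v w (dT (dA a)) = v (dA (w (dA a))) \<ominus>\<^bsub>A\<^esub> w (dA (v (dA a)))"
    using a by (simp add: \<delta>_d cl g1 a_minus_def)
qed

text \<open>Under T of \<open>tan_s\<close> both \<open>inT (dA a)\<close> and
  \<open>dT (dA a)\<close> split in two. In the first, \<open>f\<close> contributes zero and
  \<open>g\<close> contributes \<open>w (dA a)\<close>; in the second, \<open>f\<close> contributes
  \<open>u (dA a)\<close> and \<open>g\<close> contributes zero.\<close>

lemma bracket_lift:
  assumes u: "u \<in> vector_fields R P A"
  shows "bracket_lift R P A u w \<in> alg_hom R P TTA A"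
    "\<And>a. a \<in> carrier A \<Longrightarrow> bracket_lift R P A u w (inT (inA a)) = a"
    "\<And>a. a \<in> carrier A \<Longrightarrow> bracket_lift R P A u w (inT (dA a)) = w (dA a)"
    "\<And>a. a \<in> carrier A \<Longrightarrow> bracket_lift R P A u w (dT (inA a)) = \<zero>\<^bsub>A\<^esub>"
    "\<And>a. a \<in> carrier A \<Longrightarrow> bracket_lift R P A u w (dT (dA a)) = u (dA a)"
proof -
  interpret T: operad_algebra R P TA by (rule operad_algebra_tan)
  interpret TT: operad_algebra R P TTA by (rule T.operad_algebra_tan)
  interpret T2: operad_algebra R P T2A by (rule operad_algebra_tan2)
  have uh: "u \<in> alg_hom R P TA A" "\<And>a. a \<in> carrier A \<Longrightarrow> u (inA a) = a"
    using u by (simp_all add: vector_fields_iff)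
  define f where "f = compose (carrier TTA) u (tan_l R P A)"
  define g where "g = compose (carrier TTA) w (tan_z R P TA)"
  have fh: "f \<in> alg_hom R P TTA A"
    unfolding f_def by (rule alg_hom_compose[OF T.operad_algebra_tan tan_l(1) uh(1)])
  have gh: "g \<in> alg_hom R P TTA A"
    unfolding g_def by (rule alg_hom_compose[OF T.operad_algebra_tan T.tan_z(1) wh(1)])
  note cl = tan_in_closed tan_d_closed T.tan_in_closed T.tan_d_closed
  note zero = linear_map_zero[OF T.module_alg module_alg alg_hom_linear[OF uh(1)]]
    linear_map_zero[OF T.module_alg module_alg alg_hom_linear[OF wh(1)]]
  have f1: "f (inT (inA a)) = a" "f (inT (dA a)) = \<zero>\<^bsub>A\<^esub>" "f (dT (inA a)) = \<zero>\<^bsub>A\<^esub>" "f (dT (dA a)) = u (dA a)"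
    if "a \<in> carrier A" for a
    using that by (simp_all add: f_def compose_def cl tan_l uh zero)
  have g1: "g (inT x) = w x" "g (dT x) = \<zero>\<^bsub>A\<^esub>" if "x \<in> carrier TA" for x
    using that by (simp_all add: g_def compose_def cl T.tan_z zero)
  let ?h = "copair R P TTA T2.TA Tin1 Tin2 A f g"
  have h: "?h \<in> alg_hom R P T2.TA A" "\<And>x. x \<in> carrier TTA \<Longrightarrow> ?h (Tin1 x) = f x"
    "\<And>x. x \<in> carrier TTA \<Longrightarrow> ?h (Tin2 x) = g x"
    by (rule copair_tan_tan2[OF operad_algebra_axioms fh gh]; simp add: f1 g1 cl wh)+
  have h_in: "?h (T2.inA (tan2_in1 R P A x)) = f (inT x)" "?h (T2.dA (tan2_in1 R P A x)) = f (dT x)"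
    "?h (T2.inA (tan2_in2 R P A x)) = g (inT x)" "?h (T2.dA (tan2_in2 R P A x)) = g (dT x)"
    if "x \<in> carrier TA" for x
    using that h(2)[of "inT x"] h(2)[of "dT x"] h(3)[of "inT x"] h(3)[of "dT x"]
    by (simp_all add: cl Tin1 Tin2)
  have lift: "bracket_lift R P A u w = compose (carrier TTA) ?h (tan_map R P TA T2A (tan_s R P A))"
    by (simp add: bracket_lift_def Let_def f_def g_def)
  note Ts = T.tan_map[OF operad_algebra_tan2 alg_hom_algebra_map[OF tan_s(1)]]
  show "bracket_lift R P A u w \<in> alg_hom R P TTA A"
    unfolding lift by (rule alg_hom_compose[OF T.operad_algebra_tan Ts(1) h(1)])
  have l1: "bracket_lift R P A u w (inT x) = ?h (T2.inA (tan_s R P A x))"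
    "bracket_lift R P A u w (dT x) = ?h (T2.dA (tan_s R P A x))" if "x \<in> carrier TA" for x
    using that by (simp_all add: lift compose_def cl Ts)
  note in12 = alg_hom_closed[OF tan2_in1_hom] alg_hom_closed[OF tan2_in2_hom]
  fix a assume a: "a \<in> carrier A"
  have wa: "w (dA a) \<in> carrier A" "u (dA a) \<in> carrier A"
    using a wd alg_hom_closed[OF uh(1)] by (simp_all add: cl)
  show "bracket_lift R P A u w (inT (inA a)) = a" "bracket_lift R P A u w (dT (inA a)) = \<zero>\<^bsub>A\<^esub>"
    using a by (simp_all add: l1 cl tan_s h_in f1)
  show "bracket_lift R P A u w (inT (dA a)) = w (dA a)" "bracket_lift R P A u w (dT (dA a)) = u (dA a)"
    using a wa
    by (simp_all add: l1 cl tan_s h_in f1 g1 in12 linear_map_add[OF T2.tan_in_linear]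
        linear_map_add[OF T2.tan_d_linear] linear_map_add[OF alg_hom_linear[OF h(1)]]
        T2.tan_in_closed T2.tan_d_closed)
qed

text \<open>The Leibniz rule for the commutator is read off from \<open>bracket_delta\<close>: this morphism sends \<open>d'(a)\<close> to
  \<open>0\<close>, so the mixed terms of the second-order Leibniz rule for \<open>d'd\<close> vanish.\<close>

lemma commutator_derivation:
  "derivation_along R P A A (\<lambda>a. a) (\<lambda>a. v (dA (w (dA a))) \<ominus>\<^bsub>A\<^esub> w (dA (v (dA a))))"
proof -
  interpret T: operad_algebra R P TA by (rule operad_algebra_tan)
  let ?\<delta> = "bracket_delta R P A v w"
  let ?C = "\<lambda>a. v (dA (w (dA a))) \<ominus>\<^bsub>A\<^esub> w (dA (v (dA a)))"
  have K: "algebra_map R P TA (dual_alg A) (\<lambda>x. (?\<delta> (inT x), ?\<delta> (dT x)))"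
    by (rule T.tan_hom_dual[OF operad_algebra_axioms bracket_delta(1)])
  have "derivation_along R P A (dual_alg A) (\<lambda>a. (?\<delta> (inT (inA a)), ?\<delta> (dT (inA a))))
      (\<lambda>a. (?\<delta> (inT (dA a)), ?\<delta> (dT (dA a))))"
    by (rule derivation_along_compose[OF operad_algebra_tan operad_algebra_dual tan_d_derivation
          tan_in_linear K])
  then have "derivation_along R P A (dual_alg A) (\<lambda>a. (a, \<zero>\<^bsub>A\<^esub>)) (\<lambda>a. (w (dA a), ?C a))"
    by (rule derivation_along_cong[OF ops_algebra]) (simp_all add: bracket_delta)
  then have C: "derivation_along R P A A (\<lambda>a. a) (\<lambda>a. w (dA a))" "linear_map R A A ?C"
    "\<And>as \<mu>. \<mu> \<in> carrier (ops P (length as)) \<Longrightarrow> set as \<subseteq> carrier A \<Longrightarrow>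
      ?C (oper A \<mu> as) = leibniz2 A \<mu> (map (\<lambda>a. a) as) (map (\<lambda>a. w (dA a)) as) (map (\<lambda>_. \<zero>\<^bsub>A\<^esub>) as) (map ?C as)"
    unfolding derivation_along_dual_iff[OF linear_map_id linear_map_zero_fun[OF module_alg]] by auto
  have "?C (oper A \<mu> as) = leibniz A \<mu> (map (\<lambda>a. a) as) (map ?C as)"
    if "\<mu> \<in> carrier (ops P (length as))" "set as \<subseteq> carrier A" for as \<mu>
    unfolding C(3)[OF that]
    by (rule leibniz2_zero)
      (use that wd linear_map_closed[OF C(2)] in auto)
  then show ?thesis using C(2) by (simp add: derivation_along_def)
qed

lemma lie_bracket:
  shows "lie_bracket R P A v w \<in> vector_fields R P A"
    "\<And>a. a \<in> carrier A \<Longrightarrow>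
      lie_bracket R P A v w (dA a) = v (dA (w (dA a))) \<ominus>\<^bsub>A\<^esub> w (dA (v (dA a)))"
proof -
  \<comment> \<open>For every vector field \<open>u\<close> the two sides agree on all generators
    except possibly \<open>d'd(a)\<close>, so the equation fixes \<open>u\<close> on the generators
    \<open>d(a)\<close> and thereby altogether.\<close>
  have eq: "bracket_delta R P A v w = bracket_lift R P A u w \<longleftrightarrow>
      (\<forall>a\<in>carrier A. u (dA a) = v (dA (w (dA a))) \<ominus>\<^bsub>A\<^esub> w (dA (v (dA a))))"
    if u: "u \<in> vector_fields R P A" for u
  proof
    assume "bracket_delta R P A v w = bracket_lift R P A u w"
    then show "\<forall>a\<in>carrier A. u (dA a) = v (dA (w (dA a))) \<ominus>\<^bsub>A\<^esub> w (dA (v (dA a)))"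
      using bracket_delta(5) bracket_lift(5)[OF u] by simp
  next
    assume "\<forall>a\<in>carrier A. u (dA a) = v (dA (w (dA a))) \<ominus>\<^bsub>A\<^esub> w (dA (v (dA a)))"
    then show "bracket_delta R P A v w = bracket_lift R P A u w"
      by (intro tan_tan_hom_eq[OF operad_algebra_axioms bracket_delta(1) bracket_lift(1)[OF u]])
        (simp_all add: bracket_delta bracket_lift[OF u])
  qed
  obtain u where u: "u \<in> vector_fields R P A"
    "\<forall>a\<in>carrier A. u (dA a) = v (dA (w (dA a))) \<ominus>\<^bsub>A\<^esub> w (dA (v (dA a)))"
    using vector_field_exists[OF commutator_derivation] by (elim bexE)
  have "lie_bracket R P A v w = u"
    unfolding lie_bracket_def
  proof (rule the_equality)
    show "u \<in> vector_fields R P A \<and> bracket_delta R P A v w = bracket_lift R P A u w"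
      using u eq[OF u(1)] by simp
    fix u' assume "u' \<in> vector_fields R P A \<and> bracket_delta R P A v w = bracket_lift R P A u' w"
    then show "u' = u"
      using u eq[of u'] by (intro vector_field_eqI) auto
  qed
  then show "lie_bracket R P A v w \<in> vector_fields R P A"
    "\<And>a. a \<in> carrier A \<Longrightarrow>
      lie_bracket R P A v w (dA a) = v (dA (w (dA a))) \<ominus>\<^bsub>A\<^esub> w (dA (v (dA a)))"
    using u by simp_all
qed

end

end

theorem corollary4p5p3:
  fixes R :: "('r, 'z) ring_scheme" and P :: "('r, 'p) operad" and A :: "('r, 'p, 'a) opalg"
  assumes "cring R" and "operad R P" and "operad_algebra R P A"
  shows
    "bij_betw (derivation_of R P A) (vector_fields R P A) (derivations R P A) \<and>
     (\<forall>v. v \<in> vector_fields R P A \<longleftrightarrow>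
        v \<in> alg_hom R P (tan_alg R P A) A \<and>
        (\<exists>D\<in>derivations R P A. \<forall>a\<in>carrier A.
          v (tan_in R P A a) = a \<and> v (tan_d R P A a) = D a)) \<and>
     (\<forall>v\<in>vector_fields R P A. \<forall>w\<in>vector_fields R P A.
        lie_bracket R P A v w \<in> vector_fields R P A \<and>
        (\<forall>a\<in>carrier A.
          lie_bracket R P A v w (tan_in R P A a) = a \<and>
          lie_bracket R P A v w (tan_d R P A a) =
            derivation_of R P A v (derivation_of R P A w a) \<ominus>\<^bsub>A\<^esub>
            derivation_of R P A w (derivation_of R P A v a)))"
proof (intro conjI allI ballI)
  interpret A: operad_algebra R P A by fact
  show "bij_betw (derivation_of R P A) (vector_fields R P A) (derivations R P A)"
    by (rule A.bij_betw_derivation_of)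
  show "v \<in> vector_fields R P A \<longleftrightarrow> v \<in> alg_hom R P A.TA A \<and>
      (\<exists>D\<in>derivations R P A. \<forall>a\<in>carrier A. v (A.inA a) = a \<and> v (A.dA a) = D a)" for v
    \<comment> \<open>The witness is forced by the values at \<open>d(a)\<close>: it is
      \<open>derivation_of R P A v\<close>.\<close>
    using A.derivation_of_mem[of v]
    by (auto simp: A.vector_fields_iff derivation_of_def intro!: bexI[of _ "derivation_of R P A v"])
  fix v w assume v: "v \<in> vector_fields R P A" and w: "w \<in> vector_fields R P A"
  show br: "lie_bracket R P A v w \<in> vector_fields R P A" by (rule A.lie_bracket(1)[OF v w])
  fix a assume a: "a \<in> carrier A"
  show "lie_bracket R P A v w (A.inA a) = a" using br a by (simp add: A.vector_fields_iff)
  have "v (A.dA a) \<in> carrier A" "w (A.dA a) \<in> carrier A"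
    using v w alg_hom_closed[OF _ A.tan_d_closed[OF a]] by (auto simp: A.vector_fields_iff)
  then show "lie_bracket R P A v w (A.dA a) =
      derivation_of R P A v (derivation_of R P A w a) \<ominus>\<^bsub>A\<^esub>
      derivation_of R P A w (derivation_of R P A v a)"
    using A.lie_bracket(2)[OF v w a] a by (simp add: derivation_of_def)
qed

end
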